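(* Let $\Lambda$ be a Koszul self-injective algebra and let $\sigma$ be a graded automorphism of $\Lambda$. Let $\tilde\Lambda^{\sigma}=\Lambda\ltimes D\Lambda^{\sigma}$ be the twisted trivial extension of $\Lambda$. Then $$c(\tilde\Lambda^{\sigma})=c(\Lambda)+1.$$
   Context: $k$ is a field and $D=\mathrm{Hom}_k(-,k)$. A graded algebra is $\Gamma=\bigoplus_{t\ge0}\Gamma_t$, generated by $\Gamma_0$ and $\Gamma_1$, with $\Gamma_0=\bigoplus_{i=1}^n ke_i$, where $1=e_1+\cdots+e_n$ is a decomposition into orthogonal primitive idempotents. A Koszul self-injective algebra is a finite-dimensional graded algebra $\Lambda=\Lambda_0+\cdots+\Lambda_l$ which is Koszul and self-injective; as in the whole paper it is given by a stable bound quiver of Loewy length $l+1$, i.e. all indecomposable projectives have Loewy length $l+1$ and there is a permutation $\tau$ of the vertices such that $e_i\Lambda_le_{\tau i}$ is the one-dimensional socle for each vertex $i$. The trivial extension $\Lambda\ltimes M$ by a bimodule $M$ is $\Lambda\oplus M$ with $(a,x)(b,y)=(ab,ay+xb)$. A graded automorphism is an algebra automorphism preserving degrees of homogeneous elements. For a graded automorphism $\sigma$ and a $\Lambda$-bimodule $M$, the twist $M^\sigma$ is the vector space $M$ with the same left multiplication and with right multiplication $x\cdot b=x\sigma(b)$. The complexity $c(\{b_r\})$ of a sequence $\{b_r\}_r$ of positive numbers is the least non-negative number $d$ such that there exists $\lambda>0$ with $b_r\le\lambda r^{d-1}$ for almost all natural numbers $r$ (and $\infty$ if there is no such $d$). For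 a $\Lambda$-module $M$ with minimal projective resolution $\cdots\to P^r(M)\to\cdots\to P^0(M)\to M\to0$, the complexity of $M$ is $c(M)=c(\{\dim_kP^r(M)\}_r)$. The complexity $c(\Lambda)$ of the algebra is the supremum of the complexities of finitely generated (left) $\Lambda$-modules. *)

theory Defs
  imports
    "HOL-Algebra.Generated_Rings"
    "Jordan_Normal_Form.Missing_VectorSpace"
    "HOL-Library.Extended_Real"
begin

section \<open>Algebras over a field and left modules\<close>

text \<open>Neither algebras nor their modules are commutative here, so the locales \<open>algebra\<close> and
  \<open>module\<close> of HOL-Algebra do not apply; their record type \<open>module\<close> does.  A \<open>k\<close>-algebra is such a
  record with its ring structure and \<open>k\<close> as scalars; a left module over an algebra is such a record
  with the algebra as scalars, whose fields \<open>mult\<close> and \<open>one\<close> are ignored.\<close>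

definition k_algebra :: "'k ring \<Rightarrow> ('k, 'a) module \<Rightarrow> bool" where
  "k_algebra K A \<longleftrightarrow> vectorspace K A \<and> ring A \<and>
     (\<forall>c\<in>carrier K. \<forall>a\<in>carrier A. \<forall>b\<in>carrier A.
        (c \<odot>\<^bsub>A\<^esub> a) \<otimes>\<^bsub>A\<^esub> b = c \<odot>\<^bsub>A\<^esub> (a \<otimes>\<^bsub>A\<^esub> b) \<and>
        a \<otimes>\<^bsub>A\<^esub> (c \<odot>\<^bsub>A\<^esub> b) = c \<odot>\<^bsub>A\<^esub> (a \<otimes>\<^bsub>A\<^esub> b))"

definition left_module :: "('k, 'a) module \<Rightarrow> ('a, 'm) module \<Rightarrow> bool" where
  "left_module A M \<longleftrightarrow> ring A \<and> abelian_group M \<and>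
     (\<forall>a\<in>carrier A. \<forall>x\<in>carrier M. a \<odot>\<^bsub>M\<^esub> x \<in> carrier M) \<and>
     (\<forall>a\<in>carrier A. \<forall>b\<in>carrier A. \<forall>x\<in>carrier M.
        (a \<oplus>\<^bsub>A\<^esub> b) \<odot>\<^bsub>M\<^esub> x = a \<odot>\<^bsub>M\<^esub> x \<oplus>\<^bsub>M\<^esub> b \<odot>\<^bsub>M\<^esub> x) \<and>
     (\<forall>a\<in>carrier A. \<forall>x\<in>carrier M. \<forall>y\<in>carrier M.
        a \<odot>\<^bsub>M\<^esub> (x \<oplus>\<^bsub>M\<^esub> y) = a \<odot>\<^bsub>M\<^esub> x \<oplus>\<^bsub>M\<^esub> a \<odot>\<^bsub>M\<^esub> y) \<and>
     (\<forall>a\<in>carrier A. \<forall>b\<in>carrier A. \<forall>x\<in>carrier M.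
        (a \<otimes>\<^bsub>A\<^esub> b) \<odot>\<^bsub>M\<^esub> x = a \<odot>\<^bsub>M\<^esub> (b \<odot>\<^bsub>M\<^esub> x)) \<and>
     (\<forall>x\<in>carrier M. \<one>\<^bsub>A\<^esub> \<odot>\<^bsub>M\<^esub> x = x)"

text \<open>The underlying vector space of a left module: a scalar \<open>c\<close> acts as \<open>c\<cdot>1\<close>.\<close>

definition restrict_scalars :: "('k, 'a) module \<Rightarrow> ('a, 'm) module \<Rightarrow> ('k, 'm) module" where
  "restrict_scalars A M =
     \<lparr>carrier = carrier M, monoid.mult = monoid.mult M, one = \<one>\<^bsub>M\<^esub>,
      zero = \<zero>\<^bsub>M\<^esub>, add = add M, smult = \<lambda>c x. (c \<odot>\<^bsub>A\<^esub> \<one>\<^bsub>A\<^esub>) \<odot>\<^bsub>M\<^esub> x\<rparr>"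

definition dim_over :: "'k ring \<Rightarrow> ('k, 'a) module \<Rightarrow> ('a, 'm) module \<Rightarrow> nat" where
  "dim_over K A M = vectorspace.dim K (restrict_scalars A M)"

definition regular_module :: "('k, 'a) module \<Rightarrow> ('a, 'a) module" where
  "regular_module A =
     \<lparr>carrier = carrier A, monoid.mult = monoid.mult A, one = \<one>\<^bsub>A\<^esub>,
      zero = \<zero>\<^bsub>A\<^esub>, add = add A, smult = monoid.mult A\<rparr>"

text \<open>Right modules are left modules over the opposite algebra.\<close>

definition opposite :: "('k, 'a) module \<Rightarrow> ('k, 'a) module" where
  "opposite A = A\<lparr>monoid.mult := \<lambda>x y. y \<otimes>\<^bsub>A\<^esub> x\<rparr>"

definition kernel_of ::
  "('a, 'm) module \<Rightarrow> ('a, 'n) module \<Rightarrow> ('m \<Rightarrow> 'n) \<Rightarrow> 'm set" where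
  "kernel_of M N f = {x \<in> carrier M. f x = \<zero>\<^bsub>N\<^esub>}"

definition generated_submodule :: "('k, 'a) module \<Rightarrow> ('a, 'm) module \<Rightarrow> 'm set \<Rightarrow> 'm set" where
  "generated_submodule A M S = \<Inter>{N. Module.submodule N A M \<and> S \<subseteq> N}"

definition finitely_generated :: "('k, 'a) module \<Rightarrow> ('a, 'm) module \<Rightarrow> bool" where
  "finitely_generated A M \<longleftrightarrow>
     (\<exists>S. finite S \<and> S \<subseteq> carrier M \<and> generated_submodule A M S = carrier M)"

definition simple_module :: "('k, 'a) module \<Rightarrow> ('a, 'm) module \<Rightarrow> bool" where
  "simple_module A M \<longleftrightarrow> left_module A M \<and> carrier M \<noteq> {\<zero>\<^bsub>M\<^esub>} \<and>
     (\<forall>N. Module.submodule N A M \<longrightarrow> N = {\<zero>\<^bsub>M\<^esub>} \<or> N = carrier M)"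

definition indecomposable :: "('k, 'a) module \<Rightarrow> ('a, 'm) module \<Rightarrow> bool" where
  "indecomposable A M \<longleftrightarrow> left_module A M \<and> carrier M \<noteq> {\<zero>\<^bsub>M\<^esub>} \<and>
     (\<forall>N L. Module.submodule N A M \<and> Module.submodule L A M \<and>
        N <+>\<^bsub>M\<^esub> L = carrier M \<and> N \<inter> L = {\<zero>\<^bsub>M\<^esub>} \<longrightarrow> N = {\<zero>\<^bsub>M\<^esub>} \<or> L = {\<zero>\<^bsub>M\<^esub>})"

text \<open>The socle is the sum of all simple submodules.\<close>

definition socle :: "('k, 'a) module \<Rightarrow> ('a, 'm) module \<Rightarrow> 'm set" where
  "socle A M = generated_submodule A M
     (\<Union>{S. Module.submodule S A M \<and> simple_module A (M\<lparr>carrier := S\<rparr>)})"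

definition maximal_submodule :: "'m set \<Rightarrow> ('k, 'a) module \<Rightarrow> ('a, 'm) module \<Rightarrow> bool" where
  "maximal_submodule N A M \<longleftrightarrow> Module.submodule N A M \<and> N \<noteq> carrier M \<and>
     (\<forall>L. Module.submodule L A M \<and> N \<subseteq> L \<longrightarrow> L = N \<or> L = carrier M)"

definition radical :: "('k, 'a) module \<Rightarrow> ('a, 'm) module \<Rightarrow> 'm set" where
  "radical A M = carrier M \<inter> \<Inter>{N. maximal_submodule N A M}"

definition radical_power :: "('k, 'a) module \<Rightarrow> ('a, 'm) module \<Rightarrow> nat \<Rightarrow> 'm set" where
  "radical_power A M m = ((\<lambda>N. radical A (M\<lparr>carrier := N\<rparr>)) ^^ m) (carrier M)"

definition has_loewy_length :: "('k, 'a) module \<Rightarrow> ('a, 'm) module \<Rightarrow> nat \<Rightarrow> bool" where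
  "has_loewy_length A M L \<longleftrightarrow>
     radical_power A M L = {\<zero>\<^bsub>M\<^esub>} \<and> (\<forall>m<L. radical_power A M m \<noteq> {\<zero>\<^bsub>M\<^esub>})"


section \<open>Projectivity, injectivity and minimal projective resolutions\<close>

text \<open>Quantification over ``all modules'' ranges over modules whose carrier lies in the type
  \<open>nat \<Rightarrow> 'k\<close>.  This is no restriction: over a finite-dimensional algebra every module of cardinality
  at most that of \<open>nat \<Rightarrow> 'k\<close> (in particular every finitely generated module, every left ideal, and
  every free module on a set of at most that size) is isomorphic to one of these.\<close>

definition projective :: "('k, 'a) module \<Rightarrow> ('a, 'm) module \<Rightarrow> bool" where
  "projective A P \<longleftrightarrow> left_module A P \<and>
     (\<forall>(X :: ('a, nat \<Rightarrow> 'k) module) (Y :: ('a, nat \<Rightarrow> 'k) module) g f.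
        left_module A X \<and> left_module A Y \<and>
        g \<in> module_hom A X Y \<and> g ` carrier X = carrier Y \<and> f \<in> module_hom A P Y \<longrightarrow>
        (\<exists>h\<in>module_hom A P X. \<forall>p\<in>carrier P. g (h p) = f p))"

definition injective :: "('k, 'a) module \<Rightarrow> ('a, 'm) module \<Rightarrow> bool" where
  "injective A I \<longleftrightarrow> left_module A I \<and>
     (\<forall>(X :: ('a, nat \<Rightarrow> 'k) module) (Y :: ('a, nat \<Rightarrow> 'k) module) g f.
        left_module A X \<and> left_module A Y \<and>
        g \<in> module_hom A X Y \<and> inj_on g (carrier X) \<and> f \<in> module_hom A X I \<longrightarrow>
        (\<exists>h\<in>module_hom A Y I. \<forall>x\<in>carrier X. h (g x) = f x))"

definition self_injective :: "('k, 'a) module \<Rightarrow> bool" where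
  "self_injective A \<longleftrightarrow> injective A (regular_module A)"

text \<open>Here \<open>d r : P (Suc r) \<rightarrow> P r\<close> and \<open>\<epsilon> : P 0 \<rightarrow> M\<close> is the augmentation.\<close>

definition projective_resolution ::
  "('k, 'a) module \<Rightarrow> ('a, 'm) module \<Rightarrow> (nat \<Rightarrow> ('a, 'p) module) \<Rightarrow>
   (nat \<Rightarrow> 'p \<Rightarrow> 'p) \<Rightarrow> ('p \<Rightarrow> 'm) \<Rightarrow> bool" where
  "projective_resolution A M P d \<epsilon> \<longleftrightarrow>
     (\<forall>r. projective A (P r)) \<and>
     \<epsilon> \<in> module_hom A (P 0) M \<and> \<epsilon> ` carrier (P 0) = carrier M \<and>
     (\<forall>r. d r \<in> module_hom A (P (Suc r)) (P r)) \<and>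
     d 0 ` carrier (P 1) = kernel_of (P 0) M \<epsilon> \<and>
     (\<forall>r. d (Suc r) ` carrier (P (Suc (Suc r))) = kernel_of (P (Suc r)) (P r) (d r))"

definition superfluous :: "'m set \<Rightarrow> ('k, 'a) module \<Rightarrow> ('a, 'm) module \<Rightarrow> bool" where
  "superfluous N A M \<longleftrightarrow> Module.submodule N A M \<and>
     (\<forall>L. Module.submodule L A M \<and> N <+>\<^bsub>M\<^esub> L = carrier M \<longrightarrow> L = carrier M)"

text \<open>A resolution is minimal if \<open>P 0\<close> is a projective cover of \<open>M\<close> and every \<open>P (Suc r)\<close> is a
  projective cover of the \<open>r\<close>-th syzygy, that is, of the image of \<open>d r\<close>.\<close>

definition minimal_projective_resolution ::
  "('k, 'a) module \<Rightarrow> ('a, 'm) module \<Rightarrow> (nat \<Rightarrow> ('a, 'p) module) \<Rightarrow>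
   (nat \<Rightarrow> 'p \<Rightarrow> 'p) \<Rightarrow> ('p \<Rightarrow> 'm) \<Rightarrow> bool" where
  "minimal_projective_resolution A M P d \<epsilon> \<longleftrightarrow>
     projective_resolution A M P d \<epsilon> \<and>
     superfluous (kernel_of (P 0) M \<epsilon>) A (P 0) \<and>
     (\<forall>r. superfluous (kernel_of (P (Suc r)) (P r) (d r)) A (P (Suc r)))"


section \<open>Complexity\<close>

text \<open>The set of admissible \<open>d\<close> is upward closed, so \<open>Inf\<close> is its least element (if it is attained),
  and it is \<open>\<infinity>\<close> if there is no admissible \<open>d\<close>.\<close>

definition seq_complexity :: "(nat \<Rightarrow> nat) \<Rightarrow> ereal" where
  "seq_complexity b = Inf {ereal d | d :: real. 0 \<le> d \<and>
     (\<exists>c>0. eventually (\<lambda>r. real (b r) \<le> c * real r powr (d - 1)) sequentially)}"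

text \<open>Minimal projective resolutions are unique up to isomorphism, so the choice is immaterial.\<close>

definition module_complexity :: "'k ring \<Rightarrow> ('k, 'a) module \<Rightarrow> ('a, 'm) module \<Rightarrow> ereal" where
  "module_complexity K A M =
     (let P = (SOME P :: nat \<Rightarrow> ('a, nat \<Rightarrow> 'k) module.
                 \<exists>d \<epsilon>. minimal_projective_resolution A M P d \<epsilon>)
      in seq_complexity (\<lambda>r. dim_over K A (P r)))"

definition algebra_complexity :: "'k ring \<Rightarrow> ('k, 'a) module \<Rightarrow> ereal" where
  "algebra_complexity K A =
     Sup {module_complexity K A M | M :: ('a, nat \<Rightarrow> 'k) module.
            left_module A M \<and> finitely_generated A M}"


section \<open>Graded algebras and Koszul self-injective algebras\<close>

definition homog_decomposition ::
  "('x, 'c) ring_scheme \<Rightarrow> (nat \<Rightarrow> 'x set) \<Rightarrow> 'x \<Rightarrow> (nat \<Rightarrow> 'x) \<Rightarrow> bool" where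
  "homog_decomposition M G x c \<longleftrightarrow>
     (\<forall>t. c t \<in> G t) \<and> finite {t. c t \<noteq> \<zero>\<^bsub>M\<^esub>} \<and>
     x = (\<Oplus>\<^bsub>M\<^esub>t\<in>{t. c t \<noteq> \<zero>\<^bsub>M\<^esub>}. c t)"

definition direct_sum_of_pieces :: "('x, 'c) ring_scheme \<Rightarrow> (nat \<Rightarrow> 'x set) \<Rightarrow> bool" where
  "direct_sum_of_pieces M G \<longleftrightarrow> (\<forall>t. subgroup (G t) (add_monoid M)) \<and>
     (\<forall>x\<in>carrier M. \<exists>!c. homog_decomposition M G x c)"

definition homog_component ::
  "('x, 'c) ring_scheme \<Rightarrow> (nat \<Rightarrow> 'x set) \<Rightarrow> nat \<Rightarrow> 'x \<Rightarrow> 'x" where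
  "homog_component M G t x = (THE c. homog_decomposition M G x c) t"

definition primitive_idempotent :: "('k, 'a) module \<Rightarrow> 'a \<Rightarrow> bool" where
  "primitive_idempotent A e \<longleftrightarrow> e \<in> carrier A \<and> e \<otimes>\<^bsub>A\<^esub> e = e \<and> e \<noteq> \<zero>\<^bsub>A\<^esub> \<and>
     \<not> (\<exists>f\<in>carrier A. \<exists>g\<in>carrier A. f \<noteq> \<zero>\<^bsub>A\<^esub> \<and> g \<noteq> \<zero>\<^bsub>A\<^esub> \<and>
          f \<otimes>\<^bsub>A\<^esub> f = f \<and> g \<otimes>\<^bsub>A\<^esub> g = g \<and>
          f \<otimes>\<^bsub>A\<^esub> g = \<zero>\<^bsub>A\<^esub> \<and> g \<otimes>\<^bsub>A\<^esub> f = \<zero>\<^bsub>A\<^esub> \<and> e = f \<oplus>\<^bsub>A\<^esub> g)"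

text \<open>The bijection expresses \<open>G 0 = k e\<^sub>1 \<oplus> \<dots> \<oplus> k e\<^sub>n\<close>.  Since \<open>G 0\<close> contains \<open>k\<cdot>1\<close>, the subring
  generated by \<open>G 0 \<union> G 1\<close> is the subalgebra generated by it.\<close>

definition graded_algebra ::
  "'k ring \<Rightarrow> ('k, 'a) module \<Rightarrow> (nat \<Rightarrow> 'a set) \<Rightarrow> nat \<Rightarrow> (nat \<Rightarrow> 'a) \<Rightarrow> bool" where
  "graded_algebra K A G n e \<longleftrightarrow>
     k_algebra K A \<and>
     (\<forall>t. Module.submodule (G t) K A) \<and> direct_sum_of_pieces A G \<and>
     (\<forall>s t. \<forall>x\<in>G s. \<forall>y\<in>G t. x \<otimes>\<^bsub>A\<^esub> y \<in> G (s + t)) \<and>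
     generate_ring A (G 0 \<union> G 1) = carrier A \<and>
     1 \<le> n \<and>
     (\<forall>i\<in>{1..n}. primitive_idempotent A (e i)) \<and>
     (\<forall>i\<in>{1..n}. \<forall>j\<in>{1..n}. i \<noteq> j \<longrightarrow> e i \<otimes>\<^bsub>A\<^esub> e j = \<zero>\<^bsub>A\<^esub>) \<and>
     (\<Oplus>\<^bsub>A\<^esub>i\<in>{1..n}. e i) = \<one>\<^bsub>A\<^esub> \<and>
     bij_betw (\<lambda>c. \<Oplus>\<^bsub>A\<^esub>i\<in>{1..n}. c i \<odot>\<^bsub>A\<^esub> e i) ({1..n} \<rightarrow>\<^sub>E carrier K) (G 0)"

definition graded_module ::
  "('k, 'a) module \<Rightarrow> (nat \<Rightarrow> 'a set) \<Rightarrow> ('a, 'm) module \<Rightarrow> (nat \<Rightarrow> 'm set) \<Rightarrow> bool" where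
  "graded_module A G M Q \<longleftrightarrow> left_module A M \<and> direct_sum_of_pieces M Q \<and>
     (\<forall>s t. \<forall>a\<in>G s. \<forall>x\<in>Q t. a \<odot>\<^bsub>M\<^esub> x \<in> Q (s + t))"

text \<open>The left module \<open>\<Gamma>\<^sub>0 = \<Gamma> / \<Gamma>\<^bsub>\<ge>1\<^esub>\<close>, on which elements of positive degree act as zero.\<close>

definition degree_zero_module ::
  "('k, 'a) module \<Rightarrow> (nat \<Rightarrow> 'a set) \<Rightarrow> ('a, 'a) module" where
  "degree_zero_module A G =
     \<lparr>carrier = G 0, monoid.mult = monoid.mult A, one = \<one>\<^bsub>A\<^esub>, zero = \<zero>\<^bsub>A\<^esub>, add = add A,
      smult = \<lambda>a x. homog_component A G 0 (a \<otimes>\<^bsub>A\<^esub> x)\<rparr>"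

text \<open>Koszul: the graded module \<open>\<Gamma>\<^sub>0\<close>, concentrated in degree 0, has a graded projective resolution
  whose \<open>r\<close>-th term is generated in degree \<open>r\<close>.  Gradings by \<open>nat\<close> suffice, because a graded
  module generated in degree \<open>r \<ge> 0\<close> vanishes in negative degrees.\<close>

definition koszul :: "('k, 'a) module \<Rightarrow> (nat \<Rightarrow> 'a set) \<Rightarrow> bool" where
  "koszul A G \<longleftrightarrow>
     (\<exists>(P :: nat \<Rightarrow> ('a, nat \<Rightarrow> 'k) module) d \<epsilon> Q.
        projective_resolution A (degree_zero_module A G) P d \<epsilon> \<and>
        (\<forall>r. graded_module A G (P r) (Q r)) \<and>
        (\<forall>r. generated_submodule A (P r) (Q r r) = carrier (P r)) \<and>
        (\<forall>t>0. \<forall>x\<in>Q 0 t. \<epsilon> x = \<zero>\<^bsub>A\<^esub>) \<and>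
        (\<forall>r t. d r ` Q (Suc r) t \<subseteq> Q r t))"

text \<open>The right module \<open>e\<^sub>i\<Lambda>\<close>.\<close>

definition right_projective :: "('k, 'a) module \<Rightarrow> 'a \<Rightarrow> ('a, 'a) module" where
  "right_projective A e =
     (regular_module (opposite A))\<lparr>carrier := {e \<otimes>\<^bsub>A\<^esub> a | a. a \<in> carrier A}\<rparr>"

definition stable_of_loewy_length ::
  "'k ring \<Rightarrow> ('k, 'a) module \<Rightarrow> (nat \<Rightarrow> 'a set) \<Rightarrow> nat \<Rightarrow> (nat \<Rightarrow> 'a) \<Rightarrow> nat \<Rightarrow> bool" where
  "stable_of_loewy_length K A G n e l \<longleftrightarrow>
     (\<forall>P :: ('a, nat \<Rightarrow> 'k) module.
        projective A P \<and> indecomposable A P \<longrightarrow> has_loewy_length A P (l + 1)) \<and>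
     (\<exists>\<tau>. bij_betw \<tau> {1..n} {1..n} \<and>
        (\<forall>i\<in>{1..n}. let S = {e i \<otimes>\<^bsub>A\<^esub> x \<otimes>\<^bsub>A\<^esub> e (\<tau> i) | x. x \<in> G l} in
           socle (opposite A) (right_projective A (e i)) = S \<and>
           vectorspace.dim K (A\<lparr>carrier := S\<rparr>) = 1))"

definition koszul_self_injective_algebra ::
  "'k ring \<Rightarrow> ('k, 'a) module \<Rightarrow> (nat \<Rightarrow> 'a set) \<Rightarrow> nat \<Rightarrow> (nat \<Rightarrow> 'a) \<Rightarrow> nat \<Rightarrow> bool" where
  "koszul_self_injective_algebra K A G n e l \<longleftrightarrow>
     graded_algebra K A G n e \<and>
     vectorspace.fin_dim K A \<and> (\<forall>t>l. G t = {\<zero>\<^bsub>A\<^esub>}) \<and>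
     koszul A G \<and> self_injective A \<and> stable_of_loewy_length K A G n e l"

definition graded_automorphism ::
  "'k ring \<Rightarrow> ('k, 'a) module \<Rightarrow> (nat \<Rightarrow> 'a set) \<Rightarrow> ('a \<Rightarrow> 'a) \<Rightarrow> bool" where
  "graded_automorphism K A G \<sigma> \<longleftrightarrow>
     \<sigma> \<in> ring_iso A A \<and>
     (\<forall>c\<in>carrier K. \<forall>a\<in>carrier A. \<sigma> (c \<odot>\<^bsub>A\<^esub> a) = c \<odot>\<^bsub>A\<^esub> \<sigma> a) \<and>
     (\<forall>t. \<forall>x\<in>G t. \<sigma> x \<in> G t)"


section \<open>Bimodules and twisted trivial extensions\<close>

record ('k, 'a, 'm) bimodule = "('k, 'm) module" +
  lact :: "'a \<Rightarrow> 'm \<Rightarrow> 'm"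
  ract :: "'m \<Rightarrow> 'a \<Rightarrow> 'm"

text \<open>\<open>D\<Lambda> = Hom\<^sub>k(\<Lambda>, k)\<close> with \<open>(a f)(x) = f (x a)\<close> and \<open>(f a)(x) = f (a x)\<close>; a linear form is
  represented by a function that is \<open>undefined\<close> outside the carrier of \<open>\<Lambda>\<close>.\<close>

definition dual_bimodule ::
  "'k ring \<Rightarrow> ('k, 'a) module \<Rightarrow> ('k, 'a, 'a \<Rightarrow> 'k) bimodule" where
  "dual_bimodule K A =
     \<lparr>carrier = {f \<in> carrier A \<rightarrow>\<^sub>E carrier K.
        (\<forall>x\<in>carrier A. \<forall>y\<in>carrier A. f (x \<oplus>\<^bsub>A\<^esub> y) = f x \<oplus>\<^bsub>K\<^esub> f y) \<and>
        (\<forall>c\<in>carrier K. \<forall>x\<in>carrier A. f (c \<odot>\<^bsub>A\<^esub> x) = c \<otimes>\<^bsub>K\<^esub> f x)},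
      monoid.mult = undefined, one = undefined,
      zero = (\<lambda>x\<in>carrier A. \<zero>\<^bsub>K\<^esub>),
      add = (\<lambda>f g. \<lambda>x\<in>carrier A. f x \<oplus>\<^bsub>K\<^esub> g x),
      smult = (\<lambda>c f. \<lambda>x\<in>carrier A. c \<otimes>\<^bsub>K\<^esub> f x),
      lact = (\<lambda>a f. \<lambda>x\<in>carrier A. f (x \<otimes>\<^bsub>A\<^esub> a)),
      ract = (\<lambda>f a. \<lambda>x\<in>carrier A. f (a \<otimes>\<^bsub>A\<^esub> x))\<rparr>"

definition twist :: "('k, 'a, 'm) bimodule \<Rightarrow> ('a \<Rightarrow> 'a) \<Rightarrow> ('k, 'a, 'm) bimodule" where
  "twist M \<sigma> = M\<lparr>ract := \<lambda>x b. ract M x (\<sigma> b)\<rparr>"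

definition trivial_extension ::
  "('k, 'a) module \<Rightarrow> ('k, 'a, 'm) bimodule \<Rightarrow> ('k, 'a \<times> 'm) module" where
  "trivial_extension A M =
     \<lparr>carrier = carrier A \<times> carrier M,
      monoid.mult = (\<lambda>(a, x) (b, y). (a \<otimes>\<^bsub>A\<^esub> b, lact M a y \<oplus>\<^bsub>M\<^esub> ract M x b)),
      one = (\<one>\<^bsub>A\<^esub>, \<zero>\<^bsub>M\<^esub>),
      zero = (\<zero>\<^bsub>A\<^esub>, \<zero>\<^bsub>M\<^esub>),
      add = (\<lambda>(a, x) (b, y). (a \<oplus>\<^bsub>A\<^esub> b, x \<oplus>\<^bsub>M\<^esub> y)),
      smult = (\<lambda>c (a, x). (c \<odot>\<^bsub>A\<^esub> a, c \<odot>\<^bsub>M\<^esub> x))\<rparr>"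

definition twisted_trivial_extension ::
  "'k ring \<Rightarrow> ('k, 'a) module \<Rightarrow> ('a \<Rightarrow> 'a) \<Rightarrow> ('k, 'a \<times> ('a \<Rightarrow> 'k)) module" where
  "twisted_trivial_extension K A \<sigma> = trivial_extension A (twist (dual_bimodule K A) \<sigma>)"

end

theory Submission
  imports Defs
    "HOL-Computational_Algebra.Polynomial_FPS"
    "HOL-Computational_Algebra.Fundamental_Theorem_Algebra"
    "Jordan_Normal_Form.Determinant"
begin

text \<open>The socle condition yields a nondegenerate linear form \<open>y\<close> on \<open>\<Lambda>\<close>, so that \<open>D \<Lambda>\<close> is free of
  rank one on \<open>y\<close> and the twisted trivial extension is a skew polynomial ring over \<open>\<Lambda>\<close> in \<open>y\<close>
  truncated at \<open>y\<^sup>2 = 0\<close>.  Splicing twisted copies of a minimal resolution of a \<open>\<Lambda>\<close>-module \<open>M\<close> with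
  terms of dimension \<open>b\<^sub>r\<close> gives a minimal resolution of \<open>M\<close> over the extension with terms of dimension
  \<open>2 (b\<^sub>0 + ... + b\<^sub>r)\<close>.  Both complexities are attained at \<open>\<Lambda>\<^sub>0\<close>, whose Poincare series is rational
  because \<open>\<Lambda>\<close> is Koszul; for a rational series the partial sums grow exactly one order faster.\<close>

text \<open>For an arbitrary sequence the partial sums gain at most one order of growth, and a
  sequence with large sparse terms gains less; rationality is what forces the full gain. Koszulness
  supplies it: every term of the resolution of \<open>S0\<close> is generated in a single degree, so
  exactness in each degree is a linear recurrence whose coefficients are the dimensions of the
  finitely many pieces of the algebra, and Cramer's rule solves it. The supremum over all modules is
  reached at \<open>S0\<close> because every finite-dimensional module is an iterated extension of
  summands of \<open>S0\<close>, Betti numbers are subadditive along extensions, and a module over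
  the extension ring is an extension of two modules killed by \<open>y\<close>. Multiplication by
  \<open>y\<close> is only semilinear, with respect to the Nakayama automorphism composed with
  \<sigma>; hence the twisted copies. Projectivity and complexity refer to modules with carriers in
  \<open>nat => 'k\<close>, so constructed modules are copied into that type by means of
  coordinates.\<close>

abbreviation (input) smult_on ("(_ .[_] _)" [70, 0, 71] 70) where "a .[M] x \<equiv> a \<odot>\<^bsub>M\<^esub> x"
abbreviation (input) mult_on ("(_ *[_] _)" [70, 0, 71] 70) where "a *[M] x \<equiv> a \<otimes>\<^bsub>M\<^esub> x"
abbreviation (input) add_on ("(_ +[_] _)" [65, 0, 66] 65) where "a +[M] x \<equiv> a \<oplus>\<^bsub>M\<^esub> x"
abbreviation (input) minus_on ("(_ -[_] _)" [65, 0, 66] 65) where "a -[M] x \<equiv> a \<ominus>\<^bsub>M\<^esub> x"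
abbreviation (input) neg_on ("(-[_] _)" [0, 81] 80) where "-[M] x \<equiv> \<ominus>\<^bsub>M\<^esub> x"
abbreviation (input) zero_on ("(\<zero>[_])") where "\<zero>[M] \<equiv> \<zero>\<^bsub>M\<^esub>"
abbreviation (input) one_on ("(\<one>[_])") where "\<one>[M] \<equiv> \<one>\<^bsub>M\<^esub>"

section \<open>Left modules\<close>

locale lmod =
  fixes A :: "('k, 'a) module" and M :: "('a, 'm) module"
  assumes left_module: "left_module A M"

sublocale lmod \<subseteq> A: ring A
  using left_module by (simp add: left_module_def)

sublocale lmod \<subseteq> M: abelian_group M
  using left_module by (simp add: left_module_def)

context lmod
begin

lemma smult_closed [simp, intro]:
  "a : carrier A ==> x : carrier M ==> a .[M] x : carrier M"
  using left_module by (simp add: left_module_def)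

lemma smult_l_distr:
  "a : carrier A ==> b : carrier A ==> x : carrier M ==>
   (a +[A] b) .[M] x = a .[M] x +[M] b .[M] x"
  using left_module by (simp add: left_module_def)

lemma smult_r_distr:
  "a : carrier A ==> x : carrier M ==> y : carrier M ==>
   a .[M] (x +[M] y) = a .[M] x +[M] a .[M] y"
  using left_module by (simp add: left_module_def)

lemma smult_assoc:
  "a : carrier A ==> b : carrier A ==> x : carrier M ==>
   (a *[A] b) .[M] x = a .[M] (b .[M] x)"
  using left_module by (simp add: left_module_def)

lemma smult_one [simp]: "x : carrier M ==> \<one>[A] .[M] x = x"
  using left_module by (simp add: left_module_def)

lemma smult_zero_left [simp]: "x : carrier M ==> \<zero>[A] .[M] x = \<zero>[M]"
  using smult_l_distr[of "\<zero>[A]" "\<zero>[A]" x] by (simp add: M.add.l_cancel_one)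

lemma smult_zero_right [simp]: "a : carrier A ==> a .[M] \<zero>[M] = \<zero>[M]"
  using smult_r_distr[of a "\<zero>[M]" "\<zero>[M]"] by (simp add: M.add.l_cancel_one)

lemma smult_minus_one: "x : carrier M ==> (-[A] \<one>[A]) .[M] x = -[M] x"
  using smult_l_distr[of "-[A] \<one>[A]" "\<one>[A]" x]
  by (simp add: A.l_neg M.minus_equality)

lemma smult_minus_right: "a : carrier A ==> x : carrier M ==> a .[M] (-[M] x) = -[M] (a .[M] x)"
  by (metis M.add.inv_closed M.l_neg M.minus_equality smult_closed smult_r_distr smult_zero_right)

lemma submoduleI:
  assumes "N \<subseteq> carrier M" "\<zero>[M] : N" "!!x y. x : N ==> y : N ==> x +[M] y : N"
    "!!a x. a : carrier A ==> x : N ==> a .[M] x : N"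
  shows "Module.submodule N A M"
proof -
  have inv: "inv\<^bsub>add_monoid M\<^esub> x : N" if "x : N" for x
    using assms(4)[of "-[A] \<one>[A]" x] assms(1) that smult_minus_one[of x]
    by (auto simp: a_inv_def)
  have "subgroup N (add_monoid M)"
    by (rule M.add.subgroupI) (use assms inv in \<open>auto simp: a_inv_def\<close>)
  then show ?thesis
    using assms by (auto simp: Module.submodule_def submodule_axioms_def)
qed

lemma submoduleD:
  assumes "Module.submodule N A M"
  shows "N \<subseteq> carrier M" "\<zero>[M] : N" "!!x y. x : N ==> y : N ==> x +[M] y : N"
    "!!a x. a : carrier A ==> x : N ==> a .[M] x : N"
    "!!x. x : N ==> -[M] x : N" "!!x y. x : N ==> y : N ==> x -[M] y : N"
proof -
  interpret N: Module.submodule N A M by fact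
  show 1: "N \<subseteq> carrier M" using N.subset by simp
  show 2: "\<zero>[M] : N" using N.one_closed by simp
  show 3: "!!x y. x : N ==> y : N ==> x +[M] y : N" using N.m_closed by simp
  show 4: "!!a x. a : carrier A ==> x : N ==> a .[M] x : N" using N.smult_closed by simp
  show 5: "!!x. x : N ==> -[M] x : N" using N.m_inv_closed by (simp add: a_inv_def)
  show "!!x y. x : N ==> y : N ==> x -[M] y : N"
    using 3 5 by (simp add: a_minus_def)
qed

lemma submodule_left_module:
  assumes "Module.submodule N A M"
  shows "left_module A (M(|carrier := N|))"
proof -
  note N = submoduleD[OF assms]
  have "abelian_group (M(|carrier := N|))"
  proof (rule abelian_groupI, goal_cases)
    case (6 x)
    then show ?case using N(1,5) by (intro bexI[of _ "-[M] x"]) (auto simp: M.l_neg subset_iff)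
  qed (use N in \<open>auto simp: subset_iff M.a_ac\<close>)
  then show ?thesis
    unfolding left_module_def
    using N A.ring_axioms by (auto simp: smult_l_distr smult_r_distr smult_assoc subset_iff)
qed

lemma submodule_lmod: "Module.submodule N A M ==> lmod A (M(|carrier := N|))"
  by (simp add: lmod_def submodule_left_module)

lemma carrier_submodule: "Module.submodule (carrier M) A M"
  by (rule submoduleI) auto

lemma zero_submodule: "Module.submodule {\<zero>[M]} A M"
  by (rule submoduleI) simp_all

lemma submodule_carrier_iff:
  assumes "Module.submodule N A M"
  shows "Module.submodule L A (M(|carrier := N|)) \<longleftrightarrow> Module.submodule L A M & L \<subseteq> N"
proof -
  interpret N: lmod A "M(|carrier := N|)" by (rule submodule_lmod[OF assms])
  show ?thesis
  proof
    assume "Module.submodule L A (M(|carrier := N|))"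
    from N.submoduleD[OF this] show "Module.submodule L A M & L \<subseteq> N"
      using submoduleD(1)[OF assms] by (auto intro!: submoduleI)
  next
    assume L: "Module.submodule L A M & L \<subseteq> N"
    show "Module.submodule L A (M(|carrier := N|))"
      by (rule N.submoduleI) (use submoduleD[OF conjunct1[OF L]] L in auto)
  qed
qed

lemma generated_submodule_submodule:
  assumes "S \<subseteq> carrier M"
  shows "Module.submodule (generated_submodule A M S) A M"
proof (rule submoduleI)
  show "generated_submodule A M S \<subseteq> carrier M"
    using assms carrier_submodule by (auto simp: generated_submodule_def)
next
  show "\<zero>[M] : generated_submodule A M S"
    by (simp add: generated_submodule_def submoduleD(2))
  show "x +[M] y : generated_submodule A M S"
    if "x : generated_submodule A M S" "y : generated_submodule A M S" for x y
    using that by (simp add: generated_submodule_def submoduleD(3))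
  show "a .[M] x : generated_submodule A M S"
    if "a : carrier A" "x : generated_submodule A M S" for a x
    using that by (simp add: generated_submodule_def submoduleD(4))
qed

lemma generated_submodule_incl: "S \<subseteq> generated_submodule A M S"
  by (auto simp: generated_submodule_def)

lemma generated_submodule_least:
  "Module.submodule N A M ==> S \<subseteq> N ==> generated_submodule A M S \<subseteq> N"
  by (auto simp: generated_submodule_def)

lemma set_add_iff: "x : N <+>\<^bsub>M\<^esub> L \<longleftrightarrow> (\<exists>n\<in>N. \<exists>l\<in>L. x = n +[M] l)"
  by (auto simp: set_add_def set_mult_def)

lemma set_add_submodule:
  assumes "Module.submodule N A M" "Module.submodule L A M"
  shows "Module.submodule (N <+>\<^bsub>M\<^esub> L) A M"
proof (rule submoduleI)
  note N = submoduleD[OF assms(1)] and L = submoduleD[OF assms(2)]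
  show "N <+>\<^bsub>M\<^esub> L \<subseteq> carrier M" using N(1) L(1) by (auto simp: set_add_iff subset_iff)
  show "\<zero>[M] : N <+>\<^bsub>M\<^esub> L"
    unfolding set_add_iff using N(2) L(2) by (intro bexI[of _ "\<zero>[M]"]) auto
  show "x +[M] y : N <+>\<^bsub>M\<^esub> L" if "x : N <+>\<^bsub>M\<^esub> L" "y : N <+>\<^bsub>M\<^esub> L" for x y
  proof -
    from that obtain n l n' l' where *: "n : N" "l : L" "x = n +[M] l" "n' : N" "l' : L" "y = n' +[M] l'"
      by (auto simp: set_add_iff)
    have "n : carrier M" "l : carrier M" "n' : carrier M" "l' : carrier M" using * N(1) L(1) by auto
    then have "x +[M] y = (n +[M] n') +[M] (l +[M] l')" using * by (simp add: M.a_ac)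
    then show ?thesis unfolding set_add_iff using * N(3) L(3) by blast
  qed
  show "a .[M] x : N <+>\<^bsub>M\<^esub> L" if a: "a : carrier A" and "x : N <+>\<^bsub>M\<^esub> L" for a x
  proof -
    from that obtain n l where *: "n : N" "l : L" "x = n +[M] l" by (auto simp: set_add_iff)
    then have "a .[M] x = a .[M] n +[M] a .[M] l" using a N(1) L(1) by (simp add: smult_r_distr subset_iff)
    then show ?thesis unfolding set_add_iff using * N(4) L(4) a by blast
  qed
qed

lemma smult_finsum:
  assumes "a : carrier A" "f : I \<rightarrow> carrier M"
  shows "a .[M] (\<Oplus>\<^bsub>M\<^esub>i\<in>I. f i) = (\<Oplus>\<^bsub>M\<^esub>i\<in>I. a .[M] f i)"
  using assms(2)
proof (induction I rule: infinite_finite_induct)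
  case (insert x F)
  then show ?case
    using assms(1) by (simp add: M.finsum_insert Pi_def smult_r_distr)
qed (use assms in auto)

lemma finsum_in_submodule:
  assumes "Module.submodule N A M" "f : I \<rightarrow> N"
  shows "(\<Oplus>\<^bsub>M\<^esub>i\<in>I. f i) : N"
  using assms(2)
proof (induction I rule: infinite_finite_induct)
  case (insert x F)
  then have "f : F \<rightarrow> carrier M" "f x : carrier M" using submoduleD(1)[OF assms(1)] by auto
  then show ?case
    using insert submoduleD(3)[OF assms(1)] by (simp add: M.finsum_insert Pi_def)
qed (use submoduleD(2)[OF assms(1)] in auto)

end

lemma left_moduleI:
  assumes "ring A" "abelian_group M"
    "!!a x. a : carrier A ==> x : carrier M ==> a .[M] x : carrier M"
    "!!a b x. a : carrier A ==> b : carrier A ==> x : carrier M ==>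
      (a +[A] b) .[M] x = a .[M] x +[M] b .[M] x"
    "!!a x y. a : carrier A ==> x : carrier M ==> y : carrier M ==>
      a .[M] (x +[M] y) = a .[M] x +[M] a .[M] y"
    "!!a b x. a : carrier A ==> b : carrier A ==> x : carrier M ==>
      (a *[A] b) .[M] x = a .[M] (b .[M] x)"
    "!!x. x : carrier M ==> \<one>[A] .[M] x = x"
  shows "left_module A M"
  using assms unfolding left_module_def by blast

locale lmod_hom = M: lmod A M + N: lmod A N
  for A :: "('k, 'a) module" and M :: "('a, 'm) module" and N :: "('a, 'n) module" +
  fixes f
  assumes hom: "f : module_hom A M N"
begin

lemma closed [simp, intro]: "x : carrier M ==> f x : carrier N"
  using hom by (auto simp: module_hom_def)

lemma add: "x : carrier M ==> y : carrier M ==> f (x +[M] y) = f x +[N] f y"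
  using hom by (auto simp: module_hom_def)

lemma smult: "a : carrier A ==> x : carrier M ==> f (a .[M] x) = a .[N] f x"
  using hom by (auto simp: module_hom_def)

lemma zero [simp]: "f \<zero>[M] = \<zero>[N]"
proof -
  have z: "f \<zero>[M] : carrier N" by (rule closed) (rule M.M.zero_closed)
  have "f (\<zero>[M] +[M] \<zero>[M]) = f \<zero>[M]" by (simp only: M.M.l_zero M.M.zero_closed)
  then have "f \<zero>[M] +[N] f \<zero>[M] = f \<zero>[M]" unfolding add[OF M.M.zero_closed M.M.zero_closed] .
  then show ?thesis using N.M.add.l_cancel_one[OF z z] by (rule iffD1[rotated])
qed

lemma neg:
  assumes x: "x : carrier M"
  shows "f (-[M] x) = -[N] f x"
proof -
  have "f (-[M] x +[M] x) = \<zero>[N]" unfolding M.M.l_neg[OF x] by (rule zero)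
  then have "f (-[M] x) +[N] f x = \<zero>[N]" unfolding add[OF M.M.a_inv_closed[OF x] x] .
  then show ?thesis 
    by (rule N.M.minus_equality[OF _ closed[OF x] closed[OF M.M.a_inv_closed[OF x]], symmetric])
qed

lemma minus: "x : carrier M ==> y : carrier M ==> f (x -[M] y) = f x -[N] f y"
  by (simp add: a_minus_def add neg)

lemma finsum: "g : I \<rightarrow> carrier M ==> f (\<Oplus>\<^bsub>M\<^esub>i\<in>I. g i) = (\<Oplus>\<^bsub>N\<^esub>i\<in>I. f (g i))"
proof (induction I rule: infinite_finite_induct)
  case (insert x F)
  then have g: "g : F \<rightarrow> carrier M" "g x : carrier M" by auto
  then have fg: "(%i. f (g i)) : F \<rightarrow> carrier N" "f (g x) : carrier N" by auto
  have "f (\<Oplus>\<^bsub>M\<^esub>i\<in>insert x F. g i) = f (g x +[M] (\<Oplus>\<^bsub>M\<^esub>i\<in>F. g i))"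
    by (simp only: M.M.finsum_insert[OF insert(1,2) g])
  also have "... = f (g x) +[N] (\<Oplus>\<^bsub>N\<^esub>i\<in>F. f (g i))"
    by (simp only: add[OF g(2) M.M.finsum_closed[OF g(1)]] insert(3)[OF g(1)])
  also have "... = (\<Oplus>\<^bsub>N\<^esub>i\<in>insert x F. f (g i))"
    by (simp only: N.M.finsum_insert[OF insert(1,2) fg])
  finally show ?case .
qed (simp_all add: M.M.finsum_infinite N.M.finsum_infinite)

lemma kernel_submodule: "Module.submodule (kernel_of M N f) A M"
  by (rule M.submoduleI) (auto simp: kernel_of_def add smult)

lemma image_submodule:
  assumes "Module.submodule L A M"
  shows "Module.submodule (f ` L) A N"
proof -
  note L = M.submoduleD[OF assms]
  show ?thesis
  proof (rule N.submoduleI)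
    show "f ` L \<subseteq> carrier N" using L(1) by auto
    show "\<zero>[N] : f ` L" using L(2) by (rule rev_image_eqI) (rule zero[symmetric])
  next
    fix x y assume "x : f ` L" "y : f ` L"
    then obtain u v where uv: "u : L" "v : L" "x = f u" "y = f v" by blast
    then have "f (u +[M] v) = x +[N] y" using L(1) add[of u v] by blast
    then show "x +[N] y : f ` L" using L(3)[OF uv(1,2)] by (metis imageI)
  next
    fix a x assume a: "a : carrier A" and "x : f ` L"
    then obtain u where u: "u : L" "x = f u" by blast
    then have "f (a .[M] u) = a .[N] x" using L(1) smult[OF a, of u] by blast
    then show "a .[N] x : f ` L" using L(4)[OF a u(1)] by (metis imageI)
  qed
qed

lemma vimage_submodule:
  "Module.submodule L A N ==> Module.submodule {x : carrier M. f x : L} A M"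
  by (rule M.submoduleI) (auto simp: add smult N.submoduleD(2-4))

lemma inj_iff: "inj_on f (carrier M) \<longleftrightarrow> kernel_of M N f = {\<zero>[M]}"
proof
  assume "inj_on f (carrier M)"
  then show "kernel_of M N f = {\<zero>[M]}"
    by (auto simp: kernel_of_def dest: inj_onD[of f _ _ "\<zero>[M]"])
next
  assume k: "kernel_of M N f = {\<zero>[M]}"
  show "inj_on f (carrier M)"
  proof (rule inj_onI)
    fix x y assume *: "x : carrier M" "y : carrier M" "f x = f y"
    then have "x -[M] y : kernel_of M N f"
      by (simp add: kernel_of_def minus N.M.minus_other_side)
    then show "x = y" using * k by (simp add: M.M.minus_other_side)
  qed
qed

end

lemma module_homI:
  assumes "!!x. x : carrier M ==> f x : carrier N"
    "!!x y. x : carrier M ==> y : carrier M ==> f (x +[M] y) = f x +[N] f y"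
    "!!a x. a : carrier A ==> x : carrier M ==> f (a .[M] x) = a .[N] f x"
  shows "f : module_hom A M N"
  using assms by (auto simp: module_hom_def)

lemma lmod_homI:
  "left_module A M ==> left_module A N ==> f : module_hom A M N ==> lmod_hom A M N f"
  by (simp add: lmod_hom_def lmod_def lmod_hom_axioms_def)

lemma module_hom_comp:
  "f : module_hom A L M ==> g : module_hom A M N ==> (%x. g (f x)) : module_hom A L N"
  by (rule module_homI) (simp_all add: module_hom_def Pi_iff)

lemma module_hom_id: "(%x. x) : module_hom A M M"
  by (simp add: module_hom_def)

lemma module_hom_restrict:
  "f : module_hom A M N ==> L \<subseteq> carrier M ==> f ` L \<subseteq> L' ==>
   f : module_hom A (M(|carrier := L|)) (N(|carrier := L'|))"
  by (rule module_homI) (simp_all add: module_hom_def Pi_iff subset_iff image_subset_iff)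

lemma module_hom_restrict_dom:
  "f : module_hom A M N ==> L \<subseteq> carrier M ==> f : module_hom A (M(|carrier := L|)) N"
  by (rule module_homI) (simp_all add: module_hom_def Pi_iff subset_iff)

lemma module_hom_restrict_cod:
  "f : module_hom A M N ==> f ` carrier M \<subseteq> L' ==> f : module_hom A M (N(|carrier := L'|))"
  by (rule module_homI) (simp_all add: module_hom_def Pi_iff image_subset_iff)

lemma module_hom_extend_cod:
  "f : module_hom A M (N(|carrier := L'|)) ==> L' \<subseteq> carrier N ==> f : module_hom A M N"
  by (rule module_homI) (auto simp add: module_hom_def Pi_iff subset_iff)

text \<open>Sums of submodules are taken elementwise here, the form in which lifting arguments and
  Nakayama's lemma produce them.\<close>

lemma superfluousI:
  assumes "Module.submodule N A M"
    "!!L. Module.submodule L A M ==> (!!x. x : carrier M ==> \<exists>n\<in>N. \<exists>l\<in>L. x = n +[M] l) ==> carrier M \<subseteq> L"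
    "left_module A M"
  shows "superfluous N A M"
proof -
  interpret lmod A M by (simp add: lmod_def assms)
  have "L = carrier M" if "Module.submodule L A M" "N <+>\<^bsub>M\<^esub> L = carrier M" for L
    using assms(2)[OF that(1)] that(2) submoduleD(1)[OF that(1)] set_add_iff by blast
  then show ?thesis using assms(1) by (simp add: superfluous_def)
qed

lemma superfluousD:
  assumes "superfluous N A M" "left_module A M" "Module.submodule L A M"
    "!!x. x : carrier M ==> \<exists>n\<in>N. \<exists>l\<in>L. x = n +[M] l"
  shows "L = carrier M"
proof -
  interpret lmod A M by (simp add: lmod_def assms)
  have N: "Module.submodule N A M" using assms(1) by (simp add: superfluous_def)
  have "N <+>\<^bsub>M\<^esub> L = carrier M"
  proof
    show "carrier M \<subseteq> N <+>\<^bsub>M\<^esub> L" using assms(4) by (auto simp: set_add_iff)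
    show "N <+>\<^bsub>M\<^esub> L \<subseteq> carrier M"
      using submoduleD(1)[OF N] submoduleD(1)[OF assms(3)] by (auto simp: set_add_iff subset_iff)
  qed
  then show ?thesis using assms unfolding superfluous_def by blast
qed

subsection \<open>Transport along an injection, products\<close>

text \<open>Projectivity is tested only on modules with carrier in \<open>nat => 'k\<close>, and
  complexity only sees resolutions there. A product, a free module or a total complex has another
  carrier type and enters such arguments as its copy along an injection; the operations are
  conjugated by the inverse of \<open>fi\<close> on the carrier.\<close>

definition copy_module :: "('m => 'n) => ('a, 'm) module => ('a, 'n) module" where
  "copy_module fi M = (let ps = the_inv_into (carrier M) fi in
     (|carrier = fi ` carrier M, monoid.mult = undefined, one = undefined,
      zero = fi \<zero>[M], add = %x y. fi (ps x +[M] ps y), module.smult = %a x. fi (a .[M] ps x)|))"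

definition prod_module :: "('a, 'm) module => ('a, 'n) module => ('a, 'm \<times> 'n) module" where
  "prod_module M N =
     (|carrier = carrier M \<times> carrier N, monoid.mult = undefined, one = undefined,
      zero = (\<zero>[M], \<zero>[N]), add = %(x, y) (x', y'). (x +[M] x', y +[N] y'),
      module.smult = %a (x, y). (a .[M] x, a .[N] y)|)"

locale copied = lmod +
  fixes fi :: "'c => 'd"
  assumes inj: "inj_on fi (carrier M)"
begin

abbreviation "M' \<equiv> copy_module fi M"
abbreviation "ps \<equiv> the_inv_into (carrier M) fi"

lemma inv_simp [simp]: "x : carrier M ==> ps (fi x) = x"
  by (simp add: the_inv_into_f_f inj)

lemma carrier_copy: "carrier M' = fi ` carrier M"
  by (simp add: copy_module_def Let_def)

lemma copy_simps [simp]: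
  "\<zero>[M'] = fi \<zero>[M]"
  "x : carrier M ==> y : carrier M ==> fi x +[M'] fi y = fi (x +[M] y)"
  "x : carrier M ==> a .[M'] fi x = fi (a .[M] x)"
  by (simp_all add: copy_module_def Let_def)

lemma left_module_copy: "left_module A M'"
proof (rule left_moduleI)
  show "abelian_group M'"
  proof (rule abelian_groupI, goal_cases)
    case (6 x)
    then obtain u where "u : carrier M" "x = fi u" by (auto simp: carrier_copy)
    then show ?case by (intro bexI[of _ "fi (-[M] u)"]) (auto simp: M.l_neg carrier_copy)
  qed (auto simp: carrier_copy M.a_ac)
qed (auto simp: carrier_copy A.ring_axioms smult_l_distr smult_r_distr smult_assoc)

lemma hom_to: "fi : module_hom A M M'"
  by (rule module_homI) (auto simp: carrier_copy)

lemma hom_from: "ps : module_hom A M' M"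
  by (rule module_homI) (auto simp: carrier_copy)

lemma inv_simp' [simp]: "x : carrier M' ==> fi (ps x) = x"
  by (auto simp: carrier_copy)

end

lemma copied_intro: "left_module A M ==> inj_on fi (carrier M) ==> copied A M fi"
  by (simp add: copied_def lmod_def copied_axioms_def)

lemma left_module_prod:
  assumes "left_module A M" "left_module A N"
  shows "left_module A (prod_module M N)"
proof -
  interpret M: lmod A M by (simp add: lmod_def assms)
  interpret N: lmod A N by (simp add: lmod_def assms)
  have "abelian_group (prod_module M N)"
  proof (rule abelian_groupI, goal_cases)
    case (6 x)
    then show ?case
      by (intro bexI[of _ "(-[M] fst x, -[N] snd x)"])
        (auto simp: prod_module_def M.M.l_neg N.M.l_neg)
  qed (auto simp: prod_module_def M.M.a_ac N.M.a_ac)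
  then show ?thesis
    by (rule left_moduleI[OF M.A.ring_axioms])
      (auto simp: prod_module_def M.smult_l_distr M.smult_r_distr M.smult_assoc
        N.smult_l_distr N.smult_r_distr N.smult_assoc)
qed

lemma prod_module_simps [simp]:
  "carrier (prod_module M N) = carrier M \<times> carrier N"
  "\<zero>[prod_module M N] = (\<zero>[M], \<zero>[N])"
  "(x, y) +[prod_module M N] (x', y') = (x +[M] x', y +[N] y')"
  "a .[prod_module M N] (x, y) = (a .[M] x, a .[N] y)"
  by (simp_all add: prod_module_def)

section \<open>Dimensions\<close>

lemma vectorspace_map:
  assumes "vectorspace K V" "vectorspace K W" "f : module_hom K V W"
  shows "linear_map K V W f"
  using assms by (simp add: linear_map_def mod_hom_def mod_hom_axioms_def vectorspace_def)

text \<open>Modules are handled with the submodules of \<open>Module\<close>, spans and bases with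
  those of \<open>LinearCombinations\<close>; this is the bridge.\<close>

lemma submodule_convert:
  assumes "vectorspace K V" "Module.submodule N K V"
  shows "LinearCombinations.submodule K N V"
proof -
  interpret vectorspace K V by fact
  have "N \<subseteq> carrier V" "\<zero>[V] : N" "!!x y. x : N ==> y : N ==> x +[V] y : N"
    "!!a x. a : carrier K ==> x : N ==> a .[V] x : N"
    using submoduleE[OF assms(2)] subgroup.one_closed[of N "add_monoid V"] assms(2)
    by (auto simp: Module.submodule_def)
  then show ?thesis
    unfolding LinearCombinations.submodule_def using module_axioms by blast
qed

lemma vectorspace_subspace:
  assumes "vectorspace K V" "Module.submodule N K V"
  shows "vectorspace K (V(|carrier := N|))"
  using vectorspace.subspace_is_vs[OF assms(1)] submodule_convert[OF assms] assms(1)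
  by (simp add: subspace_def)

lemma rank_nullity_kernel:
  assumes "vectorspace K V" "vectorspace K W" "f : module_hom K V W"
    "vectorspace.fin_dim K V" "f ` carrier V = carrier W"
  shows "vectorspace.fin_dim K W"
    "vectorspace.dim K V = vectorspace.dim K W +
      vectorspace.dim K (V(|carrier := {v : carrier V. f v = \<zero>[W]}|))"
proof -
  interpret linear_map K V W f by (rule vectorspace_map[OF assms(1-3)])
  show "vectorspace.fin_dim K W" by (rule surj_fin_dim[OF assms(4,5)])
  have "imT = carrier W" using assms(5) by (simp add: im_def)
  moreover have "kerT = {v : carrier V. f v = \<zero>[W]}" by (simp add: ker_def)
  ultimately show "vectorspace.dim K V = vectorspace.dim K W +
      vectorspace.dim K (V(|carrier := {v : carrier V. f v = \<zero>[W]}|))"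
    using rank_nullity[OF assms(4)] by simp
qed

text \<open>Independent subsets of \<open>N\<close> stay independent in \<open>V\<close>, so their
  size is bounded and a maximal one exists. It is a basis of \<open>N\<close> and, by counting, a
  basis of \<open>V\<close> when the dimensions agree.\<close>

lemma subspace_dim:
  assumes "vectorspace K V" "Module.submodule N K V" "vectorspace.fin_dim K V"
  shows "vectorspace.fin_dim K (V(|carrier := N|))"
    "vectorspace.dim K (V(|carrier := N|)) <= vectorspace.dim K V"
    "vectorspace.dim K (V(|carrier := N|)) = vectorspace.dim K V ==> N = carrier V"
proof -
  interpret vectorspace K V by fact
  interpret N: vectorspace K "V(|carrier := N|)" by (rule vectorspace_subspace[OF assms(1,2)])
  have sub: "LinearCombinations.submodule K N V" by (rule submodule_convert[OF assms(1,2)])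
  then have NV: "N \<subseteq> carrier V" by (simp add: LinearCombinations.submodule_def)
  have li: "finite S & card S <= dim" if "S \<subseteq> N" "\<not> N.lin_dep S" for S
    using li_le_dim[OF assms(3), of S] span_li_not_depend(2)[OF that(1) sub] that NV by auto
  have "\<exists>S. finite S & maximal S (%S. S \<subseteq> carrier (V(|carrier := N|)) & \<not> N.lin_dep S)"
    by (rule maximal_exists[of _ dim "{}"]) (use li in \<open>auto simp: N.lin_dep_def\<close>)
  then obtain S where S: "finite S" "maximal S (%S. S \<subseteq> carrier (V(|carrier := N|)) & \<not> N.lin_dep S)"
    by blast
  have bas: "N.basis S" by (rule N.max_li_is_basis[OF S(2)])
  then have SN: "S \<subseteq> N" "\<not> N.lin_dep S" "N.span S = N" by (auto simp: N.basis_def)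
  show "N.fin_dim" unfolding N.fin_dim_def using bas S(1) by (auto simp: N.basis_def)
  have d: "N.dim = card S" by (rule N.dim_basis[OF S(1) bas])
  then show "N.dim <= dim" using li[OF SN(1,2)] by simp
  assume "N.dim = dim"
  then have "basis S"
    using dim_li_is_basis[OF assms(3) S(1)] SN NV d span_li_not_depend(2)[OF SN(1) sub] by auto
  then show "N = carrier V"
    using SN(3) span_li_not_depend(1)[OF SN(1) sub] by (auto simp: basis_def)
qed

text \<open>Generators of the kernel together with preimages of generators of the image generate
  everything.\<close>

lemma fin_dim_extension:
  assumes "vectorspace K V" "vectorspace K W" "f : module_hom K V W" "f ` carrier V = carrier W"
    "vectorspace.fin_dim K W" "vectorspace.fin_dim K (V(|carrier := {v : carrier V. f v = \<zero>[W]}|))"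
  shows "vectorspace.fin_dim K V"
proof -
  interpret V: vectorspace K V by fact
  interpret W: vectorspace K W by fact
  interpret linear_map K V W f by (rule vectorspace_map[OF assms(1-3)])
  define N where "N = {v : carrier V. f v = \<zero>[W]}"
  have N: "LinearCombinations.submodule K N V"
    using ker_is_submodule by (simp add: N_def ker_def)
  interpret N: vectorspace K "V(|carrier := N|)"
    using V.subspace_is_vs[of N] N assms(1) by (simp add: subspace_def)
  obtain B where B: "finite B" "B \<subseteq> N" "N.span B = N"
    using assms(6) unfolding N_def[symmetric] N.fin_dim_def by auto
  obtain C where C: "finite C" "C \<subseteq> carrier W" "W.span C = carrier W"
    using assms(5) unfolding W.fin_dim_def by auto
  have "\<forall>c\<in>C. \<exists>v. v : carrier V & f v = c" using C(2) unfolding assms(4)[symmetric] by auto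
  from bchoice[OF this] obtain g where g: "!!c. c : C ==> g c : carrier V & f (g c) = c" by blast
  let ?D = "V.span (g ` C)"
  have gC: "g ` C \<subseteq> carrier V" "B \<subseteq> carrier V" using g B(2) by (auto simp: N_def)
  have Dsub: "LinearCombinations.submodule K ?D V" by (rule V.span_is_submodule[OF gC(1)])
  then have DV: "?D \<subseteq> carrier V" by (simp add: LinearCombinations.submodule_def)
  have "f : module_hom K (V(|carrier := ?D|)) W"
    using assms(3) DV by (auto simp: module_hom_def Pi_iff subset_iff)
  then interpret D: linear_map K "V(|carrier := ?D|)" W f
    using V.subspace_is_vs[of ?D] Dsub assms by (intro vectorspace_map) (auto simp: subspace_def)
  have "LinearCombinations.submodule K (f ` ?D) W"
    using D.im_is_submodule by (simp add: D.im_def)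
  moreover have "C \<subseteq> f ` ?D"
    using g V.in_own_span[OF gC(1)] by (metis image_eqI subsetD subsetI)
  ultimately have WD: "carrier W \<subseteq> f ` ?D" using W.span_is_subset[of C "f ` ?D"] C(3) by simp
  have "V.span (B \<union> g ` C) = carrier V"
  proof
    show "V.span (B \<union> g ` C) \<subseteq> carrier V" using gC V.span_is_subset2[of "B \<union> g ` C"] by simp
    show "carrier V \<subseteq> V.span (B \<union> g ` C)"
    proof
      fix v assume v: "v : carrier V"
      then have "f v : f ` ?D" using WD by auto
      then obtain u where u: "u : ?D" "f u = f v" by auto
      have uV: "u : carrier V" using u DV by auto
      have "f (v -[V] u) = \<zero>[W]" using u v uV by simp
      then have "v -[V] u : V.span B"
        using v uV N.carrier_vs_is_self B(3) V.span_li_not_depend(1)[OF B(2) N] by (auto simp: N_def)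
      then have "v -[V] u : V.span (B \<union> g ` C)" "u : V.span (B \<union> g ` C)"
        using u(1) V.span_is_monotone[of B "B \<union> g ` C"] V.span_is_monotone[of "g ` C" "B \<union> g ` C"] by auto
      then have "(v -[V] u) +[V] u : V.span (B \<union> g ` C)"
        using gC by (intro V.span_add1) auto
      moreover have "(v -[V] u) +[V] u = v"
        using v uV by (simp add: a_minus_def V.module.M.a_assoc V.module.M.l_neg)
      ultimately show "v : V.span (B \<union> g ` C)" by simp
    qed
  qed
  then show ?thesis
    unfolding V.fin_dim_def using B(1) C(1) gC by (intro exI[of _ "B \<union> g ` C"]) auto
qed

text \<open>Coordinates with respect to a basis, encoded as functions on the natural numbers.\<close>

lemma fin_dim_embedding:
  fixes K :: "'k ring" and V :: "('k, 'v) module"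
  assumes "vectorspace K V" "vectorspace.fin_dim K V"
  shows "\<exists>fi :: 'v => nat => 'k. inj_on fi (carrier V)"
proof -
  interpret vectorspace K V by fact
  obtain B where B: "finite B" "basis B" using finite_basis_exists assms(2) by blast
  obtain h where h: "bij_betw h {0..<card B} B" using ex_bij_betw_nat_finite[OF B(1)] by blast
  have "\<exists>a. a : B \<rightarrow> carrier K & v = lincomb a B" if "v : carrier V" for v
    using that B finite_span[OF B(1)] unfolding basis_def by auto
  then obtain c where c: "!!v. v : carrier V ==> c v : B \<rightarrow> carrier K & v = lincomb (c v) B"
    by metis
  have "inj_on (%v n. if n < card B then c v (h n) else undefined) (carrier V)"
  proof (rule inj_onI)
    fix v w assume vw: "v : carrier V" "w : carrier V"
      and eq: "(%n. if n < card B then c v (h n) else undefined) = (%n. if n < card B then c w (h n) else undefined)"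
    have "c v b = c w b" if b: "b : B" for b
    proof -
      have "b : h ` {0..<card B}" using h b by (simp add: bij_betw_def)
      then obtain n where "n < card B" "h n = b" by auto
      then show ?thesis using fun_cong[OF eq, of n] by simp
    qed
    then have "lincomb (c v) B = lincomb (c w) B"
      unfolding lincomb_def using c[OF vw(2)] B(2)
      by (intro M.finsum_cong') (auto simp: basis_def)
    then show "v = w" using c[OF vw(1)] c[OF vw(2)] by metis
  qed
  then show ?thesis by blast
qed

section \<open>Finite-dimensional algebras and the dimensions of their modules\<close>

locale fd_alg =
  fixes K :: "'k ring" and A :: "('k, 'a) module"
  assumes field_K: "field K" and k_alg: "k_algebra K A" and fin_A: "vectorspace.fin_dim K A"

sublocale fd_alg \<subseteq> K: field K by (rule field_K)
sublocale fd_alg \<subseteq> AV: vectorspace K A using k_alg by (simp add: k_algebra_def)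
sublocale fd_alg \<subseteq> A: ring A using k_alg by (simp add: k_algebra_def)

context fd_alg
begin

abbreviation "scal c \<equiv> c .[A] \<one>[A]"
abbreviation "vs_of M \<equiv> restrict_scalars A M"
abbreviation "fd M \<equiv> vectorspace.fin_dim K (restrict_scalars A M)"
abbreviation "dimm M \<equiv> dim_over K A M"

lemma scal_closed [simp]: "c : carrier K ==> scal c : carrier A" by simp

lemma smult_mult:
  "c : carrier K ==> a : carrier A ==> b : carrier A ==> (c .[A] a) *[A] b = c .[A] (a *[A] b)"
  "c : carrier K ==> a : carrier A ==> b : carrier A ==> a *[A] (c .[A] b) = c .[A] (a *[A] b)"
  using k_alg by (auto simp: k_algebra_def)

lemma scal_mult: "c : carrier K ==> a : carrier A ==> scal c *[A] a = c .[A] a"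
  "c : carrier K ==> a : carrier A ==> a *[A] scal c = c .[A] a"
  by (simp_all add: smult_mult)

lemma vs_of_simps [simp]:
  "carrier (vs_of M) = carrier M" "\<zero>[vs_of M] = \<zero>[M]" "x +[vs_of M] y = x +[M] y"
  "c .[vs_of M] x = scal c .[M] x"
  "vs_of (M(|carrier := N|)) = (vs_of M)(|carrier := N|)"
  by (simp_all add: restrict_scalars_def)

lemma vs_of_vectorspace:
  assumes "left_module A M" shows "vectorspace K (vs_of M)"
proof -
  interpret lmod A M by (simp add: lmod_def assms)
  have "abelian_group (vs_of M)"
  proof (rule abelian_groupI, goal_cases)
    case (6 x) then show ?case by (intro bexI[of _ "-[M] x"]) (simp_all add: M.l_neg)
  qed (simp_all add: M.a_ac)
  then have "module K (vs_of M)"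
  proof (intro moduleI, goal_cases)
    case (4 c d x)
    then show ?case by (simp add: AV.smult_l_distr smult_l_distr)
  next
    case (6 c d x)
    have "scal (c *[K] d) = scal c *[A] scal d"
      using 6 by (simp add: scal_mult(1) AV.smult_assoc1)
    then show ?case using 6 by (simp add: smult_assoc)
  qed (simp_all add: smult_r_distr K.is_cring)
  then show ?thesis by (simp add: vectorspace_def field_K)
qed

lemma dimm_carrier: "dimm (M(|carrier := N|)) = vectorspace.dim K ((vs_of M)(|carrier := N|))"
  by (simp add: dim_over_def)

lemma dimm_def: "dimm M = vectorspace.dim K (vs_of M)" by (simp add: dim_over_def)

lemma hom_linear: "left_module A M ==> f : module_hom A M N ==> f : module_hom K (vs_of M) (vs_of N)"
  by (auto simp: module_hom_def)

lemma submodule_subspace: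
  assumes "left_module A M" "Module.submodule N A M"
  shows "Module.submodule N K (vs_of M)"
proof -
  interpret lmod A M by (simp add: lmod_def assms)
  interpret V: vectorspace K "vs_of M" by (rule vs_of_vectorspace[OF assms(1)])
  note N = submoduleD[OF assms(2)]
  have "-[vs_of M] x : N" if "x : N" for x
  proof -
    have "x : carrier M" using that N(1) by auto
    then have "-[vs_of M] x = -[M] x"
      by (intro V.module.M.minus_equality) (simp_all add: M.l_neg)
    then show ?thesis using N(5)[OF that] by simp
  qed
  then show ?thesis using N by (intro V.module.submoduleI) auto
qed

lemma sub_fd:
  assumes "left_module A M" "Module.submodule N A M" "fd M"
  shows "fd (M(|carrier := N|))" "dimm (M(|carrier := N|)) <= dimm M"
    "dimm (M(|carrier := N|)) = dimm M ==> N = carrier M"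
  using subspace_dim[OF vs_of_vectorspace[OF assms(1)] submodule_subspace[OF assms(1,2)] assms(3)]
  by (simp_all add: dim_over_def)

lemma hom_dim:
  assumes "left_module A M" "left_module A N" "f : module_hom A M N" "fd M" "f ` carrier M = carrier N"
  shows "fd N" "dimm M = dimm N + dimm (M(|carrier := kernel_of M N f|))"
  using rank_nullity_kernel[OF vs_of_vectorspace vs_of_vectorspace hom_linear, OF assms(1,2,1,3,4)] assms(5)
  by (simp_all add: dim_over_def kernel_of_def)

lemma hom_dim_le:
  assumes "left_module A M" "left_module A N" "f : module_hom A M N" "fd M" "f ` carrier M = carrier N"
  shows "dimm N <= dimm M"
  using hom_dim[OF assms] by simp

lemma zero_dim:
  assumes "left_module A M" "carrier M = {\<zero>[M]}"
  shows "fd M" "dimm M = 0"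
proof -
  interpret V: vectorspace K "vs_of M" by (rule vs_of_vectorspace[OF assms(1)])
  have g: "V.span {\<zero>[M]} = carrier (vs_of M)"
    using V.span_is_subset2[of "{\<zero>[M]}"] V.in_own_span[of "{\<zero>[M]}"] assms(2) by auto
  then show "fd M" unfolding V.fin_dim_def using assms(2) by (intro exI[of _ "{\<zero>[M]}"]) simp
  show "dimm M = 0" using V.dim0I g by (simp add: dim_over_def)
qed

lemma dim_zero_imp:
  assumes "left_module A M" "fd M" "dimm M = 0"
  shows "carrier M = {\<zero>[M]}"
proof -
  interpret lmod A M by (simp add: lmod_def assms)
  have "dimm (M(|carrier := {\<zero>[M]}|)) = 0"
    using zero_dim(2)[OF submodule_left_module[OF zero_submodule]] by simp
  then show ?thesis using sub_fd(3)[OF assms(1) zero_submodule assms(2)] assms(3) by simp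
qed

lemma iso_dim:
  assumes "left_module A M" "left_module A N" "f : module_hom A M N" "fd M"
    "bij_betw f (carrier M) (carrier N)"
  shows "fd N" "dimm M = dimm N"
proof -
  interpret lmod_hom A M N f by (rule lmod_homI[OF assms(1-3)])
  have s: "f ` carrier M = carrier N" and "kernel_of M N f = {\<zero>[M]}"
    using assms(5) inj_iff by (auto simp: bij_betw_def)
  then show "fd N" "dimm M = dimm N"
    using hom_dim[OF assms(1-4) s] zero_dim(2)[OF M.submodule_left_module[OF M.zero_submodule]]
    by simp_all
qed

lemma fd_iso_back:
  assumes "left_module A M" "left_module A N" "f : module_hom A M N" "fd N"
    "bij_betw f (carrier M) (carrier N)"
  shows "fd M" "dimm M = dimm N"
proof -
  interpret lmod_hom A M N f by (rule lmod_homI[OF assms(1-3)])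
  let ?g = "the_inv_into (carrier M) f"
  have inj: "inj_on f (carrier M)" and im: "f ` carrier M = carrier N" using assms(5) by (auto simp: bij_betw_def)
  have g: "?g y : carrier M" "f (?g y) = y" if "y : carrier N" for y
    using that inj im by (simp_all add: the_inv_into_into f_the_inv_into_f)
  have "?g : module_hom A N M"
  proof (rule module_homI)
    fix x y assume xy: "x : carrier N" "y : carrier N"
    then have "f (?g (x +[N] y)) = f (?g x +[M] ?g y)" using g add by simp
    then show "?g (x +[N] y) = ?g x +[M] ?g y"
      by (rule inj_onD[OF inj]) (use xy g(1) in simp_all)
  next
    fix a x assume ax: "a : carrier A" "x : carrier N"
    then have "f (?g (a .[N] x)) = f (a .[M] ?g x)" using g smult by simp
    then show "?g (a .[N] x) = a .[M] ?g x"
      by (rule inj_onD[OF inj]) (use ax g(1) in simp_all)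
  qed (use g in auto)
  moreover have "bij_betw ?g (carrier N) (carrier M)" by (rule bij_betw_the_inv_into[OF assms(5)])
  ultimately show "fd M" "dimm M = dimm N" using iso_dim[OF assms(2,1) _ assms(4)] by auto
qed

lemma hom_fd_extension:
  assumes "left_module A M" "left_module A N" "f : module_hom A M N" "f ` carrier M = carrier N"
    "fd N" "fd (M(|carrier := kernel_of M N f|))"
  shows "fd M"
  using fin_dim_extension[OF vs_of_vectorspace vs_of_vectorspace hom_linear, OF assms(1,2,1,3)] assms(4-6)
  by (simp add: kernel_of_def)

lemma prod_dim:
  assumes "left_module A M" "left_module A N" "fd M" "fd N"
  shows "fd (prod_module M N)" "dimm (prod_module M N) = dimm M + dimm N"
proof -
  interpret M: lmod A M by (simp add: lmod_def assms)
  interpret N: lmod A N by (simp add: lmod_def assms)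
  have P: "left_module A (prod_module M N)" by (rule left_module_prod[OF assms(1,2)])
  have h: "snd : module_hom A (prod_module M N) N" by (rule module_homI) auto
  interpret snd: lmod_hom A "prod_module M N" N snd by (rule lmod_homI[OF P assms(2) h])
  let ?k = "kernel_of (prod_module M N) N snd"
  have k: "?k = carrier M \<times> {\<zero>[N]}" by (auto simp: kernel_of_def)
  have kl: "left_module A (prod_module M N(|carrier := ?k|))"
    by (rule snd.M.submodule_left_module[OF snd.kernel_submodule])
  have "fst : module_hom A (prod_module M N(|carrier := ?k|)) M"
    by (rule module_homI) (auto simp: k)
  moreover have "bij_betw fst (carrier (prod_module M N(|carrier := ?k|))) (carrier M)"
    by (auto simp: k bij_betw_def inj_on_def image_iff)
  ultimately have *: "fd (prod_module M N(|carrier := ?k|))" "dimm (prod_module M N(|carrier := ?k|)) = dimm M"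
    using fd_iso_back[OF kl assms(1) _ assms(3)] by auto
  have s: "snd ` carrier (prod_module M N) = carrier N" by (auto simp: image_iff)
  show "fd (prod_module M N)" by (rule hom_fd_extension[OF P assms(2) h s assms(4) *(1)])
  then show "dimm (prod_module M N) = dimm M + dimm N"
    using hom_dim(2)[OF P assms(2) h _ s] *(2) by simp
qed

end

section \<open>Projective covers and minimal resolutions\<close>

lemma inverse_hom:
  assumes "left_module A M" "left_module A N" "f : module_hom A M N"
    "bij_betw f (carrier M) (carrier N)"
  shows "the_inv_into (carrier M) f : module_hom A N M"
proof -
  interpret lmod_hom A M N f by (rule lmod_homI[OF assms(1-3)])
  let ?g = "the_inv_into (carrier M) f"
  have inj: "inj_on f (carrier M)" and im: "f ` carrier M = carrier N" using assms(4) by (auto simp: bij_betw_def)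
  have g: "?g y : carrier M" "f (?g y) = y" if "y : carrier N" for y
    using that inj im by (simp_all add: the_inv_into_into f_the_inv_into_f)
  show ?thesis
  proof (rule module_homI)
    fix x y assume xy: "x : carrier N" "y : carrier N"
    then have "f (?g (x +[N] y)) = f (?g x +[M] ?g y)" using g add by simp
    then show "?g (x +[N] y) = ?g x +[M] ?g y"
      by (rule inj_onD[OF inj]) (use xy g(1) in simp_all)
  next
    fix a x assume ax: "a : carrier A" "x : carrier N"
    then have "f (?g (a .[N] x)) = f (a .[M] ?g x)" using g smult by simp
    then show "?g (a .[N] x) = a .[M] ?g x"
      by (rule inj_onD[OF inj]) (use ax g(1) in simp_all)
  qed (use g in auto)
qed

lemma projective_left_module: "projective A P ==> left_module A P"
  by (simp add: projective_def)

lemma projective_lift: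
  fixes A :: "('k, 'a) module" and X Y :: "('a, nat => 'k) module"
  assumes "projective A P" "left_module A X" "left_module A Y" "g : module_hom A X Y"
    "g ` carrier X = carrier Y" "f : module_hom A P Y"
  obtains h where "h : module_hom A P X" "!!p. p : carrier P ==> g (h p) = f p"
  using assms unfolding projective_def by blast

lemma projective_retract:
  fixes A :: "('k, 'a) module"
  assumes "projective A P" "left_module A Q" "i : module_hom A Q P" "p : module_hom A P Q"
    "!!x. x : carrier Q ==> p (i x) = x"
  shows "projective A Q"
  unfolding projective_def
proof (intro conjI allI impI)
  fix X Y :: "('a, nat => 'k) module" and g f
  assume *: "left_module A X & left_module A Y & g : module_hom A X Y &
    g ` carrier X = carrier Y & f : module_hom A Q Y"
  obtain h where h: "h : module_hom A P X" "!!q. q : carrier P ==> g (h q) = f (p q)"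
    by (rule projective_lift[OF assms(1), of X Y g "%q. f (p q)"])
      (use * module_hom_comp[OF assms(4), of f Y] in auto)
  show "\<exists>h\<in>module_hom A Q X. \<forall>q\<in>carrier Q. g (h q) = f q"
  proof (rule bexI[OF _ module_hom_comp[OF assms(3) h(1)]], rule ballI)
    fix q assume q: "q : carrier Q"
    then have "i q : carrier P" using assms(3) by (auto simp: module_hom_def)
    then show "g (h (i q)) = f q" using h(2) assms(5)[OF q] by simp
  qed
qed (rule assms(2))

lemma projective_copy:
  assumes "projective A P" "inj_on fi (carrier P)"
  shows "projective A (copy_module fi P)"
proof -
  interpret copied A P fi by (rule copied_intro[OF projective_left_module[OF assms(1)] assms(2)])
  show ?thesis
    by (rule projective_retract[OF assms(1) left_module_copy hom_from hom_to]) simp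
qed

lemma projective_prod:
  fixes A :: "('k, 'a) module"
  assumes "projective A P" "projective A Q"
  shows "projective A (prod_module P Q)"
  unfolding projective_def
proof (intro conjI allI impI)
  show lm: "left_module A (prod_module P Q)"
    by (intro left_module_prod projective_left_module assms)
  interpret P: lmod A P by (simp add: lmod_def projective_left_module assms)
  interpret Q: lmod A Q by (simp add: lmod_def projective_left_module assms)
  fix X Y :: "('a, nat => 'k) module" and g f
  assume *: "left_module A X & left_module A Y & g : module_hom A X Y &
    g ` carrier X = carrier Y & f : module_hom A (prod_module P Q) Y"
  then interpret g: lmod_hom A X Y g by (intro lmod_homI) auto
  interpret f: lmod_hom A "prod_module P Q" Y f using * lm by (intro lmod_homI) auto
  have 1: "(%x. (x, \<zero>[Q])) : module_hom A P (prod_module P Q)"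
    and 2: "(%x. (\<zero>[P], x)) : module_hom A Q (prod_module P Q)"
    by (rule module_homI; simp)+
  obtain h where h: "h : module_hom A P X" "!!p. p : carrier P ==> g (h p) = f (p, \<zero>[Q])"
    by (rule projective_lift[OF assms(1), of X Y g "%p. f (p, \<zero>[Q])"])
      (use * module_hom_comp[OF 1] in auto)
  obtain h' where h': "h' : module_hom A Q X" "!!p. p : carrier Q ==> g (h' p) = f (\<zero>[P], p)"
    by (rule projective_lift[OF assms(2), of X Y g "%p. f (\<zero>[P], p)"])
      (use * module_hom_comp[OF 2] in auto)
  interpret h: lmod_hom A P X h using * h(1) projective_left_module[OF assms(1)] by (intro lmod_homI) auto
  interpret h': lmod_hom A Q X h' using * h'(1) projective_left_module[OF assms(2)] by (intro lmod_homI) auto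
  have "(%(p, q). h p +[X] h' q) : module_hom A (prod_module P Q) X"
    by (rule module_homI)
      (auto simp: h.add h'.add h.smult h'.smult g.M.smult_r_distr g.M.M.a_ac)
  moreover have "g (h p +[X] h' q) = f (p, q)" if "p : carrier P" "q : carrier Q" for p q
    using f.add[of "(p, \<zero>[Q])" "(\<zero>[P], q)"] that h(2) h'(2) by (simp add: g.add)
  ultimately show "\<exists>h\<in>module_hom A (prod_module P Q) X. \<forall>q\<in>carrier (prod_module P Q). g (h q) = f q"
    by (intro bexI[of _ "%(p, q). h p +[X] h' q"]) auto
qed

lemma regular_module_simps [simp]:
  "carrier (regular_module A) = carrier A" "\<zero>[regular_module A] = \<zero>[A]"
  "x +[regular_module A] y = x +[A] y" "a .[regular_module A] x = a *[A] x"
  by (simp_all add: regular_module_def)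

lemma regular_left_module:
  assumes "ring A" shows "left_module A (regular_module A)"
proof -
  interpret ring A by fact
  have "abelian_group (regular_module A)"
  proof (rule abelian_groupI, goal_cases)
    case (6 x) then show ?case by (intro bexI[of _ "-[A] x"]) (simp_all add: l_neg)
  qed (simp_all add: a_ac)
  then show ?thesis
    by (intro left_moduleI) (simp_all add: assms l_distr r_distr m_assoc)
qed

lemma projective_regular:
  fixes A :: "('k, 'a) module"
  assumes "ring A" shows "projective A (regular_module A)"
  unfolding projective_def
proof (intro conjI allI impI)
  interpret ring A by fact
  show lm: "left_module A (regular_module A)" by (rule regular_left_module[OF assms])
  fix X Y :: "('a, nat => 'k) module" and g f
  assume *: "left_module A X & left_module A Y & g : module_hom A X Y &
    g ` carrier X = carrier Y & f : module_hom A (regular_module A) Y"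
  then interpret g: lmod_hom A X Y g by (intro lmod_homI) auto
  interpret f: lmod_hom A "regular_module A" Y f using * lm by (intro lmod_homI) auto
  have "f \<one>[A] : g ` carrier X" using * by auto
  then obtain x where x: "x : carrier X" "g x = f \<one>[A]" by auto
  have "(%a. a .[X] x) : module_hom A (regular_module A) X"
    by (rule module_homI) (auto simp: x g.M.smult_l_distr g.M.smult_assoc)
  moreover have "g (a .[X] x) = f a" if "a : carrier A" for a
    using that x f.smult[of a "\<one>[A]"] by (simp add: g.smult)
  ultimately show "\<exists>h\<in>module_hom A (regular_module A) X. \<forall>q\<in>carrier (regular_module A). g (h q) = f q"
    by (intro bexI[of _ "%a. a .[X] x"]) auto
qed

lemma projective_zero:
  fixes A :: "('k, 'a) module"
  assumes "left_module A P" "carrier P = {\<zero>[P]}" shows "projective A P"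
  unfolding projective_def
proof (intro conjI allI impI)
  fix X Y :: "('a, nat => 'k) module" and g f
  assume *: "left_module A X & left_module A Y & g : module_hom A X Y &
    g ` carrier X = carrier Y & f : module_hom A P Y"
  then interpret g: lmod_hom A X Y g by (intro lmod_homI) auto
  interpret f: lmod_hom A P Y f using * assms(1) by (intro lmod_homI) auto
  have "(%_. \<zero>[X]) : module_hom A P X" by (rule module_homI) auto
  then show "\<exists>h\<in>module_hom A P X. \<forall>q\<in>carrier P. g (h q) = f q"
    using assms(2) by (intro bexI[of _ "%_. \<zero>[X]"]) auto
qed (rule assms(1))

text \<open>A direct summand up to isomorphism, given by maps instead of a complement: both maps
  lift to projective covers and restrict to kernels, so the relation passes to syzygies.\<close>

definition retract :: "('k, 'a) module => ('a, 'm) module => ('a, 'n) module => bool" where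
  "retract A M N \<longleftrightarrow> left_module A M & left_module A N &
    (\<exists>i\<in>module_hom A M N. \<exists>p\<in>module_hom A N M. \<forall>x\<in>carrier M. p (i x) = x)"

lemma retractI:
  "left_module A M ==> left_module A N ==> i : module_hom A M N ==> p : module_hom A N M ==>
   (!!x. x : carrier M ==> p (i x) = x) ==> retract A M N"
  unfolding retract_def by blast

lemma retract_refl: "left_module A M ==> retract A M M"
  by (rule retractI[OF _ _ module_hom_id module_hom_id]) simp_all

definition cover :: "('k, 'a) module => ('a, 'p) module => ('p => 'm) => ('a, 'm) module => bool" where
  "cover A P ep M \<longleftrightarrow> projective A P & ep : module_hom A P M & ep ` carrier P = carrier M &
     superfluous (kernel_of P M ep) A P"

section \<open>Existence and comparison of projective covers\<close>

context fd_alg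
begin

lemma regular_fd: "fd (regular_module A)" "dimm (regular_module A) = AV.dim"
proof -
  have vs: "vectorspace K (vs_of (regular_module A))"
    by (rule vs_of_vectorspace[OF regular_left_module[OF A.ring_axioms]])
  have h: "(%x. x) : module_hom K A (vs_of (regular_module A))"
    by (auto simp: module_hom_def scal_mult)
  interpret linear_map K A "vs_of (regular_module A)" "%x. x"
    by (rule vectorspace_map[OF AV.vectorspace_axioms vs h])
  show "fd (regular_module A)" by (rule surj_fin_dim[OF fin_A]) simp
  show "dimm (regular_module A) = AV.dim" using dim_eq[OF fin_A] by (simp add: dim_over_def)
qed

text \<open>One regular summand is added for each element of \<open>S\<close>, and the product is
  copied back into \<open>nat => 'k\<close> at once. This replaces a free module of variable finite
  rank, which would need a carrier type of its own.\<close>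

lemma projective_hitting:
  fixes M :: "('a, nat => 'k) module"
  assumes "left_module A M" "finite S" "S \<subseteq> carrier M"
  shows "\<exists>(P :: ('a, nat => 'k) module) ep. projective A P & fd P & ep : module_hom A P M & S \<subseteq> ep ` carrier P"
  using assms(2,3)
proof (induction S rule: finite_induct)
  case empty
  interpret lmod A M by (simp add: lmod_def assms)
  have lm: "left_module A (M(|carrier := {\<zero>[M]}|))" by (rule submodule_left_module[OF zero_submodule])
  have "(%x. x) : module_hom A (M(|carrier := {\<zero>[M]}|)) M" by (auto simp: module_hom_def)
  then show ?case using projective_zero[OF lm] zero_dim(1)[OF lm]
    by (intro exI[of _ "M(|carrier := {\<zero>[M]}|)"] exI[of _ "%x. x"]) simp
next
  case (insert x S)
  then obtain P0 :: "('a, nat => 'k) module" and e0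
    where P0: "projective A P0" "fd P0" "e0 : module_hom A P0 M" "S \<subseteq> e0 ` carrier P0" by auto
  interpret e0: lmod_hom A P0 M e0
    by (rule lmod_homI[OF projective_left_module[OF P0(1)] assms(1) P0(3)])
  let ?Q = "prod_module P0 (regular_module A)"
  have Q: "projective A ?Q" by (intro projective_prod P0 projective_regular A.ring_axioms)
  note lmQ = projective_left_module[OF Q]
  have fQ: "fd ?Q"
    by (intro prod_dim projective_left_module P0 projective_regular A.ring_axioms regular_fd)
  obtain fi :: "(nat => 'k) \<times> 'a => nat => 'k" where fi: "inj_on fi (carrier ?Q)"
    using fin_dim_embedding[OF vs_of_vectorspace[OF lmQ] fQ] by auto
  interpret c: copied A ?Q fi by (rule copied_intro[OF lmQ fi])
  have x: "x : carrier M" using insert by auto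
  define \<pi> where "\<pi> = (%(p, a). e0 p +[M] a .[M] x)"
  have \<pi>: "\<pi> : module_hom A ?Q M"
    by (rule module_homI)
      (auto simp: \<pi>_def x e0.add e0.smult e0.N.smult_l_distr e0.N.smult_r_distr e0.N.smult_assoc e0.N.M.a_ac)
  have "insert x S \<subseteq> (%u. \<pi> (c.ps u)) ` carrier c.M'"
  proof
    fix y assume "y : insert x S"
    then have "\<exists>q\<in>carrier ?Q. \<pi> q = y"
    proof
      assume "y = x"
      then show ?thesis by (intro bexI[of _ "(\<zero>[P0], \<one>[A])"]) (simp_all add: \<pi>_def x)
    next
      assume "y : S"
      then obtain p where "p : carrier P0" "y = e0 p" using P0(4) by auto
      then show ?thesis by (intro bexI[of _ "(p, \<zero>[A])"]) (simp_all add: \<pi>_def x)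
    qed
    then obtain q where "q : carrier ?Q" "\<pi> q = y" by auto
    then have "y = \<pi> (c.ps (fi q))" "fi q : carrier c.M'"
      by (simp_all only: c.inv_simp c.carrier_copy imageI)
    then show "y : (%u. \<pi> (c.ps u)) ` carrier c.M'" by (rule image_eqI)
  qed
  moreover have "(%u. \<pi> (c.ps u)) : module_hom A c.M' M" by (rule module_hom_comp[OF c.hom_from \<pi>])
  moreover have "bij_betw fi (carrier ?Q) (carrier c.M')"
    using fi by (simp add: bij_betw_def c.carrier_copy)
  then have "fd c.M'" by (rule iso_dim(1)[OF lmQ c.left_module_copy c.hom_to fQ])
  moreover have "projective A c.M'" by (rule projective_copy[OF Q fi])
  ultimately show ?case by blast
qed

lemma fd_spanning:
  assumes "left_module A M" "fd M"
  obtains S where "finite S" "S \<subseteq> carrier M"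
    "!!N. Module.submodule N A M ==> S \<subseteq> N ==> N = carrier M"
proof -
  interpret lmod A M by (simp add: lmod_def assms)
  interpret V: vectorspace K "vs_of M" by (rule vs_of_vectorspace[OF assms(1)])
  obtain S where S: "finite S" "S \<subseteq> carrier M" "V.span S = carrier M"
    using assms(2) by (auto simp: V.fin_dim_def)
  have "N = carrier M" if "Module.submodule N A M" "S \<subseteq> N" for N
  proof -
    have "LinearCombinations.submodule K N (vs_of M)"
      by (rule submodule_convert[OF V.vectorspace_axioms submodule_subspace[OF assms(1) that(1)]])
    then have "V.span S \<subseteq> N" using V.span_is_subset[OF that(2)] by blast
    then show ?thesis using S(3) submoduleD(1)[OF that(1)] by auto
  qed
  then show ?thesis using that S(1,2) by blast
qed

text \<open>The complexity of the algebra ranges over finitely generated modules, while covers and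
  inductions are controlled by dimension.\<close>

lemma finitely_generated_iff_fd:
  fixes M :: "('a, nat => 'k) module"
  assumes "left_module A M"
  shows "finitely_generated A M \<longleftrightarrow> fd M"
proof
  interpret lmod A M by (simp add: lmod_def assms)
  assume "finitely_generated A M"
  then obtain S where S: "finite S" "S \<subseteq> carrier M" "generated_submodule A M S = carrier M"
    by (auto simp: finitely_generated_def)
  obtain P :: "('a, nat => 'k) module" and ep
    where P: "projective A P" "fd P" "ep : module_hom A P M" "S \<subseteq> ep ` carrier P"
    using projective_hitting[OF assms S(1,2)] by auto
  interpret e: lmod_hom A P M ep by (rule lmod_homI[OF projective_left_module[OF P(1)] assms P(3)])
  have "ep ` carrier P = carrier M"
    using generated_submodule_least[OF e.image_submodule[OF e.M.carrier_submodule] P(4)] S(3) by auto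
  then show "fd M" by (rule hom_dim(1)[OF e.M.left_module assms P(3,2)])
next
  interpret lmod A M by (simp add: lmod_def assms)
  assume "fd M"
  then obtain S where S: "finite S" "S \<subseteq> carrier M"
    "!!N. Module.submodule N A M ==> S \<subseteq> N ==> N = carrier M" using fd_spanning[OF assms] by metis
  have "generated_submodule A M S = carrier M"
    by (rule S(3)[OF generated_submodule_submodule[OF S(2)] generated_submodule_incl])
  then show "finitely_generated A M" using S(1,2) by (auto simp: finitely_generated_def)
qed

lemma projective_onto:
  fixes M :: "('a, nat => 'k) module"
  assumes "left_module A M" "fd M"
  shows "\<exists>(P :: ('a, nat => 'k) module) ep. projective A P & fd P & ep : module_hom A P M & ep ` carrier P = carrier M"
proof -
  interpret lmod A M by (simp add: lmod_def assms)
  obtain S where S: "finite S" "S \<subseteq> carrier M"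
    "!!N. Module.submodule N A M ==> S \<subseteq> N ==> N = carrier M" using fd_spanning[OF assms] by metis
  obtain P :: "('a, nat => 'k) module" and ep
    where P: "projective A P" "fd P" "ep : module_hom A P M" "S \<subseteq> ep ` carrier P"
    using projective_hitting[OF assms(1) S(1,2)] by auto
  interpret e: lmod_hom A P M ep by (rule lmod_homI[OF projective_left_module[OF P(1)] assms(1) P(3)])
  have "ep ` carrier P = carrier M"
    by (rule S(3)[OF e.image_submodule[OF e.M.carrier_submodule] P(4)])
  then show ?thesis using P by blast
qed

lemma surj_endo_bij:
  assumes "left_module A M" "fd M" "f : module_hom A M M" "f ` carrier M = carrier M"
  shows "bij_betw f (carrier M) (carrier M)"
proof -
  interpret lmod_hom A M M f by (rule lmod_homI[OF assms(1,1,3)])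
  let ?k = "kernel_of M M f"
  have k: "left_module A (M(|carrier := ?k|))" by (rule M.submodule_left_module[OF kernel_submodule])
  have "dimm (M(|carrier := ?k|)) = 0"
    using hom_dim(2)[OF assms(1,1,3,2,4)] by simp
  then have "?k = {\<zero>[M]}"
    using dim_zero_imp[OF k sub_fd(1)[OF assms(1) kernel_submodule assms(2)]] by simp
  then show ?thesis using assms(4) inj_iff by (simp add: bij_betw_def)
qed

text \<open>Fitting's lemma: if a surjection from a projective module of least dimension factors through
  an endomorphism with image in a submodule, a high power of that endomorphism splits off a
  projective summand inside the submodule.\<close>

lemma cover_exists:
  fixes M :: "('a, nat => 'k) module"
  assumes lmM: "left_module A M" and fdM: "fd M"
  shows "\<exists>(P :: ('a, nat => 'k) module) ep. cover A P ep M & fd P"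
proof -
  define good where "good = (%(P :: ('a, nat => 'k) module) ep. projective A P & fd P & ep : module_hom A P M & ep ` carrier P = carrier M)"
  define n where "n = (LEAST n. \<exists>P ep. good P ep & dimm P = n)"
  have "\<exists>n P ep. good P ep & dimm P = n" using projective_onto[OF lmM fdM] unfolding good_def by blast
  then have "\<exists>P ep. good P ep & dimm P = n" unfolding n_def by (rule LeastI_ex)
  then obtain P ep where g: "good P ep" and dP: "dimm P = n" by blast
  have least: "n <= dimm P'" if "good P' ep'" for P' ep' unfolding n_def using that by (intro Least_le) blast
  have P: "projective A P" "fd P" "ep : module_hom A P M" "ep ` carrier P = carrier M"
    using g by (auto simp: good_def)
  note lmP = projective_left_module[OF P(1)]
  interpret e: lmod_hom A P M ep by (rule lmod_homI[OF lmP lmM P(3)])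
  have "superfluous (kernel_of P M ep) A P"
  proof (rule superfluousI[OF e.kernel_submodule _ lmP])
    fix L assume L: "Module.submodule L A P"
      and sum: "!!x. x : carrier P ==> \<exists>n\<in>kernel_of P M ep. \<exists>l\<in>L. x = n +[P] l"
    note LD = e.M.submoduleD[OF L]
    have lmL: "left_module A (P(|carrier := L|))" by (rule e.M.submodule_left_module[OF L])
    have hL: "ep : module_hom A (P(|carrier := L|)) M" by (rule module_hom_restrict_dom[OF P(3) LD(1)])
    have sL: "ep ` carrier (P(|carrier := L|)) = carrier M"
    proof
      show "ep ` carrier (P(|carrier := L|)) \<subseteq> carrier M" using LD(1) by auto
      show "carrier M \<subseteq> ep ` carrier (P(|carrier := L|))"
      proof
        fix m assume "m : carrier M"
        then obtain x where x: "x : carrier P" "m = ep x" using P(4) by auto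
        obtain k l where kl: "k : kernel_of P M ep" "l : L" "x = k +[P] l" using sum[OF x(1)] by auto
        have "l : carrier P" using kl(2) LD(1) by auto
        then have "m = ep l" using kl x by (simp add: kernel_of_def e.add)
        then show "m : ep ` carrier (P(|carrier := L|))" using kl by simp
      qed
    qed
    obtain fi where fi: "fi : module_hom A P (P(|carrier := L|))" "!!p. p : carrier P ==> ep (fi p) = ep p"
      using projective_lift[OF P(1) lmL lmM hL sL P(3)] by blast
    have fiP: "fi : module_hom A P P" by (rule module_hom_extend_cod[OF fi(1) LD(1)])
    have fiL: "fi p : L" if "p : carrier P" for p using fi(1) that by (auto simp: module_hom_def)
    have pw: "(fi ^^ m) : module_hom A P P" for m
    proof (induction m)
      case 0 show ?case by (simp add: id_def module_hom_id)
    next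
      case (Suc m) show ?case using module_hom_comp[OF Suc fiP] by (simp add: comp_def)
    qed
    have pwc: "(fi ^^ m) p : carrier P" if "p : carrier P" for m p
      using pw[of m] that by (auto simp: module_hom_def)
    have pwe: "ep ((fi ^^ m) p) = ep p" if "p : carrier P" for m p
      by (induction m) (simp_all add: fi(2) pwc that)
    \<comment> \<open>Starting the powers at \<open>Suc m\<close> puts every image inside
      \<open>L\<close>.\<close>
    define I where "I m = (fi ^^ Suc m) ` carrier P" for m
    have Isub: "Module.submodule (I m) A P" for m
    proof -
      interpret w: lmod_hom A P P "fi ^^ Suc m" by (rule lmod_homI[OF lmP lmP pw])
      show ?thesis unfolding I_def by (rule w.image_submodule[OF e.M.carrier_submodule])
    qed
    \<comment> \<open>An image of least dimension takes the place of a stabilising chain: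
      \<open>u\<close> maps \<open>I m\<close> onto \<open>I (m + Suc m)\<close>, which lies in
      \<open>I m\<close> and cannot be smaller.\<close>
    obtain m where m: "!!m'. dimm (P(|carrier := I m|)) <= dimm (P(|carrier := I m'|))"
      using ex_has_least_nat[of "%_. True" 0 "%m. dimm (P(|carrier := I m|))"] by auto
    let ?I = "P(|carrier := I m|)"
    have lmI: "left_module A ?I" and fdI: "fd ?I"
      by (rule e.M.submodule_left_module[OF Isub]) (rule sub_fd(1)[OF lmP Isub P(2)])
    interpret Im: lmod A ?I by (simp add: lmod_def lmI)
    define u where "u = fi ^^ Suc m"
    have u: "u : module_hom A P P" unfolding u_def by (rule pw)
    have uI: "u p : I m" if "p : carrier P" for p using that by (simp add: I_def u_def)
    have IP: "I m \<subseteq> carrier P" using e.M.submoduleD(1)[OF Isub] .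
    have I2: "I (m + Suc m) = u ` I m"
    proof -
      have "Suc (m + Suc m) = Suc m + Suc m" by simp
      then have *: "fi ^^ Suc (m + Suc m) = u \<circ> u" by (simp only: u_def funpow_add)
      show ?thesis unfolding I_def * u_def[symmetric] by (simp only: image_comp)
    qed
    have "I (m + Suc m) \<subseteq> I m" unfolding I2 using uI IP by auto
    then have "Module.submodule (I (m + Suc m)) A ?I"
      using e.M.submodule_carrier_iff[OF Isub] Isub by blast
    from sub_fd(2,3)[OF lmI this fdI] have "I (m + Suc m) = I m"
      using m[of "m + Suc m"] by simp
    then have surj: "u ` carrier ?I = carrier ?I" using I2 by simp
    have uh: "u : module_hom A ?I ?I" by (rule module_hom_restrict[OF u IP]) (use surj in simp)
    have bij: "bij_betw u (carrier ?I) (carrier ?I)" by (rule surj_endo_bij[OF lmI fdI uh surj])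
    let ?v = "the_inv_into (carrier ?I) u"
    have v: "?v : module_hom A ?I ?I" by (rule inverse_hom[OF lmI lmI uh bij])
    have up: "u : module_hom A P ?I" by (rule module_hom_restrict_cod[OF u]) (use uI in auto)
    \<comment> \<open>Following \<open>u\<close> by the inverse of its restriction to the image
      retracts \<open>P\<close> onto that image.\<close>
    have "projective A ?I"
    proof (rule projective_retract[OF P(1) lmI _ module_hom_comp[OF up v]])
      show "(%x. x) : module_hom A ?I P" by (rule module_hom_restrict_dom[OF module_hom_id IP])
      show "?v (u x) = x" if "x : carrier ?I" for x
        using bij that by (simp add: bij_betw_def the_inv_into_f_f)
    qed
    moreover have "ep ` carrier ?I = carrier M"
    proof -
      have "ep ` I m = (%p. ep (u p)) ` carrier P" by (auto simp: I_def u_def image_iff)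
      also have "... = ep ` carrier P" by (rule image_cong) (simp_all only: u_def pwe)
      finally show ?thesis using P(4) by simp
    qed
    moreover have "ep : module_hom A ?I M" by (rule module_hom_restrict_dom[OF P(3) IP])
    ultimately have "good ?I ep" using fdI by (simp add: good_def)
    then have "dimm ?I = dimm P" using least[of ?I ep] sub_fd(2)[OF lmP Isub P(2), of m] dP by simp
    then have "I m = carrier P" by (rule sub_fd(3)[OF lmP Isub P(2)])
    moreover have "I m \<subseteq> L" using fiL pwc by (auto simp: I_def)
    ultimately show "carrier P \<subseteq> L" by simp
  qed
  then show ?thesis using P by (auto simp: cover_def)
qed

lemma cover_fd:
  fixes P :: "('a, nat => 'k) module"
  assumes "cover A P ep M" "left_module A M" "fd M"
  shows "fd P"
proof -
  have P: "projective A P" "ep : module_hom A P M" "ep ` carrier P = carrier M" "superfluous (kernel_of P M ep) A P"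
    using assms(1) by (auto simp: cover_def)
  note lmP = projective_left_module[OF P(1)]
  interpret e: lmod_hom A P M ep by (rule lmod_homI[OF lmP assms(2) P(2)])
  obtain S where S: "finite S" "S \<subseteq> carrier M"
    "!!N. Module.submodule N A M ==> S \<subseteq> N ==> N = carrier M" using fd_spanning[OF assms(2,3)] by metis
  obtain T where T: "T \<subseteq> carrier P" "finite T" "ep ` T = S"
    using finite_subset_image[OF S(1), of ep "carrier P"] S(2) P(3) by metis
  let ?L = "generated_submodule A P T"
  have L: "Module.submodule ?L A P" by (rule e.M.generated_submodule_submodule[OF T(1)])
  have "ep ` ?L = carrier M"
    by (rule S(3)[OF e.image_submodule[OF L]]) (use T(3) e.M.generated_submodule_incl[of T] in blast)
  have "?L = carrier P"
  proof (rule superfluousD[OF P(4) lmP L])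
    fix x assume x: "x : carrier P"
    then have "ep x : ep ` ?L" using \<open>ep ` ?L = carrier M\<close> by simp
    then obtain l where l: "l : ?L" "ep x = ep l" by auto
    have lP: "l : carrier P" using l(1) e.M.submoduleD(1)[OF L] by auto
    have "x -[P] l : kernel_of P M ep" using x lP l(2) by (simp add: kernel_of_def e.minus)
    moreover have "x = (x -[P] l) +[P] l"
      using x lP by (simp add: a_minus_def e.M.M.a_assoc e.M.M.l_neg)
    ultimately show "\<exists>n\<in>kernel_of P M ep. \<exists>l\<in>?L. x = n +[P] l" using l(1) by blast
  qed
  then have "finitely_generated A P" using T unfolding finitely_generated_def by blast
  then show ?thesis using finitely_generated_iff_fd[OF lmP] by simp
qed

lemma retract_dim:
  assumes "retract A M N" "fd N"
  shows "dimm M <= dimm N"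
proof -
  obtain i p where *: "left_module A M" "left_module A N" "i : module_hom A M N" "p : module_hom A N M"
    "\<forall>x\<in>carrier M. p (i x) = x" using assms(1) unfolding retract_def by blast
  interpret i: lmod_hom A M N i by (rule lmod_homI[OF *(1-3)])
  interpret p: lmod_hom A N M p by (rule lmod_homI[OF *(2,1,4)])
  have "p ` carrier N = carrier M"
  proof
    show "carrier M \<subseteq> p ` carrier N"
      using *(5) i.closed by (metis image_eqI subsetI)
  qed auto
  then show ?thesis by (rule hom_dim_le[OF *(2,1,4) assms(2)])
qed

lemma cover_retract:
  fixes M N P Q :: "('a, nat => 'k) module"
  assumes ret: "retract A M N" and cov: "cover A P ep M" and fdM: "fd M"
    and Q: "projective A Q" "et : module_hom A Q N" "et ` carrier Q = carrier N"
  shows "retract A P Q"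
    "retract A (P(|carrier := kernel_of P M ep|)) (Q(|carrier := kernel_of Q N et|))"
proof -
  obtain i p where *: "left_module A M" "left_module A N" "i : module_hom A M N" "p : module_hom A N M"
    "!!x. x : carrier M ==> p (i x) = x" using ret unfolding retract_def by blast
  have P: "projective A P" "ep : module_hom A P M" "ep ` carrier P = carrier M" "superfluous (kernel_of P M ep) A P"
    using cov by (auto simp: cover_def)
  note lmP = projective_left_module[OF P(1)] and lmQ = projective_left_module[OF Q(1)]
  interpret i: lmod_hom A M N i by (rule lmod_homI[OF *(1-3)])
  interpret p: lmod_hom A N M p by (rule lmod_homI[OF *(2,1,4)])
  interpret e: lmod_hom A P M ep by (rule lmod_homI[OF lmP *(1) P(2)])
  interpret n: lmod_hom A Q N et by (rule lmod_homI[OF lmQ *(2) Q(2)])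
  obtain f where f: "f : module_hom A P Q" "!!x. x : carrier P ==> et (f x) = i (ep x)"
    using projective_lift[OF P(1) lmQ *(2) Q(2,3) module_hom_comp[OF P(2) *(3)]] by blast
  obtain g where g: "g : module_hom A Q P" "!!x. x : carrier Q ==> ep (g x) = p (et x)"
    using projective_lift[OF Q(1) lmP *(1) P(2,3) module_hom_comp[OF Q(2) *(4)]] by blast
  interpret f: lmod_hom A P Q f by (rule lmod_homI[OF lmP lmQ f(1)])
  interpret g: lmod_hom A Q P g by (rule lmod_homI[OF lmQ lmP g(1)])
  define h where "h x = g (f x)" for x
  have hh: "h : module_hom A P P" unfolding h_def by (rule module_hom_comp[OF f(1) g(1)])
  interpret h: lmod_hom A P P h by (rule lmod_homI[OF lmP lmP hh])
  have eh: "ep (h x) = ep x" if "x : carrier P" for x using that by (simp add: h_def f g *)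
  have surj: "h ` carrier P = carrier P"
  proof (rule superfluousD[OF P(4) lmP h.image_submodule[OF e.M.carrier_submodule]])
    fix x assume x: "x : carrier P"
    have "x -[P] h x : kernel_of P M ep" using x by (simp add: kernel_of_def e.minus eh)
    moreover have "x = (x -[P] h x) +[P] h x"
      using x by (simp add: a_minus_def e.M.M.a_assoc e.M.M.l_neg)
    ultimately show "\<exists>n\<in>kernel_of P M ep. \<exists>l\<in>h ` carrier P. x = n +[P] l" using x by blast
  qed
  have bij: "bij_betw h (carrier P) (carrier P)"
    by (rule surj_endo_bij[OF lmP cover_fd[OF cov *(1) fdM] hh surj])
  let ?v = "the_inv_into (carrier P) h"
  have v: "?v : module_hom A P P" by (rule inverse_hom[OF lmP lmP hh bij])
  have hv: "h (?v x) = x" "?v x : carrier P" if "x : carrier P" for x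
    using bij that by (simp_all add: bij_betw_def f_the_inv_into_f the_inv_into_into)
  have vh: "?v (h x) = x" if "x : carrier P" for x
    using bij that by (simp add: bij_betw_def the_inv_into_f_f)
  have vg: "(%x. ?v (g x)) : module_hom A Q P" by (rule module_hom_comp[OF g(1) v])
  show "retract A P Q"
    by (rule retractI[OF lmP lmQ f(1) vg]) (use vh h_def in simp)
  have ev: "ep (?v x) = ep x" if "x : carrier P" for x using eh[of "?v x"] hv that by simp
  show "retract A (P(|carrier := kernel_of P M ep|)) (Q(|carrier := kernel_of Q N et|))"
  proof (rule retractI)
    show "left_module A (P(|carrier := kernel_of P M ep|))" "left_module A (Q(|carrier := kernel_of Q N et|))"
      by (rule e.M.submodule_left_module[OF e.kernel_submodule], rule n.M.submodule_left_module[OF n.kernel_submodule])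
    show "f : module_hom A (P(|carrier := kernel_of P M ep|)) (Q(|carrier := kernel_of Q N et|))"
      by (rule module_hom_restrict[OF f(1)]) (auto simp: kernel_of_def f(2))
    show "(%x. ?v (g x)) : module_hom A (Q(|carrier := kernel_of Q N et|)) (P(|carrier := kernel_of P M ep|))"
      by (rule module_hom_restrict[OF vg]) (auto simp: kernel_of_def ev g(2) hv)
    show "?v (g (f x)) = x" if "x : carrier (P(|carrier := kernel_of P M ep|))" for x
      using vh[of x] that by (simp add: h_def kernel_of_def)
  qed
qed

end

lemma kernel_of_carrier_update [simp]:
  "kernel_of P (M(|carrier := S|)) f = kernel_of P M f"
  by (simp add: kernel_of_def)

text \<open>Dropping the first term leaves a minimal resolution of the first syzygy; the inductions
  over the homological degree use this form.\<close>

lemma minimal_resolution_tail: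
  assumes "minimal_projective_resolution A M P d ep"
  shows "cover A (P 0) ep M"
    "minimal_projective_resolution A (P 0(|carrier := kernel_of (P 0) M ep|))
       (%r. P (Suc r)) (%r. d (Suc r)) (d 0)"
proof -
  have *: "\<forall>r. projective A (P r)" "ep : module_hom A (P 0) M" "ep ` carrier (P 0) = carrier M"
    "\<forall>r. d r : module_hom A (P (Suc r)) (P r)" "d 0 ` carrier (P 1) = kernel_of (P 0) M ep"
    "\<forall>r. d (Suc r) ` carrier (P (Suc (Suc r))) = kernel_of (P (Suc r)) (P r) (d r)"
    "superfluous (kernel_of (P 0) M ep) A (P 0)"
    "\<forall>r. superfluous (kernel_of (P (Suc r)) (P r) (d r)) A (P (Suc r))"
    using assms by (simp_all add: minimal_projective_resolution_def projective_resolution_def)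
  show "cover A (P 0) ep M" using * by (simp add: cover_def)
  have "d 0 : module_hom A (P 1) (P 0(|carrier := kernel_of (P 0) M ep|))"
    by (rule module_hom_restrict_cod) (use * in simp_all)
  then show "minimal_projective_resolution A (P 0(|carrier := kernel_of (P 0) M ep|))
       (%r. P (Suc r)) (%r. d (Suc r)) (d 0)"
    using * by (simp add: minimal_projective_resolution_def projective_resolution_def)
qed

section \<open>Betti numbers and their subadditivity\<close>

context fd_alg
begin

text \<open>\<open>betti_le r M b\<close>: some projective resolution of \<open>M\<close> has an \<open>r\<close>-th term of dimension at
  most \<open>b\<close>.\<close>

primrec betti_le :: "nat => ('a, nat => 'k) module => nat => bool" where
  "betti_le 0 M b = (\<exists>(Q :: ('a, nat => 'k) module) et. projective A Q & fd Q &
     et : module_hom A Q M & et ` carrier Q = carrier M & dimm Q <= b)"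
| "betti_le (Suc r) M b = (\<exists>(Q :: ('a, nat => 'k) module) et. projective A Q & fd Q &
     et : module_hom A Q M & et ` carrier Q = carrier M &
     betti_le r (Q(|carrier := kernel_of Q M et|)) b)"

lemma betti_le_mono: "betti_le r M b ==> b <= c ==> betti_le r M c"
proof (induction r arbitrary: M)
  case 0
  then show ?case unfolding betti_le.simps by (meson le_trans)
next
  case (Suc r)
  then show ?case unfolding betti_le.simps by blast
qed

lemma cover_kernel:
  fixes P :: "('a, nat => 'k) module"
  assumes "cover A P ep M" "left_module A M" "fd M"
  shows "left_module A (P(|carrier := kernel_of P M ep|))" "fd (P(|carrier := kernel_of P M ep|))"
proof -
  have P: "projective A P" "ep : module_hom A P M" using assms(1) by (auto simp: cover_def)
  note lmP = projective_left_module[OF P(1)]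
  interpret e: lmod_hom A P M ep by (rule lmod_homI[OF lmP assms(2) P(2)])
  show "left_module A (P(|carrier := kernel_of P M ep|))"
    by (rule e.M.submodule_left_module[OF e.kernel_submodule])
  show "fd (P(|carrier := kernel_of P M ep|))"
    by (rule sub_fd(1)[OF lmP e.kernel_submodule cover_fd[OF assms]])
qed

lemma minres_fd:
  fixes M :: "('a, nat => 'k) module" and P :: "nat => ('a, nat => 'k) module"
  assumes "minimal_projective_resolution A M P d ep" "left_module A M" "fd M"
  shows "fd (P r)"
  using assms
proof (induction r arbitrary: M P d ep)
  case 0
  then show ?case using cover_fd minimal_resolution_tail(1) by blast
next
  case (Suc r)
  note t = minimal_resolution_tail[OF Suc.prems(1)]
  show ?case using Suc.IH[OF t(2) cover_kernel[OF t(1) Suc.prems(2,3)]] .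
qed

text \<open>The retract relation survives passage to kernels, so each term of a minimal resolution
  is a summand of the corresponding term of any finite-dimensional resolution of \<open>N\<close>.
  The case \<open>N = M\<close> gives minimality of the Betti numbers.\<close>

lemma minres_dim_le:
  fixes M N :: "('a, nat => 'k) module" and P :: "nat => ('a, nat => 'k) module"
  assumes "minimal_projective_resolution A M P d ep" "fd M" "retract A M N" "betti_le r N b"
  shows "dimm (P r) <= b"
  using assms
proof (induction r arbitrary: M N P d ep)
  case 0
  then obtain Q :: "('a, nat => 'k) module" and et where Q: "projective A Q" "fd Q"
    "et : module_hom A Q N" "et ` carrier Q = carrier N" "dimm Q <= b" by auto
  note t = minimal_resolution_tail[OF 0(1)]
  show ?case
    using retract_dim[OF cover_retract(1)[OF 0(3) t(1) 0(2) Q(1,3,4)] Q(2)] Q(5) by simp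
next
  case (Suc r)
  then obtain Q :: "('a, nat => 'k) module" and et where Q: "projective A Q" "fd Q"
    "et : module_hom A Q N" "et ` carrier Q = carrier N"
    "betti_le r (Q(|carrier := kernel_of Q N et|)) b" by auto
  note t = minimal_resolution_tail[OF Suc.prems(1)]
  have lmM: "left_module A M" using Suc.prems(3) by (simp add: retract_def)
  show ?case
    by (rule Suc.IH[OF t(2) cover_kernel(2)[OF t(1) lmM Suc.prems(2)]
          cover_retract(2)[OF Suc.prems(3) t(1) Suc.prems(2) Q(1,3,4)] Q(5)])
qed

text \<open>Together with \<open>minres_dim_le\<close> this makes the terms of a minimal resolution
  have the least dimensions that \<open>betti_le\<close> permits.\<close>

lemma minres_betti_le:
  fixes M :: "('a, nat => 'k) module" and P :: "nat => ('a, nat => 'k) module"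
  assumes "minimal_projective_resolution A M P d ep" "left_module A M" "fd M"
  shows "betti_le r M (dimm (P r))"
  using assms
proof (induction r arbitrary: M P d ep)
  case 0
  note t = minimal_resolution_tail(1)[OF 0(1)]
  show ?case using t cover_fd[OF t 0(2,3)] by (auto simp: cover_def)
next
  case (Suc r)
  note t = minimal_resolution_tail[OF Suc.prems(1)]
  show ?case
    using Suc.IH[OF t(2) cover_kernel[OF t(1) Suc.prems(2,3)]] t(1) cover_fd[OF t(1) Suc.prems(2,3)]
    by (auto simp: cover_def)
qed

lemma minres_exists:
  fixes M :: "('a, nat => 'k) module"
  assumes "left_module A M" "fd M"
  shows "\<exists>(P :: nat => ('a, nat => 'k) module) d ep. minimal_projective_resolution A M P d ep"
proof -
  \<comment> \<open>Covers are chosen for all modules simultaneously, so that the resolution arises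
    by iterating one function on modules, the first syzygy.\<close>
  have ex: "\<exists>Pe :: ('a, nat => 'k) module \<times> ((nat => 'k) => (nat => 'k)).
      left_module A N & fd N --> cover A (fst Pe) (snd Pe) N" for N :: "('a, nat => 'k) module"
  proof (cases "left_module A N & fd N")
    case True
    then obtain P :: "('a, nat => 'k) module" and ep where "cover A P ep N" using cover_exists[of N] by blast
    then show ?thesis by (intro exI[of _ "(P, ep)"]) simp
  qed blast
  define F where "F N = (SOME Pe :: ('a, nat => 'k) module \<times> ((nat => 'k) => (nat => 'k)).
      left_module A N & fd N --> cover A (fst Pe) (snd Pe) N)" for N :: "('a, nat => 'k) module"
  have F: "cover A (fst (F N)) (snd (F N)) N"
    if "left_module A N" "fd N" for N :: "('a, nat => 'k) module"
    using someI_ex[OF ex[of N]] that unfolding F_def by simp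
  define step where "step = (%N :: ('a, nat => 'k) module. (fst (F N))(|carrier := kernel_of (fst (F N)) N (snd (F N))|))"
  define W where "W r = (step ^^ r) M" for r
  have W0: "W 0 = M" and WS: "W (Suc r) = step (W r)" for r by (simp_all add: W_def)
  have W: "left_module A (W r) & fd (W r)" for r
  proof (induction r)
    case 0 then show ?case using assms by (simp add: W0)
  next
    case (Suc r)
    then show ?case using cover_kernel[OF F[of "W r"]] by (simp add: WS step_def)
  qed
  define P where "P r = fst (F (W r))" for r
  define e where "e r = snd (F (W r))" for r
  have cov: "cover A (P r) (e r) (W r)" for r using F W by (simp add: P_def e_def)
  have WP: "W (Suc r) = (P r)(|carrier := kernel_of (P r) (W r) (e r)|)" for r
    by (simp add: WS step_def P_def e_def)
  have ker: "kernel_of X (W (Suc r)) f = kernel_of X (P r) f"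
    for X :: "('a, nat => 'k) module" and f r by (simp add: WP)
  have cP: "carrier (W (Suc r)) = kernel_of (P r) (W r) (e r)" for r by (simp add: WP)
  have dh: "e (Suc r) : module_hom A (P (Suc r)) (P r)" for r
  proof (rule module_hom_extend_cod)
    show "e (Suc r) : module_hom A (P (Suc r)) ((P r)(|carrier := kernel_of (P r) (W r) (e r)|))"
      using cov[of "Suc r"] WP[of r] by (simp add: cover_def)
    show "kernel_of (P r) (W r) (e r) \<subseteq> carrier (P r)" by (auto simp: kernel_of_def)
  qed
  have "minimal_projective_resolution A M P (%r. e (Suc r)) (e 0)"
    unfolding minimal_projective_resolution_def projective_resolution_def
  proof (intro conjI allI)
    fix r
    show "projective A (P r)" using cov[of r] by (simp add: cover_def)
    show "e 0 : module_hom A (P 0) M" "e 0 ` carrier (P 0) = carrier M"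
      "superfluous (kernel_of (P 0) M (e 0)) A (P 0)"
      using cov[of 0] by (simp_all add: cover_def W0)
    show "e (Suc r) : module_hom A (P (Suc r)) (P r)" by (rule dh)
    show "e (Suc 0) ` carrier (P 1) = kernel_of (P 0) M (e 0)"
      using cov[of "Suc 0"] cP[of 0] by (simp add: cover_def W0)
    show "e (Suc (Suc r)) ` carrier (P (Suc (Suc r))) = kernel_of (P (Suc r)) (P r) (e (Suc r))"
      using cov[of "Suc (Suc r)"] cP[of "Suc r"] ker[of "P (Suc r)" r] by (simp add: cover_def)
    show "superfluous (kernel_of (P (Suc r)) (P r) (e (Suc r))) A (P (Suc r))"
      using cov[of "Suc r"] ker[of "P (Suc r)" r] by (simp add: cover_def)
  qed
  then show ?thesis by blast
qed

text \<open>The resolution picked by the choice operator and the given one bound each other degree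
  by degree.\<close>

lemma module_complexity_minres:
  fixes M :: "('a, nat => 'k) module" and P :: "nat => ('a, nat => 'k) module"
  assumes "minimal_projective_resolution A M P d ep" "left_module A M" "fd M"
  shows "module_complexity K A M = seq_complexity (%r. dimm (P r))"
proof -
  let ?Q = "SOME P :: nat => ('a, nat => 'k) module. \<exists>d ep. minimal_projective_resolution A M P d ep"
  have "\<exists>d ep. minimal_projective_resolution A M ?Q d ep"
    by (rule someI[of "%P :: nat => ('a, nat => 'k) module. \<exists>d ep. minimal_projective_resolution A M P d ep" P])
      (use assms(1) in blast)
  then obtain d' ep' where Q: "minimal_projective_resolution A M ?Q d' ep'" by blast
  have "dimm (?Q r) = dimm (P r)" for r
    using minres_dim_le[OF Q assms(3) retract_refl[OF assms(2)] minres_betti_le[OF assms]]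
      minres_dim_le[OF assms(1,3) retract_refl[OF assms(2)] minres_betti_le[OF Q assms(2,3)]]
    by (rule antisym)
  then show ?thesis unfolding module_complexity_def Let_def by simp
qed

lemma module_complexity_le:
  fixes M :: "('a, nat => 'k) module"
  assumes "left_module A M" "fd M" "!!r. betti_le r M (b r)"
  shows "\<exists>c. (\<forall>r. c r <= b r) & module_complexity K A M = seq_complexity c"
proof -
  obtain P :: "nat => ('a, nat => 'k) module" and d ep
    where P: "minimal_projective_resolution A M P d ep" using minres_exists[OF assms(1,2)] by blast
  show ?thesis
    using minres_dim_le[OF P assms(2) retract_refl[OF assms(1)] assms(3)]
      module_complexity_minres[OF P assms(1,2)] by (intro exI[of _ "%r. dimm (P r)"]) simp
qed

text \<open>One step of the horseshoe lemma.\<close>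

lemma horseshoe_step:
  fixes M N L Q' Q'' :: "('a, nat => 'k) module"
  assumes lm: "left_module A M" "left_module A N" "left_module A L"
    and i: "i : module_hom A N M" "inj_on i (carrier N)"
    and g: "g : module_hom A M L" "g ` carrier M = carrier L" "i ` carrier N = kernel_of M L g"
    and Q': "projective A Q'" "fd Q'" "e' : module_hom A Q' N" "e' ` carrier Q' = carrier N"
    and Q'': "projective A Q''" "fd Q''" "e'' : module_hom A Q'' L" "e'' ` carrier Q'' = carrier L"
  obtains Q :: "('a, nat => 'k) module" and et j h where "projective A Q" "fd Q"
    "dimm Q = dimm Q' + dimm Q''" "et : module_hom A Q M" "et ` carrier Q = carrier M"
    "j : module_hom A (Q'(|carrier := kernel_of Q' N e'|)) (Q(|carrier := kernel_of Q M et|))"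
    "inj_on j (kernel_of Q' N e')"
    "h : module_hom A (Q(|carrier := kernel_of Q M et|)) (Q''(|carrier := kernel_of Q'' L e''|))"
    "h ` kernel_of Q M et = kernel_of Q'' L e''"
    "j ` kernel_of Q' N e' = {x : kernel_of Q M et. h x = \<zero>[Q'']}"
proof -
  note lmQ' = projective_left_module[OF Q'(1)] and lmQ'' = projective_left_module[OF Q''(1)]
  interpret i: lmod_hom A N M i by (rule lmod_homI[OF lm(2,1) i(1)])
  interpret g: lmod_hom A M L g by (rule lmod_homI[OF lm(1,3) g(1)])
  interpret e': lmod_hom A Q' N e' by (rule lmod_homI[OF lmQ' lm(2) Q'(3)])
  interpret e'': lmod_hom A Q'' L e'' by (rule lmod_homI[OF lmQ'' lm(3) Q''(3)])
  \<comment> \<open>This lift of \<open>e''\<close> through \<open>g\<close> is the second component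
    of the map from the product onto \<open>M\<close>.\<close>
  obtain s where s: "s : module_hom A Q'' M" "!!y. y : carrier Q'' ==> g (s y) = e'' y"
    using projective_lift[OF Q''(1) lm(1,3) g(1,2) Q''(3)] by blast
  interpret s: lmod_hom A Q'' M s by (rule lmod_homI[OF lmQ'' lm(1) s(1)])
  let ?R = "prod_module Q' Q''"
  have R: "projective A ?R" by (rule projective_prod[OF Q'(1) Q''(1)])
  note lmR = projective_left_module[OF R]
  have fR: "fd ?R" "dimm ?R = dimm Q' + dimm Q''" by (rule prod_dim[OF lmQ' lmQ'' Q'(2) Q''(2)])+
  obtain fi :: "(nat => 'k) \<times> (nat => 'k) => nat => 'k" where fi: "inj_on fi (carrier ?R)"
    using fin_dim_embedding[OF vs_of_vectorspace[OF lmR] fR(1)] by auto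
  interpret c: copied A ?R fi by (rule copied_intro[OF lmR fi])
  have bij: "bij_betw fi (carrier ?R) (carrier c.M')" using fi by (simp add: bij_betw_def c.carrier_copy)
  have psfi: "c.ps (fi (x, y)) = (x, y)" if "x : carrier Q'" "y : carrier Q''" for x y
    by (rule c.inv_simp) (simp add: that)
  define \<pi> where "\<pi> = (%(x, y). i (e' x) +[M] s y)"
  have \<pi>: "\<pi> : module_hom A ?R M"
    by (rule module_homI)
      (auto simp: \<pi>_def e'.add e'.smult i.add i.smult s.add s.smult i.N.smult_r_distr i.N.M.a_ac)
  define et where "et u = \<pi> (c.ps u)" for u
  have et: "et : module_hom A c.M' M" unfolding et_def by (rule module_hom_comp[OF c.hom_from \<pi>])
  have etfi: "et (fi (x, y)) = i (e' x) +[M] s y" if "x : carrier Q'" "y : carrier Q''" for x y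
    unfolding et_def psfi[OF that] \<pi>_def by simp
  have gi: "g (i x) = \<zero>[L]" if "x : carrier N" for x
  proof -
    have "i x : kernel_of M L g" using that g(3) by blast
    then show ?thesis by (simp add: kernel_of_def)
  qed
  have ex: "\<exists>x\<in>carrier Q'. i (e' x) = m" if "m : carrier M" "g m = \<zero>[L]" for m
  proof -
    have "m : i ` carrier N" using that unfolding g(3) by (simp add: kernel_of_def)
    then obtain n where "n : carrier N" "m = i n" by auto
    moreover from this(1) have "n : e' ` carrier Q'" using Q'(4) by simp
    ultimately show ?thesis by auto
  qed
  have surj: "et ` carrier c.M' = carrier M"
  proof
    show "et ` carrier c.M' \<subseteq> carrier M" using et by (auto simp: module_hom_def)
    show "carrier M \<subseteq> et ` carrier c.M'"
    proof
      fix m assume m: "m : carrier M"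
      then have "g m : e'' ` carrier Q''" using Q''(4) by simp
      then obtain y where y: "y : carrier Q''" "g m = e'' y" by auto
      have "g (m -[M] s y) = \<zero>[L]" using m y by (simp add: g.minus s(2))
      then obtain x where x: "x : carrier Q'" "i (e' x) = m -[M] s y"
        using ex[of "m -[M] s y"] m y by auto
      have "et (fi (x, y)) = m"
        using x y m by (simp add: etfi a_minus_def i.N.M.a_assoc i.N.M.l_neg)
      moreover have "fi (x, y) : carrier c.M'" using x y by (simp add: c.carrier_copy)
      ultimately show "m : et ` carrier c.M'" by blast
    qed
  qed
  have kern: "kernel_of c.M' M et = {fi (x, y) | x y. x : carrier Q' & y : carrier Q'' & i (e' x) +[M] s y = \<zero>[M]}"
  proof (intro equalityI subsetI)
    fix u assume "u : kernel_of c.M' M et"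
    then obtain x y where "x : carrier Q'" "y : carrier Q''" "u = fi (x, y)" "et u = \<zero>[M]"
      by (auto simp: kernel_of_def c.carrier_copy)
    then show "u : {fi (x, y) | x y. x : carrier Q' & y : carrier Q'' & i (e' x) +[M] s y = \<zero>[M]}"
      using etfi by auto
  qed (auto simp: kernel_of_def c.carrier_copy etfi)
  define j where "j x = fi (x, \<zero>[Q''])" for x
  define h where "h u = snd (c.ps u)" for u
  have hfi: "h (fi (x, y)) = y" if "x : carrier Q'" "y : carrier Q''" for x y
    unfolding h_def psfi[OF that] by simp
  have i0: "e' x = \<zero>[N]" if "x : carrier Q'" "i (e' x) = \<zero>[M]" for x
    using inj_onD[OF i(2), of "e' x" "\<zero>[N]"] that by simp
  have jh: "j : module_hom A Q' c.M'"
  proof (rule module_homI)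
    fix x assume "x : carrier Q'" then show "j x : carrier c.M'" by (simp add: j_def c.carrier_copy)
  next
    fix x y assume "x : carrier Q'" "y : carrier Q'"
    then show "j (x +[Q'] y) = j x +[c.M'] j y" by (simp add: j_def)
  next
    fix a x assume "a : carrier A" "x : carrier Q'"
    then show "j (a .[Q'] x) = a .[c.M'] j x" by (simp add: j_def)
  qed
  have snd: "snd : module_hom A ?R Q''" by (rule module_homI) auto
  have hh: "h : module_hom A c.M' Q''" unfolding h_def by (rule module_hom_comp[OF c.hom_from snd])
  have k'sub: "kernel_of Q' N e' \<subseteq> carrier Q'" by (auto simp: kernel_of_def)
  have jk: "j ` kernel_of Q' N e' \<subseteq> kernel_of c.M' M et"
  proof
    fix u assume "u : j ` kernel_of Q' N e'"
    then obtain x where x: "x : carrier Q'" "e' x = \<zero>[N]" "u = fi (x, \<zero>[Q''])"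
      by (auto simp: j_def kernel_of_def)
    show "u : kernel_of c.M' M et"
      unfolding kern mem_Collect_eq by (intro exI conjI, rule x(3)) (simp_all add: x)
  qed
  show ?thesis
  proof (rule that[of c.M' et j h])
    show "projective A c.M'" by (rule projective_copy[OF R fi])
    show "fd c.M'" "dimm c.M' = dimm Q' + dimm Q''"
      using iso_dim[OF lmR c.left_module_copy c.hom_to fR(1) bij] fR(2) by simp_all
    show "j : module_hom A (Q'(|carrier := kernel_of Q' N e'|)) (c.M'(|carrier := kernel_of c.M' M et|))"
      by (rule module_hom_restrict[OF jh k'sub jk])
    show "inj_on j (kernel_of Q' N e')"
    proof (rule inj_onI)
      fix x y assume "x : kernel_of Q' N e'" "y : kernel_of Q' N e'" "j x = j y"
      then have "(x, \<zero>[Q'']) = (y, \<zero>[Q''])"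
        unfolding j_def by (intro inj_onD[OF fi]) (auto simp: kernel_of_def)
      then show "x = y" by simp
    qed
    have him: "h ` kernel_of c.M' M et \<subseteq> kernel_of Q'' L e''"
    proof
      fix v assume "v : h ` kernel_of c.M' M et"
      then obtain x y where xy: "x : carrier Q'" "y : carrier Q''" "i (e' x) +[M] s y = \<zero>[M]" "v = y"
        unfolding kern by (auto simp: hfi)
      have "e'' y = g (i (e' x) +[M] s y)" using xy(1,2) by (simp add: g.add gi s(2))
      then show "v : kernel_of Q'' L e''" using xy by (simp add: kernel_of_def)
    qed
    show "h : module_hom A (c.M'(|carrier := kernel_of c.M' M et|)) (Q''(|carrier := kernel_of Q'' L e''|))"
      by (rule module_hom_restrict[OF hh _ him]) (auto simp: kernel_of_def)
    show "h ` kernel_of c.M' M et = kernel_of Q'' L e''"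
    proof (rule subset_antisym[OF him subsetI])
      fix y assume y: "y : kernel_of Q'' L e''"
      then have yc: "y : carrier Q''" "g (s y) = \<zero>[L]" by (simp_all add: kernel_of_def s(2))
      then obtain x where x: "x : carrier Q'" "i (e' x) = s y" using ex[of "s y"] by auto
      have "fi (-[Q'] x, y) : kernel_of c.M' M et"
        unfolding kern mem_Collect_eq
        by (intro exI conjI, rule refl) (use x yc in \<open>simp_all add: e'.neg i.neg i.N.M.l_neg\<close>)
      moreover have "h (fi (-[Q'] x, y)) = y" using x yc by (simp add: hfi)
      ultimately show "y : h ` kernel_of c.M' M et" by (metis imageI)
    qed
    show "j ` kernel_of Q' N e' = {x : kernel_of c.M' M et. h x = \<zero>[Q'']}"
    proof
      show "j ` kernel_of Q' N e' \<subseteq> {x : kernel_of c.M' M et. h x = \<zero>[Q'']}"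
        using jk by (auto simp: j_def kernel_of_def hfi)
      show "{x : kernel_of c.M' M et. h x = \<zero>[Q'']} \<subseteq> j ` kernel_of Q' N e'"
      proof
        fix u assume "u : {x : kernel_of c.M' M et. h x = \<zero>[Q'']}"
        then obtain x where x: "x : carrier Q'" "i (e' x) +[M] s \<zero>[Q''] = \<zero>[M]" "u = fi (x, \<zero>[Q''])"
          unfolding kern by (auto simp: hfi)
        then have "x : kernel_of Q' N e'" using i0[of x] by (simp add: kernel_of_def)
        then show "u : j ` kernel_of Q' N e'" using x by (simp add: j_def)
      qed
    qed
  qed (rule et, rule surj)
qed

text \<open>\<open>horseshoe_step\<close> returns a short exact sequence of kernels, so the
  induction continues with the syzygies.\<close>

lemma horseshoe:
  fixes M N L :: "('a, nat => 'k) module"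
  assumes "left_module A M" "left_module A N" "left_module A L"
    "i : module_hom A N M" "inj_on i (carrier N)" "g : module_hom A M L"
    "g ` carrier M = carrier L" "i ` carrier N = kernel_of M L g"
    "betti_le r N b" "betti_le r L c"
  shows "betti_le r M (b + c)"
  using assms
proof (induction r arbitrary: M N L i g)
  case (0 M N L i g)
  from 0(9) obtain Q' :: "('a, nat => 'k) module" and e' where Q': "projective A Q'" "fd Q'"
    "e' : module_hom A Q' N" "e' ` carrier Q' = carrier N" "dimm Q' <= b" by auto
  from 0(10) obtain Q'' :: "('a, nat => 'k) module" and e'' where Q'': "projective A Q''" "fd Q''"
    "e'' : module_hom A Q'' L" "e'' ` carrier Q'' = carrier L" "dimm Q'' <= c" by auto
  obtain Q :: "('a, nat => 'k) module" and et where "projective A Q" "fd Q"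
    "dimm Q = dimm Q' + dimm Q''" "et : module_hom A Q M" "et ` carrier Q = carrier M"
    by (rule horseshoe_step[OF 0(1-8) Q'(1-4) Q''(1-4)])
  moreover from this(3) have "dimm Q <= b + c" using Q'(5) Q''(5) by simp
  ultimately show ?case unfolding betti_le.simps by blast
next
  case (Suc r M N L i g)
  from Suc.prems(9) obtain Q' :: "('a, nat => 'k) module" and e' where Q': "projective A Q'" "fd Q'"
    "e' : module_hom A Q' N" "e' ` carrier Q' = carrier N"
    "betti_le r (Q'(|carrier := kernel_of Q' N e'|)) b" by auto
  from Suc.prems(10) obtain Q'' :: "('a, nat => 'k) module" and e'' where Q'': "projective A Q''" "fd Q''"
    "e'' : module_hom A Q'' L" "e'' ` carrier Q'' = carrier L"
    "betti_le r (Q''(|carrier := kernel_of Q'' L e''|)) c" by auto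
  obtain Q :: "('a, nat => 'k) module" and et j h where Q: "projective A Q" "fd Q"
    "et : module_hom A Q M" "et ` carrier Q = carrier M"
    and jh: "j : module_hom A (Q'(|carrier := kernel_of Q' N e'|)) (Q(|carrier := kernel_of Q M et|))"
    "inj_on j (kernel_of Q' N e')"
    "h : module_hom A (Q(|carrier := kernel_of Q M et|)) (Q''(|carrier := kernel_of Q'' L e''|))"
    "h ` kernel_of Q M et = kernel_of Q'' L e''"
    "j ` kernel_of Q' N e' = {x : kernel_of Q M et. h x = \<zero>[Q'']}"
    by (rule horseshoe_step[OF Suc.prems(1-8) Q'(1-4) Q''(1-4)])
  interpret e: lmod_hom A Q M et by (rule lmod_homI[OF projective_left_module[OF Q(1)] Suc.prems(1) Q(3)])
  interpret e': lmod_hom A Q' N e' by (rule lmod_homI[OF projective_left_module[OF Q'(1)] Suc.prems(2) Q'(3)])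
  interpret e'': lmod_hom A Q'' L e'' by (rule lmod_homI[OF projective_left_module[OF Q''(1)] Suc.prems(3) Q''(3)])
  have "betti_le r (Q(|carrier := kernel_of Q M et|)) (b + c)"
  proof (rule Suc.IH[OF _ _ _ jh(1) _ jh(3) _ _ Q'(5) Q''(5)])
    show "left_module A (Q(|carrier := kernel_of Q M et|))" by (rule e.M.submodule_left_module[OF e.kernel_submodule])
    show "left_module A (Q'(|carrier := kernel_of Q' N e'|))" by (rule e'.M.submodule_left_module[OF e'.kernel_submodule])
    show "left_module A (Q''(|carrier := kernel_of Q'' L e''|))" by (rule e''.M.submodule_left_module[OF e''.kernel_submodule])
  qed (use jh in \<open>simp_all add: kernel_of_def[of "_(|carrier := _|)"]\<close>)
  then show ?case using Q by auto
qed

end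

section \<open>Change of rings and transport of resolutions\<close>

text \<open>Restriction of scalars: along the projection \<open>p1\<close> it inflates modules to
  the extension, along twisted embeddings it returns to the base algebra.\<close>

definition pull :: "('s => 'a) => ('a, 'm) module => ('s, 'm) module" where
  "pull f M = (|carrier = carrier M, monoid.mult = undefined, one = undefined,
     zero = \<zero>[M], add = add M, module.smult = %s x. f s .[M] x|)"

lemma pull_simps [simp]:
  "carrier (pull f M) = carrier M" "\<zero>[pull f M] = \<zero>[M]" "x +[pull f M] y = x +[M] y"
  "s .[pull f M] x = f s .[M] x"
  "(pull f M)(|carrier := N|) = pull f (M(|carrier := N|))"
  by (simp_all add: pull_def)

lemma abelian_group_cong:
  assumes "abelian_group M" "carrier N = carrier M" "\<zero>[N] = \<zero>[M]"
    "!!x y. x : carrier M ==> y : carrier M ==> x +[N] y = x +[M] y"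
  shows "abelian_group N"
proof -
  interpret M: abelian_group M by fact
  show ?thesis
  proof (rule abelian_groupI, goal_cases)
    case (6 x)
    then have "-[M] x : carrier N" "-[M] x +[N] x = \<zero>[N]" by (simp_all add: assms M.l_neg)
    then show ?case by blast
  qed (simp_all add: assms M.a_ac)
qed

lemma left_module_pull:
  assumes "ring S" "left_module A M" "!!s. s : carrier S ==> f s : carrier A"
    "!!s t. s : carrier S ==> t : carrier S ==> f (s +[S] t) = f s +[A] f t"
    "!!s t. s : carrier S ==> t : carrier S ==> f (s *[S] t) = f s *[A] f t"
    "f \<one>[S] = \<one>[A]"
  shows "left_module S (pull f M)"
proof -
  interpret lmod A M by (simp add: lmod_def assms)
  have "abelian_group (pull f M)" by (rule abelian_group_cong[OF M.abelian_group_axioms]) simp_all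
  then show ?thesis
    by (intro left_moduleI)
      (simp_all add: assms smult_l_distr smult_r_distr smult_assoc)
qed

lemma pull_hom:
  assumes "h : module_hom A M N" "!!s. s : carrier S ==> f s : carrier A"
  shows "h : module_hom S (pull f M) (pull f N)"
  using assms by (auto simp: module_hom_def)

lemma copy_superfluous:
  assumes "left_module A M" "left_module A N" "f : module_hom A M N"
    "bij_betw f (carrier M) (carrier N)" "superfluous S A M"
  shows "superfluous (f ` S) A N"
proof -
  interpret f: lmod_hom A M N f by (rule lmod_homI[OF assms(1-3)])
  have S: "Module.submodule S A M" using assms(5) by (simp add: superfluous_def)
  have im: "f ` carrier M = carrier N" and inj: "inj_on f (carrier M)"
    using assms(4) by (auto simp: bij_betw_def)
  show ?thesis
  proof (rule superfluousI[OF f.image_submodule[OF S] _ assms(2)])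
    fix L assume L: "Module.submodule L A N"
      and sum: "!!x. x : carrier N ==> \<exists>n\<in>f ` S. \<exists>l\<in>L. x = n +[N] l"
    let ?L = "{x : carrier M. f x : L}"
    have "?L = carrier M"
    proof (rule superfluousD[OF assms(5,1) f.vimage_submodule[OF L]])
      fix x assume x: "x : carrier M"
      then obtain n l where nl: "n : S" "l : L" "f x = f n +[N] l" using sum[of "f x"] by auto
      have n: "n : carrier M" using nl(1) f.M.submoduleD(1)[OF S] by auto
      have l: "l : carrier N" using nl(2) f.N.submoduleD(1)[OF L] by auto
      have "l = f (-[M] n +[M] x)"
        using n l x nl(3) by (simp add: f.add f.neg f.N.M.r_neg1)
      then have "-[M] n +[M] x : ?L" using nl(2) n x by simp
      moreover have "x = n +[M] (-[M] n +[M] x)" using n x by (simp add: f.M.M.r_neg2)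
      ultimately show "\<exists>n\<in>S. \<exists>l\<in>?L. x = n +[M] l" using nl(1) by blast
    qed
    then have "x : carrier M ==> f x : L" for x by blast
    then show "carrier N \<subseteq> L" unfolding im[symmetric] by auto
  qed
qed

context fd_alg
begin

text \<open>The total complex constructed below has carriers in
  \<open>nat => 'm \<times> 'm\<close>, whereas complexity is defined by resolutions in
  \<open>nat => 'k\<close>.\<close>

lemma minres_transport:
  fixes Q :: "nat => ('a, 'q) module"
  assumes mr: "minimal_projective_resolution A M Q D E" and lmM: "left_module A M"
    and fdQ: "!!r. fd (Q r)"
  shows "\<exists>(P :: nat => ('a, nat => 'k) module) d ep.
    minimal_projective_resolution A M P d ep & (\<forall>r. dimm (P r) = dimm (Q r))"
proof -
  have *: "!!r. projective A (Q r)" "E : module_hom A (Q 0) M" "E ` carrier (Q 0) = carrier M"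
    "!!r. D r : module_hom A (Q (Suc r)) (Q r)" "D 0 ` carrier (Q 1) = kernel_of (Q 0) M E"
    "!!r. D (Suc r) ` carrier (Q (Suc (Suc r))) = kernel_of (Q (Suc r)) (Q r) (D r)"
    "superfluous (kernel_of (Q 0) M E) A (Q 0)"
    "!!r. superfluous (kernel_of (Q (Suc r)) (Q r) (D r)) A (Q (Suc r))"
    using mr by (simp_all add: minimal_projective_resolution_def projective_resolution_def)
  have lm: "left_module A (Q r)" for r by (rule projective_left_module[OF *(1)])
  have "\<exists>fi :: 'q => nat => 'k. inj_on fi (carrier (Q r))" for r
    using fin_dim_embedding[OF vs_of_vectorspace[OF lm] fdQ, of r] by simp
  then obtain fi :: "nat => 'q => nat => 'k" where fi: "!!r. inj_on (fi r) (carrier (Q r))" by metis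
  have c: "copied A (Q r) (fi r)" for r by (rule copied_intro[OF lm fi])
  define P where "P r = copy_module (fi r) (Q r)" for r
  define ps where "ps r = the_inv_into (carrier (Q r)) (fi r)" for r
  have cP: "carrier (P r) = fi r ` carrier (Q r)" for r unfolding P_def by (rule copied.carrier_copy[OF c])
  have zP: "\<zero>[P r] = fi r \<zero>[Q r]" for r unfolding P_def by (rule copied.copy_simps(1)[OF c])
  have lmP: "left_module A (P r)" for r unfolding P_def by (rule copied.left_module_copy[OF c])
  have fih: "fi r : module_hom A (Q r) (P r)" for r unfolding P_def by (rule copied.hom_to[OF c])
  have psh: "ps r : module_hom A (P r) (Q r)" for r unfolding P_def ps_def by (rule copied.hom_from[OF c])
  have psfi: "ps r (fi r x) = x" if "x : carrier (Q r)" for r x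
    unfolding ps_def by (rule copied.inv_simp[OF c that])
  have bij: "bij_betw (fi r) (carrier (Q r)) (carrier (P r))" for r
    using fi by (simp add: bij_betw_def cP)
  define d where "d r u = fi r (D r (ps (Suc r) u))" for r u
  define e where "e u = E (ps 0 u)" for u
  have Dc: "D r x : carrier (Q r)" if "x : carrier (Q (Suc r))" for r x
    using *(4)[of r] that by (auto simp: module_hom_def)
  have z: "\<zero>[Q r] : carrier (Q r)" for r
  proof -
    interpret lmod A "Q r" by (simp add: lmod_def lm)
    show ?thesis by simp
  qed
  have kd: "kernel_of (P (Suc r)) (P r) (d r) = fi (Suc r) ` kernel_of (Q (Suc r)) (Q r) (D r)" for r
  proof -
    have "fi r (D r x) = fi r \<zero>[Q r] \<longleftrightarrow> D r x = \<zero>[Q r]" if "x : carrier (Q (Suc r))" for x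
      using inj_onD[OF fi _ Dc[OF that] z] by auto
    then show ?thesis by (auto simp: kernel_of_def cP zP d_def psfi)
  qed
  have ke: "kernel_of (P 0) M e = fi 0 ` kernel_of (Q 0) M E"
    by (auto simp: kernel_of_def cP e_def psfi)
  have imd: "d r ` carrier (P (Suc r)) = fi r ` D r ` carrier (Q (Suc r))" for r
    unfolding cP image_image d_def by (rule image_cong) (simp_all add: psfi)
  have "minimal_projective_resolution A M P d e"
    unfolding minimal_projective_resolution_def projective_resolution_def
  proof (intro conjI allI)
    fix r
    show "projective A (P r)" unfolding P_def by (rule projective_copy[OF *(1) fi])
    show "e : module_hom A (P 0) M" unfolding e_def by (rule module_hom_comp[OF psh *(2)])
    show "e ` carrier (P 0) = carrier M"
      unfolding cP image_image e_def *(3)[symmetric] by (rule image_cong) (simp_all add: psfi)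
    show "d r : module_hom A (P (Suc r)) (P r)"
      unfolding d_def by (rule module_hom_comp[OF module_hom_comp[OF psh *(4)] fih])
    show "d 0 ` carrier (P 1) = kernel_of (P 0) M e"
      using imd[of 0] *(5) ke by simp
    show "d (Suc r) ` carrier (P (Suc (Suc r))) = kernel_of (P (Suc r)) (P r) (d r)"
      using imd[of "Suc r"] *(6) kd by simp
    show "superfluous (kernel_of (P 0) M e) A (P 0)"
      unfolding ke by (rule copy_superfluous[OF lm lmP fih bij *(7)])
    show "superfluous (kernel_of (P (Suc r)) (P r) (d r)) A (P (Suc r))"
      unfolding kd by (rule copy_superfluous[OF lm lmP fih bij *(8)])
  qed
  moreover have "dimm (P r) = dimm (Q r)" for r
    using iso_dim(2)[OF lm lmP fih fdQ bij] by simp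
  ultimately show ?thesis by blast
qed

end

section \<open>Minimal resolutions over a skew extension by a square-zero element\<close>

text \<open>\<open>B = A \<oplus> A y\<close> with \<open>y\<^sup>2 = 0\<close> and \<open>y a = ps(a) y\<close>; \<open>p1\<close> and \<open>p2\<close> are the two coordinates and
  \<open>th\<close> is the inverse of \<open>ps\<close>.\<close>

locale skew_ext = A: fd_alg K A + B: fd_alg K B
  for K :: "'k ring" and A :: "('k, 'a) module" and B :: "('k, 'b) module" +
  fixes p1 p2 :: "'b => 'a" and io :: "'a => 'b" and y :: 'b and ps th :: "'a => 'a"
  assumes p_closed [simp]: "b : carrier B ==> p1 b : carrier A" "b : carrier B ==> p2 b : carrier A"
    and p_add: "b : carrier B ==> c : carrier B ==> p1 (b +[B] c) = p1 b +[A] p1 c"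
      "b : carrier B ==> c : carrier B ==> p2 (b +[B] c) = p2 b +[A] p2 c"
    and p_mult: "b : carrier B ==> c : carrier B ==> p1 (b *[B] c) = p1 b *[A] p1 c"
      "b : carrier B ==> c : carrier B ==> p2 (b *[B] c) = p1 b *[A] p2 c +[A] p2 b *[A] ps (p1 c)"
    and p_one [simp]: "p1 \<one>[B] = \<one>[A]" "p2 \<one>[B] = \<zero>[A]"
    and p_scal [simp]: "r : carrier K ==> p1 (B.scal r) = A.scal r" "r : carrier K ==> p2 (B.scal r) = \<zero>[A]"
    and io_closed [simp]: "a : carrier A ==> io a : carrier B"
    and p_io [simp]: "a : carrier A ==> p1 (io a) = a" "a : carrier A ==> p2 (io a) = \<zero>[A]"
    and y_closed [simp]: "y : carrier B" and p_y [simp]: "p1 y = \<zero>[A]" "p2 y = \<one>[A]"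
    and p_inj: "b : carrier B ==> c : carrier B ==> p1 b = p1 c ==> p2 b = p2 c ==> b = c"
    and ps_closed [simp]: "a : carrier A ==> ps a : carrier A"
    and th_closed [simp]: "a : carrier A ==> th a : carrier A"
    and psth [simp]: "a : carrier A ==> ps (th a) = a" and thps [simp]: "a : carrier A ==> th (ps a) = a"
    and ps_add: "a : carrier A ==> a' : carrier A ==> ps (a +[A] a') = ps a +[A] ps a'"
    and ps_mult: "a : carrier A ==> a' : carrier A ==> ps (a *[A] a') = ps a *[A] ps a'"
    and ps_scal [simp]: "r : carrier K ==> ps (A.scal r) = A.scal r"
begin

lemma ps_one [simp]: "ps \<one>[A] = \<one>[A]"
  using ps_scal[of "\<one>[K]"] by simp

lemma ps_zero [simp]: "ps \<zero>[A] = \<zero>[A]"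
  using ps_scal[of "\<zero>[K]"] by simp

lemma th_inj: "a : carrier A ==> b : carrier A ==> ps a = ps b ==> a = b"
  by (metis thps)

lemma th_add: "a : carrier A ==> b : carrier A ==> th (a +[A] b) = th a +[A] th b"
  by (rule th_inj) (simp_all add: ps_add)

lemma th_mult: "a : carrier A ==> b : carrier A ==> th (a *[A] b) = th a *[A] th b"
  by (rule th_inj) (simp_all add: ps_mult)

lemma th_scal [simp]: "c : carrier K ==> th (A.scal c) = A.scal c"
  by (rule th_inj) simp_all

lemma pow_ps:
  "a : carrier A ==> (ps ^^ k) a : carrier A"
  "a : carrier A ==> b : carrier A ==> (ps ^^ k) (a +[A] b) = (ps ^^ k) a +[A] (ps ^^ k) b"
  "a : carrier A ==> b : carrier A ==> (ps ^^ k) (a *[A] b) = (ps ^^ k) a *[A] (ps ^^ k) b"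
  "(ps ^^ k) \<one>[A] = \<one>[A]"
proof -
  show c: "a : carrier A ==> (ps ^^ k) a : carrier A" for a by (induction k) simp_all
  show "a : carrier A ==> b : carrier A ==> (ps ^^ k) (a +[A] b) = (ps ^^ k) a +[A] (ps ^^ k) b"
    "a : carrier A ==> b : carrier A ==> (ps ^^ k) (a *[A] b) = (ps ^^ k) a *[A] (ps ^^ k) b"
  proof -
    have c: "a : carrier A ==> (ps ^^ k) a : carrier A" for a k by (induction k) simp_all
    show "a : carrier A ==> b : carrier A ==> (ps ^^ k) (a +[A] b) = (ps ^^ k) a +[A] (ps ^^ k) b"
      "a : carrier A ==> b : carrier A ==> (ps ^^ k) (a *[A] b) = (ps ^^ k) a *[A] (ps ^^ k) b"
      by (induction k) (simp_all add: c ps_add ps_mult)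
  qed
  show "(ps ^^ k) \<one>[A] = \<one>[A]" by (induction k) simp_all
qed

lemma pow_th_closed [simp]: "a : carrier A ==> (th ^^ k) a : carrier A"
  by (induction k) simp_all

lemma pow_th:
  "a : carrier A ==> b : carrier A ==> (th ^^ k) (a +[A] b) = (th ^^ k) a +[A] (th ^^ k) b"
  "a : carrier A ==> b : carrier A ==> (th ^^ k) (a *[A] b) = (th ^^ k) a *[A] (th ^^ k) b"
  by (induction k) (simp_all add: th_add th_mult)

lemma pow_th_scal [simp]: "c : carrier K ==> (th ^^ k) (A.scal c) = A.scal c"
  by (induction k) simp_all

lemma pow_th_one [simp]: "(th ^^ k) \<one>[A] = \<one>[A]" "(th ^^ k) \<zero>[A] = \<zero>[A]"
  using pow_th_scal[of "\<one>[K]"] pow_th_scal[of "\<zero>[K]"] by simp_all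

text \<open>Cancels the \<open>ps\<close> in the product formula for \<open>p2\<close>; this is what
  makes the action on the total complex associative.\<close>

lemma pow_th_Suc_ps: "a : carrier A ==> (th ^^ Suc k) (ps a) = (th ^^ k) a"
  by (simp only: funpow_Suc_right comp_def thps)

lemma pow_psth [simp]: "a : carrier A ==> (ps ^^ k) ((th ^^ k) a) = a"
proof (induction k arbitrary: a)
  case (Suc k)
  have "(ps ^^ Suc k) ((th ^^ Suc k) a) = (ps ^^ k) (ps (th ((th ^^ k) a)))"
    by (simp only: funpow_Suc_right[of k ps] funpow.simps(2)[of k th] comp_def)
  then show ?case using Suc by simp
qed simp

lemma pow_thps [simp]: "a : carrier A ==> (th ^^ k) ((ps ^^ k) a) = a"
proof (induction k arbitrary: a)
  case (Suc k)
  have "(th ^^ Suc k) ((ps ^^ Suc k) a) = (th ^^ k) (th (ps ((ps ^^ k) a)))"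
    by (simp only: funpow_Suc_right[of k th] funpow.simps(2)[of k ps] comp_def)
  then show ?case using Suc pow_ps(1) by simp
qed simp

lemma io_add: "a : carrier A ==> b : carrier A ==> io (a +[A] b) = io a +[B] io b"
  by (rule p_inj) (simp_all add: p_add)

lemma io_mult: "a : carrier A ==> b : carrier A ==> io (a *[A] b) = io a *[B] io b"
  by (rule p_inj) (simp_all add: p_mult)

lemma io_one [simp]: "io \<one>[A] = \<one>[B]"
  by (rule p_inj) simp_all

lemma io_scal [simp]: "c : carrier K ==> io (A.scal c) = B.scal c"
  by (rule p_inj) simp_all

lemma decompose: "b : carrier B ==> b = io (p1 b) +[B] io (p2 b) *[B] y"
  by (rule p_inj) (simp_all add: p_add p_mult)

lemma y_io: "a : carrier A ==> y *[B] io a = io (ps a) *[B] y"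
  by (rule p_inj) (simp_all add: p_mult)

lemma y_y [simp]: "y *[B] y = \<zero>[B]"
proof -
  have "y *[B] y = io \<zero>[A]" by (rule p_inj) (simp_all add: p_mult)
  moreover have "io \<zero>[A] = \<zero>[B]" using io_scal[of "\<zero>[K]"] by simp
  ultimately show ?thesis by simp
qed

lemma inflate:
  assumes "left_module A M" shows "left_module B (pull p1 M)"
  by (rule left_module_pull[OF B.A.ring_axioms assms]) (simp_all add: p_add p_mult)

lemma restrict_twisted:
  assumes "left_module B X" shows "left_module A (pull (%a. io ((ps ^^ k) a)) X)"
  by (rule left_module_pull[OF A.A.ring_axioms assms]) (simp_all add: pow_ps io_add io_mult)

end

section \<open>The total complex over the skew extension\<close>

locale skew_resolution = skew_ext K A B p1 p2 io y ps th
  for K :: "'k ring" and A :: "('k, 'a) module" and B :: "('k, 'b) module"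
    and p1 p2 :: "'b => 'a" and io :: "'a => 'b" and y :: 'b and ps th :: "'a => 'a" +
  fixes M :: "('a, 'n) module" and P :: "nat => ('a, 'm) module"
    and d :: "nat => 'm => 'm" and ep :: "'m => 'n"
  assumes minres: "minimal_projective_resolution A M P d ep" and lmM: "left_module A M"

sublocale skew_resolution \<subseteq> P: lmod A "P s" for s
  using minres projective_left_module
  by (auto simp: lmod_def minimal_projective_resolution_def projective_resolution_def)

sublocale skew_resolution \<subseteq> d: lmod_hom A "P (Suc s)" "P s" "d s" for s
  using minres P.left_module
  by (intro lmod_homI) (auto simp: minimal_projective_resolution_def projective_resolution_def)

sublocale skew_resolution \<subseteq> e: lmod_hom A "P 0" M ep
  using minres P.left_module lmM
  by (intro lmod_homI) (auto simp: minimal_projective_resolution_def projective_resolution_def)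

context skew_resolution
begin

lemma resolution_facts:
  "projective A (P r)" "ep ` carrier (P 0) = carrier M"
  "d 0 ` carrier (P 1) = kernel_of (P 0) M ep"
  "d (Suc r) ` carrier (P (Suc (Suc r))) = kernel_of (P (Suc r)) (P r) (d r)"
  "superfluous (kernel_of (P 0) M ep) A (P 0)"
  "superfluous (kernel_of (P (Suc r)) (P r) (d r)) A (P (Suc r))"
  using minres by (simp_all add: minimal_projective_resolution_def projective_resolution_def)

lemma d_d [simp]: "x : carrier (P (Suc (Suc r))) ==> d r (d (Suc r) x) = \<zero>[P r]"
  using resolution_facts(4)[of r] by (auto simp: kernel_of_def)

lemma e_d [simp]: "x : carrier (P (Suc 0)) ==> ep (d 0 x) = \<zero>[M]"
  using resolution_facts(3) by (auto simp: kernel_of_def)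

text \<open>The \<open>s\<close>-th summand is the module \<open>P s \<oplus> y P s\<close> induced from \<open>P s\<close>, twisted by
  \<open>th\<^bsup>R - s\<^esup>\<close>; the twist makes multiplication by \<open>y\<close> into a map from the \<open>s\<close>-th summand of
  one term to that of the preceding term, and the differential is the total differential of the
  resulting double complex.\<close>

definition tot :: "nat => ('b, nat => 'm \<times> 'm) module" where
  "tot R = (|carrier = {u. (\<forall>s. fst (u s) : carrier (P s) & snd (u s) : carrier (P s)) &
       (\<forall>s>R. u s = (\<zero>[P s], \<zero>[P s]))},
     monoid.mult = undefined, one = undefined, zero = (%s. (\<zero>[P s], \<zero>[P s])),
     add = (%u v s. (fst (u s) +[P s] fst (v s), snd (u s) +[P s] snd (v s))),
     module.smult = (%b u s. ((th ^^ (R - s)) (p1 b) .[P s] fst (u s),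
       (th ^^ Suc (R - s)) (p1 b) .[P s] snd (u s) +[P s] (th ^^ Suc (R - s)) (p2 b) .[P s] fst (u s)))|)"

text \<open>The sign \<open>(-1)^s\<close> of the vertical map, which makes the two mixed
  contributions to the square of the total differential cancel.\<close>

definition sg :: "nat => 'm => 'm" where "sg s x = (if even s then x else -[P s] x)"

text \<open>A pair \<open>(x, x')\<close> stands for \<open>x + y x'\<close>. The horizontal part is
  \<open>d\<close>; the vertical part is multiplication by \<open>y\<close>, so a first coordinate
  reappears as a second one in the same summand.\<close>

definition totd :: "nat => (nat => 'm \<times> 'm) => nat => 'm \<times> 'm" where
  "totd r u = (%s. if s <= r then (d s (fst (u (Suc s))), d s (snd (u (Suc s))) +[P s] sg s (fst (u s)))
     else (\<zero>[P s], \<zero>[P s]))"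

definition tote :: "(nat => 'm \<times> 'm) => 'n" where "tote u = ep (fst (u 0))"

lemma tot_carrier: "u : carrier (tot R) \<longleftrightarrow>
   (\<forall>s. fst (u s) : carrier (P s) & snd (u s) : carrier (P s)) & (\<forall>s>R. u s = (\<zero>[P s], \<zero>[P s]))"
  by (simp add: tot_def)

lemma tot_closed [simp]:
  "u : carrier (tot R) ==> fst (u s) : carrier (P s)"
  "u : carrier (tot R) ==> snd (u s) : carrier (P s)"
  by (simp_all add: tot_carrier)

lemma tot_beyond: "u : carrier (tot R) ==> R < s ==> u s = (\<zero>[P s], \<zero>[P s])"
  unfolding tot_carrier by blast

lemma tot_I:
  assumes "!!s. fst (u s) : carrier (P s)" "!!s. snd (u s) : carrier (P s)"
    "!!s. R < s ==> u s = (\<zero>[P s], \<zero>[P s])"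
  shows "u : carrier (tot R)"
  unfolding tot_carrier using assms by blast

lemma tot_simps:
  "\<zero>[tot R] = (%s. (\<zero>[P s], \<zero>[P s]))"
  "u +[tot R] v = (%s. (fst (u s) +[P s] fst (v s), snd (u s) +[P s] snd (v s)))"
  "b .[tot R] u = (%s. ((th ^^ (R - s)) (p1 b) .[P s] fst (u s),
       (th ^^ Suc (R - s)) (p1 b) .[P s] snd (u s) +[P s] (th ^^ Suc (R - s)) (p2 b) .[P s] fst (u s)))"
  unfolding tot_def by (simp_all only: ring.simps module.simps)

lemma sg_simps [simp]:
  "x : carrier (P s) ==> sg s x : carrier (P s)"
  "x : carrier (P s) ==> sg s (sg s x) = x"
  "sg s \<zero>[P s] = \<zero>[P s]"
  by (auto simp: sg_def)

lemma sg_add: "x : carrier (P s) ==> z : carrier (P s) ==> sg s (x +[P s] z) = sg s x +[P s] sg s z"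
  by (simp add: sg_def P.M.minus_add)

lemma sg_smult: "a : carrier A ==> x : carrier (P s) ==> sg s (a .[P s] x) = a .[P s] sg s x"
  by (simp add: sg_def P.smult_minus_right)

lemma d_sg: "x : carrier (P (Suc s)) ==> d s (sg (Suc s) x) = -[P s] sg s (d s x)"
  by (simp add: sg_def d.neg)

lemma sg_neg: "x : carrier (P s) ==> sg s (-[P s] x) = -[P s] sg s x"
  by (simp add: sg_def)

lemma tot_add_closed:
  assumes "u : carrier (tot R)" "v : carrier (tot R)"
  shows "u +[tot R] v : carrier (tot R)"
  unfolding tot_simps using assms by (intro tot_I) (simp_all add: tot_beyond[of _ R])

lemma tot_left_module: "left_module B (tot R)"
proof (rule left_moduleI[OF B.A.ring_axioms])
  have zero: "\<zero>[tot R] : carrier (tot R)" unfolding tot_simps by (rule tot_I) simp_all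
  show "abelian_group (tot R)"
  proof (rule abelian_groupI)
    fix u v w assume u: "u : carrier (tot R)" and v: "v : carrier (tot R)" and w: "w : carrier (tot R)"
    show "(u +[tot R] v) +[tot R] w = u +[tot R] (v +[tot R] w)"
      unfolding tot_simps by (rule ext) (simp add: P.M.a_assoc tot_closed[OF u] tot_closed[OF v] tot_closed[OF w])
  next
    fix u v assume u: "u : carrier (tot R)" and v: "v : carrier (tot R)"
    show "u +[tot R] v : carrier (tot R)" by (rule tot_add_closed[OF u v])
    show "u +[tot R] v = v +[tot R] u"
      unfolding tot_simps by (rule ext) (simp add: P.M.a_comm tot_closed[OF u] tot_closed[OF v])
  next
    fix u assume u: "u : carrier (tot R)"
    show "\<zero>[tot R] +[tot R] u = u"
      unfolding tot_simps by (rule ext) (simp add: tot_closed[OF u])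
    have "(%s. (-[P s] fst (u s), -[P s] snd (u s))) : carrier (tot R)"
      by (rule tot_I) (simp_all add: tot_closed[OF u] tot_beyond[OF u])
    moreover have "(%s. (-[P s] fst (u s), -[P s] snd (u s))) +[tot R] u = \<zero>[tot R]"
      unfolding tot_simps by (rule ext) (simp add: P.M.l_neg tot_closed[OF u])
    ultimately show "\<exists>v\<in>carrier (tot R). v +[tot R] u = \<zero>[tot R]" by blast
  qed (rule zero)
next
  fix b u assume "b : carrier B" and u: "u : carrier (tot R)"
  then show "b .[tot R] u : carrier (tot R)"
    unfolding tot_simps by (intro tot_I) (simp_all add: tot_closed[OF u] tot_beyond[OF u] del: funpow.simps)
next
  fix b c u assume "b : carrier B" "c : carrier B" "u : carrier (tot R)"
  then show "(b +[B] c) .[tot R] u = b .[tot R] u +[tot R] c .[tot R] u"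
    by (simp add: tot_simps p_add pow_th P.smult_l_distr P.M.a_ac fun_eq_iff del: funpow.simps)
next
  fix b u v assume "b : carrier B" "u : carrier (tot R)" "v : carrier (tot R)"
  then show "b .[tot R] (u +[tot R] v) = b .[tot R] u +[tot R] b .[tot R] v"
    by (simp add: tot_simps P.smult_r_distr P.M.a_ac fun_eq_iff del: funpow.simps)
next
  fix b c u assume "b : carrier B" "c : carrier B" "u : carrier (tot R)"
  then show "(b *[B] c) .[tot R] u = b .[tot R] (c .[tot R] u)"
    by (simp add: tot_simps p_mult pow_th pow_th_Suc_ps P.smult_l_distr P.smult_r_distr P.smult_assoc
        P.M.a_ac fun_eq_iff del: funpow.simps)
next
  fix u assume "u : carrier (tot R)"
  then show "\<one>[B] .[tot R] u = u"
    by (simp add: tot_simps fun_eq_iff prod_eq_iff del: funpow.simps)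
qed

lemma totd_hom: "totd r : module_hom B (tot (Suc r)) (tot r)"
proof (rule module_homI)
  fix u assume u: "u : carrier (tot (Suc r))"
  show "totd r u : carrier (tot r)"
    by (rule tot_I) (simp_all add: totd_def tot_closed[OF u])
  fix v assume "v : carrier (tot (Suc r))"
  with u show "totd r (u +[tot (Suc r)] v) = totd r u +[tot r] totd r v"
    by (auto simp: totd_def tot_simps d.add sg_add P.M.a_ac fun_eq_iff)
next
  fix b u assume bu: "b : carrier B" "u : carrier (tot (Suc r))"
  have "totd r (b .[tot (Suc r)] u) s = (b .[tot r] totd r u) s" for s
  proof (cases "s <= r")
    case True
    \<comment> \<open>Summand \<open>Suc s\<close> of the source and summand \<open>s\<close> of the
      target carry the same twist, so \<open>d\<close> is linear. Summand \<open>s\<close> of the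
      source carries one power more, which is the twist of the second coordinate in the
      target.\<close>
    then have "Suc r - s = Suc (r - s)" by simp
    then show ?thesis using bu True
      by (simp add: totd_def tot_simps d.add d.smult sg_smult P.smult_r_distr P.M.a_ac del: funpow.simps)
  next
    case False
    then show ?thesis using bu by (simp add: totd_def tot_simps del: funpow.simps)
  qed
  then show "totd r (b .[tot (Suc r)] u) = b .[tot r] totd r u" by (rule ext)
qed

lemma totd_closed: "u : carrier (tot (Suc r)) ==> totd r u : carrier (tot r)"
  using totd_hom[of r] unfolding module_hom_def by blast

lemma tote_hom: "tote : module_hom B (tot 0) (pull p1 M)"
  by (rule module_homI) (simp_all add: tote_def tot_simps e.add e.smult)

lemma tote_surj: "tote ` carrier (tot 0) = carrier M"
proof
  show "carrier M \<subseteq> tote ` carrier (tot 0)"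
  proof
    fix m assume "m : carrier M"
    then obtain x where x: "x : carrier (P 0)" "m = ep x" using resolution_facts(2) by auto
    have "(%s. if s = 0 then (x, \<zero>[P s]) else (\<zero>[P s], \<zero>[P s])) : carrier (tot 0)"
      by (rule tot_I) (simp_all add: x)
    then show "m : tote ` carrier (tot 0)"
      by (rule rev_image_eqI) (simp add: tote_def x)
  qed
qed (auto simp: tote_def)

lemma totd_exact:
  assumes z: "!!s. s <= r ==> d s (fst (u (Suc s))) = \<zero>[P s] & d s (snd (u (Suc s))) +[P s] sg s (fst (u s)) = \<zero>[P s]"
    and u: "u : carrier (tot (Suc r))"
  shows "u : totd (Suc r) ` carrier (tot (Suc (Suc r)))"
proof -
  have "fst (u (Suc r)) : kernel_of (P (Suc r)) (P r) (d r)"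
    using z[of r] u by (simp add: kernel_of_def)
  then obtain w where w: "w : carrier (P (Suc (Suc r)))" "d (Suc r) w = fst (u (Suc r))"
    unfolding resolution_facts(4)[symmetric] by auto
  \<comment> \<open>The vertical map reaches every second coordinate, so \<open>v\<close> prescribes
    \<open>snd (u s)\<close> up to sign and has zero second coordinates. The kernel equations then
    make the lower first coordinates agree; only the top one, through \<open>w\<close>, uses
    exactness of the given resolution.\<close>
  define v where "v = (%s. (if s <= Suc r then sg s (snd (u s)) else if s = Suc (Suc r) then w else \<zero>[P s], \<zero>[P s]))"
  have "v : carrier (tot (Suc (Suc r)))"
    by (rule tot_I) (simp_all add: v_def tot_closed[OF u] w)
  moreover have "u s = totd (Suc r) v s" for s
  proof -
    consider "s <= r" | "s = Suc r" | "s > Suc r" by linarith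
    then show ?thesis
    proof cases
      case 1
      have x: "fst (u s) : carrier (P s)" "snd (u (Suc s)) : carrier (P (Suc s))" using u by simp_all
      have "d s (snd (u (Suc s))) = -[P s] sg s (fst (u s))"
        using z[OF 1] x by (intro P.M.minus_equality[symmetric]) simp_all
      then have "d s (sg (Suc s) (snd (u (Suc s)))) = fst (u s)"
        using x by (simp add: d_sg sg_neg)
      then show ?thesis using 1 u by (simp add: totd_def v_def prod_eq_iff)
    next
      case 2
      then show ?thesis using u w by (simp add: totd_def v_def prod_eq_iff)
    next
      case 3
      then show ?thesis using tot_beyond[OF u, of s] by (simp add: totd_def v_def)
    qed
  qed
  ultimately show ?thesis by (metis ext image_eqI)
qed

lemma totd_image_Suc:
  "totd (Suc r) ` carrier (tot (Suc (Suc r))) = kernel_of (tot (Suc r)) (tot r) (totd r)"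
proof
  show "totd (Suc r) ` carrier (tot (Suc (Suc r))) \<subseteq> kernel_of (tot (Suc r)) (tot r) (totd r)"
  proof
    fix u assume "u : totd (Suc r) ` carrier (tot (Suc (Suc r)))"
    then obtain v where v: "v : carrier (tot (Suc (Suc r)))" "u = totd (Suc r) v" by auto
    have u: "u : carrier (tot (Suc r))" unfolding v(2) by (rule totd_closed[OF v(1)])
    have "totd r u s = (\<zero>[P s], \<zero>[P s])" for s
      using v(1) by (simp add: v(2) totd_def d.add d_sg P.M.l_neg)
    then have "totd r u = \<zero>[tot r]" by (simp add: tot_simps fun_eq_iff)
    then show "u : kernel_of (tot (Suc r)) (tot r) (totd r)" using u by (simp add: kernel_of_def)
  qed
  show "kernel_of (tot (Suc r)) (tot r) (totd r) \<subseteq> totd (Suc r) ` carrier (tot (Suc (Suc r)))"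
  proof
    fix u assume "u : kernel_of (tot (Suc r)) (tot r) (totd r)"
    then have u: "u : carrier (tot (Suc r))" "totd r u = \<zero>[tot r]" by (simp_all add: kernel_of_def)
    show "u : totd (Suc r) ` carrier (tot (Suc (Suc r)))"
    proof (rule totd_exact[OF _ u(1)])
      fix s assume "s <= r"
      then show "d s (fst (u (Suc s))) = \<zero>[P s] & d s (snd (u (Suc s))) +[P s] sg s (fst (u s)) = \<zero>[P s]"
        using fun_cong[OF u(2), of s] by (simp add: totd_def tot_simps)
    qed
  qed
qed

lemma totd_image_0: "totd 0 ` carrier (tot 1) = kernel_of (tot 0) (pull p1 M) tote"
proof
  show "totd 0 ` carrier (tot 1) \<subseteq> kernel_of (tot 0) (pull p1 M) tote"
  proof
    fix u assume "u : totd 0 ` carrier (tot 1)"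
    then obtain v where v: "v : carrier (tot (Suc 0))" "u = totd 0 v" by auto
    have u: "u : carrier (tot 0)" unfolding v(2) by (rule totd_closed[OF v(1)])
    have "tote u = \<zero>[M]" using v(1) by (simp add: v(2) totd_def tote_def)
    then show "u : kernel_of (tot 0) (pull p1 M) tote" using u by (simp add: kernel_of_def)
  qed
  show "kernel_of (tot 0) (pull p1 M) tote \<subseteq> totd 0 ` carrier (tot 1)"
  proof
    fix u assume "u : kernel_of (tot 0) (pull p1 M) tote"
    then have u: "u : carrier (tot 0)" "ep (fst (u 0)) = \<zero>[M]" by (simp_all add: kernel_of_def tote_def)
    then have "fst (u 0) : d 0 ` carrier (P 1)"
      unfolding resolution_facts(3) by (simp add: kernel_of_def)
    then obtain w where w: "w : carrier (P (Suc 0))" "d 0 w = fst (u 0)" by auto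
    define v where "v = (%s. (if s = 0 then snd (u s) else if s = Suc 0 then w else \<zero>[P s], \<zero>[P s]))"
    have v: "v : carrier (tot (Suc 0))" by (rule tot_I) (simp_all add: v_def tot_closed[OF u(1)] w)
    have "u s = totd 0 v s" for s
      using u w tot_beyond[OF u(1), of s] by (cases "s = 0") (simp_all add: totd_def v_def prod_eq_iff sg_def)
    then have "u = totd 0 v" by (rule ext)
    then show "u : totd 0 ` carrier (tot 1)" using v by simp
  qed
qed

text \<open>One name for the kernel inside \<open>P s\<close>, although for \<open>s = 0\<close> the
  outgoing map is the augmentation.\<close>

definition syz :: "nat => 'm set" where
  "syz s = (case s of 0 => kernel_of (P 0) M ep | Suc r => kernel_of (P (Suc r)) (P r) (d r))"

lemma syz_superfluous: "superfluous (syz s) A (P s)"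
  using resolution_facts(5,6) by (simp add: syz_def split: nat.split)

lemma syz_submodule: "Module.submodule (syz s) A (P s)"
  using syz_superfluous by (simp add: superfluous_def)

text \<open>The argument has two stages. Modulo \<open>L\<close>, first coordinates are cleared one
  summand at a time, each advance using superfluity of \<open>syz t\<close> in \<open>P t\<close>.
  What remains has only second coordinates, so it is a multiple of \<open>y\<close>; applying the
  first stage once more shows that it is \<open>y\<close> times an element of
  \<open>L\<close>.\<close>

lemma tot_superfluous:
  assumes N: "Module.submodule N B (tot R)" and NK: "!!n s. n : N ==> fst (n s) : syz s"
  shows "superfluous N B (tot R)"
proof (rule superfluousI[OF N _ tot_left_module])
  interpret T: lmod B "tot R" by (simp add: lmod_def tot_left_module)
  fix L assume L: "Module.submodule L B (tot R)"
    and sum: "!!x. x : carrier (tot R) ==> \<exists>n\<in>N. \<exists>l\<in>L. x = n +[tot R] l"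
  note LD = T.submoduleD[OF L] and ND = T.submoduleD[OF N]
  \<comment> \<open>The claim retains that the remaining first coordinates lie in syzygies, because
    superfluity is applied to them at the later stages.\<close>
  have claim: "\<exists>n\<in>carrier (tot R). \<exists>l\<in>L. q = n +[tot R] l & (\<forall>s. fst (n s) : syz s) & (\<forall>s<t. fst (n s) = \<zero>[P s])"
    if "q : carrier (tot R)" "t <= Suc R" for q t
    using that
  proof (induction t arbitrary: q)
    case 0
    then show ?case using sum[OF 0(1)] NK ND(1) by blast
  next
    case (Suc t)
    \<comment> \<open>Leading first coordinates at \<open>t\<close> of elements of \<open>L\<close>;
      entries after \<open>t\<close> are only required to be syzygies, which is all that the
      induction preserves.\<close>
    define Lt where "Lt = {x : carrier (P t). \<exists>l\<in>L. fst (l t) = x & (\<forall>s<t. fst (l s) = \<zero>[P s]) & (\<forall>s>t. fst (l s) : syz s)}"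
    have Lt: "Module.submodule Lt A (P t)"
    proof (rule P.submoduleI)
      show "Lt \<subseteq> carrier (P t)" by (auto simp: Lt_def)
      show "\<zero>[P t] : Lt"
        unfolding Lt_def using LD(2) P.submoduleD(2)[OF syz_submodule]
        by (auto intro!: bexI[of _ "\<zero>[tot R]"] simp: tot_simps)
    next
      fix x z assume "x : Lt" "z : Lt"
      then obtain l l' where l: "l : L" "fst (l t) = x" "\<forall>s<t. fst (l s) = \<zero>[P s]" "\<forall>s>t. fst (l s) : syz s"
        "l' : L" "fst (l' t) = z" "\<forall>s<t. fst (l' s) = \<zero>[P s]" "\<forall>s>t. fst (l' s) : syz s"
        and xz: "x : carrier (P t)" "z : carrier (P t)" by (auto simp: Lt_def)
      show "x +[P t] z : Lt"
        unfolding Lt_def mem_Collect_eq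
      proof (intro conjI bexI[of _ "l +[tot R] l'"])
        show "l +[tot R] l' : L" by (rule LD(3)[OF l(1,5)])
        show "\<forall>s>t. fst ((l +[tot R] l') s) : syz s"
          using l P.submoduleD(3)[OF syz_submodule] by (simp add: tot_simps)
      qed (use l xz in \<open>simp_all add: tot_simps\<close>)
    next
      fix a x assume a: "a : carrier A" and "x : Lt"
      then obtain l where l: "l : L" "fst (l t) = x" "\<forall>s<t. fst (l s) = \<zero>[P s]" "\<forall>s>t. fst (l s) : syz s"
        and x: "x : carrier (P t)" by (auto simp: Lt_def)
      \<comment> \<open>Applying \<open>ps\<close> to the scalar undoes the twist of summand
        \<open>t\<close>, so that \<open>a\<close> itself acts there.\<close>
      let ?b = "io ((ps ^^ (R - t)) a)"
      have b: "?b : carrier B" "(ps ^^ (R - t)) a : carrier A" using a pow_ps(1) by simp_all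
      show "a .[P t] x : Lt"
        unfolding Lt_def mem_Collect_eq
      proof (intro conjI bexI[of _ "?b .[tot R] l"])
        show "?b .[tot R] l : L" by (rule LD(4)[OF b(1) l(1)])
        show "\<forall>s>t. fst ((?b .[tot R] l) s) : syz s"
          using l P.submoduleD(4)[OF syz_submodule] b by (simp add: tot_simps)
      qed (use l x a b in \<open>simp_all add: tot_simps\<close>)
    qed
    have "Lt = carrier (P t)"
    proof (rule superfluousD[OF syz_superfluous P.left_module Lt])
      fix x assume x: "x : carrier (P t)"
      define q where "q = (%s. if s = t then (x, \<zero>[P s]) else (\<zero>[P s], \<zero>[P s]))"
      have "q : carrier (tot R)" using Suc.prems(2) by (intro tot_I) (simp_all add: q_def x)
      then obtain n l where nl: "n : carrier (tot R)" "l : L" "q = n +[tot R] l"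
        "\<forall>s. fst (n s) : syz s" "\<forall>s<t. fst (n s) = \<zero>[P s]"
        using Suc.IH[of q] Suc.prems(2) by auto
      have lc: "l : carrier (tot R)" using nl(2) LD(1) by auto
      have q: "fst (q s) = fst (n s) +[P s] fst (l s)" for s by (simp add: nl(3) tot_simps)
      have "fst (l t) : Lt"
        unfolding Lt_def mem_Collect_eq
      proof (intro conjI bexI[OF _ nl(2)] allI impI refl)
        fix s assume "s < t"
        then show "fst (l s) = \<zero>[P s]" using q[of s] nl(5) lc by (simp add: q_def)
      next
        fix s assume "s > t"
        then have "fst (n s) +[P s] fst (l s) = \<zero>[P s]" using q[of s] by (simp add: q_def)
        then have "-[P s] fst (n s) = fst (l s)"
          using nl(1) lc by (intro P.M.minus_equality) (simp_all add: P.M.a_comm)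
        then show "fst (l s) : syz s"
          using nl(4) P.submoduleD(5)[OF syz_submodule] by metis
      qed (use lc in simp)
      moreover have "x = fst (n t) +[P t] fst (l t)" using q[of t] by (simp add: q_def)
      ultimately show "\<exists>n\<in>syz t. \<exists>l\<in>Lt. x = n +[P t] l" using nl(4) by blast
    qed
    obtain n l where nl: "n : carrier (tot R)" "l : L" "q = n +[tot R] l"
      "\<forall>s. fst (n s) : syz s" "\<forall>s<t. fst (n s) = \<zero>[P s]"
      using Suc.IH[of q] Suc.prems by auto
    have "fst (n t) : Lt" using \<open>Lt = carrier (P t)\<close> nl(1) by simp
    then obtain l' where l': "l' : L" "fst (l' t) = fst (n t)" "\<forall>s<t. fst (l' s) = \<zero>[P s]" "\<forall>s>t. fst (l' s) : syz s"
      by (auto simp: Lt_def)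
    have lc: "l : carrier (tot R)" "l' : carrier (tot R)" using nl(2) l'(1) LD(1) by auto
    define n' where "n' = (%s. (fst (n s) -[P s] fst (l' s), snd (n s) -[P s] snd (l' s)))"
    have n'c: "n' : carrier (tot R)"
      by (rule tot_I)
        (simp_all add: n'_def a_minus_def tot_closed[OF nl(1)] tot_closed[OF lc(2)] tot_beyond[OF nl(1)] tot_beyond[OF lc(2)])
    have cancel: "(a -[P s] c) +[P s] (b +[P s] c) = a +[P s] b"
      if "a : carrier (P s)" "b : carrier (P s)" "c : carrier (P s)" for a b c s
    proof -
      have "(a -[P s] c) +[P s] (b +[P s] c) = (a +[P s] b) +[P s] (-[P s] c +[P s] c)"
        using that by (simp add: a_minus_def P.M.a_ac)
      then show ?thesis using that by (simp add: P.M.l_neg)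
    qed
    have "q = n' +[tot R] (l +[tot R] l')"
      unfolding nl(3) using nl(1) lc by (simp add: tot_simps n'_def cancel fun_eq_iff)
    moreover have "l +[tot R] l' : L" by (rule LD(3)[OF nl(2) l'(1)])
    moreover have "fst (n' s) = \<zero>[P s]" if "s < Suc t" for s
      using that l' nl lc by (cases "s = t") (simp_all add: n'_def a_minus_def P.M.r_neg)
    moreover have "fst (n' s) : syz s" for s
    proof -
      consider "s < Suc t" | "s > t" by linarith
      then show ?thesis
      proof cases
        case 1
        then show ?thesis using \<open>!!s. s < Suc t ==> fst (n' s) = \<zero>[P s]\<close> P.submoduleD(2)[OF syz_submodule] by simp
      next
        case 2
        then show ?thesis using nl(4) l'(4) P.submoduleD(6)[OF syz_submodule] by (simp add: n'_def)
      qed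
    qed
    ultimately show ?case using n'c by blast
  qed
  have y0: "fst ((y .[tot R] u) s) = \<zero>[P s]" "snd ((y .[tot R] u) s) = fst (u s)"
    if "u : carrier (tot R)" for u s
    using that by (simp_all add: tot_simps del: funpow.simps)
  show "carrier (tot R) \<subseteq> L"
  proof
    fix q assume q: "q : carrier (tot R)"
    obtain n l where nl: "n : carrier (tot R)" "l : L" "q = n +[tot R] l" "\<forall>s<Suc R. fst (n s) = \<zero>[P s]"
      using claim[OF q, of "Suc R"] by auto
    have n0: "fst (n s) = \<zero>[P s]" for s using nl(4) tot_beyond[OF nl(1), of s] by (cases "s <= R") auto
    \<comment> \<open>Moving the second coordinates to the first place gives an element whose
      product with \<open>y\<close> is \<open>n\<close>.\<close>
    define q' where "q' = (%s. (snd (n s), \<zero>[P s]))"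
    have q': "q' : carrier (tot R)" by (rule tot_I) (simp_all add: q'_def tot_closed[OF nl(1)] tot_beyond[OF nl(1)])
    obtain n1 l1 where nl1: "n1 : carrier (tot R)" "l1 : L" "q' = n1 +[tot R] l1" "\<forall>s<Suc R. fst (n1 s) = \<zero>[P s]"
      using claim[OF q', of "Suc R"] by auto
    have l1c: "l1 : carrier (tot R)" using nl1(2) LD(1) by auto
    have n10: "fst (n1 s) = \<zero>[P s]" for s using nl1(4) tot_beyond[OF nl1(1), of s] by (cases "s <= R") auto
    have "fst (q' s) = fst (l1 s)" for s
      using l1c n10[of s] by (simp add: nl1(3) tot_simps)
    then have "n = y .[tot R] l1"
      using y0[OF l1c] n0 by (simp add: fun_eq_iff prod_eq_iff q'_def)
    then have "n : L" using LD(4)[OF y_closed nl1(2)] by simp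
    then show "q : L" unfolding nl(3) by (rule LD(3)[OF _ nl(2)])
  qed
qed

end

lemma vectorspace_iso:
  assumes "vectorspace K V" "vectorspace K W" "f : module_hom K V W"
    "bij_betw f (carrier V) (carrier W)" "vectorspace.fin_dim K V"
  shows "vectorspace.fin_dim K W" "vectorspace.dim K W = vectorspace.dim K V"
proof -
  have im: "f ` carrier V = carrier W" and inj: "inj_on f (carrier V)"
    using assms(4) by (auto simp: bij_betw_def)
  show "vectorspace.fin_dim K W" by (rule rank_nullity_kernel(1)[OF assms(1-3,5) im])
  show "vectorspace.dim K W = vectorspace.dim K V"
    by (rule linear_map.dim_eq[OF vectorspace_map[OF assms(1-3)] assms(5) inj im, symmetric])
qed

section \<open>Projectivity, dimension and minimality of the total complex\<close>

context skew_resolution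
begin

definition cmp :: "nat => 'm => 'm => nat => 'm \<times> 'm" where
  "cmp s x x' = (%t. if t = s then (x, x') else (\<zero>[P t], \<zero>[P t]))"

lemma cmp_closed:
  "x : carrier (P s) ==> x' : carrier (P s) ==> s <= R ==> cmp s x x' : carrier (tot R)"
  by (rule tot_I) (auto simp: cmp_def)

lemma cmp_add:
  "x : carrier (P s) ==> x' : carrier (P s) ==> z : carrier (P s) ==> z' : carrier (P s) ==>
   cmp s (x +[P s] z) (x' +[P s] z') = cmp s x x' +[tot R] cmp s z z'"
  unfolding tot_simps by (rule ext) (simp add: cmp_def)

lemma cmp_smult:
  assumes "b : carrier B" "x : carrier (P s)" "x' : carrier (P s)"
  shows "b .[tot R] cmp s x x' = cmp s ((th ^^ (R - s)) (p1 b) .[P s] x)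
    ((th ^^ Suc (R - s)) (p1 b) .[P s] x' +[P s] (th ^^ Suc (R - s)) (p2 b) .[P s] x)"
  unfolding tot_simps by (rule ext) (use assms in \<open>simp add: cmp_def del: funpow.simps\<close>)

lemma tot_finsum:
  assumes u: "u : carrier (tot R)"
  shows "(\<Oplus>\<^bsub>tot R\<^esub>s\<in>{..R}. cmp s (fst (u s)) (snd (u s))) = u"
proof -
  interpret T: lmod B "tot R" by (simp add: lmod_def tot_left_module)
  have c: "cmp s (fst (u s)) (snd (u s)) : carrier (tot R)" if "s <= R" for s
    by (rule cmp_closed[OF tot_closed[OF u] that])
  have "(\<Oplus>\<^bsub>tot R\<^esub>s\<in>{..<t}. cmp s (fst (u s)) (snd (u s))) = (%s. if s < t then u s else (\<zero>[P s], \<zero>[P s]))"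
    if "t <= Suc R" for t
    using that
  proof (induction t)
    case 0
    then show ?case by (simp add: tot_simps)
  next
    case (Suc t)
    have "(\<Oplus>\<^bsub>tot R\<^esub>s\<in>insert t {..<t}. cmp s (fst (u s)) (snd (u s))) =
        cmp t (fst (u t)) (snd (u t)) +[tot R] (%s. if s < t then u s else (\<zero>[P s], \<zero>[P s]))"
      using Suc c by (subst T.M.finsum_insert) auto
    also have "... = (%s. if s < Suc t then u s else (\<zero>[P s], \<zero>[P s]))"
      unfolding tot_simps
    proof (rule ext, goal_cases)
      case (1 s)
      show ?case by (cases "s = t") (simp_all add: cmp_def tot_closed[OF u] less_Suc_eq)
    qed
    finally show ?case by (simp add: lessThan_Suc)
  qed
  from this[of "Suc R"] have "(\<Oplus>\<^bsub>tot R\<^esub>s\<in>{..R}. cmp s (fst (u s)) (snd (u s))) =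
      (%s. if s < Suc R then u s else (\<zero>[P s], \<zero>[P s]))" by (simp add: lessThan_Suc_atMost)
  also have "... = u" using tot_beyond[OF u] by (auto simp: fun_eq_iff)
  finally show ?thesis .
qed

text \<open>Induction is left adjoint to restriction, so induced modules of projectives are projective.\<close>

lemma tot_projective: "projective B (tot R)"
  unfolding projective_def
proof (intro conjI allI impI)
  show "left_module B (tot R)" by (rule tot_left_module)
  fix X Y :: "('b, nat => 'k) module" and g f
  assume *: "left_module B X & left_module B Y & g : module_hom B X Y &
    g ` carrier X = carrier Y & f : module_hom B (tot R) Y"
  interpret g: lmod_hom B X Y g by (rule lmod_homI) (use * in auto)
  interpret f: lmod_hom B "tot R" Y f by (rule lmod_homI) (use * tot_left_module in auto)
  \<comment> \<open>Pulling back along this twisted embedding turns the twisted action on summand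
    \<open>s\<close> into the given action on \<open>P s\<close>, so that projectivity of
    \<open>P s\<close> over \<open>A\<close> applies.\<close>
  define tw where "tw s a = io ((ps ^^ (R - s)) a)" for s a
  have twc: "tw s a : carrier B" if "a : carrier A" for s a using that by (simp add: tw_def pow_ps)
  have ptw: "p1 (tw s a) = (ps ^^ (R - s)) a" "p2 (tw s a) = \<zero>[A]" if "a : carrier A" for s a
    using that by (simp_all add: tw_def pow_ps)
  have lmX: "left_module A (pull (tw s) X)" and lmY: "left_module A (pull (tw s) Y)" for s
    using restrict_twisted[of X "R - s"] restrict_twisted[of Y "R - s"] * by (simp_all add: tw_def[abs_def])
  have gA: "g : module_hom A (pull (tw s) X) (pull (tw s) Y)" for s
    by (rule pull_hom) (use * twc in auto)
  have "\<exists>h. h : module_hom A (P s) (pull (tw s) X) & (\<forall>x\<in>carrier (P s). g (h x) = f (cmp s x \<zero>[P s]))"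
    if s: "s <= R" for s
  proof -
    have "(%x. f (cmp s x \<zero>[P s])) : module_hom A (P s) (pull (tw s) Y)"
    proof (rule module_homI)
      fix x assume x: "x : carrier (P s)"
      show "f (cmp s x \<zero>[P s]) : carrier (pull (tw s) Y)" using cmp_closed[OF x _ s] by simp
      fix z assume z: "z : carrier (P s)"
      show "f (cmp s (x +[P s] z) \<zero>[P s]) = f (cmp s x \<zero>[P s]) +[pull (tw s) Y] f (cmp s z \<zero>[P s])"
        using cmp_add[OF x _ z, of "\<zero>[P s]" "\<zero>[P s]" R] f.add[OF cmp_closed[OF x _ s] cmp_closed[OF z _ s]]
        by simp
    next
      fix a x assume a: "a : carrier A" and x: "x : carrier (P s)"
      have "tw s a .[tot R] cmp s x \<zero>[P s] = cmp s (a .[P s] x) \<zero>[P s]"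
        using a x twc[OF a, of s] pow_ps(1)[OF a] by (simp add: cmp_smult ptw del: funpow.simps)
      then show "f (cmp s (a .[P s] x) \<zero>[P s]) = a .[pull (tw s) Y] f (cmp s x \<zero>[P s])"
        using f.smult[OF twc[OF a, of s] cmp_closed[OF x P.M.zero_closed s]] by simp
    qed
    from projective_lift[OF resolution_facts(1) lmX lmY gA _ this] show ?thesis
      using * by (metis pull_simps(1))
  qed
  then obtain h where h: "!!s. s <= R ==> h s : module_hom A (P s) (pull (tw s) X)"
    "!!s x. s <= R ==> x : carrier (P s) ==> g (h s x) = f (cmp s x \<zero>[P s])" by metis
  have hc: "h s x : carrier X" if "s <= R" "x : carrier (P s)" for s x
    using h(1)[OF that(1)] that(2) by (auto simp: module_hom_def)
  have ha: "h s (x +[P s] z) = h s x +[X] h s z" if "s <= R" "x : carrier (P s)" "z : carrier (P s)" for s x z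
    using h(1)[OF that(1)] that(2,3) by (simp add: module_hom_def)
  have hs: "io c .[X] h s x = h s ((th ^^ (R - s)) c .[P s] x)"
    if "s <= R" "x : carrier (P s)" "c : carrier A" for s x c
  proof -
    have "h s ((th ^^ (R - s)) c .[P s] x) = tw s ((th ^^ (R - s)) c) .[X] h s x"
      using h(1)[OF that(1)] that(2,3) by (simp add: module_hom_def)
    then show ?thesis using that(3) by (simp add: tw_def)
  qed
  have yio: "io c .[X] (y .[X] v) = y .[X] (io (th c) .[X] v)" if "c : carrier A" "v : carrier X" for c v
    using that y_io[of "th c"] by (simp add: g.M.smult_assoc[symmetric])
  have yy: "y .[X] (y .[X] v) = \<zero>[X]" if "v : carrier X" for v
    using that by (simp add: g.M.smult_assoc[symmetric])
  have bs: "b .[X] v = io (p1 b) .[X] v +[X] io (p2 b) .[X] (y .[X] v)" if "b : carrier B" "v : carrier X" for b v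
  proof -
    have "b .[X] v = (io (p1 b) +[B] io (p2 b) *[B] y) .[X] v" using decompose[OF that(1)] by simp
    also have "... = io (p1 b) .[X] v +[X] (io (p2 b) *[B] y) .[X] v"
      using that by (intro g.M.smult_l_distr) simp_all
    also have "(io (p2 b) *[B] y) .[X] v = io (p2 b) .[X] (y .[X] v)"
      using that by (intro g.M.smult_assoc) simp_all
    finally show ?thesis .
  qed
  \<comment> \<open>The forced extension of \<open>h s\<close> to pairs, a pair standing for
    \<open>x + y x'\<close>.\<close>
  define T where "T s u = h s (fst (u s)) +[X] y .[X] h s (snd (u s))" for s and u :: "nat => 'm \<times> 'm"
  have Tc: "T s u : carrier X" if "s <= R" "u : carrier (tot R)" for s u
    unfolding T_def using hc[OF that(1)] tot_closed[OF that(2)] by simp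
  have Ta: "T s (u +[tot R] v) = T s u +[X] T s v"
    if "s <= R" "u : carrier (tot R)" "v : carrier (tot R)" for s u v
    unfolding T_def tot_simps using hc[OF that(1)] ha[OF that(1)] tot_closed[OF that(2)] tot_closed[OF that(3)]
    by (simp add: g.M.smult_r_distr g.M.M.a_ac)
  have Ts: "T s (b .[tot R] u) = b .[X] T s u"
    if s: "s <= R" and u: "u : carrier (tot R)" and b: "b : carrier B" for s b u
  proof -
    let ?k = "R - s" and ?x = "fst (u s)" and ?x' = "snd (u s)"
    have x: "?x : carrier (P s)" "?x' : carrier (P s)" using tot_closed[OF u] by auto
    have sw: "(th ^^ Suc ?k) c = (th ^^ ?k) (th c)" for c by (simp only: funpow_Suc_right comp_def)
    have 1: "b .[X] h s ?x = h s ((th ^^ ?k) (p1 b) .[P s] ?x) +[X] y .[X] h s ((th ^^ Suc ?k) (p2 b) .[P s] ?x)"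
      unfolding bs[OF b hc[OF s x(1)]] sw
      using b x hc[OF s] hs[OF s] by (simp add: yio)
    have 2: "b .[X] (y .[X] h s ?x') = y .[X] h s ((th ^^ Suc ?k) (p1 b) .[P s] ?x')"
    proof -
      have v: "y .[X] h s ?x' : carrier X" using hc[OF s x(2)] by simp
      show ?thesis unfolding bs[OF b v] sw
        using b x hc[OF s] hs[OF s] by (simp add: yio yy)
    qed
    have "b .[X] T s u = b .[X] h s ?x +[X] b .[X] (y .[X] h s ?x')"
      unfolding T_def using b hc[OF s x(1)] hc[OF s x(2)] by (simp add: g.M.smult_r_distr)
    also have "... = T s (b .[tot R] u)"
      unfolding 1 2 T_def tot_simps using b x hc[OF s] ha[OF s]
      by (simp add: g.M.smult_r_distr g.M.M.a_ac del: funpow.simps)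
    finally show ?thesis ..
  qed
  have gT: "g (T s u) = f (cmp s (fst (u s)) (snd (u s)))" if s: "s <= R" and u: "u : carrier (tot R)" for s u
  proof -
    have x: "fst (u s) : carrier (P s)" "snd (u s) : carrier (P s)" using tot_closed[OF u] by auto
    have "y .[tot R] cmp s (snd (u s)) \<zero>[P s] = cmp s \<zero>[P s] (snd (u s))"
      using x by (simp add: cmp_smult del: funpow.simps)
    then have "f (cmp s \<zero>[P s] (snd (u s))) = y .[Y] f (cmp s (snd (u s)) \<zero>[P s])"
      using f.smult[OF y_closed cmp_closed[OF x(2) P.M.zero_closed s]] by simp
    moreover have "cmp s (fst (u s)) (snd (u s)) = cmp s (fst (u s)) \<zero>[P s] +[tot R] cmp s \<zero>[P s] (snd (u s))"
      using cmp_add[OF x(1) _ _ x(2), of "\<zero>[P s]" "\<zero>[P s]" R] x by simp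
    ultimately have "f (cmp s (fst (u s)) (snd (u s))) = f (cmp s (fst (u s)) \<zero>[P s]) +[Y] y .[Y] f (cmp s (snd (u s)) \<zero>[P s])"
      using f.add[OF cmp_closed[OF x(1) _ s] cmp_closed[OF _ x(2) s]] by simp
    then show ?thesis
      unfolding T_def using hc[OF s] x h(2)[OF s] by (simp add: g.add g.smult)
  qed
  have Tpi: "(%s. T s u) : {..R} \<rightarrow> carrier X" if "u : carrier (tot R)" for u using Tc[OF _ that] by auto
  define H where "H u = (\<Oplus>\<^bsub>X\<^esub>s\<in>{..R}. T s u)" for u
  have "H : module_hom B (tot R) X"
  proof (rule module_homI)
    fix u assume u: "u : carrier (tot R)"
    show "H u : carrier X" unfolding H_def by (rule g.M.M.finsum_closed[OF Tpi[OF u]])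
    fix v assume v: "v : carrier (tot R)"
    have "H (u +[tot R] v) = (\<Oplus>\<^bsub>X\<^esub>s\<in>{..R}. T s u +[X] T s v)"
      unfolding H_def by (rule g.M.M.finsum_cong') (use Ta[OF _ u v] Tc[OF _ u] Tc[OF _ v] in auto)
    then show "H (u +[tot R] v) = H u +[X] H v"
      unfolding H_def using g.M.M.finsum_addf[OF Tpi[OF u] Tpi[OF v]] by simp
  next
    fix b u assume b: "b : carrier B" and u: "u : carrier (tot R)"
    have "H (b .[tot R] u) = (\<Oplus>\<^bsub>X\<^esub>s\<in>{..R}. b .[X] T s u)"
      unfolding H_def by (rule g.M.M.finsum_cong') (use Ts[OF _ u b] Tc[OF _ u] b in auto)
    then show "H (b .[tot R] u) = b .[X] H u"
      unfolding H_def using g.M.smult_finsum[OF b Tpi[OF u]] by simp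
  qed
  moreover have "g (H u) = f u" if u: "u : carrier (tot R)" for u
  proof -
    have c: "(%s. cmp s (fst (u s)) (snd (u s))) : {..R} \<rightarrow> carrier (tot R)"
      using cmp_closed[OF tot_closed[OF u]] by auto
    have "g (H u) = (\<Oplus>\<^bsub>Y\<^esub>s\<in>{..R}. g (T s u))" unfolding H_def by (rule g.finsum[OF Tpi[OF u]])
    also have "... = (\<Oplus>\<^bsub>Y\<^esub>s\<in>{..R}. f (cmp s (fst (u s)) (snd (u s))))"
      by (rule g.N.M.finsum_cong') (use gT[OF _ u] c in auto)
    also have "... = f (\<Oplus>\<^bsub>tot R\<^esub>s\<in>{..R}. cmp s (fst (u s)) (snd (u s)))" by (rule f.finsum[OF c, symmetric])
    finally show ?thesis by (simp add: tot_finsum[OF u])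
  qed
  ultimately show "\<exists>h\<in>module_hom B (tot R) X. \<forall>q\<in>carrier (tot R). g (h q) = f q" by blast
qed

text \<open>Filter by the elements that vanish from position \<open>t\<close> on; each step has
  quotient \<open>P t \<times> P t\<close>, which accounts for the factor 2.\<close>

lemma tot_dim:
  assumes fdP: "!!s. A.fd (P s)"
  shows "B.fd (tot R)" "B.dimm (tot R) = 2 * (\<Sum>s\<le>R. A.dimm (P s))"
proof -
  interpret T: lmod B "tot R" by (simp add: lmod_def tot_left_module)
  define Q where "Q t = {u : carrier (tot R). \<forall>s\<ge>t. u s = (\<zero>[P s], \<zero>[P s])}" for t
  have Qsub: "Module.submodule (Q t) B (tot R)" for t
  proof (rule T.submoduleI)
    show "\<zero>[tot R] : Q t" unfolding Q_def using T.M.zero_closed by (simp add: tot_simps(1))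
  next
    fix u v assume "u : Q t" "v : Q t"
    then show "u +[tot R] v : Q t" using tot_add_closed unfolding Q_def by (simp add: tot_simps(2))
  next
    fix b u assume b: "b : carrier B" and "u : Q t"
    then have u: "u : carrier (tot R)" "\<forall>s\<ge>t. u s = (\<zero>[P s], \<zero>[P s])" by (simp_all add: Q_def)
    have "(b .[tot R] u) s = (\<zero>[P s], \<zero>[P s])" if "s \<ge> t" for s
      using u(2) that b by (simp add: tot_simps(3) del: funpow.simps)
    then show "b .[tot R] u : Q t" using T.smult_closed[OF b u(1)] by (simp add: Q_def)
  qed (auto simp: Q_def)
  note lmQ = T.submodule_left_module[OF Qsub]
  have "B.fd (tot R(|carrier := Q t|)) & B.dimm (tot R(|carrier := Q t|)) = 2 * (\<Sum>s<t. A.dimm (P s))"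
    if "t <= Suc R" for t
    using that
  proof (induction t)
    case 0
    have "Q 0 = {\<zero>[tot R]}"
      using T.M.zero_closed by (auto simp: Q_def tot_simps(1) fun_eq_iff)
    then show ?case using B.zero_dim[OF lmQ[of 0]] by simp
  next
    case (Suc t)
    let ?V = "B.vs_of (tot R(|carrier := Q (Suc t)|))" and ?W = "A.vs_of (prod_module (P t) (P t))"
    have lmW: "left_module A (prod_module (P t) (P t))" by (rule left_module_prod[OF P.left_module P.left_module])
    have V: "vectorspace K ?V" by (rule B.vs_of_vectorspace[OF lmQ])
    have W: "vectorspace K ?W" by (rule A.vs_of_vectorspace[OF lmW])
    have Wd: "A.fd (prod_module (P t) (P t))" "A.dimm (prod_module (P t) (P t)) = 2 * A.dimm (P t)"
      using A.prod_dim[OF P.left_module P.left_module fdP fdP, of t t] by simp_all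
    have f: "(%u. u t) : module_hom K ?V ?W"
    proof (rule module_homI)
      fix u assume u: "u : carrier ?V"
      then have uc: "u : carrier (tot R)" by (simp add: Q_def)
      show "u t : carrier ?W" using tot_closed[OF uc, of t] by (simp add: mem_Times_iff)
      fix v assume "v : carrier ?V"
      show "(u +[?V] v) t = u t +[?W] v t"
        by (cases "u t"; cases "v t") (simp add: tot_simps(2))
    next
      fix c u assume c: "c : carrier K" and "u : carrier ?V"
      then have uc: "u : carrier (tot R)" by (simp add: Q_def)
      show "(c .[?V] u) t = c .[?W] u t"
        using tot_closed[OF uc, of t] c by (cases "u t") (simp add: tot_simps(3) del: funpow.simps)
    qed
    have surj: "(%u. u t) ` carrier ?V = carrier ?W"
    proof
      show "carrier ?W \<subseteq> (%u. u t) ` carrier ?V"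
      proof
        fix w assume "w : carrier ?W"
        then obtain x x' where w: "w = (x, x')" "x : carrier (P t)" "x' : carrier (P t)" by auto
        have "cmp t x x' : carrier ?V" using cmp_closed[OF w(2,3), of R] Suc.prems by (simp add: Q_def cmp_def)
        moreover have "cmp t x x' t = w" by (simp add: cmp_def w)
        ultimately show "w : (%u. u t) ` carrier ?V" by (metis image_eqI)
      qed
      show "(%u. u t) ` carrier ?V \<subseteq> carrier ?W"
      proof
        fix w assume "w : (%u. u t) ` carrier ?V"
        then obtain u where u: "u : carrier (tot R)" "w = u t" by (auto simp: Q_def)
        then show "w : carrier ?W" using tot_closed[OF u(1), of t] by (simp add: mem_Times_iff)
      qed
    qed
    have "{v : carrier ?V. v t = \<zero>[?W]} = Q t"
    proof (intro equalityI subsetI)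
      fix v assume "v : {v : carrier ?V. v t = \<zero>[?W]}"
      then have v: "v : carrier (tot R)" "\<forall>s\<ge>Suc t. v s = (\<zero>[P s], \<zero>[P s])" "v t = (\<zero>[P t], \<zero>[P t])"
        by (simp_all add: Q_def)
      then have "v s = (\<zero>[P s], \<zero>[P s])" if "s \<ge> t" for s using that by (cases "s = t") auto
      then show "v : Q t" using v(1) by (simp add: Q_def)
    qed (auto simp: Q_def)
    then have ker: "?V(|carrier := {v : carrier ?V. v t = \<zero>[?W]}|) = B.vs_of (tot R(|carrier := Q t|))"
      by simp
    have fV: "vectorspace.fin_dim K ?V"
      by (rule fin_dim_extension[OF V W f surj Wd(1)]) (use Suc ker in simp)
    show ?case
      using rank_nullity_kernel(2)[OF V W f fV surj] ker Suc Wd(2) fV by (simp add: dim_over_def)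
  qed
  moreover have "Q (Suc R) = carrier (tot R)"
    using tot_beyond by (auto simp: Q_def)
  then have "tot R(|carrier := Q (Suc R)|) = tot R" by simp
  ultimately have "B.fd (tot R) & B.dimm (tot R) = 2 * (\<Sum>s<Suc R. A.dimm (P s))" by (metis order_refl)
  then show "B.fd (tot R)" "B.dimm (tot R) = 2 * (\<Sum>s\<le>R. A.dimm (P s))"
    by (simp_all add: lessThan_Suc_atMost)
qed

lemma tot_minres: "minimal_projective_resolution B (pull p1 M) tot totd tote"
  unfolding minimal_projective_resolution_def projective_resolution_def
proof (intro conjI allI)
  fix r
  show "projective B (tot r)" by (rule tot_projective)
  show "tote : module_hom B (tot 0) (pull p1 M)" by (rule tote_hom)
  show "tote ` carrier (tot 0) = carrier (pull p1 M)" using tote_surj by simp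
  show "totd r : module_hom B (tot (Suc r)) (tot r)" by (rule totd_hom)
  show "totd 0 ` carrier (tot 1) = kernel_of (tot 0) (pull p1 M) tote" by (rule totd_image_0)
  show "totd (Suc r) ` carrier (tot (Suc (Suc r))) = kernel_of (tot (Suc r)) (tot r) (totd r)"
    by (rule totd_image_Suc)
  interpret E: lmod_hom B "tot 0" "pull p1 M" tote
    by (rule lmod_homI[OF tot_left_module inflate[OF lmM] tote_hom])
  show "superfluous (kernel_of (tot 0) (pull p1 M) tote) B (tot 0)"
  proof (rule tot_superfluous[OF E.kernel_submodule])
    fix n s assume "n : kernel_of (tot 0) (pull p1 M) tote"
    then have n: "n : carrier (tot 0)" "ep (fst (n 0)) = \<zero>[M]" by (simp_all add: kernel_of_def tote_def)
    show "fst (n s) : syz s"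
    proof (cases "s = 0")
      case True
      then show ?thesis using n tot_closed(1)[OF n(1)] by (simp add: syz_def kernel_of_def)
    next
      case False
      then show ?thesis using tot_beyond[OF n(1), of s] P.submoduleD(2)[OF syz_submodule] by simp
    qed
  qed
  interpret D: lmod_hom B "tot (Suc r)" "tot r" "totd r"
    by (rule lmod_homI[OF tot_left_module tot_left_module totd_hom])
  show "superfluous (kernel_of (tot (Suc r)) (tot r) (totd r)) B (tot (Suc r))"
  proof (rule tot_superfluous[OF D.kernel_submodule])
    fix n s assume "n : kernel_of (tot (Suc r)) (tot r) (totd r)"
    then have n: "n : carrier (tot (Suc r))" "totd r n = \<zero>[tot r]" by (simp_all add: kernel_of_def)
    have z: "d s (fst (n (Suc s))) = \<zero>[P s]" "d s (snd (n (Suc s))) +[P s] sg s (fst (n s)) = \<zero>[P s]"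
      if "s <= r" for s
      using fun_cong[OF n(2), of s] that by (simp_all add: totd_def tot_simps)
    show "fst (n s) : syz s"
    proof (cases s)
      case 0
      have x: "fst (n 0) : carrier (P 0)" "snd (n (Suc 0)) : carrier (P (Suc 0))" using tot_closed[OF n(1)] by auto
      \<comment> \<open>The kernel equation makes \<open>fst (n 0)\<close> a boundary up to sign,
        hence the augmentation kills it.\<close>
      have "d 0 (snd (n (Suc 0))) +[P 0] fst (n 0) = \<zero>[P 0]" using z(2)[of 0] by (simp add: sg_def)
      then have "-[P 0] fst (n 0) = d 0 (snd (n (Suc 0)))" using x by (intro P.M.minus_equality) simp_all
      then have "ep (-[P 0] fst (n 0)) = \<zero>[M]" using x by simp
      then have "ep (fst (n 0)) = \<zero>[M]" using x by (simp add: e.neg e.N.M.add.inv_eq_1_iff)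
      then show ?thesis using 0 x by (simp add: syz_def kernel_of_def)
    next
      case (Suc s')
      show ?thesis
      proof (cases "s' <= r")
        case True
        then show ?thesis using z(1)[OF True] Suc tot_closed(1)[OF n(1), of s] by (simp add: syz_def kernel_of_def)
      next
        case False
        then show ?thesis using tot_beyond[OF n(1), of s] Suc P.submoduleD(2)[OF syz_submodule, of s] by simp
      qed
    qed
  qed
qed

end

section \<open>Betti numbers over the skew extension\<close>

context skew_ext
begin

lemma inflate_minres:
  fixes M :: "('a, nat => 'k) module" and P :: "nat => ('a, nat => 'k) module"
  assumes "minimal_projective_resolution A M P d ep" "left_module A M" "A.fd M"
  shows "\<exists>(P' :: nat => ('b, nat => 'k) module) d' ep'. minimal_projective_resolution B (pull p1 M) P' d' ep' &
    (\<forall>r. B.dimm (P' r) = 2 * (\<Sum>s\<le>r. A.dimm (P s)))"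
proof -
  interpret R: skew_resolution K A B p1 p2 io y ps th M P d ep
    by unfold_locales (rule assms)+
  have fdP: "A.fd (P s)" for s by (rule A.minres_fd[OF assms])
  show ?thesis
    using B.minres_transport[OF R.tot_minres inflate[OF assms(2)] R.tot_dim(1)[OF fdP]] R.tot_dim(2)[OF fdP]
    by simp
qed

lemma pull_dim_A:
  assumes "left_module B X" "B.fd X" "left_module A (pull f X)" "!!r. r : carrier K ==> f (A.scal r) = B.scal r"
  shows "A.fd (pull f X)" "A.dimm (pull f X) = B.dimm X"
proof -
  have h: "(%x. x) : module_hom K (B.vs_of X) (A.vs_of (pull f X))"
    by (simp add: module_hom_def assms(4))
  have b: "bij_betw (%x. x) (carrier (B.vs_of X)) (carrier (A.vs_of (pull f X)))"
    by (simp add: bij_betw_def)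
  show "A.fd (pull f X)" "A.dimm (pull f X) = B.dimm X"
    using vectorspace_iso[OF B.vs_of_vectorspace[OF assms(1)] A.vs_of_vectorspace[OF assms(3)] h b assms(2)]
    by (simp_all add: dim_over_def)
qed

lemma inflate_fd:
  assumes "left_module A M" "A.fd M"
  shows "B.fd (pull p1 M)"
proof -
  have h: "(%x. x) : module_hom K (A.vs_of M) (B.vs_of (pull p1 M))"
    by (simp add: module_hom_def)
  have b: "bij_betw (%x. x) (carrier (A.vs_of M)) (carrier (B.vs_of (pull p1 M)))"
    by (simp add: bij_betw_def)
  show ?thesis
    using vectorspace_iso(1)[OF A.vs_of_vectorspace[OF assms(1)] B.vs_of_vectorspace[OF inflate[OF assms(1)]] h b assms(2)]
    by simp
qed

lemma inflate_betti_le: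
  fixes M :: "('a, nat => 'k) module"
  assumes "left_module A M" "A.fd M" "!!s. A.betti_le s M (c s)"
  shows "B.betti_le r (pull p1 M) (2 * (\<Sum>s\<le>r. c s))"
proof -
  obtain P :: "nat => ('a, nat => 'k) module" and d ep
    where P: "minimal_projective_resolution A M P d ep" using A.minres_exists[OF assms(1,2)] by blast
  obtain P' :: "nat => ('b, nat => 'k) module" and d' ep'
    where P': "minimal_projective_resolution B (pull p1 M) P' d' ep'"
      "!!r. B.dimm (P' r) = 2 * (\<Sum>s\<le>r. A.dimm (P s))"
    using inflate_minres[OF P assms(1,2)] by blast
  have "A.dimm (P s) <= c s" for s
    by (rule A.minres_dim_le[OF P assms(2) retract_refl[OF assms(1)] assms(3)])
  then have "B.dimm (P' r) <= 2 * (\<Sum>s\<le>r. c s)" unfolding P'(2) by (simp add: sum_mono)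
  then show ?thesis
    using B.minres_betti_le[OF P'(1) inflate[OF assms(1)] inflate_fd[OF assms(1,2)], of r]
      B.betti_le_mono by blast
qed

text \<open>An arbitrary module \<open>N\<close> is an extension of the inflated modules \<open>N / {n. y n = 0} \<cong> y N\<close>
  (with a twisted action) and \<open>{n. y n = 0}\<close>.\<close>

lemma skew_betti_bound:
  fixes N :: "('b, nat => 'k) module"
  assumes lmN: "left_module B N" and fdN: "B.fd N"
    and bound: "!!(M :: ('a, nat => 'k) module) s. left_module A M ==> A.fd M ==> A.betti_le s M (A.dimm M * c s)"
  shows "B.betti_le r N (4 * B.dimm N * (\<Sum>s\<le>r. c s))"
proof -
  interpret N: lmod B N by (simp add: lmod_def lmN)
  have yio: "y .[N] (io a .[N] v) = io (ps a) .[N] (y .[N] v)" if "a : carrier A" "v : carrier N" for a v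
    using that y_io[of a] by (simp add: N.smult_assoc[symmetric])
  have yy: "y .[N] (y .[N] v) = \<zero>[N]" if "v : carrier N" for v
    using that by (simp add: N.smult_assoc[symmetric])
  have bs: "b .[N] v = io (p1 b) .[N] v +[N] io (p2 b) .[N] (y .[N] v)" if "b : carrier B" "v : carrier N" for b v
  proof -
    have "b .[N] v = (io (p1 b) +[B] io (p2 b) *[B] y) .[N] v" using decompose[OF that(1)] by simp
    also have "... = io (p1 b) .[N] v +[N] (io (p2 b) *[B] y) .[N] v"
      using that by (intro N.smult_l_distr) simp_all
    also have "(io (p2 b) *[B] y) .[N] v = io (p2 b) .[N] (y .[N] v)"
      using that by (intro N.smult_assoc) simp_all
    finally show ?thesis .
  qed
  have yb: "y .[N] (b .[N] v) = io (ps (p1 b)) .[N] (y .[N] v)" if "b : carrier B" "v : carrier N" for b v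
    using that by (simp add: bs[OF that] N.smult_r_distr yio yy)
  define N1 where "N1 = {v : carrier N. y .[N] v = \<zero>[N]}"
  define N2 where "N2 = (%v. y .[N] v) ` carrier N"
  have N1: "Module.submodule N1 B N"
  proof (rule N.submoduleI)
    fix b v assume b: "b : carrier B" and "v : N1"
    then have v: "v : carrier N" "y .[N] v = \<zero>[N]" by (simp_all add: N1_def)
    have "y .[N] (b .[N] v) = \<zero>[N]" unfolding yb[OF b v(1)] v(2) using b by simp
    then show "b .[N] v : N1" using b v(1) by (simp add: N1_def)
  qed (auto simp: N1_def N.smult_r_distr)
  have N2: "Module.submodule N2 B N"
  proof (rule N.submoduleI)
    show "\<zero>[N] : N2" unfolding N2_def by (rule rev_image_eqI[of "\<zero>[N]"]) simp_all
  next
    fix v w assume "v : N2" "w : N2"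
    then obtain v' w' where "v' : carrier N" "v = y .[N] v'" "w' : carrier N" "w = y .[N] w'" by (auto simp: N2_def)
    then show "v +[N] w : N2"
      unfolding N2_def by (intro rev_image_eqI[of "v' +[N] w'"]) (simp_all add: N.smult_r_distr)
  next
    fix b v assume b: "b : carrier B" and "v : N2"
    then obtain v' where v': "v' : carrier N" "v = y .[N] v'" by (auto simp: N2_def)
    have "b .[N] v = y .[N] (io (th (p1 b)) .[N] v')"
      unfolding v'(2) using v'(1) b by (simp add: bs[OF b N.smult_closed[OF y_closed v'(1)]] yy yio)
    then show "b .[N] v : N2" unfolding N2_def using v' b by (intro rev_image_eqI) simp_all
  qed (auto simp: N2_def)
  note lm1 = N.submodule_left_module[OF N1] and lm2 = N.submodule_left_module[OF N2]
  note f1 = B.sub_fd(1,2)[OF lmN N1 fdN] and f2 = B.sub_fd(1,2)[OF lmN N2 fdN]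
  define M1 where "M1 = pull io (N(|carrier := N1|))"
  \<comment> \<open>The twist by \<open>ps\<close> makes multiplication by \<open>y\<close> a linear
    map from \<open>N\<close> onto the inflation of \<open>M2\<close>.\<close>
  define M2 where "M2 = pull (%a. io (ps a)) (N(|carrier := N2|))"
  have lmM1: "left_module A M1"
    unfolding M1_def using restrict_twisted[OF lm1, of 0] by simp
  have lmM2: "left_module A M2"
    unfolding M2_def using restrict_twisted[OF lm2, of 1] by simp
  have d1: "A.fd M1" "A.dimm M1 <= B.dimm N"
    using pull_dim_A[OF lm1 f1(1), of io] lmM1 f1(2) unfolding M1_def by simp_all
  have d2: "A.fd M2" "A.dimm M2 <= B.dimm N"
    using pull_dim_A[OF lm2 f2(1), of "%a. io (ps a)"] lmM2 f2(2) unfolding M2_def by simp_all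
  have m: "B.betti_le r (pull p1 M) (2 * (\<Sum>s\<le>r. B.dimm N * c s))"
    if "left_module A M" "A.fd M" "A.dimm M <= B.dimm N" for M :: "('a, nat => 'k) module"
    by (rule inflate_betti_le[OF that(1,2)])
      (rule A.betti_le_mono[OF bound[OF that(1,2)]], simp add: that(3))
  have i: "(%x. x) : module_hom B (pull p1 M1) N"
  proof (rule module_homI)
    fix b v assume "b : carrier B" "v : carrier (pull p1 M1)"
    then have b: "b : carrier B" and v: "v : carrier N" "y .[N] v = \<zero>[N]" by (simp_all add: M1_def N1_def)
    show "b .[pull p1 M1] v = b .[N] v" using b v(1) by (simp add: M1_def bs[OF b v(1)] v(2))
  qed (simp_all add: M1_def N1_def)
  have g: "(%v. y .[N] v) : module_hom B N (pull p1 M2)"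
  proof (rule module_homI)
    fix b v assume bv: "b : carrier B" "v : carrier N"
    show "y .[N] (b .[N] v) = b .[pull p1 M2] (y .[N] v)" unfolding yb[OF bv] by (simp add: M2_def)
  qed (simp_all add: M2_def N2_def N.smult_r_distr)
  \<comment> \<open>One doubled partial sum for the kernel of \<open>y\<close> and one for its
    image, each of dimension at most that of \<open>N\<close>; together they give the factor
    4.\<close>
  have "B.betti_le r N (2 * (\<Sum>s\<le>r. B.dimm N * c s) + 2 * (\<Sum>s\<le>r. B.dimm N * c s))"
  proof (rule B.horseshoe[OF lmN inflate[OF lmM1] inflate[OF lmM2] i _ g _ _ m[OF lmM1 d1] m[OF lmM2 d2]])
    show "(%v. y .[N] v) ` carrier N = carrier (pull p1 M2)" by (simp add: M2_def N2_def)
    show "(%x. x) ` carrier (pull p1 M1) = kernel_of N (pull p1 M2) (%v. y .[N] v)"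
      by (auto simp: M1_def M2_def N1_def kernel_of_def)
  qed simp
  moreover have "2 * (\<Sum>s\<le>r. B.dimm N * c s) + 2 * (\<Sum>s\<le>r. B.dimm N * c s) = 4 * B.dimm N * (\<Sum>s\<le>r. c s)"
    by (simp add: sum_distrib_left[symmetric])
  ultimately show ?thesis by simp
qed

end

section \<open>Growth of coefficients of rational power series\<close>

text \<open>Coefficients of order \<open>r^(D - 1)\<close>. Index 0 is excluded because
  \<open>0 powr x\<close> is 0.\<close>

definition pgrowth :: "real => complex fps => bool" where
  "pgrowth D f \<longleftrightarrow> (\<exists>C. \<forall>r\<ge>1. cmod (fps_nth f r) <= C * real r powr (D - 1))"

lemma pgrowth_add:
  assumes "pgrowth D f" "pgrowth D g" shows "pgrowth D (f + g)"
proof -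
  obtain C1 C2 where C: "\<forall>r\<ge>1. cmod (fps_nth f r) <= C1 * real r powr (D - 1)"
    "\<forall>r\<ge>1. cmod (fps_nth g r) <= C2 * real r powr (D - 1)"
    using assms by (auto simp: pgrowth_def)
  have "cmod (fps_nth (f + g) r) <= (C1 + C2) * real r powr (D - 1)" if "r \<ge> 1" for r
    using C that norm_triangle_ineq[of "fps_nth f r" "fps_nth g r"] by (force simp: algebra_simps)
  then show ?thesis unfolding pgrowth_def by blast
qed

lemma pgrowth_const:
  assumes "pgrowth D f" shows "pgrowth D (fps_const c * f)"
proof -
  obtain C where C: "\<forall>r\<ge>1. cmod (fps_nth f r) <= C * real r powr (D - 1)"
    using assms by (auto simp: pgrowth_def)
  have "cmod (fps_nth (fps_const c * f) r) <= (cmod c * C) * real r powr (D - 1)" if "r \<ge> 1" for r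
    using mult_left_mono[of "cmod (fps_nth f r)" "C * real r powr (D - 1)" "cmod c"] C that
    by (simp add: norm_mult mult.assoc)
  then show ?thesis unfolding pgrowth_def by blast
qed

lemma pgrowth_X:
  assumes "pgrowth D f" "0 <= D" shows "pgrowth D (fps_X * f)"
proof -
  obtain C where C: "\<forall>r\<ge>1. cmod (fps_nth f r) <= C * real r powr (D - 1)"
    using assms by (auto simp: pgrowth_def)
  have C0: "0 <= C" using order_trans[OF norm_ge_zero C[rule_format, of 1]] by simp
  \<comment> \<open>The term \<open>fps_nth f 0\<close> covers index 1. For \<open>D < 1\<close> the
    bound decreases in \<open>r\<close>, and the shift costs at most a factor 2, since
    \<open>k \<ge> r / 2\<close> and the exponent is at least -1.\<close>
  define C' where "C' = cmod (fps_nth f 0) + 2 * C"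
  have "cmod (fps_nth (fps_X * f) r) <= C' * real r powr (D - 1)" if r: "r \<ge> 1" for r
  proof (cases "r = 1")
    case True
    then show ?thesis using C0 by (simp add: C'_def)
  next
    case False
    with r obtain k where k: "r = Suc k" "k \<ge> 1" by (cases r) auto
    have "real k powr (D - 1) <= 2 * real r powr (D - 1)"
    proof (cases "D \<ge> 1")
      case True
      then have "real k powr (D - 1) <= real r powr (D - 1)" using k by (intro powr_mono2) auto
      also have "... <= 2 * real r powr (D - 1)" by simp
      finally show ?thesis .
    next
      case False
      have "real k powr (D - 1) <= (real r / 2) powr (D - 1)"
        using k False by (intro powr_mono2') auto
      also have "... = real r powr (D - 1) * 2 powr (1 - D)"
      proof -
        have "(real r / 2) powr (D - 1) = real r powr (D - 1) / 2 powr (D - 1)" by (rule powr_divide)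
        also have "... = real r powr (D - 1) * 2 powr (- (D - 1))" by (simp only: powr_minus divide_inverse)
        finally show ?thesis by simp
      qed
      also have "... <= real r powr (D - 1) * 2"
      proof (rule mult_left_mono)
        have "2 powr (1 - D) <= (2::real) powr 1" using assms(2) by (intro powr_mono) auto
        then show "2 powr (1 - D) <= (2::real)" by simp
      qed simp
      finally show ?thesis by (simp only: mult.commute)
    qed
    then have "C * real k powr (D - 1) <= C * (2 * real r powr (D - 1))" using C0 by (intro mult_left_mono)
    also have "... <= C' * real r powr (D - 1)" by (simp add: C'_def algebra_simps)
    finally show ?thesis using C[rule_format, OF k(2)] k(1) by simp
  qed
  then show ?thesis unfolding pgrowth_def by blast
qed

lemma pgrowth_poly:
  assumes "pgrowth D f" "0 <= D" shows "pgrowth D (fps_of_poly p * f)"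
proof (induction p)
  case 0
  show ?case by (auto simp: pgrowth_def intro!: exI[of _ 0])
next
  case (pCons a p)
  have "fps_of_poly (pCons a p) * f = fps_const a * f + fps_X * (fps_of_poly p * f)"
    by (simp add: fps_of_poly_pCons algebra_simps)
  then show ?case using pCons pgrowth_add pgrowth_const pgrowth_X assms by metis
qed

lemma pgrowth_one: "pgrowth D 1"
  by (auto simp: pgrowth_def intro!: exI[of _ 0])

definition geom :: "complex => complex fps" where "geom a = Abs_fps (%r. a ^ r)"

lemma geom_inverse: "(1 - fps_const a * fps_X) * geom a = 1"
proof (rule fps_ext)
  fix n
  have "fps_nth ((1 - fps_const a * fps_X) * geom a) n = fps_nth (geom a) n - a * fps_nth (fps_X * geom a) n"
    by (simp add: left_diff_distrib mult.assoc)
  then show "fps_nth ((1 - fps_const a * fps_X) * geom a) n = fps_nth 1 n"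
    by (cases n) (simp_all add: geom_def)
qed

text \<open>Each further convolution with the geometric series has \<open>r + 1\<close> terms, all
  bounded by the same quantity.\<close>

lemma geom_power_bound: "cmod (fps_nth (geom a ^ Suc m) r) <= cmod a ^ r * real (r + 1) ^ m"
proof (induction m arbitrary: r)
  case 0
  then show ?case by (simp add: geom_def norm_power)
next
  case (Suc m)
  have "cmod (fps_nth (geom a ^ Suc (Suc m)) r) = cmod (\<Sum>i=0..r. fps_nth (geom a ^ Suc m) i * a ^ (r - i))"
    unfolding power_Suc2[of _ "Suc m"] fps_mult_nth by (simp add: geom_def)
  also have "... <= (\<Sum>i=0..r. cmod (fps_nth (geom a ^ Suc m) i * a ^ (r - i)))" by (rule norm_sum)
  also have "... <= (\<Sum>i=0..r. cmod a ^ r * real (r + 1) ^ m)"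
  proof (rule sum_mono)
    fix i assume i: "i : {0..r}"
    have "cmod (fps_nth (geom a ^ Suc m) i * a ^ (r - i)) <= (cmod a ^ i * real (i + 1) ^ m) * cmod a ^ (r - i)"
      unfolding norm_mult norm_power by (intro mult_right_mono Suc) simp
    also have "... = cmod a ^ r * real (i + 1) ^ m" using i by (simp add: power_add[symmetric])
    also have "... <= cmod a ^ r * real (r + 1) ^ m" using i by (intro mult_left_mono power_mono) auto
    finally show "cmod (fps_nth (geom a ^ Suc m) i * a ^ (r - i)) <= cmod a ^ r * real (r + 1) ^ m" .
  qed
  also have "... = cmod a ^ r * real (r + 1) ^ Suc m" by (simp add: algebra_simps)
  finally show ?case .
qed

text \<open>Writing \<open>x = z^m\<close> reduces the claim to boundedness of
  \<open>n z^n\<close>.\<close>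

lemma power_times_poly_bounded:
  fixes x :: real
  assumes "0 <= x" "x < 1"
  shows "\<exists>C. \<forall>r. x ^ r * real (r + 1) ^ m <= C"
proof (cases "m = 0")
  case True
  then show ?thesis using assms by (auto intro!: exI[of _ 1] power_le_one)
next
  case False
  define z where "z = root m x"
  have m: "0 < m" using False by simp
  have z: "0 <= z" "z < 1" "z ^ m = x"
    unfolding z_def using real_root_lt_1_iff[OF m, of x] assms m
    by (simp_all only: real_root_ge_zero real_root_pow_pos2)
  have "norm z < 1" using z(1,2) by simp
  then have "(%n. of_nat n * z ^ n) \<longlonglongrightarrow> 0" by (rule powser_times_n_limit_0)
  then have "Bseq (%n. real n * z ^ n)" by (rule convergent_imp_Bseq[OF convergentI])
  then obtain C where C: "!!n. norm (real n * z ^ n) <= C" using BseqE by blast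
  have "x ^ r * real (r + 1) ^ m <= (C + 1) ^ m" for r
  proof -
    have "x ^ r * real (r + 1) ^ m = (real r * z ^ r + z ^ r) ^ m"
    proof -
      have "x ^ r = (z ^ r) ^ m" unfolding z(3)[symmetric] by (simp only: power_mult[symmetric] mult.commute)
      then have "x ^ r * real (r + 1) ^ m = (z ^ r * real (r + 1)) ^ m" by (simp only: power_mult_distrib)
      then show ?thesis by (simp add: algebra_simps)
    qed
    also have "... <= (C + 1) ^ m"
      using C[of r] z power_le_one[of z r] by (intro power_mono add_mono) auto
    finally show ?thesis .
  qed
  then show ?thesis by blast
qed

lemma pgrowth_geom_power:
  assumes "0 <= D" "cmod a < 1 \<or> (cmod a = 1 & real m <= D)"
  shows "pgrowth D (geom a ^ m)"
proof (cases m)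
  case 0
  then show ?thesis by (simp add: pgrowth_one)
next
  case (Suc k)
  show ?thesis
  proof (cases "cmod a < 1")
    case True
    obtain C where C: "!!r. cmod a ^ r * real (r + 1) ^ Suc k <= C"
      using power_times_poly_bounded[of "cmod a" "Suc k"] True by auto
    have "cmod (fps_nth (geom a ^ m) r) <= C * real r powr (D - 1)" if r: "r \<ge> 1" for r
    proof -
      \<comment> \<open>One extra factor \<open>r + 1\<close> compensates for
        \<open>r powr (D - 1)\<close>, whose exponent can be as low as -1.\<close>
      have "1 <= real (r + 1) * real r powr (D - 1)"
      proof -
        have "1 = real r * real r powr (- 1)" using r by (simp add: powr_minus_divide)
        also have "... <= real (r + 1) * real r powr (D - 1)"
          using r assms(1) by (intro mult_mono powr_mono) auto
        finally show ?thesis .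
      qed
      then have "cmod a ^ r * real (r + 1) ^ k * 1 <= cmod a ^ r * real (r + 1) ^ k * (real (r + 1) * real r powr (D - 1))"
        by (intro mult_left_mono) auto
      also have "... = (cmod a ^ r * real (r + 1) ^ Suc k) * real r powr (D - 1)" by (simp add: mult_ac)
      also have "... <= C * real r powr (D - 1)" by (intro mult_right_mono C) simp
      finally show ?thesis using geom_power_bound[of a k r] Suc by simp
    qed
    then show ?thesis unfolding pgrowth_def by blast
  next
    case False
    then have a: "cmod a = 1" "real m <= D" using assms by auto
    have "cmod (fps_nth (geom a ^ m) r) <= 2 ^ k * real r powr (D - 1)" if r: "r \<ge> 1" for r
    proof -
      have "cmod (fps_nth (geom a ^ m) r) <= real (r + 1) ^ k"
        using geom_power_bound[of a k r] a Suc by simp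
      also have "... <= (2 * real r) ^ k" using r by (intro power_mono) auto
      also have "... = 2 ^ k * real r powr real k" using r by (simp add: power_mult_distrib powr_realpow)
      also have "... <= 2 ^ k * real r powr (D - 1)"
        using a Suc r by (intro mult_left_mono powr_mono) auto
      finally show ?thesis .
    qed
    then show ?thesis unfolding pgrowth_def by blast
  qed
qed

text \<open>An inverse of \<open>q\<close> modulo \<open>L\<close> comes from
  \<open>q = q(z) + L s\<close>. Inserting the resulting expression for 1 next to
  \<open>u L^m\<close> raises the exponent by one.\<close>

lemma linear_power_bezout:
  fixes q :: "complex poly"
  assumes "poly q z ~= 0"
  shows "\<exists>u v. u * [:- z, 1:] ^ m + v * q = 1"
proof (induction m)
  case 0
  show ?case by (intro exI[of _ 1] exI[of _ 0]) simp
next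
  case (Suc m)
  then obtain u v where uv: "u * [:- z, 1:] ^ m + v * q = 1" by blast
  define L where "L = [:- z, 1:]"
  define e where "e = [:poly q z:]"
  have "poly (q - e) z = 0" by (simp add: e_def)
  then obtain s where s: "q - e = L * s" unfolding poly_eq_0_iff_dvd L_def by (rule dvdE)
  define c where "c = [:1 / poly q z:]"
  have c1: "c * e = 1" using assms by (simp add: c_def e_def one_pCons)
  have q: "q = e + L * s" using s by (simp add: algebra_simps)
  have "- c * s * L + c * (e + L * s) = c * e" by (simp add: algebra_simps)
  then have one: "- c * s * L + c * q = 1" using c1 q by simp
  have "u * L ^ m * (- c * s * L + c * q) + v * q = 1" unfolding one using uv by (simp add: L_def)
  then have "(- u * c * s) * L ^ Suc m + (u * L ^ m * c + v) * q = 1"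
    by (simp add: algebra_simps)
  then have "\<exists>u v. u * L ^ Suc m + v * q = 1" by blast
  then have "\<exists>u v. u * [:- z, 1:] ^ Suc m + v * q = 1" unfolding L_def .
  then show ?case by blast
qed

text \<open>Let \<open>q = L^m q2\<close> with \<open>L\<close> the linear factor of a root. By a
  Bezout identity \<open>f\<close> is a polynomial combination of \<open>L^m f\<close>, whose
  denominator is \<open>q2\<close>, and of \<open>q2 f\<close>, whose denominator is
  \<open>L^m\<close>. Induction on the degree handles the first and powers of the geometric series
  the second, so no partial fraction expansion is formed.\<close>

lemma pgrowth_rational:
  assumes "0 <= D" "poly q 0 ~= 0"
    "!!z. poly q z = 0 ==> cmod z > 1 \<or> (cmod z = 1 & real (order z q) <= D)"
    "fps_of_poly q * f = fps_of_poly p"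
  shows "pgrowth D f"
  using assms(2-4)
proof (induction "degree q" arbitrary: q f p rule: less_induct)
  case less
  show ?case
  proof (cases "degree q = 0")
    case True
    then obtain c where c: "q = [:c:]" using degree_eq_zeroE by blast
    then have "c ~= 0" using less.prems by simp
    have "fps_const (1 / c) * fps_of_poly q * f = fps_const (1 / c) * fps_of_poly p"
      using less.prems(3) by (simp add: mult.assoc)
    then have "f = fps_const (1 / c) * (fps_of_poly p * 1)" using c \<open>c ~= 0\<close>
      by (simp add: fps_of_poly_pCons fps_const_mult)
    then show ?thesis using pgrowth_const pgrowth_poly pgrowth_one assms(1) by metis
  next
    case False
    then obtain z where z: "poly q z = 0"
      using fundamental_theorem_of_algebra constant_degree by metis
    have q0: "q ~= 0" using less.prems(1) by auto
    have z0: "z ~= 0" using z less.prems(1) by auto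
    define m where "m = order z q"
    obtain q2 where q2: "q = [:- z, 1:] ^ m * q2" "\<not> [:- z, 1:] dvd q2"
      using order_decomp[OF q0] by (metis m_def)
    have m0: "m ~= 0" using z q0 by (simp add: m_def order_root)
    have q2z: "poly q2 z ~= 0" using q2(2) by (simp add: poly_eq_0_iff_dvd)
    have q20: "q2 ~= 0" using q2(1) q0 by auto
    obtain u v where uv: "u * [:- z, 1:] ^ m + v * q2 = 1" using linear_power_bezout[OF q2z] by blast
    let ?Q1 = "fps_of_poly ([:- z, 1:] ^ m)" and ?Q2 = "fps_of_poly q2"
    have prod: "?Q2 * (?Q1 * f) = fps_of_poly p" "?Q1 * (?Q2 * f) = fps_of_poly p"
      using less.prems(3) q2(1) by (simp_all add: fps_of_poly_mult mult_ac)
    have deg: "degree q = m + degree q2"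
      unfolding q2(1) using q20 by (subst degree_mult_eq) (simp_all add: degree_power_eq)
    have "pgrowth D (?Q1 * f)"
    proof (rule less.hyps[OF _ _ _ prod(1)])
      show "degree q2 < degree q" using deg m0 by simp
      show "poly q2 0 ~= 0" using less.prems(1) q2(1) by auto
      fix w assume w: "poly q2 w = 0"
      then have "poly q w = 0" using q2(1) by simp
      moreover have "order w q = order w q2"
      proof -
        have "w ~= z" using w q2z by auto
        then have "poly ([:- z, 1:] ^ m) w ~= 0" by (simp add: poly_power)
        then have "order w ([:- z, 1:] ^ m) = 0" by (rule order_0I)
        moreover have "[:- z, 1:] ^ m * q2 ~= 0" using q0 q2(1) by simp
        ultimately show ?thesis unfolding q2(1) by (simp add: order_mult)
      qed
      ultimately show "1 < cmod w \<or> cmod w = 1 & real (order w q2) <= D" using less.prems(2) by metis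
    qed
    moreover have "pgrowth D (?Q2 * f)"
    proof -
      define a where "a = 1 / z"
      have lin: "fps_of_poly [:- z, 1:] = fps_const (- z) * (1 - fps_const a * fps_X)"
        using z0 by (simp add: fps_of_poly_pCons a_def algebra_simps fps_const_mult[symmetric] del: fps_const_mult)
      have "geom a ^ m * ?Q1 = fps_const ((- z) ^ m)"
      proof -
        have "geom a ^ m * ?Q1 = fps_const (- z) ^ m * ((1 - fps_const a * fps_X) * geom a) ^ m"
          by (simp add: fps_of_poly_power lin power_mult_distrib mult_ac)
        then show ?thesis by (simp add: geom_inverse fps_const_power)
      qed
      then have "fps_const ((- z) ^ m) * (?Q2 * f) = geom a ^ m * fps_of_poly p"
        using prod(2) by (metis mult.assoc)
      then have "fps_const (1 / (- z) ^ m) * (fps_const ((- z) ^ m) * (?Q2 * f)) =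
          fps_const (1 / (- z) ^ m) * (fps_of_poly p * geom a ^ m)" by (simp add: mult.commute)
      then have eq: "?Q2 * f = fps_const (1 / (- z) ^ m) * (fps_of_poly p * geom a ^ m)"
        using z0 by (simp add: mult.assoc[symmetric] fps_const_mult)
      have "cmod a < 1 \<or> (cmod a = 1 & real m <= D)"
        using less.prems(2)[OF z] by (auto simp: a_def m_def norm_divide divide_less_eq_1)
      from pgrowth_geom_power[OF assms(1) this] show ?thesis
        unfolding eq using pgrowth_const pgrowth_poly assms(1) by metis
    qed
    ultimately have "pgrowth D (fps_of_poly u * (?Q1 * f) + fps_of_poly v * (?Q2 * f))"
      using pgrowth_add pgrowth_poly assms(1) by metis
    moreover have "fps_of_poly u * (?Q1 * f) + fps_of_poly v * (?Q2 * f) = f"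
    proof -
      have "fps_of_poly u * (?Q1 * f) + fps_of_poly v * (?Q2 * f) = fps_of_poly (u * [:- z, 1:] ^ m + v * q2) * f"
        by (simp add: fps_of_poly_add fps_of_poly_mult algebra_simps)
      then show ?thesis unfolding uv by simp
    qed
    ultimately show ?thesis by simp
  qed
qed

lemma summable_powr_exp:
  "summable (%j. real (j + 1) powr D * exp (- real j))"
proof -
  obtain k :: nat where k: "D <= real k" using real_arch_simple by blast
  \<comment> \<open>Half of the exponential decay is spent on the polynomial factor; the other half
    remains for the comparison with a geometric series.\<close>
  define h where "h = exp (- (1/2) :: real)"
  have h: "0 < h" "h < 1" by (simp_all add: h_def)
  obtain E where E: "!!r. h ^ r * real (r + 1) ^ k <= E"
    using power_times_poly_bounded[of h k] h by (auto simp: less_imp_le)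
  have le: "real (j + 1) powr D * exp (- real j) <= E * h ^ j" for j
  proof -
    have "real (j + 1) powr D <= real (j + 1) powr real k" using k by (intro powr_mono) auto
    also have "... = real (j + 1) ^ k" by (rule powr_realpow) simp
    finally have "real (j + 1) powr D * exp (- real j) <= real (j + 1) ^ k * exp (- real j)"
      by (rule mult_right_mono) simp
    also have "... = (h ^ j * real (j + 1) ^ k) * h ^ j"
    proof -
      have "h ^ j = exp (real j * - (1/2))" unfolding h_def by (rule exp_of_nat_mult[symmetric])
      then have "exp (- real j) = h ^ j * h ^ j" by (simp add: exp_add[symmetric])
      then show ?thesis by (simp only: mult_ac)
    qed
    also have "... <= E * h ^ j" using h by (intro mult_right_mono E) simp
    finally show ?thesis .
  qed
  have "summable (%j. E * h ^ j)" using h by (intro summable_mult summable_geometric) simp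
  then show ?thesis
    by (rule summable_comparison_test'[where N = 0]) (use le in simp)
qed

text \<open>Cut the sum into blocks of length \<open>n\<close>: the \<open>j\<close>-th block contributes at most
  \<open>C ((j+1) n) powr D * exp (-j)\<close>.\<close>

lemma block_bound:
  fixes b :: "nat => real" and x :: real
  assumes b: "!!r. 0 <= b r" and C: "0 <= C" "!!r. r \<ge> 1 ==> (\<Sum>s\<le>r. b s) <= C * real r powr D"
    and n: "n \<ge> 1" and x: "0 <= x" "x <= 1" "x <= exp (- (1 / real n))"
  shows "(\<Sum>r<J * n. b r * x ^ r) <= C * (\<Sum>j. real (j + 1) powr D * exp (- real j)) * real n powr D"
proof -
  have "(\<Sum>r<J * n. b r * x ^ r) = (\<Sum>j<J. \<Sum>r=j * n..<j * n + n. b r * x ^ r)"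
    by (rule sum.nat_group[symmetric])
  also have "... <= (\<Sum>j<J. C * (real n powr D * (real (j + 1) powr D * exp (- real j))))"
  proof (rule sum_mono)
    fix j assume "j : {..<J}"
    have e: "x ^ (j * n) <= exp (- real j)"
    proof -
      have "x ^ (j * n) <= exp (- (1 / real n)) ^ (j * n)" by (rule power_mono[OF x(3,1)])
      also have "... = exp (real (j * n) * - (1 / real n))" by (rule exp_of_nat_mult[symmetric])
      also have "real (j * n) * - (1 / real n) = - real j" using n by simp
      finally show ?thesis .
    qed
    have "(\<Sum>r=j * n..<j * n + n. b r * x ^ r) <= (\<Sum>r=j * n..<j * n + n. b r * x ^ (j * n))"
      using b x by (intro sum_mono mult_left_mono power_decreasing) auto
    also have "... = (\<Sum>r=j * n..<j * n + n. b r) * x ^ (j * n)" by (rule sum_distrib_right[symmetric])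
    also have "... <= (\<Sum>s\<le>(j + 1) * n. b s) * exp (- real j)"
    proof (rule mult_mono)
      show "(\<Sum>r=j * n..<j * n + n. b r) <= (\<Sum>s\<le>(j + 1) * n. b s)"
        using b by (intro sum_mono2) auto
      show "0 <= (\<Sum>s\<le>(j + 1) * n. b s)" using b by (intro sum_nonneg) auto
    qed (use e x in simp_all)
    also have "... <= (C * real ((j + 1) * n) powr D) * exp (- real j)"
      using n by (intro mult_right_mono C(2)) auto
    also have "real ((j + 1) * n) powr D = real (j + 1) powr D * real n powr D"
      unfolding of_nat_mult by (rule powr_mult)
    finally show "(\<Sum>r=j * n..<j * n + n. b r * x ^ r) <= C * (real n powr D * (real (j + 1) powr D * exp (- real j)))"
      by (simp only: mult_ac)
  qed
  also have "... = C * (real n powr D * (\<Sum>j<J. real (j + 1) powr D * exp (- real j)))"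
    by (simp only: sum_distrib_left)
  also have "... <= C * (real n powr D * (\<Sum>j. real (j + 1) powr D * exp (- real j)))"
    using C(1) by (intro mult_left_mono sum_le_suminf summable_powr_exp) auto
  finally show ?thesis by (simp only: mult_ac)
qed

text \<open>The points \<open>x = 1 - 1/n\<close> satisfy \<open>x \<le> exp (-1/n)\<close>, so
  consecutive blocks of length \<open>n\<close> lose a factor of \<open>e\<close> each and the
  partial sum bound becomes a bound on radial growth.\<close>

lemma radial_bound:
  fixes b :: "nat => real"
  assumes b: "!!r. 0 <= b r" and C: "0 <= C" "!!r. r \<ge> 1 ==> (\<Sum>s\<le>r. b s) <= C * real r powr D"
  shows "\<exists>C'. \<forall>n\<ge>1. summable (%r. b r * (1 - 1 / real n) ^ r) & (\<Sum>r. b r * (1 - 1 / real n) ^ r) <= C' * real n powr D"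
proof -
  define S where "S = C * (\<Sum>j. real (j + 1) powr D * exp (- real j))"
  have "summable (%r. b r * (1 - 1 / real n) ^ r) & (\<Sum>r. b r * (1 - 1 / real n) ^ r) <= S * real n powr D"
    if n: "n \<ge> 1" for n
  proof -
    define x where "x = 1 - 1 / real n"
    have x: "0 <= x" "x <= 1" "x <= exp (- (1 / real n))"
      using n exp_ge_add_one_self[of "- (1 / real n)"] by (simp_all add: x_def)
    have nn: "0 <= b r * x ^ r" for r using b x by simp
    have part: "(\<Sum>r<J. b r * x ^ r) <= S * real n powr D" for J
    proof -
      have "J <= J * n" using n by simp
      then have "(\<Sum>r<J. b r * x ^ r) <= (\<Sum>r<J * n. b r * x ^ r)" using nn by (intro sum_mono2) auto
      also have "... <= S * real n powr D" unfolding S_def by (rule block_bound[OF b C n x])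
      finally show ?thesis .
    qed
    have s: "summable (%r. b r * x ^ r)"
      by (rule summableI_nonneg_bounded[OF nn part])
    show ?thesis unfolding x_def[symmetric] using s suminf_le_const[OF s part] by blast
  qed
  then show ?thesis by blast
qed

text \<open>The formal identity becomes numerical through the Cauchy product, as the series
  converges absolutely at \<open>z\<close>.\<close>

lemma rational_eval:
  fixes b :: "nat => real"
  assumes "!!r. 0 <= b r" and "fps_of_poly q * Abs_fps (%r. complex_of_real (b r)) = fps_of_poly p"
    and s: "summable (%r. b r * cmod z ^ r)"
  shows "poly p z = poly q z * (\<Sum>r. complex_of_real (b r) * z ^ r)"
    and "cmod (\<Sum>r. complex_of_real (b r) * z ^ r) <= (\<Sum>r. b r * cmod z ^ r)"
proof -
  let ?a = "%i. coeff q i * z ^ i" and ?c = "%r. complex_of_real (b r) * z ^ r"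
  have nc: "norm (?c r) = b r * cmod z ^ r" for r by (simp add: norm_mult norm_power assms(1))
  have sa: "summable (%i. norm (?a i))"
    by (rule summable_finite[of "{..degree q}"]) (auto simp: coeff_eq_0)
  have sc: "summable (%r. norm (?c r))" unfolding nc by (rule s)
  have "(%k. \<Sum>i\<le>k. ?a i * ?c (k - i)) sums ((\<Sum>k. ?a k) * (\<Sum>k. ?c k))"
    by (rule Cauchy_product_sums[OF sa sc])
  moreover have "(\<Sum>i\<le>k. ?a i * ?c (k - i)) = coeff p k * z ^ k" for k
  proof -
    have "(\<Sum>i\<le>k. ?a i * ?c (k - i)) = (\<Sum>i=0..k. coeff q i * complex_of_real (b (k - i))) * z ^ k"
      unfolding sum_distrib_right atLeast0AtMost
      by (rule sum.cong) (simp_all add: mult_ac power_add[symmetric])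
    also have "(\<Sum>i=0..k. coeff q i * complex_of_real (b (k - i))) = fps_nth (fps_of_poly p) k"
      unfolding assms(2)[symmetric] fps_mult_nth by simp
    finally show ?thesis by simp
  qed
  ultimately have 1: "(%k. coeff p k * z ^ k) sums ((\<Sum>k. ?a k) * (\<Sum>k. ?c k))" by simp
  have pe: "(%k. coeff r k * z ^ k) sums poly r z" for r
  proof -
    have "(%k. coeff r k * z ^ k) sums (\<Sum>k\<le>degree r. coeff r k * z ^ k)"
      by (rule sums_finite) (auto simp: coeff_eq_0)
    then show ?thesis by (simp add: poly_altdef)
  qed
  have "(\<Sum>k. ?a k) = poly q z" using pe[of q] by (simp add: sums_iff)
  then show "poly p z = poly q z * (\<Sum>r. ?c r)" using sums_unique2[OF pe[of p] 1] by simp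
  show "cmod (\<Sum>r. ?c r) <= (\<Sum>r. b r * cmod z ^ r)"
    using summable_norm[OF sc] unfolding nc .
qed

text \<open>Nonnegativity of the coefficients lets the growth of the partial sums bound the order of
  every pole on the unit circle, by comparison with the radial growth towards \<open>1\<close>.\<close>

theorem rational_growth:
  fixes b :: "nat => real"
  assumes b: "!!r. 0 <= b r" and D: "0 <= D" and C: "0 <= C" "!!r. r \<ge> 1 ==> (\<Sum>s\<le>r. b s) <= C * real r powr D"
    and rat: "poly q 0 ~= 0" "fps_of_poly q * Abs_fps (%r. complex_of_real (b r)) = fps_of_poly p"
  shows "\<exists>C'. \<forall>r\<ge>1. b r <= C' * real r powr (D - 1)"
proof -
  let ?F = "Abs_fps (%r. complex_of_real (b r))"
  \<comment> \<open>A denominator of least degree shares no root with its numerator, so each of its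
    roots is a genuine pole.\<close>
  define good where "good q = (poly q 0 ~= 0 & (\<exists>p. fps_of_poly q * ?F = fps_of_poly p))" for q
  have "good q" using rat by (auto simp: good_def)
  then obtain q where gq: "good q" and min: "!!q'. good q' ==> degree q <= degree q'"
    using ex_has_least_nat[of good q degree] by blast
  then obtain p where q: "poly q 0 ~= 0" "fps_of_poly q * ?F = fps_of_poly p" by (auto simp: good_def)
  have q0: "q ~= 0" using q by auto
  have nocommon: "poly p z ~= 0" if "poly q z = 0" for z
  proof
    assume "poly p z = 0"
    then have "[:- z, 1:] dvd p" "[:- z, 1:] dvd q" using that by (simp_all only: poly_eq_0_iff_dvd)
    obtain p' where pq1: "p = [:- z, 1:] * p'" using \<open>[:- z, 1:] dvd p\<close> by (rule dvdE)
    obtain q' where pq2: "q = [:- z, 1:] * q'" using \<open>[:- z, 1:] dvd q\<close> by (rule dvdE)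
    note pq = pq1 pq2
    have "fps_of_poly [:- z, 1:] * (fps_of_poly q' * ?F) = fps_of_poly [:- z, 1:] * fps_of_poly p'"
      using q(2) unfolding pq by (simp only: fps_of_poly_mult mult.assoc)
    then have "fps_of_poly q' * ?F = fps_of_poly p'" by simp
    moreover have "poly q' 0 ~= 0" using q(1) pq(2) by auto
    ultimately have "good q'" by (auto simp: good_def)
    from min[OF this] have "degree q <= degree q'" .
    moreover have "degree q = Suc (degree q')"
      unfolding pq(2) using q0 pq(2) by (subst degree_mult_eq) auto
    ultimately show False by simp
  qed
  obtain E where E: "!!n. n \<ge> 1 ==> summable (%r. b r * (1 - 1 / real n) ^ r)"
    "!!n. n \<ge> 1 ==> (\<Sum>r. b r * (1 - 1 / real n) ^ r) <= E * real n powr D"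
    using radial_bound[OF b C] by blast
  have roots: "cmod z > 1 \<or> (cmod z = 1 & real (order z q) <= D)" if z: "poly q z = 0" for z
  proof -
    have "\<not> cmod z < 1"
    proof
      assume "cmod z < 1"
      \<comment> \<open>With \<open>cmod z \<le> 1 - 1/n\<close> the series converges at
        \<open>z\<close>, and a root of \<open>q\<close> there would be a root of \<open>p\<close>
        as well.\<close>
      then obtain n :: nat where n: "1 / (1 - cmod z) < real n" using reals_Archimedean2 by blast
      have n1: "n \<ge> 1" using n \<open>cmod z < 1\<close> by (cases n) (auto simp: divide_less_0_iff)
      have "1 < real n * (1 - cmod z)" using n \<open>cmod z < 1\<close> by (simp add: divide_less_eq)
      then have "cmod z <= 1 - 1 / real n" using n1 by (simp add: field_simps)
      then have "summable (%r. b r * cmod z ^ r)"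
        by (intro summable_comparison_test'[OF E(1)[OF n1], of 0])
          (auto simp: b intro!: mult_left_mono power_mono)
      from rational_eval(1)[OF b q(2) this] z nocommon[OF z] show False by simp
    qed
    moreover have "real (order z q) <= D" if z1: "cmod z = 1"
    proof (rule ccontr)
      assume "\<not> real (order z q) <= D"
      then have mD: "D < real (order z q)" by simp
      define m where "m = order z q"
      obtain q2 where q2: "q = [:- z, 1:] ^ m * q2" using order_decomp[OF q0] by (metis m_def)
      obtain B where B: "!!w. cmod w <= 1 ==> cmod (poly q2 w) <= B"
        using poly_bound_exists[of 1 q2] by blast
      have B0: "0 <= B" by (rule order_trans[OF norm_ge_zero B[of 0]]) simp
      \<comment> \<open>Along the radius towards \<open>z\<close> the denominator vanishes to order
        \<open>m\<close> while the series grows at most like \<open>n powr D\<close>. For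
        \<open>m > D\<close> the numerator tends to 0, which contradicts that \<open>z\<close> is a
        pole.\<close>
      have bound: "cmod (poly p (of_real (1 - 1 / real n) * z)) <= B * E * real n powr (D - real m)" if n: "n \<ge> 1" for n
      proof -
        let ?x = "1 - 1 / real n" and ?w = "of_real (1 - 1 / real n) * z"
        have x: "0 <= ?x" "?x <= 1" using n by auto
        have nw: "cmod ?w = ?x" using z1 x by (simp add: norm_mult del: of_real_diff of_real_divide)
        have s: "summable (%r. b r * cmod ?w ^ r)" unfolding nw by (rule E(1)[OF n])
        have "?w - z = - (of_real (1 / real n) * z)" by (simp add: algebra_simps)
        then have d: "cmod (?w - z) = 1 / real n" using z1 by (simp add: norm_mult norm_divide)
        have "cmod (poly q ?w) = (1 / real n) ^ m * cmod (poly q2 ?w)"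
          unfolding q2 using d by (simp add: norm_mult norm_power)
        also have "... <= (1 / real n) ^ m * B" using x nw by (intro mult_left_mono B) auto
        finally have 1: "cmod (poly q ?w) <= (1 / real n) ^ m * B" .
        have 2: "cmod (\<Sum>r. complex_of_real (b r) * ?w ^ r) <= E * real n powr D"
          using rational_eval(2)[OF b q(2) s] E(2)[OF n] unfolding nw by linarith
        have "cmod (poly p ?w) <= ((1 / real n) ^ m * B) * (E * real n powr D)"
          unfolding rational_eval(1)[OF b q(2) s] norm_mult
          by (rule mult_mono[OF 1 2]) (use B0 in auto)
        also have "... = B * E * (real n powr D * (1 / real n) ^ m)" by (simp add: mult_ac)
        also have "(1 / real n) ^ m = real n powr (- real m)"
          using n by (simp add: powr_minus powr_realpow power_divide divide_inverse power_inverse)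
        also have "real n powr D * real n powr (- real m) = real n powr (D - real m)"
          by (simp add: powr_add[symmetric])
        finally show ?thesis .
      qed
      have lim1: "(%n. B * E * real n powr (D - real m)) \<longlonglongrightarrow> 0"
      proof -
        have "(%n. real n powr (D - real m)) \<longlonglongrightarrow> 0"
          using mD by (intro tendsto_neg_powr filterlim_real_sequentially) (simp add: m_def)
        then show ?thesis by (rule tendsto_mult_right_zero)
      qed
      have "(%n. poly p (of_real (1 - 1 / real n) * z)) \<longlonglongrightarrow> poly p (of_real (1 - 0) * z)"
        by (intro tendsto_intros isCont_tendsto_compose[of _ "poly p"] lim_1_over_n) simp_all
      moreover have "(%n. poly p (of_real (1 - 1 / real n) * z)) \<longlonglongrightarrow> 0"
      proof (rule tendsto_0_le[OF lim1])
        show "\<forall>\<^sub>F n in sequentially. cmod (poly p (of_real (1 - 1 / real n) * z)) <= norm (B * E * real n powr (D - real m)) * 1"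
          unfolding eventually_sequentially using bound by (fastforce intro!: exI[of _ 1] intro: order_trans[OF _ abs_ge_self])
      qed
      ultimately have "poly p z = 0" using LIMSEQ_unique by fastforce
      then show False using nocommon[OF z] by simp
    qed
    ultimately show ?thesis by linarith
  qed
  have "pgrowth D ?F" by (rule pgrowth_rational[OF D q(1) roots q(2)])
  then obtain C' where "\<forall>r\<ge>1. cmod (fps_nth ?F r) <= C' * real r powr (D - 1)" by (auto simp: pgrowth_def)
  then show ?thesis using b by auto
qed

section \<open>Complexity of sequences\<close>

definition admissible :: "(nat => nat) => real => bool" where
  "admissible b d \<longleftrightarrow> 0 <= d & (\<exists>c>0. eventually (%r. real (b r) <= c * real r powr (d - 1)) sequentially)"

lemma seq_complexity_admissible: "seq_complexity b = Inf (ereal ` {d. admissible b d})"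
  unfolding seq_complexity_def admissible_def by (rule arg_cong[of _ _ Inf]) blast

lemma admissible_mono:
  assumes "admissible b d" "!!r. a r <= k * b r"
  shows "admissible a d"
proof -
  obtain c where c: "c > 0" "\<forall>\<^sub>F r in sequentially. real (b r) <= c * real r powr (d - 1)"
    using assms(1) by (auto simp: admissible_def)
  have "\<forall>\<^sub>F r in sequentially. real (a r) <= (real k * c + 1) * real r powr (d - 1)"
    using c(2)
  proof eventually_elim
    case (elim r)
    have "real (a r) <= real k * real (b r)" using assms(2)[of r] by (metis of_nat_le_iff of_nat_mult)
    also have "... <= real k * (c * real r powr (d - 1))" using elim by (rule mult_left_mono) simp
    also have "... <= (real k * c + 1) * real r powr (d - 1)" by (simp add: algebra_simps)
    finally show ?case .
  qed
  moreover have "real k * c + 1 > 0" using c(1) by (simp add: add_nonneg_pos)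
  ultimately show ?thesis using assms(1) unfolding admissible_def by blast
qed

lemma seq_complexity_mono:
  assumes "!!r. a r <= k * b r" shows "seq_complexity a <= seq_complexity b"
  unfolding seq_complexity_admissible
  by (rule Inf_superset_mono) (use admissible_mono[OF _ assms] in auto)

text \<open>For \<open>d < 1\<close> the bound tends to 0 and forces the integer values to vanish
  eventually, so the sums are bounded. For \<open>d \<ge> 1\<close> the bound is monotone, and
  \<open>r + 1\<close> terms contribute one more power.\<close>

lemma admissible_sums:
  assumes "admissible b d" shows "admissible (%r. \<Sum>s\<le>r. b s) (d + 1)"
proof -
  obtain c where c: "c > 0" "\<forall>\<^sub>F r in sequentially. real (b r) <= c * real r powr (d - 1)"
    using assms by (auto simp: admissible_def)
  have d: "0 <= d" using assms by (simp add: admissible_def)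
  have "\<exists>E. \<exists>N\<ge>1. \<forall>r\<ge>N. real (\<Sum>s\<le>r. b s) <= E * real r powr d"
  proof (cases "d < 1")
    case True
    have "(%r. c * real r powr (d - 1)) \<longlonglongrightarrow> 0"
      using tendsto_neg_powr[of "d - 1" real sequentially] True
      by (intro tendsto_mult_right_zero) (auto simp: filterlim_real_sequentially)
    then have "\<forall>\<^sub>F r in sequentially. c * real r powr (d - 1) < 1" by (rule order_tendstoD(2)) simp
    then have "\<forall>\<^sub>F r in sequentially. b r = 0" using c(2) by eventually_elim simp
    then obtain N where N: "!!r. r \<ge> N ==> b r = 0" by (auto simp: eventually_sequentially)
    define T where "T = real (\<Sum>s\<le>N. b s)"
    have T: "0 <= T" unfolding T_def by (rule of_nat_0_le_iff)
    have "real (\<Sum>s\<le>r. b s) <= T * real r powr d" if r: "r \<ge> Suc N" for r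
    proof -
      have "(\<Sum>s\<le>r. b s) = (\<Sum>s\<le>N. b s)" using r N by (intro sum.mono_neutral_right) auto
      moreover have "1 <= real r powr d" using r d by (intro ge_one_powr_ge_zero) auto
      ultimately show ?thesis
        using mult_left_mono[OF _ T, of 1 "real r powr d"] by (simp only: T_def mult_1_right)
    qed
    then show ?thesis by (metis Suc_le_mono One_nat_def le0)
  next
    case False
    obtain N where N: "!!r. r \<ge> N ==> real (b r) <= c * real r powr (d - 1)"
      using c(2) by (auto simp: eventually_sequentially)
    define T where "T = real (\<Sum>s\<le>N. b s)"
    have T: "0 <= T" unfolding T_def by (rule of_nat_0_le_iff)
    define E where "E = T + c"
    have E: "0 <= E" using T c(1) by (simp add: E_def)
    have "real (\<Sum>s\<le>r. b s) <= (E + E) * real r powr d" if r: "r \<ge> Suc N" for r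
    proof -
      have mono: "1 <= real r powr (d - 1)" using r False by (intro ge_one_powr_ge_zero) auto
      have "real (b s) <= E * real r powr (d - 1)" if s: "s <= r" for s
      proof (cases "s <= N")
        case True
        then have "b s <= (\<Sum>s\<le>N. b s)" by (intro member_le_sum) auto
        then have "real (b s) <= T" unfolding T_def by (rule of_nat_mono)
        then have "real (b s) <= E * 1" using c(1) by (simp add: E_def)
        also have "... <= E * real r powr (d - 1)" by (rule mult_left_mono[OF mono E])
        finally show ?thesis .
      next
        case False
        then have "real (b s) <= c * real s powr (d - 1)" using N by simp
        also have "... <= c * real r powr (d - 1)"
          using s c(1) \<open>\<not> d < 1\<close> by (intro mult_left_mono powr_mono2) auto
        also have "... <= E * real r powr (d - 1)" using T by (intro mult_right_mono) (auto simp: E_def)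
        finally show ?thesis .
      qed
      then have "real (\<Sum>s\<le>r. b s) <= (\<Sum>s\<le>r. E * real r powr (d - 1))"
        unfolding of_nat_sum by (intro sum_mono) auto
      also have "... = real (r + 1) * (E * real r powr (d - 1))" by simp
      also have "... <= (2 * real r) * (E * real r powr (d - 1))"
        using r E by (intro mult_right_mono) auto
      also have "... = (E + E) * (real r * real r powr (d - 1))" by (simp add: algebra_simps)
      also have "real r * real r powr (d - 1) = real r powr d"
        using r powr_add[of "real r" 1 "d - 1"] by simp
      finally show ?thesis .
    qed
    then show ?thesis by (metis Suc_le_mono One_nat_def le0)
  qed
  then obtain E N where EN: "N \<ge> 1" "!!r. r \<ge> N ==> real (\<Sum>s\<le>r. b s) <= E * real r powr d" by blast
  have "real (\<Sum>s\<le>r. b s) <= (max E 1) * real r powr (d + 1 - 1)" if "r \<ge> N" for r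
    using EN(2)[OF that] mult_right_mono[of E "max E 1" "real r powr d"] by simp
  then show ?thesis
    using d unfolding admissible_def eventually_sequentially
    by (intro conjI exI[of _ "max E 1"]) auto
qed

text \<open>The first term keeps the sums at least 1, which excludes \<open>d < 1\<close>; then
  \<open>rational_growth\<close> recovers the growth of the terms from that of the sums.\<close>

lemma admissible_of_sums:
  assumes adm: "admissible (%r. \<Sum>s\<le>r. b s) d" and b0: "b 0 > 0"
    and rat: "poly q 0 ~= 0" "fps_of_poly q * Abs_fps (%r. complex_of_real (real (b r))) = fps_of_poly p"
  shows "1 <= d & admissible b (d - 1)"
proof -
  obtain c where c: "c > 0" "\<forall>\<^sub>F r in sequentially. real (\<Sum>s\<le>r. b s) <= c * real r powr (d - 1)"
    using adm by (auto simp: admissible_def)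
  have ge1: "1 <= (\<Sum>s\<le>r. b s)" for r
    using member_le_sum[of 0 "{..r}" b] b0 by simp
  have d1: "1 <= d"
  proof (rule ccontr)
    assume "\<not> 1 <= d"
    then have "(%r. c * real r powr (d - 1)) \<longlonglongrightarrow> 0"
      using tendsto_neg_powr[of "d - 1" real sequentially]
      by (intro tendsto_mult_right_zero) (auto simp: filterlim_real_sequentially)
    then have "\<forall>\<^sub>F r in sequentially. c * real r powr (d - 1) < 1" by (rule order_tendstoD(2)) simp
    then have "\<forall>\<^sub>F r in sequentially. False" using c(2)
    proof eventually_elim
      case (elim r)
      have "1 <= real (\<Sum>s\<le>r. b s)" using ge1[of r] by linarith
      then show ?case using elim by linarith
    qed
    then show False by simp
  qed
  obtain N where N: "!!r. r \<ge> N ==> real (\<Sum>s\<le>r. b s) <= c * real r powr (d - 1)"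
    using c(2) by (auto simp: eventually_sequentially)
  define T where "T = real (\<Sum>s\<le>N. b s)"
  have T: "0 <= T" unfolding T_def by (rule of_nat_0_le_iff)
  define C where "C = c + T"
  have C0: "0 <= C" using T c(1) by (simp add: C_def)
  have C: "(\<Sum>s\<le>r. real (b s)) <= C * real r powr (d - 1)" if r: "r \<ge> 1" for r
  proof (cases "r \<ge> N")
    case True
    have "c * real r powr (d - 1) <= C * real r powr (d - 1)" using T by (intro mult_right_mono) (auto simp: C_def)
    then show ?thesis using N[OF True] by simp
  next
    case False
    have "(\<Sum>s\<le>r. real (b s)) <= (\<Sum>s\<le>N. real (b s))" using False by (intro sum_mono2) auto
    also have "... <= C * 1" using c(1) by (simp add: C_def T_def)
    also have "... <= C * real r powr (d - 1)"
      using r d1 C0 by (intro mult_left_mono ge_one_powr_ge_zero) auto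
    finally show ?thesis .
  qed
  have "\<exists>C'. \<forall>r\<ge>1. real (b r) <= C' * real r powr (d - 1 - 1)"
    by (rule rational_growth[OF _ _ _ C rat]) (use d1 C0 in auto)
  then obtain C' where C': "!!r. r \<ge> 1 ==> real (b r) <= C' * real r powr (d - 1 - 1)" by blast
  have "real (b r) <= max C' 1 * real r powr (d - 1 - 1)" if "r \<ge> 1" for r
    using C'[OF that] mult_right_mono[of C' "max C' 1" "real r powr (d - 1 - 1)"] by simp
  then show ?thesis
    using d1 unfolding admissible_def eventually_sequentially
    by (intro conjI exI[of _ "max C' 1"]) auto
qed

text \<open>The set of admissible exponents shifts by exactly one; if it is empty, both sides are
  infinite.\<close>

theorem seq_complexity_sums:
  assumes b0: "b 0 > 0"
    and rat: "poly q 0 ~= 0" "fps_of_poly q * Abs_fps (%r. complex_of_real (real (b r))) = fps_of_poly p"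
  shows "seq_complexity (%r. \<Sum>s\<le>r. b s) = seq_complexity b + 1"
proof -
  have "{d. admissible (%r. \<Sum>s\<le>r. b s) d} = (%d. d + 1) ` {d. admissible b d}"
  proof (intro equalityI subsetI)
    fix d assume "d : {d. admissible (%r. \<Sum>s\<le>r. b s) d}"
    then have "admissible b (d - 1)" using admissible_of_sums[OF _ b0 rat] by blast
    then show "d : (%d. d + 1) ` {d. admissible b d}" by (intro image_eqI[of _ _ "d - 1"]) auto
  qed (use admissible_sums in auto)
  then have "seq_complexity (%r. \<Sum>s\<le>r. b s) = Inf ((%x. x + 1) ` ereal ` {d. admissible b d})"
    unfolding seq_complexity_admissible by (simp add: image_image)
  also have "... = Inf (ereal ` {d. admissible b d}) + 1"
  proof (cases "{d. admissible b d} = {}")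
    case True
    then show ?thesis by (simp add: top_ereal_def)
  next
    case False
    have "0 <= x" if "x : ereal ` {d. admissible b d}" for x using that by (auto simp: admissible_def)
    then show ?thesis
      using INF_ereal_add_left[of "ereal ` {d. admissible b d}" 1 "%x. x"] False by simp
  qed
  finally show ?thesis by (simp add: seq_complexity_admissible)
qed

text \<open>The recurrences say that the polynomial matrix with entries
  \<open>\<Sum>s\<le>l. (-1)^s a s j i z^s\<close> sends the vector of generating series of
  \<open>\<beta>\<close> to a constant vector. Its determinant takes the value 1 at 0 and is a
  common denominator; the adjugate matrix gives the numerators. Hence one \<open>q\<close> serves
  all weights \<open>w\<close>.\<close>

lemma rational_of_recurrence:
  fixes \<beta> :: "nat => nat => nat" and a :: "nat => nat => nat => nat"
  assumes a0: "!!i j. i < n ==> j < n ==> a 0 j i = (if i = j then 1 else 0)"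
    and rec: "!!t j. 1 <= t ==> j < n ==> (\<Sum>r\<le>t. (-1) ^ r * (\<Sum>i<n. int (\<beta> r i) * int (a (t - r) j i))) = 0"
    and fin: "!!s i j. s > l ==> a s j i = 0"
  shows "\<exists>q. poly q 0 ~= 0 & (\<forall>w :: nat => nat. \<exists>p.
    fps_of_poly q * Abs_fps (%r. complex_of_real (real (\<Sum>i<n. w i * \<beta> r i))) = fps_of_poly p)"
proof -
  define cp where "cp j i = (\<Sum>s\<le>l. monom ((-1) ^ s * complex_of_nat (a s j i)) s)" for j i
  have cp_coeff: "coeff (cp j i) s = (-1) ^ s * complex_of_nat (a s j i)" for j i s
    using fin[of s j i] by (cases "s <= l") (auto simp: cp_def coeff_sum coeff_monom if_distrib cong: if_cong)
  define M where "M = mat n n (%(j, i). cp j i)"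
  have M: "M : carrier_mat n n" by (simp add: M_def)
  define q where "q = det M"
  define F where "F i = Abs_fps (%r. complex_of_nat (\<beta> r i))" for i
  have q0: "poly q 0 = 1"
  proof -
    interpret ev: comm_ring_hom "%p :: complex poly. poly p 0" by unfold_locales simp_all
    have "map_mat (%p. poly p 0) M = 1\<^sub>m n"
    proof (rule eq_matI)
      fix i j assume "i < dim_row (1\<^sub>m n :: complex mat)" "j < dim_col (1\<^sub>m n :: complex mat)"
      then show "map_mat (%p. poly p 0) M $$ (i, j) = 1\<^sub>m n $$ (i, j)"
        using a0[of j i] cp_coeff[of i j 0] by (simp add: M_def poly_0_coeff_0)
    qed (simp_all add: M_def)
    then show ?thesis unfolding q_def using ev.hom_det[of M] by simp
  qed
  have eqn: "(\<Sum>i<n. fps_of_poly (cp j i) * F i) = fps_const (complex_of_nat (\<beta> 0 j))" if j: "j < n" for j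
  proof (rule fps_ext)
    fix t
    have "fps_nth (\<Sum>i<n. fps_of_poly (cp j i) * F i) t =
        (\<Sum>i<n. \<Sum>s=0..t. ((-1) ^ s * complex_of_nat (a s j i)) * complex_of_nat (\<beta> (t - s) i))"
      by (simp add: fps_sum_nth fps_mult_nth F_def cp_coeff)
    also have "... = (\<Sum>s=0..t. \<Sum>i<n. ((-1) ^ s * complex_of_nat (a s j i)) * complex_of_nat (\<beta> (t - s) i))"
      by (rule sum.swap)
    also have "... = (\<Sum>r=0..t. \<Sum>i<n. ((-1) ^ (t - r) * complex_of_nat (a (t - r) j i)) * complex_of_nat (\<beta> r i))"
      by (rule sum.reindex_bij_witness[of _ "%r. t - r" "%r. t - r"]) auto
    also have "... = (\<Sum>r\<le>t. (-1) ^ t * ((-1) ^ r * (\<Sum>i<n. complex_of_nat (\<beta> r i) * complex_of_nat (a (t - r) j i))))"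
    proof (rule sum.cong)
      fix r assume "r : {..t}"
      then have "(-1 :: complex) ^ (t - r) = (-1) ^ t * (-1) ^ r"
        by (simp add: uminus_power_if even_diff_nat)
      then show "(\<Sum>i<n. ((-1) ^ (t - r) * complex_of_nat (a (t - r) j i)) * complex_of_nat (\<beta> r i)) =
          (-1) ^ t * ((-1) ^ r * (\<Sum>i<n. complex_of_nat (\<beta> r i) * complex_of_nat (a (t - r) j i)))"
        by (simp add: sum_distrib_left mult_ac)
    qed auto
    also have "... = (-1) ^ t * of_int (\<Sum>r\<le>t. (-1) ^ r * (\<Sum>i<n. int (\<beta> r i) * int (a (t - r) j i)))"
      by (simp add: sum_distrib_left)
    also have "... = fps_nth (fps_const (complex_of_nat (\<beta> 0 j))) t"
    proof (cases "t = 0")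
      case True
      have "(\<Sum>i<n. int (\<beta> 0 i) * int (a 0 j i)) = (\<Sum>i<n. if i = j then int (\<beta> 0 i) else 0)"
        by (rule sum.cong) (use a0 j in auto)
      then show ?thesis using True j by (simp add: sum.delta)
    next
      case False
      then show ?thesis using rec[of t j] j by simp
    qed
    finally show "fps_nth (\<Sum>i<n. fps_of_poly (cp j i) * F i) t = fps_nth (fps_const (complex_of_nat (\<beta> 0 j))) t" .
  qed
  define N where "N = adj_mat M"
  have N: "N : carrier_mat n n" "N * M = q \<cdot>\<^sub>m 1\<^sub>m n"
    using adj_mat[OF M] by (simp_all add: N_def q_def)
  have sol: "fps_of_poly q * F k = fps_of_poly (\<Sum>j<n. N $$ (k, j) * [:complex_of_nat (\<beta> 0 j):])" if k: "k < n" for k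
  proof -
    have "(\<Sum>j<n. N $$ (k, j) * cp j i) = (if i = k then q else 0)" if i: "i < n" for i
    proof -
      have "(N * M) $$ (k, i) = (\<Sum>j<n. N $$ (k, j) * cp j i)"
        using N(1) M k i by (simp add: scalar_prod_def M_def atLeast0LessThan)
      then show ?thesis using N(2) k i by auto
    qed
    then have *: "(\<Sum>j<n. fps_of_poly (N $$ (k, j)) * fps_of_poly (cp j i)) = (if i = k then fps_of_poly q else 0)"
      if "i < n" for i
      using that by (simp add: fps_of_poly_sum[symmetric] fps_of_poly_mult[symmetric])
    have "fps_of_poly q * F k = (\<Sum>i<n. (if i = k then fps_of_poly q else 0) * F i)"
      using k by (simp add: if_distrib[of "%x. x * _"] sum.delta cong: if_cong)
    also have "... = (\<Sum>i<n. \<Sum>j<n. fps_of_poly (N $$ (k, j)) * fps_of_poly (cp j i) * F i)"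
      by (rule sum.cong) (simp_all add: *[symmetric] sum_distrib_right)
    also have "... = (\<Sum>j<n. \<Sum>i<n. fps_of_poly (N $$ (k, j)) * (fps_of_poly (cp j i) * F i))"
      by (subst sum.swap) (simp add: mult.assoc)
    also have "... = (\<Sum>j<n. fps_of_poly (N $$ (k, j)) * fps_const (complex_of_nat (\<beta> 0 j)))"
      by (rule sum.cong) (simp_all add: sum_distrib_left[symmetric] eqn)
    also have "... = fps_of_poly (\<Sum>j<n. N $$ (k, j) * [:complex_of_nat (\<beta> 0 j):])"
      by (simp only: fps_of_poly_sum fps_of_poly_mult fps_of_poly_const)
    finally show ?thesis .
  qed
  have "\<exists>p. fps_of_poly q * Abs_fps (%r. complex_of_real (real (\<Sum>i<n. w i * \<beta> r i))) = fps_of_poly p" for w :: "nat => nat"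
  proof -
    have "Abs_fps (%r. complex_of_real (real (\<Sum>i<n. w i * \<beta> r i))) = (\<Sum>i<n. fps_const (complex_of_nat (w i)) * F i)"
      by (rule fps_ext) (simp add: fps_sum_nth F_def)
    then have "fps_of_poly q * Abs_fps (%r. complex_of_real (real (\<Sum>i<n. w i * \<beta> r i))) =
        (\<Sum>i<n. fps_const (complex_of_nat (w i)) * (fps_of_poly q * F i))"
      by (simp add: sum_distrib_left mult_ac)
    also have "... = (\<Sum>i<n. fps_of_poly ([:complex_of_nat (w i):] * (\<Sum>j<n. N $$ (i, j) * [:complex_of_nat (\<beta> 0 j):])))"
      by (rule sum.cong) (simp_all only: sol lessThan_iff fps_of_poly_mult fps_of_poly_const)
    also have "... = fps_of_poly (\<Sum>i<n. [:complex_of_nat (w i):] * (\<Sum>j<n. N $$ (i, j) * [:complex_of_nat (\<beta> 0 j):]))"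
      by (simp only: fps_of_poly_sum)
    finally show ?thesis by blast
  qed
  then show ?thesis using q0 by (intro exI[of _ q]) simp
qed

section \<open>Graded algebras and modules\<close>

lemma (in abelian_monoid) finsum_in:
  assumes "N \<subseteq> carrier G" "\<zero> : N" "!!x y. x : N ==> y : N ==> x \<oplus> y : N" "f : I \<rightarrow> N"
  shows "finsum G f I : N"
  using assms(4)
proof (induction I rule: infinite_finite_induct)
  case (insert x F)
  then have "f : F \<rightarrow> carrier G" "f x : carrier G" using assms(1) by auto
  then show ?case using insert assms(3) by (simp add: finsum_insert Pi_iff)
qed (use assms(2) in auto)

lemma (in abelian_group) add_diff_left: "g : carrier G ==> j : carrier G ==> (g \<oplus> j) \<ominus> g = j"
proof -
  assume c: "g : carrier G" "j : carrier G"
  then have "(g \<oplus> j) \<ominus> g = \<ominus> g \<oplus> (g \<oplus> j)" unfolding a_minus_def by (intro a_comm) simp_all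
  then show ?thesis using c by (simp add: r_neg1)
qed

lemma (in abelian_group) diff_add_left: "a : carrier G ==> g : carrier G ==> g \<oplus> (a \<ominus> g) = a"
proof -
  assume c: "a : carrier G" "g : carrier G"
  then have "a \<ominus> g = \<ominus> g \<oplus> a" unfolding a_minus_def by (intro a_comm) simp_all
  then show ?thesis using c by (simp add: r_neg2)
qed

lemma (in abelian_group) diff_cross:
  assumes "g : carrier G" "j : carrier G" "g' : carrier G" "j' : carrier G" "g \<oplus> j = g' \<oplus> j'"
  shows "g \<ominus> g' = j' \<ominus> j"
proof -
  have "(g \<ominus> g') \<oplus> j = (g \<oplus> j) \<ominus> g'"
    unfolding a_minus_def using assms(1-4) by (simp add: a_ac)
  also have "... = j'" unfolding assms(5) by (rule add_diff_left[OF assms(3,4)])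
  finally have "j \<oplus> (g \<ominus> g') = j'" using assms(1-4) by (simp add: a_comm)
  then have "j' \<ominus> j = (j \<oplus> (g \<ominus> g')) \<ominus> j" by simp
  also have "... = g \<ominus> g'" using assms(1-4) by (intro add_diff_left) simp_all
  finally show ?thesis by simp
qed

text \<open>A form of the homogeneous decomposition with a fixed range of summation.\<close>

lemma (in abelian_group) homog_decomposition_iff:
  assumes "!!t. Q t \<subseteq> carrier G" "!!t. \<zero> : Q t"
  shows "homog_decomposition G Q x c \<longleftrightarrow>
    (\<forall>t. c t : Q t) & (\<exists>N. (\<forall>t\<ge>N. c t = \<zero>) & x = (\<Oplus>t\<in>{..<N}. c t))"
proof
  assume h: "homog_decomposition G Q x c"
  then have c: "!!t. c t : Q t" and f: "finite {t. c t ~= \<zero>}" and x: "x = (\<Oplus>t\<in>{t. c t ~= \<zero>}. c t)"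
    by (auto simp: homog_decomposition_def)
  obtain N where N: "{t. c t ~= \<zero>} \<subseteq> {..<N}" using f finite_nat_iff_bounded by blast
  have "x = (\<Oplus>t\<in>{..<N}. c t)"
    unfolding x by (rule add.finprod_mono_neutral_cong_left) (use N c assms in auto)
  then show "(\<forall>t. c t : Q t) & (\<exists>N. (\<forall>t\<ge>N. c t = \<zero>) & x = (\<Oplus>t\<in>{..<N}. c t))"
    using c N by (intro conjI allI exI[of _ N]) (auto simp: subset_iff leD)
next
  assume "(\<forall>t. c t : Q t) & (\<exists>N. (\<forall>t\<ge>N. c t = \<zero>) & x = (\<Oplus>t\<in>{..<N}. c t))"
  then obtain N where c: "!!t. c t : Q t" and N: "!!t. t \<ge> N ==> c t = \<zero>" and x: "x = (\<Oplus>t\<in>{..<N}. c t)" by blast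
  have sub: "{t. c t ~= \<zero>} \<subseteq> {..<N}" using N leI by blast
  then have "finite {t. c t ~= \<zero>}" by (rule finite_subset) simp
  moreover have "x = (\<Oplus>t\<in>{t. c t ~= \<zero>}. c t)"
    unfolding x by (rule add.finprod_mono_neutral_cong_right) (use sub c assms in auto)
  ultimately show "homog_decomposition G Q x c" using c by (simp add: homog_decomposition_def)
qed

locale pieces = abelian_group G for G (structure) +
  fixes Q :: "nat => 'a set"
  assumes direct: "direct_sum_of_pieces G Q"
begin

lemma piece_sub: "Q t \<subseteq> carrier G" "\<zero> : Q t" "x : Q t ==> y : Q t ==> x \<oplus> y : Q t" "x : Q t ==> \<ominus> x : Q t"
proof -
  interpret subgroup "Q t" "add_monoid G" using direct by (simp add: direct_sum_of_pieces_def)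
  show "Q t \<subseteq> carrier G" using subset by simp
  show "\<zero> : Q t" using one_closed by simp
  show "x : Q t ==> y : Q t ==> x \<oplus> y : Q t" using m_closed by simp
  show "x : Q t ==> \<ominus> x : Q t" using m_inv_closed by (simp add: a_inv_def)
qed

lemma piece_carrier [simp]: "x : Q t ==> x : carrier G"
  using piece_sub(1) by blast

lemma pieces_exist:
  assumes "x : carrier G"
  obtains c N where "!!t. c t : Q t" "!!t. t \<ge> N ==> c t = \<zero>" "x = (\<Oplus>t\<in>{..<N}. c t)"
proof -
  have "\<exists>!c. homog_decomposition G Q x c" using direct assms by (simp add: direct_sum_of_pieces_def)
  then obtain c where "homog_decomposition G Q x c" by (rule ex1E)
  then show ?thesis using that unfolding homog_decomposition_iff[OF piece_sub(1,2)] by blast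
qed

lemma pieces_unique:
  assumes "!!t. c t : Q t" "!!t. t \<ge> N ==> c t = \<zero>" "!!t. c' t : Q t" "!!t. t \<ge> N' ==> c' t = \<zero>"
    "(\<Oplus>t\<in>{..<N}. c t) = (\<Oplus>t\<in>{..<N'}. c' t)"
  shows "c = c'"
proof -
  let ?x = "\<Oplus>t\<in>{..<N}. c t"
  have "?x : carrier G" by (rule finsum_closed) (use piece_carrier[OF assms(1)] in auto)
  then have "\<exists>!c. homog_decomposition G Q ?x c" using direct by (simp add: direct_sum_of_pieces_def)
  moreover have "homog_decomposition G Q ?x c"
    unfolding homog_decomposition_iff[OF piece_sub(1,2)]
    by (intro conjI allI assms(1) exI[of _ N] impI assms(2) refl)
  moreover have "homog_decomposition G Q ?x c'"
    unfolding homog_decomposition_iff[OF piece_sub(1,2)]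
    by (intro conjI allI assms(3) exI[of _ N'] impI assms(4,5))
  ultimately show ?thesis by (blast elim: ex1E)
qed

lemma single_sum:
  fixes s :: nat
  assumes "x : carrier G" "s < N"
  shows "(\<Oplus>t\<in>{..<N}. if t = s then x else \<zero>) = x"
proof -
  have *: "(%t. if t = s then x else \<zero>) = (%t. if s = t then x else \<zero>)" by auto
  show ?thesis unfolding * by (rule finsum_singleton[of s _ "%_. x"]) (use assms in auto)
qed

lemma pieces_homogeneous:
  assumes "!!t. c t : Q t" "!!t. t \<ge> N ==> c t = \<zero>" "(\<Oplus>t\<in>{..<N}. c t) : Q s"
  shows "c s = (\<Oplus>t\<in>{..<N}. c t)" "t ~= s ==> c t = \<zero>"
proof -
  let ?x = "\<Oplus>t\<in>{..<N}. c t"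
  have "c = (%t. if t = s then ?x else \<zero>)"
    by (rule pieces_unique[where N = N and N' = "Suc s"])
      (use assms piece_sub single_sum[of ?x s "Suc s"] in auto)
  then have *: "c t = (if t = s then ?x else \<zero>)" for t by (rule fun_cong)
  show "c s = ?x" using *[of s] by simp
  show "t ~= s ==> c t = \<zero>" using *[of t] by simp
qed

end

locale galg = fd_alg K A for K :: "'k ring" and A :: "('k, 'a) module" +
  fixes G :: "nat => 'a set" and n :: nat and e :: "nat => 'a" and l :: nat
  assumes graded: "graded_algebra K A G n e" and top: "t > l ==> G t = {\<zero>[A]}"

sublocale galg \<subseteq> G: pieces A G
  using graded by unfold_locales (simp add: graded_algebra_def)

context galg
begin

lemma graded_facts:
  "x : G s ==> y : G t ==> x *[A] y : G (s + t)"
  "Module.submodule (G t) K A"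
  "i : {1..n} ==> e i : carrier A" "i : {1..n} ==> e i *[A] e i = e i" "i : {1..n} ==> e i ~= \<zero>[A]"
  "i : {1..n} ==> j : {1..n} ==> i ~= j ==> e i *[A] e j = \<zero>[A]"
  "(\<Oplus>\<^bsub>A\<^esub>i\<in>{1..n}. e i) = \<one>[A]"
  "bij_betw (%c. \<Oplus>\<^bsub>A\<^esub>i\<in>{1..n}. c i .[A] e i) ({1..n} \<rightarrow>\<^sub>E carrier K) (G 0)" "1 <= n"
  using graded by (auto simp: graded_algebra_def primitive_idempotent_def)

lemma e_pi: "e : {1..n} \<rightarrow> carrier A" using graded_facts(3) by auto

lemma G_scal: "c : carrier K ==> x : G t ==> c .[A] x : G t"
  using graded_facts(2)[of t] by (auto simp: Module.submodule_def submodule_axioms_def)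

lemma G0_expand:
  assumes "x : G 0"
  obtains c where "c : {1..n} \<rightarrow> carrier K" "x = (\<Oplus>\<^bsub>A\<^esub>i\<in>{1..n}. c i .[A] e i)"
proof -
  have "x : (%c. \<Oplus>\<^bsub>A\<^esub>i\<in>{1..n}. c i .[A] e i) ` ({1..n} \<rightarrow>\<^sub>E carrier K)"
    using graded_facts(8) assms by (simp add: bij_betw_def)
  then show ?thesis using that by (auto simp: PiE_def)
qed

lemma sum_orth:
  assumes c: "c : {1..n} \<rightarrow> carrier K" and j: "j : {1..n}"
  shows "e j *[A] (\<Oplus>\<^bsub>A\<^esub>i\<in>{1..n}. c i .[A] e i) = c j .[A] e j"
    "(\<Oplus>\<^bsub>A\<^esub>i\<in>{1..n}. c i .[A] e i) *[A] e j = c j .[A] e j"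
proof -
  have ce: "(%i. c i .[A] e i) : {1..n} \<rightarrow> carrier A" using c e_pi by auto
  have ej: "e j : carrier A" using graded_facts(3) j by blast
  have cj: "c j .[A] e j : carrier A" using ce j by auto
  have 1: "e j *[A] (c i .[A] e i) = (if i = j then c j .[A] e j else \<zero>[A])"
    and 2: "(c i .[A] e i) *[A] e j = (if i = j then c j .[A] e j else \<zero>[A])" if i: "i : {1..n}" for i
  proof -
    have ci: "c i : carrier K" "e i : carrier A" using c i e_pi by auto
    show "e j *[A] (c i .[A] e i) = (if i = j then c j .[A] e j else \<zero>[A])"
      using graded_facts(4)[OF j] graded_facts(6)[OF j i] ci ej by (auto simp: smult_mult AV.rmult_0)
    show "(c i .[A] e i) *[A] e j = (if i = j then c j .[A] e j else \<zero>[A])"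
      using graded_facts(4)[OF j] graded_facts(6)[OF i j] ci ej by (auto simp: smult_mult AV.rmult_0)
  qed
  have s: "(\<Oplus>\<^bsub>A\<^esub>i\<in>{1..n}. if i = j then c j .[A] e j else \<zero>[A]) = c j .[A] e j"
    using AV.M.finsum_singleton[of j "{1..n}" "%_. c j .[A] e j"] j cj by (simp add: eq_commute[of j])
  have "e j *[A] (\<Oplus>\<^bsub>A\<^esub>i\<in>{1..n}. c i .[A] e i) = (\<Oplus>\<^bsub>A\<^esub>i\<in>{1..n}. e j *[A] (c i .[A] e i))"
    by (rule A.finsum_rdistr) (use ej ce in auto)
  also have "... = (\<Oplus>\<^bsub>A\<^esub>i\<in>{1..n}. if i = j then c j .[A] e j else \<zero>[A])"
    by (rule AV.M.finsum_cong') (use 1 cj in auto)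
  finally show "e j *[A] (\<Oplus>\<^bsub>A\<^esub>i\<in>{1..n}. c i .[A] e i) = c j .[A] e j" using s by simp
  have "(\<Oplus>\<^bsub>A\<^esub>i\<in>{1..n}. c i .[A] e i) *[A] e j = (\<Oplus>\<^bsub>A\<^esub>i\<in>{1..n}. (c i .[A] e i) *[A] e j)"
    by (rule A.finsum_ldistr) (use ej ce in auto)
  also have "... = (\<Oplus>\<^bsub>A\<^esub>i\<in>{1..n}. if i = j then c j .[A] e j else \<zero>[A])"
    by (rule AV.M.finsum_cong') (use 2 cj in auto)
  finally show "(\<Oplus>\<^bsub>A\<^esub>i\<in>{1..n}. c i .[A] e i) *[A] e j = c j .[A] e j" using s by simp
qed

text \<open>\<open>G 0\<close> is a product of copies of the field, so each of its elements acts on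
  \<open>e j\<close> by the same scalar from either side.\<close>

lemma G0_e:
  assumes "x : G 0" "j : {1..n}"
  obtains c where "c : carrier K" "e j *[A] x = c .[A] e j" "x *[A] e j = c .[A] e j"
proof -
  obtain c where c: "c : {1..n} \<rightarrow> carrier K" "x = (\<Oplus>\<^bsub>A\<^esub>i\<in>{1..n}. c i .[A] e i)"
    by (rule G0_expand[OF assms(1)])
  have "c j : carrier K" using c(1) assms(2) by (rule Pi_mem)
  then show ?thesis using that[of "c j"] sum_orth[OF c(1) assms(2)] unfolding c(2) by blast
qed

lemma G0_combination:
  assumes "c : {1..n} \<rightarrow>\<^sub>E carrier K"
  shows "(\<Oplus>\<^bsub>A\<^esub>i\<in>{1..n}. c i .[A] e i) : G 0"
  using bij_betwE[OF graded_facts(8)] assms by blast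

lemma one_G0: "\<one>[A] : G 0"
proof -
  have "(\<Oplus>\<^bsub>A\<^esub>i\<in>{1..n}. (\<lambda>i\<in>{1..n}. \<one>[K]) i .[A] e i) = (\<Oplus>\<^bsub>A\<^esub>i\<in>{1..n}. e i)"
    by (rule AV.M.finsum_cong') (use graded_facts(3) in auto)
  then have "(\<Oplus>\<^bsub>A\<^esub>i\<in>{1..n}. (\<lambda>i\<in>{1..n}. \<one>[K]) i .[A] e i) = \<one>[A]" by (simp only: graded_facts(7))
  moreover have "(\<lambda>i\<in>{1..n}. \<one>[K]) : {1..n} \<rightarrow>\<^sub>E carrier K" by simp
  ultimately show ?thesis using G0_combination by metis
qed

lemma e_G0:
  assumes j: "j : {1..n}" shows "e j : G 0"
proof -
  let ?c = "\<lambda>i\<in>{1..n}. if i = j then \<one>[K] else \<zero>[K]"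
  have cc: "?c : {1..n} \<rightarrow>\<^sub>E carrier K" by simp
  have ej: "e j : carrier A" by (rule graded_facts(3)[OF j])
  have "(\<Oplus>\<^bsub>A\<^esub>i\<in>{1..n}. ?c i .[A] e i) = (\<Oplus>\<^bsub>A\<^esub>i\<in>{1..n}. if j = i then e j else \<zero>[A])"
    by (rule AV.M.finsum_cong') (use graded_facts(3) ej in auto)
  also have "... = e j" by (rule AV.M.finsum_singleton[OF j]) (use ej in auto)
  finally show "e j : G 0" using G0_combination[OF cc] by simp
qed

text \<open>\<open>J k\<close> is the sum of the \<open>G t\<close> with \<open>t \<ge> k\<close>.\<close>

definition J :: "nat => 'a set" where
  "J k = {a. \<exists>c. (\<forall>t. c t : G t) & (\<forall>t<k. c t = \<zero>[A]) & a = (\<Oplus>\<^bsub>A\<^esub>t\<in>{..<Suc l}. c t)}"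

lemma J_I:
  "(!!t. c t : G t) ==> (!!t. t < k ==> c t = \<zero>[A]) ==> a = (\<Oplus>\<^bsub>A\<^esub>t\<in>{..<Suc l}. c t) ==> a : J k"
  unfolding J_def mem_Collect_eq by (rule exI[of _ c]) simp

lemma J_E:
  assumes "a : J k"
  obtains c where "!!t. c t : G t" "!!t. t < k ==> c t = \<zero>[A]" "a = (\<Oplus>\<^bsub>A\<^esub>t\<in>{..<Suc l}. c t)"
proof -
  from assms have "\<exists>c. (\<forall>t. c t : G t) & (\<forall>t<k. c t = \<zero>[A]) & a = (\<Oplus>\<^bsub>A\<^esub>t\<in>{..<Suc l}. c t)"
    by (simp only: J_def mem_Collect_eq)
  then obtain c where "(\<forall>t. c t : G t) & (\<forall>t<k. c t = \<zero>[A]) & a = (\<Oplus>\<^bsub>A\<^esub>t\<in>{..<Suc l}. c t)" by (rule exE)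
  then show ?thesis by (intro that[of c]) simp_all
qed

lemma J_sub: "J k \<subseteq> carrier A" by (auto simp: J_def intro!: AV.M.finsum_closed intro: G.piece_carrier)

lemma J_closed [simp]: "a : J k ==> a : carrier A" using J_sub by blast

lemma J_zero: "\<zero>[A] : J k"
  unfolding J_def by (auto intro!: exI[of _ "%_. \<zero>[A]"] G.piece_sub(2))

lemma J_add:
  assumes "a : J k" "b : J k" shows "a +[A] b : J k"
proof -
  obtain c where c: "!!t. c t : G t" "!!t. t < k ==> c t = \<zero>[A]" "a = (\<Oplus>\<^bsub>A\<^esub>t\<in>{..<Suc l}. c t)"
    using J_E[OF assms(1)] by metis
  obtain c' where c': "!!t. c' t : G t" "!!t. t < k ==> c' t = \<zero>[A]" "b = (\<Oplus>\<^bsub>A\<^esub>t\<in>{..<Suc l}. c' t)"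
    using J_E[OF assms(2)] by metis
  have "c : {..<Suc l} \<rightarrow> carrier A" "c' : {..<Suc l} \<rightarrow> carrier A"
    using G.piece_carrier[OF c(1)] G.piece_carrier[OF c'(1)] by auto
  then have "a +[A] b = (\<Oplus>\<^bsub>A\<^esub>t\<in>{..<Suc l}. c t +[A] c' t)"
    unfolding c(3) c'(3) by (rule AV.M.finsum_addf[symmetric])
  then show ?thesis
    by (intro J_I[of "%t. c t +[A] c' t"]) (simp_all add: c(1,2) c'(1,2) G.piece_sub(3))
qed

lemma J_homogeneous: "x : G t ==> k <= t ==> x : J k"
proof (cases "t <= l")
  case True
  assume x: "x : G t" "k <= t"
  have "x = (\<Oplus>\<^bsub>A\<^esub>s\<in>{..<Suc l}. if s = t then x else \<zero>[A])"
    using G.single_sum[of x t "Suc l"] x True by simp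
  then show ?thesis unfolding J_def using x G.piece_sub(2)
    by (intro CollectI exI[of _ "%s. if s = t then x else \<zero>[A]"]) auto
next
  case False
  assume "x : G t" "k <= t"
  then show ?thesis using top[of t] False J_zero by simp
qed

lemma J_finsum: "f : I \<rightarrow> J k ==> (\<Oplus>\<^bsub>A\<^esub>i\<in>I. f i) : J k"
  by (rule AV.M.finsum_in[OF J_sub J_zero J_add])

lemma J_0: "J 0 = carrier A"
proof
  show "carrier A \<subseteq> J 0"
  proof
    fix a assume "a : carrier A"
    then obtain c N where c: "!!t. c t : G t" "a = (\<Oplus>\<^bsub>A\<^esub>t\<in>{..<N}. c t)" using G.pieces_exist by metis
    then show "a : J 0" using J_homogeneous[OF c(1)] by (auto intro!: J_finsum)
  qed
qed (rule J_sub)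

lemma J_beyond: "J (Suc l) = {\<zero>[A]}"
proof -
  have "a = \<zero>[A]" if a: "a : J (Suc l)" for a
  proof -
    obtain c where c: "!!t. t < Suc l ==> c t = \<zero>[A]" "a = (\<Oplus>\<^bsub>A\<^esub>t\<in>{..<Suc l}. c t)"
      using J_E[OF a] by metis
    have "(\<Oplus>\<^bsub>A\<^esub>t\<in>{..<Suc l}. c t) = (\<Oplus>\<^bsub>A\<^esub>t\<in>{..<Suc l}. \<zero>[A])" by (rule AV.M.finsum_cong') (use c in auto)
    then show ?thesis using c(2) by simp
  qed
  then show ?thesis using J_zero by blast
qed

lemma J_mult:
  assumes "a : J k" "b : J m"
  shows "a *[A] b : J (k + m)"
proof -
  obtain c where c: "!!t. c t : G t" "!!t. t < k ==> c t = \<zero>[A]" "a = (\<Oplus>\<^bsub>A\<^esub>t\<in>{..<Suc l}. c t)"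
    using J_E[OF assms(1)] by metis
  obtain c' where c': "!!t. c' t : G t" "!!t. t < m ==> c' t = \<zero>[A]" "b = (\<Oplus>\<^bsub>A\<^esub>t\<in>{..<Suc l}. c' t)"
    using J_E[OF assms(2)] by metis
  have cc: "c s : carrier A" "c' s : carrier A" for s using G.piece_carrier[OF c(1)] G.piece_carrier[OF c'(1)] by auto
  have st: "c s *[A] c' t : J (k + m)" for s t
  proof (cases "s < k \<or> t < m")
    case True
    then have "c s *[A] c' t = \<zero>[A]" using c(2)[of s] c'(2)[of t] cc by auto
    then show ?thesis using J_zero by simp
  next
    case False
    then show ?thesis using J_homogeneous[OF graded_facts(1)[OF c(1)[of s] c'(1)[of t]], of "k + m"] by auto
  qed
  have "c s *[A] b : J (k + m)" for s
  proof -
    have "c s *[A] b = (\<Oplus>\<^bsub>A\<^esub>t\<in>{..<Suc l}. c s *[A] c' t)"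
      unfolding c'(3) by (rule A.finsum_rdistr) (use cc in auto)
    also have "... : J (k + m)" using st by (intro J_finsum) auto
    finally show ?thesis .
  qed
  moreover have "a *[A] b = (\<Oplus>\<^bsub>A\<^esub>s\<in>{..<Suc l}. c s *[A] b)"
    unfolding c(3) by (rule A.finsum_ldistr) (use cc assms in auto)
  ultimately show ?thesis using J_finsum[of "%s. c s *[A] b" "{..<Suc l}" "k + m"] by auto
qed

definition JM :: "nat => ('a, 'm) module => 'm set" where
  "JM k M = generated_submodule A M {a .[M] x | a x. a : J k & x : carrier M}"

lemma JM_submodule:
  assumes "left_module A M" shows "Module.submodule (JM k M) A M"
proof -
  interpret lmod A M by (simp add: lmod_def assms)
  show ?thesis unfolding JM_def by (rule generated_submodule_submodule) auto
qed

lemma JM_gen: 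
  assumes "left_module A M" "a : J k" "x : carrier M" shows "a .[M] x : JM k M"
proof -
  interpret lmod A M by (simp add: lmod_def assms)
  have "a .[M] x : {a .[M] x | a x. a : J k & x : carrier M}" using assms(2,3) by blast
  then show ?thesis unfolding JM_def by (rule subsetD[OF generated_submodule_incl])
qed

text \<open>The radical is nilpotent: \<open>L\<close> and \<open>JM k M\<close> together give all
  of \<open>M\<close> for every \<open>k\<close>, and \<open>JM (Suc l) M\<close> is zero.\<close>

lemma nakayama:
  assumes lm: "left_module A M" and L: "Module.submodule L A M"
    and sum: "!!x. x : carrier M ==> \<exists>u\<in>L. \<exists>v\<in>JM 1 M. x = u +[M] v"
  shows "L = carrier M"
proof -
  interpret lmod A M by (simp add: lmod_def lm)
  have claim: "\<exists>u\<in>L. \<exists>v\<in>JM k M. x = u +[M] v" if "x : carrier M" "1 <= k" for x k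
    using that(2,1)
  proof (induction k arbitrary: x rule: dec_induct)
    case base
    then show ?case by (rule sum)
  next
    case (step k)
    let ?S = "L <+>\<^bsub>M\<^esub> JM (Suc k) M"
    have S: "Module.submodule ?S A M" by (rule set_add_submodule[OF L JM_submodule[OF lm]])
    have "JM k M \<subseteq> ?S"
      unfolding JM_def[of k]
    proof (rule generated_submodule_least[OF S], rule subsetI)
      fix w assume "w : {a .[M] x | a x. a : J k & x : carrier M}"
      then obtain a x where w: "w = a .[M] x" "a : J k" "x : carrier M" by blast
      \<comment> \<open>\<open>JM 1 M\<close> is only generated by products. That \<open>J k\<close>
        carries it into \<open>JM (Suc k) M\<close> is therefore shown by checking that the elements
        with this property form a submodule.\<close>
      let ?T = "{r : carrier M. \<forall>a\<in>J k. a .[M] r : JM (Suc k) M}"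
      note JD = submoduleD[OF JM_submodule[OF lm, of "Suc k"]]
      have T: "Module.submodule ?T A M"
      proof (rule submoduleI)
        show "\<zero>[M] : ?T" using JD(2) by simp
        fix c r assume c: "c : carrier A" and r: "r : ?T"
        have "a .[M] (c .[M] r) : JM (Suc k) M" if "a : J k" for a
        proof -
          have "a *[A] c : J k" using J_mult[OF that, of c 0] c J_0 by simp
          then show ?thesis using r c that smult_assoc[of a c r] by auto
        qed
        then show "c .[M] r : ?T" using c r by simp
      next
        fix r r' assume "r : ?T" "r' : ?T"
        then show "r +[M] r' : ?T" using JD(3) by (simp add: smult_r_distr)
      qed auto
      have "JM 1 M \<subseteq> ?T"
        unfolding JM_def[of 1]
      proof (rule generated_submodule_least[OF T], rule subsetI)
        fix v assume "v : {a .[M] x | a x. a : J 1 & x : carrier M}"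
        then obtain b z where v: "v = b .[M] z" "b : J 1" "z : carrier M" by blast
        have "a .[M] v : JM (Suc k) M" if "a : J k" for a
          using JM_gen[OF lm _ v(3), of "a *[A] b" "Suc k"] J_mult[OF that v(2)] v that by (simp add: smult_assoc)
        then show "v : ?T" using v by simp
      qed
      moreover obtain u v where uv: "u : L" "v : JM 1 M" "x = u +[M] v" using sum[OF w(3)] by blast
      ultimately have av: "a .[M] v : JM (Suc k) M" "v : carrier M" using w(2) by blast+
      have "w = a .[M] u +[M] a .[M] v"
        using w uv av(2) submoduleD(1)[OF L] by (auto simp: smult_r_distr)
      then show "w : ?S" unfolding set_add_iff using av submoduleD(4)[OF L J_closed[OF w(2)] uv(1)] by blast
    qed
    moreover obtain u v where uv: "u : L" "v : JM k M" "x = u +[M] v" using step by blast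
    ultimately have "v : ?S" by blast
    then obtain u' v' where uv': "u' : L" "v' : JM (Suc k) M" "v = u' +[M] v'"
      unfolding set_add_iff by blast
    have "x = (u +[M] u') +[M] v'"
      using uv uv' submoduleD(1)[OF L] submoduleD(1)[OF JM_submodule[OF lm, of "Suc k"]]
      by (simp add: M.a_assoc subset_iff)
    then show ?case using submoduleD(3)[OF L uv(1) uv'(1)] uv'(2) by blast
  qed
  have JM0: "JM (Suc l) M \<subseteq> {\<zero>[M]}"
    unfolding JM_def by (rule generated_submodule_least[OF zero_submodule]) (auto simp: J_beyond)
  have "x : L" if x: "x : carrier M" for x
  proof -
    obtain u v where uv: "u : L" "v : JM (Suc l) M" "x = u +[M] v"
      using claim[OF x, of "Suc l"] by auto
    have "u : carrier M" "v = \<zero>[M]" using uv(1,2) submoduleD(1)[OF L] JM0 by auto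
    then show ?thesis using uv by simp
  qed
  then show ?thesis using submoduleD(1)[OF L] by blast
qed

lemma split_G0_J:
  assumes "a : carrier A"
  obtains g j where "g : G 0" "j : J 1" "a = g +[A] j" "g = homog_component A G 0 a"
proof -
  have "a : J 0" using assms J_0 by simp
  then obtain c where c: "!!t. c t : G t" "a = (\<Oplus>\<^bsub>A\<^esub>t\<in>{..<Suc l}. c t)" using J_E by metis
  have z: "c t = \<zero>[A]" if "t \<ge> Suc l" for t using c(1)[of t] top[of t] that by auto
  have cp: "c t : carrier A" for t by (rule G.piece_carrier[OF c(1)])
  have a: "a = c 0 +[A] (\<Oplus>\<^bsub>A\<^esub>t\<in>{1..<Suc l}. c t)"
  proof -
    have "{..<Suc l} = insert 0 {1..<Suc l}" by auto
    then show ?thesis unfolding c(2) using cp by (simp add: AV.M.finsum_insert Pi_iff)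
  qed
  have "(\<Oplus>\<^bsub>A\<^esub>t\<in>{1..<Suc l}. c t) : J 1" using J_homogeneous[OF c(1)] by (intro J_finsum) auto
  moreover have "c 0 = homog_component A G 0 a"
  proof -
    have hd: "homog_decomposition A G a c"
      unfolding AV.M.homog_decomposition_iff[OF G.piece_sub(1,2)] using c z by blast
    have ex: "\<exists>!c. homog_decomposition A G a c"
      using G.direct assms by (simp add: direct_sum_of_pieces_def)
    have "(THE c. homog_decomposition A G a c) = c"
    proof (rule the_equality[of "homog_decomposition A G a"])
      show "c' = c" if "homog_decomposition A G a c'" for c' using ex hd that by (blast elim: ex1E)
    qed (rule hd)
    then show ?thesis by (simp add: homog_component_def)
  qed
  ultimately show ?thesis using that c(1)[of 0] a by blast
qed

lemma G0_J_disjoint: "x : G 0 ==> x : J 1 ==> x = \<zero>[A]"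
proof -
  assume x: "x : G 0" "x : J 1"
  obtain c where c: "!!t. c t : G t" "!!t. t < 1 ==> c t = \<zero>[A]" "x = (\<Oplus>\<^bsub>A\<^esub>t\<in>{..<Suc l}. c t)"
    using J_E[OF x(2)] by metis
  have z: "c t = \<zero>[A]" if "t \<ge> Suc l" for t using c(1)[of t] top[of t] that by auto
  have "(\<Oplus>\<^bsub>A\<^esub>t\<in>{..<Suc l}. c t) : G 0" using x(1) c(3) by simp
  from G.pieces_homogeneous(1)[OF c(1) z this] show ?thesis using c(2,3) by simp
qed

lemma J_neg: "a : J k ==> -[A] a : J k"
proof -
  assume a: "a : J k"
  have "-[A] \<one>[A] : J 0" by (simp add: J_0)
  from J_mult[OF this a] show ?thesis using a by (simp add: A.l_minus)
qed

abbreviation "hc0 \<equiv> homog_component A G 0"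

lemma hc0_props:
  assumes "a : carrier A"
  shows "hc0 a : G 0" "hc0 a : carrier A" "a -[A] hc0 a : J 1"
proof -
  obtain g j where gj: "g : G 0" "j : J 1" "a = g +[A] j" "g = hc0 a" by (rule split_G0_J[OF assms])
  show "hc0 a : G 0" unfolding gj(4)[symmetric] by (rule gj(1))
  then show "hc0 a : carrier A" by (rule G.piece_carrier)
  have "g : carrier A" "j : carrier A" using gj(1,2) by auto
  then have "(g +[A] j) -[A] g = j" by (rule AV.M.add_diff_left)
  then have "a -[A] hc0 a = j" unfolding gj(3)[symmetric] gj(4)[symmetric] .
  then show "a -[A] hc0 a : J 1" using gj(2) by (simp only:)
qed

lemma hc0_unique:
  assumes "g : G 0" "j : J 1" shows "hc0 (g +[A] j) = g"
proof -
  have ac: "g +[A] j : carrier A" using assms by simp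
  obtain g' j' where gj: "g' : G 0" "j' : J 1" "g +[A] j = g' +[A] j'" "g' = hc0 (g +[A] j)" by (rule split_G0_J[OF ac])
  have c: "g : carrier A" "j : carrier A" "g' : carrier A" "j' : carrier A"
    using assms gj(1,2) by (simp_all only: G.piece_carrier J_closed)
  have "g -[A] g' = j' -[A] j" by (rule AV.M.diff_cross[OF c gj(3)])
  moreover have "g -[A] g' : G 0" unfolding a_minus_def by (rule G.piece_sub(3)[OF assms(1) G.piece_sub(4)[OF gj(1)]])
  moreover have "j' -[A] j : J 1" unfolding a_minus_def by (rule J_add[OF gj(2) J_neg[OF assms(2)]])
  ultimately have "g -[A] g' = \<zero>[A]" using G0_J_disjoint by simp
  then have "g = g'" using c(1,3) AV.M.minus_other_side by simp
  then show ?thesis by (rule trans[OF gj(4)[symmetric] sym])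
qed

lemma hc0_G0: "x : G 0 ==> hc0 x = x"
  using hc0_unique[of x "\<zero>[A]"] J_zero by simp

lemma hc0_decomp: "a : carrier A ==> a = hc0 a +[A] (a -[A] hc0 a)"
  using AV.M.diff_add_left[of a "hc0 a"] hc0_props(2)[of a] by simp

lemma hc0_add:
  assumes "a : carrier A" "b : carrier A" shows "hc0 (a +[A] b) = hc0 a +[A] hc0 b"
proof -
  let ?j = "(a -[A] hc0 a) +[A] (b -[A] hc0 b)"
  have c: "hc0 a : carrier A" "hc0 b : carrier A" "a -[A] hc0 a : carrier A" "b -[A] hc0 b : carrier A"
    using assms hc0_props by auto
  have "a +[A] b = (hc0 a +[A] (a -[A] hc0 a)) +[A] (hc0 b +[A] (b -[A] hc0 b))"
    using hc0_decomp assms by simp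
  also have "... = (hc0 a +[A] hc0 b) +[A] ?j" using c by (simp add: AV.M.a_ac)
  finally show ?thesis
    using hc0_unique[of "hc0 a +[A] hc0 b" ?j] J_add[OF hc0_props(3)[OF assms(1)] hc0_props(3)[OF assms(2)]]
      G.piece_sub(3)[OF hc0_props(1)[OF assms(1)] hc0_props(1)[OF assms(2)]] by simp
qed

text \<open>\<open>J 1\<close> is an ideal, so the projection to degree 0 is a ring homomorphism,
  and \<open>A\<close> acts on \<open>S0\<close> through it.\<close>

lemma hc0_mult:
  assumes "a : carrier A" "b : carrier A" shows "hc0 (a *[A] b) = hc0 a *[A] hc0 b"
proof -
  define j where "j = a -[A] hc0 a"
  define j' where "j' = b -[A] hc0 b"
  have j: "j : J 1" "j' : J 1" using hc0_props assms by (simp_all add: j_def j'_def)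
  have c: "hc0 a : carrier A" "hc0 b : carrier A" "j : carrier A" "j' : carrier A"
    using assms hc0_props j by auto
  have "a *[A] b = (hc0 a +[A] j) *[A] (hc0 b +[A] j')"
    using hc0_decomp assms by (simp add: j_def j'_def)
  also have "... = hc0 a *[A] hc0 b +[A] (hc0 a *[A] j' +[A] j *[A] (hc0 b +[A] j'))"
    using c by (simp add: A.l_distr A.r_distr AV.M.a_ac)
  finally have ab: "a *[A] b = hc0 a *[A] hc0 b +[A] (hc0 a *[A] j' +[A] j *[A] (hc0 b +[A] j'))" .
  have "hc0 a *[A] j' : J 1" using J_mult[of "hc0 a" 0 j' 1] c j J_0 by simp
  moreover have "j *[A] (hc0 b +[A] j') : J 1" using J_mult[of j 1 "hc0 b +[A] j'" 0] c j J_0 by simp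
  ultimately show ?thesis
    unfolding ab using graded_facts(1)[OF hc0_props(1)[OF assms(1)] hc0_props(1)[OF assms(2)]]
    by (intro hc0_unique J_add) simp_all
qed

section \<open>The degree-zero module\<close>

abbreviation "S0 \<equiv> degree_zero_module A G"

lemma S0_simps [simp]:
  "carrier S0 = G 0" "\<zero>[S0] = \<zero>[A]" "x +[S0] y = x +[A] y" "a .[S0] x = hc0 (a *[A] x)"
  by (simp_all add: degree_zero_module_def)

lemma S0_act: "a : carrier A ==> x : G 0 ==> a .[S0] x = hc0 a *[A] x"
  by (simp add: hc0_mult hc0_G0)

lemma S0_left_module: "left_module A S0"
proof (rule left_moduleI[OF A.ring_axioms])
  show "abelian_group S0"
  proof (rule abelian_groupI)
    fix x assume "x : carrier S0"
    then show "\<exists>y\<in>carrier S0. y +[S0] x = \<zero>[S0]"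
      using G.piece_sub(4) by (intro bexI[of _ "-[A] x"]) (simp_all add: AV.M.l_neg)
  qed (use G.piece_sub in \<open>simp_all add: AV.M.a_ac\<close>)
next
  fix a x assume a: "a : carrier A" and x: "x : carrier S0"
  show "a .[S0] x : carrier S0"
    using a x graded_facts(1)[OF hc0_props(1)[OF a], of x 0] S0_act[OF a] by simp
  fix b assume b: "b : carrier A"
  show "(a +[A] b) .[S0] x = a .[S0] x +[S0] b .[S0] x"
    using a b x by (simp add: A.l_distr hc0_add)
  show "(a *[A] b) .[S0] x = a .[S0] (b .[S0] x)"
    using a b x by (simp add: hc0_mult hc0_G0 hc0_props A.m_assoc)
next
  fix a x y assume "a : carrier A" "x : carrier S0" "y : carrier S0"
  then show "a .[S0] (x +[S0] y) = a .[S0] x +[S0] a .[S0] y"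
    by (simp add: A.r_distr hc0_add)
next
  fix x assume "x : carrier S0"
  then show "\<one>[A] .[S0] x = x" by (simp add: hc0_G0)
qed

lemma S0_fd: "fd S0"
proof -
  have sub: "vectorspace.fin_dim K (A(|carrier := G 0|))"
    by (rule subspace_dim(1)[OF AV.vectorspace_axioms graded_facts(2) fin_A])
  have h: "(%x. x) : module_hom K (A(|carrier := G 0|)) (vs_of S0)"
    by (rule module_homI) (simp_all add: scal_mult hc0_G0 G_scal)
  show ?thesis
    by (rule vectorspace_iso(1)[OF vectorspace_subspace[OF AV.vectorspace_axioms graded_facts(2)]
          vs_of_vectorspace[OF S0_left_module] h _ sub]) (simp add: bij_betw_def)
qed

end

lemma (in lmod) finsum_smult:
  assumes "finite I" "f : I \<rightarrow> carrier A" "x : carrier M"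
  shows "(\<Oplus>\<^bsub>A\<^esub>i\<in>I. f i) .[M] x = (\<Oplus>\<^bsub>M\<^esub>i\<in>I. f i .[M] x)"
  using assms(1,2)
proof (induction I rule: finite_induct)
  case empty
  then show ?case using assms(3) by simp
next
  case (insert i F)
  then have "(%i. f i .[M] x) : F \<rightarrow> carrier M" "f : F \<rightarrow> carrier A" using assms(3) by auto
  then show ?case
    using insert assms(3) by (simp add: A.finsum_insert M.finsum_insert smult_l_distr)
qed

context fd_alg
begin

lemma betti_le_zero:
  fixes M :: "('a, nat => 'k) module"
  assumes "left_module A M" "carrier M = {\<zero>[M]}"
  shows "betti_le r M 0"
  using assms
proof (induction r arbitrary: M)
  case 0
  have "(%x. x) ` carrier M = carrier M" by simp
  then show ?case
    unfolding betti_le.simps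
    using projective_zero[OF 0] zero_dim[OF 0] module_hom_id by blast
next
  case (Suc r)
  have k: "kernel_of M M (%x. x) = {\<zero>[M]}" using Suc.prems(2) by (auto simp: kernel_of_def)
  then have "M(|carrier := kernel_of M M (%x. x)|) = M" using Suc.prems(2) by simp
  then have "betti_le r (M(|carrier := kernel_of M M (%x. x)|)) 0" using Suc by simp
  moreover have "(%x. x) ` carrier M = carrier M" by simp
  ultimately show ?case
    unfolding betti_le.simps
    using projective_zero[OF Suc.prems] zero_dim(1)[OF Suc.prems] module_hom_id by blast
qed

text \<open>The minimal resolution of the summand is itself a witness, bounded by
  \<open>minres_dim_le\<close>.\<close>

lemma betti_le_retract:
  fixes M N :: "('a, nat => 'k) module"
  assumes "retract A M N" "fd M" "betti_le r N b"
  shows "betti_le r M b"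
proof -
  have lm: "left_module A M" using assms(1) by (simp add: retract_def)
  obtain P :: "nat => ('a, nat => 'k) module" and d ep
    where P: "minimal_projective_resolution A M P d ep" using minres_exists[OF lm assms(2)] by blast
  show ?thesis
    using betti_le_mono[OF minres_betti_le[OF P lm assms(2)] minres_dim_le[OF P assms(2,1,3)]] .
qed

text \<open>Maximal submodules exist by dimension.\<close>

lemma maximal_submodule_exists:
  assumes "left_module A M" "fd M" "carrier M ~= {\<zero>[M]}"
  obtains N where "Module.submodule N A M" "N ~= carrier M"
    "!!L. Module.submodule L A M ==> N \<subseteq> L ==> L ~= carrier M ==> L = N"
proof -
  interpret lmod A M by (simp add: lmod_def assms)
  define good where "good N \<longleftrightarrow> Module.submodule N A M & N ~= carrier M" for N
  have "good {\<zero>[M]}" using zero_submodule assms(3) by (simp add: good_def)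
  moreover have "\<forall>N. good N --> dimm (M(|carrier := N|)) <= dimm M"
    using sub_fd(2)[OF assms(1) _ assms(2)] by (simp add: good_def)
  ultimately have "\<exists>N. good N & (\<forall>L. good L --> dimm (M(|carrier := L|)) <= dimm (M(|carrier := N|)))"
    using ex_has_greatest_nat[of good "{\<zero>[M]}" "%N. dimm (M(|carrier := N|))" "Suc (dimm M)"] by (simp add: less_Suc_eq_le)
  then obtain N where N: "good N" "!!L. good L ==> dimm (M(|carrier := L|)) <= dimm (M(|carrier := N|))" by blast
  have "L = N" if L: "Module.submodule L A M" "N \<subseteq> L" "L ~= carrier M" for L
  proof -
    have Nsub: "Module.submodule N A (M(|carrier := L|))"
      using submodule_carrier_iff[OF L(1)] N(1) L(2) by (simp add: good_def)
    note lmL = submodule_left_module[OF L(1)] and fL = sub_fd(1)[OF assms(1) L(1) assms(2)]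
    have "dimm (M(|carrier := L|)) <= dimm (M(|carrier := N|))" using N(2) L by (simp add: good_def)
    moreover have "dimm (M(|carrier := N|)) <= dimm (M(|carrier := L|))" using sub_fd(2)[OF lmL Nsub fL] by simp
    ultimately show ?thesis using sub_fd(3)[OF lmL Nsub fL] by simp
  qed
  then show ?thesis using that[of N] N(1) unfolding good_def by blast
qed

end

context galg
begin

lemma sum_e_act:
  assumes "left_module A M" "x : carrier M"
  shows "x = (\<Oplus>\<^bsub>M\<^esub>i\<in>{1..n}. e i .[M] x)"
proof -
  interpret lmod A M by (simp add: lmod_def assms)
  have "(\<Oplus>\<^bsub>A\<^esub>i\<in>{1..n}. e i) .[M] x = (\<Oplus>\<^bsub>M\<^esub>i\<in>{1..n}. e i .[M] x)"
    by (rule finsum_smult) (use e_pi assms(2) in simp_all)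
  then show ?thesis unfolding graded_facts(7) using assms(2) by simp
qed

text \<open>If \<open>N\<close> did not contain \<open>JM 1 M\<close>, maximality would make their
  sum everything, and Nakayama's lemma would then give the same for \<open>N\<close> itself.\<close>

lemma JM_proper:
  assumes "left_module A M" "Module.submodule N A M" "N ~= carrier M"
    "!!L. Module.submodule L A M ==> N \<subseteq> L ==> L ~= carrier M ==> L = N"
  shows "JM 1 M \<subseteq> N"
proof -
  interpret lmod A M by (simp add: lmod_def assms)
  let ?S = "N <+>\<^bsub>M\<^esub> JM 1 M"
  have JS: "Module.submodule (JM 1 M) A M" by (rule JM_submodule[OF assms(1)])
  have S: "Module.submodule ?S A M" by (rule set_add_submodule[OF assms(2) JS])
  have NS: "N \<subseteq> ?S"
  proof
    fix x assume "x : N"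
    then show "x : ?S" unfolding set_add_iff
      using submoduleD(1)[OF assms(2)] submoduleD(2)[OF JS] by (intro bexI[of _ x] bexI[of _ "\<zero>[M]"]) auto
  qed
  have JS': "JM 1 M \<subseteq> ?S"
  proof
    fix x assume "x : JM 1 M"
    then show "x : ?S" unfolding set_add_iff
      using submoduleD(2)[OF assms(2)] submoduleD(1)[OF JS] by (intro bexI[of _ "\<zero>[M]"] bexI[of _ x]) auto
  qed
  have "?S ~= carrier M"
  proof
    assume eq: "?S = carrier M"
    have "N = carrier M"
    proof (rule nakayama[OF assms(1,2)])
      fix x assume "x : carrier M"
      then have "x : ?S" by (simp only: eq)
      then show "\<exists>u\<in>N. \<exists>v\<in>JM 1 M. x = u +[M] v" unfolding set_add_iff .
    qed
    then show False using assms(3) by simp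
  qed
  then have "?S = N" using assms(4)[OF S NS] by simp
  then show ?thesis using JS' by simp
qed

text \<open>A nonzero module maps onto a simple direct summand of \<open>\<Gamma>\<^sub>0\<close>, with kernel of smaller
  dimension.\<close>

lemma simple_quotient:
  fixes M S :: "('a, nat => 'k) module"
  assumes lmM: "left_module A M" and fdM: "fd M" and nz: "carrier M ~= {\<zero>[M]}"
    and fi: "inj_on fi (G 0)" and S: "S = copy_module fi S0"
  obtains N and L :: "('a, nat => 'k) module" and g where "Module.submodule N A M" "dimm (M(|carrier := N|)) < dimm M"
    "retract A L S" "fd L" "g : module_hom A M L" "g ` carrier M = carrier L" "N = kernel_of M L g"
proof -
  interpret lmod A M by (simp add: lmod_def lmM)
  interpret c: copied A S0 fi by (rule copied_intro[OF S0_left_module]) (simp add: fi)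
  obtain N where N: "Module.submodule N A M" "N ~= carrier M"
    "!!L. Module.submodule L A M ==> N \<subseteq> L ==> L ~= carrier M ==> L = N"
    using maximal_submodule_exists[OF lmM fdM nz] by metis
  note ND = submoduleD[OF N(1)]
  have JN: "JM 1 M \<subseteq> N" by (rule JM_proper[OF lmM N])
  obtain x where x: "x : carrier M" "x \<notin> N" using N(2) ND(1) by blast
  have "\<exists>i\<in>{1..n}. e i .[M] x \<notin> N"
  proof (rule ccontr)
    assume "\<not> (\<exists>i\<in>{1..n}. e i .[M] x \<notin> N)"
    then have "(\<Oplus>\<^bsub>M\<^esub>i\<in>{1..n}. e i .[M] x) : N" by (intro finsum_in_submodule[OF N(1)]) auto
    then show False using sum_e_act[OF lmM x(1)] x(2) by simp
  qed
  then obtain i where i: "i : {1..n}" "e i .[M] x \<notin> N" by blast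
  have ei: "e i : carrier A" "e i *[A] e i = e i" "e i : G 0" "e i ~= \<zero>[A]"
    using graded_facts(3,4,5)[OF i(1)] e_G0[OF i(1)] by auto
  \<comment> \<open>The vector \<open>z\<close> lies outside \<open>N\<close> and is fixed by one
    idempotent; as \<open>J 1\<close> maps it into \<open>N\<close>, the algebra acts on it modulo
    \<open>N\<close> by scalars.\<close>
  define z where "z = e i .[M] x"
  have z: "z : carrier M" "z \<notin> N" "e i .[M] z = z"
    using x i ei by (simp_all add: z_def smult_assoc[symmetric])
  have uniq: "r = s" if r: "r : carrier K" "s : carrier K" "u : N" "v : N"
    "u +[M] scal r .[M] z = v +[M] scal s .[M] z" for r s u v
  proof (rule ccontr)
    assume "r ~= s"
    have uv: "u : carrier M" "v : carrier M" using r ND(1) by auto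
    define t where "t = s -[K] r"
    have t: "t : carrier K" "t ~= \<zero>[K]" using r \<open>r ~= s\<close> by (simp_all add: t_def)
    interpret V: vectorspace K "vs_of M" by (rule vs_of_vectorspace[OF lmM])
    have "u -[M] v = scal s .[M] z -[M] scal r .[M] z"
      by (rule M.diff_cross[OF _ _ _ _ r(5)]) (use r uv z in simp_all)
    also have "... = scal t .[M] z"
    proof -
      have "scal s = scal t +[A] scal r"
      proof -
        have "t +[K] r = s"
          unfolding t_def using abelian_group.diff_add_left[OF K.abelian_group_axioms r(2,1)] r by (simp add: K.a_comm)
        then show ?thesis using r t(1) by (simp add: AV.smult_l_distr[symmetric])
      qed
      then have "scal s .[M] z = scal r .[M] z +[M] scal t .[M] z"
        using r t z by (simp add: smult_l_distr M.a_comm)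
      then show ?thesis using r t z by (simp add: M.add_diff_left)
    qed
    finally have "scal t .[M] z : N" using ND(6)[OF r(3,4)] by simp
    then have "scal (inv\<^bsub>K\<^esub> t) .[M] (scal t .[M] z) : N"
      by (intro ND(4)[where x = "scal t .[M] z"]) (use t in \<open>simp_all add: K.field_Units\<close>)
    moreover have "scal (inv\<^bsub>K\<^esub> t) *[A] scal t = \<one>[A]"
      using t by (simp add: scal_mult(1) AV.smult_assoc1[symmetric] K.field_Units)
    moreover have "scal (inv\<^bsub>K\<^esub> t) .[M] (scal t .[M] z) = (scal (inv\<^bsub>K\<^esub> t) *[A] scal t) .[M] z"
      using t z by (intro smult_assoc[symmetric]) (simp_all add: K.field_Units)
    ultimately show False using z by simp
  qed
  have act: "\<exists>s\<in>carrier K. \<exists>w\<in>N. hc0 a *[A] e i = s .[A] e i & a .[M] z = w +[M] scal s .[M] z"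
    if a: "a : carrier A" for a
  proof -
    obtain s where s: "s : carrier K" "hc0 a *[A] e i = s .[A] e i"
      by (rule G0_e[OF hc0_props(1)[OF a] i(1)])
    have c: "hc0 a : carrier A" "a -[A] hc0 a : carrier A" using hc0_props[OF a] by auto
    have "a .[M] z = (hc0 a +[A] (a -[A] hc0 a)) .[M] z" using hc0_decomp[OF a] by simp
    also have "... = hc0 a .[M] z +[M] (a -[A] hc0 a) .[M] z" using c z by (intro smult_l_distr)
    also have "hc0 a .[M] z = scal s .[M] z"
    proof -
      have "hc0 a .[M] z = (hc0 a *[A] e i) .[M] z" using c ei z by (simp add: smult_assoc)
      also have "... = (scal s *[A] e i) .[M] z" using s ei by (simp add: scal_mult)
      also have "... = scal s .[M] z" using s ei z by (simp add: smult_assoc)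
      finally show ?thesis .
    qed
    finally have "a .[M] z = (a -[A] hc0 a) .[M] z +[M] scal s .[M] z" using c s z by (simp add: M.a_comm)
    moreover have "(a -[A] hc0 a) .[M] z : N" using JM_gen[OF lmM hc0_props(3)[OF a] z(1)] JN by blast
    ultimately show ?thesis using s by blast
  qed
  \<comment> \<open>\<open>N + k z\<close> is stable under \<open>A\<close> and larger than
    \<open>N\<close>, so by maximality it is all of \<open>M\<close> and \<open>M / N\<close> is
    one-dimensional.\<close>
  let ?T = "{m. \<exists>u\<in>N. \<exists>s\<in>carrier K. m = u +[M] scal s .[M] z}"
  have T: "Module.submodule ?T A M"
  proof (rule submoduleI)
    show "?T \<subseteq> carrier M" using ND(1) z by auto
    show "\<zero>[M] : ?T" using ND(2) z by (auto intro!: bexI[of _ "\<zero>[M]"] bexI[of _ "\<zero>[K]"])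
  next
    fix m m' assume "m : ?T" "m' : ?T"
    then obtain u s u' s' where us: "u : N" "s : carrier K" "m = u +[M] scal s .[M] z"
      "u' : N" "s' : carrier K" "m' = u' +[M] scal s' .[M] z" by auto
    have "u : carrier M" "u' : carrier M" using us ND(1) by auto
    then have "m +[M] m' = (u +[M] u') +[M] scal (s +[K] s') .[M] z"
      using us z by (simp add: AV.smult_l_distr smult_l_distr M.a_ac)
    then show "m +[M] m' : ?T" using us ND(3) by blast
  next
    fix a m assume a: "a : carrier A" and "m : ?T"
    then obtain u s where us: "u : N" "s : carrier K" "m = u +[M] scal s .[M] z" by auto
    obtain t w where tw: "t : carrier K" "w : N" "a .[M] z = w +[M] scal t .[M] z" using act[OF a] by blast
    have uw: "u : carrier M" "w : carrier M" using us tw ND(1) by auto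
    have "a .[M] (scal s .[M] z) = scal s .[M] (a .[M] z)"
      using a us z by (simp add: smult_assoc[symmetric] scal_mult)
    also have "... = scal s .[M] w +[M] scal (s *[K] t) .[M] z"
      unfolding tw(3) using us tw uw z
      by (simp add: smult_r_distr smult_assoc[symmetric] scal_mult(1) AV.smult_assoc1)
    finally have "a .[M] m = (a .[M] u +[M] scal s .[M] w) +[M] scal (s *[K] t) .[M] z"
      unfolding us(3) using a us uw tw z by (simp add: smult_r_distr M.a_assoc)
    moreover have "a .[M] u +[M] scal s .[M] w : N" using a us tw by (intro ND(3,4)) simp_all
    ultimately show "a .[M] m : ?T" using us tw by blast
  qed
  have "N \<subseteq> ?T"
  proof
    fix u assume u: "u : N"
    then have "u = u +[M] scal \<zero>[K] .[M] z" using ND(1) z by auto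
    then show "u : ?T" using u by blast
  qed
  moreover have "z : ?T" using ND(2) z by (auto intro!: bexI[of _ "\<zero>[M]"] bexI[of _ "\<one>[K]"])
  ultimately have Tall: "?T = carrier M" using N(3)[OF T] z(2) by blast
  have "\<forall>m\<in>carrier M. \<exists>s. s : carrier K & (\<exists>u\<in>N. m = u +[M] scal s .[M] z)"
    unfolding Tall[symmetric] by blast
  from bchoice[OF this] obtain lam
    where lam: "!!m. m : carrier M ==> lam m : carrier K & (\<exists>u\<in>N. m = u +[M] scal (lam m) .[M] z)" by blast
  have lamI: "lam m = s" if "u : N" "s : carrier K" "m = u +[M] scal s .[M] z" for m u s
  proof -
    have "m : carrier M" using that ND(1) z by auto
    then show ?thesis using lam[of m] uniq[of "lam m" s _ u] that by auto
  qed
  \<comment> \<open>The copy of the line \<open>k e i\<close> in \<open>S0\<close>. It is the simple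
    module isomorphic to \<open>M / N\<close>, and right multiplication by \<open>e i\<close>
    retracts \<open>S0\<close> onto it.\<close>
  define L where "L = S(|carrier := fi ` {r .[A] e i | r. r : carrier K}|)"
  define g where "g m = fi (lam m .[A] e i)" for m
  have reG: "r .[A] e i : G 0" if "r : carrier K" for r using that ei G_scal by simp
  have S': "S = c.M'" using S by simp
  have Lsub: "Module.submodule (fi ` {r .[A] e i | r. r : carrier K}) A S"
  proof -
    interpret CS: lmod A S unfolding S' by (simp add: lmod_def c.left_module_copy)
    show ?thesis
    proof (rule CS.submoduleI)
      show "fi ` {r .[A] e i | r. r : carrier K} \<subseteq> carrier S"
        unfolding S' c.carrier_copy using reG by auto
      have "\<zero>[A] = \<zero>[K] .[A] e i" using ei by simp
      then show "\<zero>[S] : fi ` {r .[A] e i | r. r : carrier K}"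
        unfolding S' c.copy_simps(1) S0_simps by blast
    next
      fix u v assume "u : fi ` {r .[A] e i | r. r : carrier K}" "v : fi ` {r .[A] e i | r. r : carrier K}"
      then obtain r s where rs: "r : carrier K" "s : carrier K" "u = fi (r .[A] e i)" "v = fi (s .[A] e i)" by auto
      have "u +[S] v = fi ((r +[K] s) .[A] e i)"
        unfolding S' rs using c.copy_simps(2) reG rs ei by (simp add: AV.smult_l_distr)
      then show "u +[S] v : fi ` {r .[A] e i | r. r : carrier K}" using rs by blast
    next
      fix a u assume a: "a : carrier A" and "u : fi ` {r .[A] e i | r. r : carrier K}"
      then obtain r where r: "r : carrier K" "u = fi (r .[A] e i)" by auto
      obtain t where t: "t : carrier K" "hc0 a *[A] e i = t .[A] e i" using act[OF a] by blast
      have "a .[S0] (r .[A] e i) = (r *[K] t) .[A] e i"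
        using S0_act[OF a reG[OF r(1)]] hc0_props(2)[OF a] r t ei by (simp add: smult_mult AV.smult_assoc1)
      then have "a .[S] u = fi ((r *[K] t) .[A] e i)"
        unfolding S' r(2) using c.copy_simps(3)[of "r .[A] e i" a] reG[OF r(1)] by simp
      then show "a .[S] u : fi ` {r .[A] e i | r. r : carrier K}" using r t by blast
    qed
  qed
  have lmS: "left_module A S" unfolding S' by (rule c.left_module_copy)
  interpret CS: lmod A S by (simp add: lmod_def lmS)
  have lmL: "left_module A L" unfolding L_def by (rule CS.submodule_left_module[OF Lsub])
  have fdS: "fd S" unfolding S'
    by (rule iso_dim(1)[OF S0_left_module c.left_module_copy c.hom_to S0_fd]) (simp add: bij_betw_def c.inj[simplified] fi c.carrier_copy)
  have fdL: "fd L" unfolding L_def by (rule sub_fd(1)[OF lmS Lsub fdS])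
  have "retract A L S"
  proof (rule retractI[OF lmL lmS])
    show "(%x. x) : module_hom A L S"
      unfolding L_def by (rule module_hom_restrict_dom[OF module_hom_id CS.submoduleD(1)[OF Lsub]])
    have rh: "(%x. x *[A] e i) : module_hom A S0 S0"
    proof (rule module_homI)
      fix x assume "x : carrier S0"
      then show "x *[A] e i : carrier S0" using graded_facts(1)[of x 0 "e i" 0] ei by simp
    next
      fix x y assume "x : carrier S0" "y : carrier S0"
      then show "(x +[S0] y) *[A] e i = x *[A] e i +[S0] y *[A] e i" using ei by (simp add: A.l_distr)
    next
      fix a x assume a: "a : carrier A" and x: "x : carrier S0"
      have xe: "x *[A] e i : G 0" using graded_facts(1)[of x 0 "e i" 0] ei x by simp
      show "(a .[S0] x) *[A] e i = a .[S0] (x *[A] e i)"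
        using x S0_act[OF a] S0_act[OF a xe] hc0_props(2)[OF a] ei by (simp add: A.m_assoc)
    qed
    have ph: "(%x. fi (c.ps x *[A] e i)) : module_hom A S S"
      unfolding S' by (rule module_hom_comp[OF module_hom_comp[OF c.hom_from rh] c.hom_to])
    show "(%x. fi (c.ps x *[A] e i)) : module_hom A S L"
      unfolding L_def
    proof (rule module_hom_restrict_cod[OF ph], rule image_subsetI)
      fix v assume "v : carrier S"
      then obtain x where x: "x : G 0" "v = fi x" unfolding S' c.carrier_copy by auto
      have "c.ps v = x" unfolding x(2) by (rule c.inv_simp) (simp add: x)
      moreover obtain s where "s : carrier K" "x *[A] e i = s .[A] e i" by (rule G0_e[OF x(1) i(1)])
      ultimately show "fi (c.ps v *[A] e i) : fi ` {r .[A] e i | r. r : carrier K}" by auto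
    qed
    fix v assume "v : carrier L"
    then obtain r where r: "r : carrier K" "v = fi (r .[A] e i)" by (auto simp: L_def)
    have "c.ps v = r .[A] e i" unfolding r(2) by (rule c.inv_simp) (simp add: reG[OF r(1)])
    then show "fi (c.ps v *[A] e i) = v" using r ei by (simp add: smult_mult)
  qed
  moreover have gh: "g : module_hom A M L"
  proof (rule module_homI)
    fix m assume m: "m : carrier M"
    show "g m : carrier L" unfolding g_def L_def using lam[OF m] by auto
    fix m' assume m': "m' : carrier M"
    obtain u u' where u: "u : N" "m = u +[M] scal (lam m) .[M] z" "u' : N" "m' = u' +[M] scal (lam m') .[M] z"
      using lam[OF m] lam[OF m'] by blast
    have lk: "lam m : carrier K" "lam m' : carrier K" using lam m m' by auto
    have uc: "u : carrier M" "u' : carrier M" using u ND(1) by auto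
    have "(u +[M] scal (lam m) .[M] z) +[M] (u' +[M] scal (lam m') .[M] z) = (u +[M] u') +[M] scal (lam m +[K] lam m') .[M] z"
      using uc lk z by (simp add: AV.smult_l_distr smult_l_distr M.a_ac)
    then have "lam (m +[M] m') = lam m +[K] lam m'"
      using lamI[OF ND(3)[OF u(1,3)], of "lam m +[K] lam m'" "m +[M] m'"] lk u(2,4) by simp
    then show "g (m +[M] m') = g m +[L] g m'"
      unfolding g_def L_def S' using c.copy_simps(2)[of "lam m .[A] e i" "lam m' .[A] e i"] lk reG ei
      by (simp add: AV.smult_l_distr)
  next
    fix a m assume a: "a : carrier A" and m: "m : carrier M"
    obtain u where u: "u : N" "m = u +[M] scal (lam m) .[M] z" using lam[OF m] by blast
    have lk: "lam m : carrier K" using lam m by auto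
    obtain t w where tw: "t : carrier K" "w : N" "hc0 a *[A] e i = t .[A] e i" "a .[M] z = w +[M] scal t .[M] z"
      using act[OF a] by blast
    have uw: "u : carrier M" "w : carrier M" using u tw ND(1) by auto
    have "a .[M] (scal (lam m) .[M] z) = scal (lam m) .[M] (a .[M] z)"
      using a lk z by (simp add: smult_assoc[symmetric] scal_mult)
    also have "... = scal (lam m) .[M] w +[M] scal (lam m *[K] t) .[M] z"
      unfolding tw(4) using lk tw uw z
      by (simp add: smult_r_distr smult_assoc[symmetric] scal_mult(1) AV.smult_assoc1)
    finally have "a .[M] (u +[M] scal (lam m) .[M] z) = (a .[M] u +[M] scal (lam m) .[M] w) +[M] scal (lam m *[K] t) .[M] z"
      using a lk uw tw z by (simp add: smult_r_distr M.a_assoc)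
    then have am: "a .[M] m = (a .[M] u +[M] scal (lam m) .[M] w) +[M] scal (lam m *[K] t) .[M] z"
      unfolding u(2)[symmetric] .
    have "a .[M] u +[M] scal (lam m) .[M] w : N" using a u tw lk by (intro ND(3,4)) simp_all
    from lamI[OF this _ am] have "lam (a .[M] m) = lam m *[K] t" using lk tw by simp
    moreover have "a .[S0] (lam m .[A] e i) = (lam m *[K] t) .[A] e i"
      using S0_act[OF a reG[OF lk]] hc0_props(2)[OF a] lk tw ei by (simp add: smult_mult AV.smult_assoc1)
    ultimately show "g (a .[M] m) = a .[L] g m"
      unfolding g_def L_def S' using c.copy_simps(3)[of "lam m .[A] e i" a] reG[OF lk] by simp
  qed
  moreover have "g ` carrier M = carrier L"
  proof
    show "carrier L \<subseteq> g ` carrier M"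
    proof
      fix v assume "v : carrier L"
      then obtain r where r: "r : carrier K" "v = fi (r .[A] e i)" by (auto simp: L_def)
      have "lam (scal r .[M] z) = r" by (rule lamI[OF ND(2) r(1)]) (use r z in simp)
      then show "v : g ` carrier M" using r z by (intro image_eqI[of _ _ "scal r .[M] z"]) (simp_all add: g_def)
    qed
    show "g ` carrier M \<subseteq> carrier L" using gh by (auto simp: module_hom_def)
  qed
  moreover have "N = kernel_of M L g"
  proof -
    have zero_iff: "r .[A] e i = \<zero>[A] \<longleftrightarrow> r = \<zero>[K]" if r: "r : carrier K" for r
    proof
      assume *: "r .[A] e i = \<zero>[A]"
      show "r = \<zero>[K]"
      proof (rule ccontr)
        assume "r ~= \<zero>[K]"
        then have "inv\<^bsub>K\<^esub> r : carrier K" "inv\<^bsub>K\<^esub> r *[K] r = \<one>[K]" using r by (simp_all add: K.field_Units)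
        then have "e i = inv\<^bsub>K\<^esub> r .[A] (r .[A] e i)" using r ei by (simp add: AV.smult_assoc1[symmetric])
        then show False using * ei \<open>inv\<^bsub>K\<^esub> r : carrier K\<close> by simp
      qed
    qed (use ei in simp)
    have g0: "g m = \<zero>[L] \<longleftrightarrow> lam m = \<zero>[K]" if m: "m : carrier M" for m
    proof -
      have lk: "lam m : carrier K" using lam m by auto
      have "\<zero>[L] = fi \<zero>[A]" unfolding L_def S' using c.copy_simps(1) by simp
      then show ?thesis
        unfolding g_def using inj_onD[OF fi, of "lam m .[A] e i" "\<zero>[A]"] reG[OF lk] G.piece_sub(2)[of 0] zero_iff[OF lk] by auto
    qed
    show ?thesis
    proof (intro equalityI subsetI)
      fix u assume u: "u : N"
      then have uc: "u : carrier M" using ND(1) by auto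
      have "lam u = \<zero>[K]" by (rule lamI[OF u]) (use uc z in simp_all)
      then show "u : kernel_of M L g" using uc g0 by (simp add: kernel_of_def)
    next
      fix m assume "m : kernel_of M L g"
      then have m: "m : carrier M" "lam m = \<zero>[K]" using g0 by (auto simp: kernel_of_def)
      obtain u where u: "u : N" "m = u +[M] scal (lam m) .[M] z" using lam[OF m(1)] by blast
      then have "m = u" using m z ND(1) by auto
      then show "m : N" using u by simp
    qed
  qed
  moreover have "dimm (M(|carrier := N|)) < dimm M"
    using sub_fd(2,3)[OF lmM N(1) fdM] N(2) by linarith
  ultimately show ?thesis using that[OF N(1) _ _ fdL, of g] by blast
qed

text \<open>Induction along a maximal submodule: each simple quotient is a summand of
  \<open>S0\<close> and contributes at most \<open>b\<close> by the horseshoe lemma.\<close>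

lemma betti_bound:
  fixes M S :: "('a, nat => 'k) module"
  assumes "left_module A M" "fd M" and fi: "inj_on fi (G 0)" "S = copy_module fi S0"
    and b: "betti_le r S b"
  shows "betti_le r M (dimm M * b)"
  using assms(1,2)
proof (induction "dimm M" arbitrary: M rule: less_induct)
  case less
  show ?case
  proof (cases "carrier M = {\<zero>[M]}")
    case True
    then show ?thesis using betti_le_mono[OF betti_le_zero[OF less.prems(1) True]] by simp
  next
    case False
    interpret lmod A M by (simp add: lmod_def less.prems)
    obtain N and L :: "('a, nat => 'k) module" and g where *: "Module.submodule N A M" "dimm (M(|carrier := N|)) < dimm M"
      "retract A L S" "fd L" "g : module_hom A M L" "g ` carrier M = carrier L" "N = kernel_of M L g"
      using simple_quotient[OF less.prems False fi] by metis
    have lmL: "left_module A L" using *(3) by (simp add: retract_def)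
    note lmN = submodule_left_module[OF *(1)] and fdN = sub_fd(1)[OF less.prems(1) *(1) less.prems(2)]
    have "betti_le r M (dimm (M(|carrier := N|)) * b + b)"
    proof (rule horseshoe[OF less.prems(1) lmN lmL _ _ *(5,6)])
      show "(%x. x) : module_hom A (M(|carrier := N|)) M"
        by (rule module_hom_restrict_dom[OF module_hom_id submoduleD(1)[OF *(1)]])
      show "betti_le r (M(|carrier := N|)) (dimm (M(|carrier := N|)) * b)"
        by (rule less.hyps[OF *(2) lmN fdN])
      show "betti_le r L b" by (rule betti_le_retract[OF *(3,4) b])
    qed (use *(7) in simp_all)
    moreover have "dimm (M(|carrier := N|)) * b + b <= dimm M * b"
      using *(2) mult_le_mono1[of "Suc (dimm (M(|carrier := N|)))" "dimm M" b] by simp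
    ultimately show ?thesis by (rule betti_le_mono)
  qed
qed

end

section \<open>Graded modules generated in one degree\<close>

context pieces
begin

lemma sum_extend:
  assumes "!!t. c t : Q t" "!!t. t \<ge> N ==> c t = \<zero>" "N <= N'"
  shows "(\<Oplus>t\<in>{..<N'}. c t) = (\<Oplus>t\<in>{..<N}. c t)"
  by (rule add.finprod_mono_neutral_cong_right) (use assms piece_carrier[OF assms(1)] in auto)

lemma component_sum:
  assumes "!!t. c t : Q t" "!!t. t \<ge> N ==> c t = \<zero>"
  shows "homog_component G Q s (\<Oplus>t\<in>{..<N}. c t) = c s"
proof -
  let ?x = "\<Oplus>t\<in>{..<N}. c t"
  have hd: "homog_decomposition G Q ?x c"
    unfolding homog_decomposition_iff[OF piece_sub(1,2)] using assms by blast
  have "?x : carrier G" by (rule finsum_closed) (use piece_carrier[OF assms(1)] in auto)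
  then have ex: "\<exists>!c. homog_decomposition G Q ?x c" using direct by (simp add: direct_sum_of_pieces_def)
  have "(THE c. homog_decomposition G Q ?x c) = c"
  proof (rule the_equality[of "homog_decomposition G Q ?x"])
    show "c' = c" if "homog_decomposition G Q ?x c'" for c' using ex hd that by (blast elim: ex1E)
  qed (rule hd)
  then show ?thesis by (simp add: homog_component_def)
qed

lemma component_closed:
  assumes "x : carrier G" shows "homog_component G Q s x : Q s"
proof -
  obtain c N where c: "!!t. c t : Q t" "!!t. t \<ge> N ==> c t = \<zero>" "x = (\<Oplus>t\<in>{..<N}. c t)"
    using pieces_exist[OF assms] by metis
  have "homog_component G Q s x = c s" unfolding c(3) by (rule component_sum) (rule c(1), rule c(2))
  then show ?thesis using c(1)[of s] by simp
qed

lemma component_add: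
  assumes "x : carrier G" "y : carrier G"
  shows "homog_component G Q s (x \<oplus> y) = homog_component G Q s x \<oplus> homog_component G Q s y"
proof -
  obtain c N where c: "!!t. c t : Q t" "!!t. t \<ge> N ==> c t = \<zero>" "x = (\<Oplus>t\<in>{..<N}. c t)"
    using pieces_exist[OF assms(1)] by metis
  obtain c' N' where c': "!!t. c' t : Q t" "!!t. t \<ge> N' ==> c' t = \<zero>" "y = (\<Oplus>t\<in>{..<N'}. c' t)"
    using pieces_exist[OF assms(2)] by metis
  let ?N = "max N N'"
  have xy: "(\<Oplus>t\<in>{..<?N}. c t) = x" "(\<Oplus>t\<in>{..<?N}. c' t) = y"
    unfolding c(3) c'(3) by (rule sum_extend; use c(1,2) c'(1,2) in simp)+
  have "(\<Oplus>t\<in>{..<?N}. c t \<oplus> c' t) = (\<Oplus>t\<in>{..<?N}. c t) \<oplus> (\<Oplus>t\<in>{..<?N}. c' t)"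
    by (rule finsum_addf) (use piece_carrier[OF c(1)] piece_carrier[OF c'(1)] in auto)
  then have "(\<Oplus>t\<in>{..<?N}. c t \<oplus> c' t) = x \<oplus> y" unfolding xy .
  moreover have "homog_component G Q s (\<Oplus>t\<in>{..<?N}. c t \<oplus> c' t) = c s \<oplus> c' s"
    by (rule component_sum) (use c(1,2) c'(1,2) piece_sub(3) in auto)
  moreover have "homog_component G Q s x = c s" "homog_component G Q s y = c' s"
    unfolding c(3) c'(3) by (rule component_sum; use c(1,2) c'(1,2) in simp)+
  ultimately show ?thesis by simp
qed

lemma component_homogeneous:
  assumes "x : Q t" shows "homog_component G Q s x = (if s = t then x else \<zero>)"
proof -
  have "homog_component G Q s (\<Oplus>r\<in>{..<Suc t}. if r = t then x else \<zero>) = (if s = t then x else \<zero>)"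
    by (rule component_sum) (use assms piece_sub(2) in auto)
  then show ?thesis using single_sum[of x t "Suc t"] assms by simp
qed

lemma component_finsum:
  assumes "finite I" "f : I \<rightarrow> carrier G"
  shows "homog_component G Q s (\<Oplus>i\<in>I. f i) = (\<Oplus>i\<in>I. homog_component G Q s (f i))"
  using assms
proof (induction I rule: finite_induct)
  case empty
  then show ?case using component_homogeneous[OF piece_sub(2)] by simp
next
  case (insert i F)
  then have "f i : carrier G" "f : F \<rightarrow> carrier G" by auto
  moreover have "(%i. homog_component G Q s (f i)) : F \<rightarrow> carrier G" "homog_component G Q s (f i) : carrier G"
    using calculation piece_carrier[OF component_closed] by auto
  ultimately show ?case using insert by (simp add: component_add)
qed

end

text \<open>Closure under sums is enough, because negatives come from the action of
  \<open>-1\<close>; the inductive form permits proofs generator by generator.\<close>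

inductive_set addspan :: "('x, 'c) ring_scheme => 'x set => 'x set" for M U where
  addspan_zero: "\<zero>[M] : addspan M U"
| addspan_incl: "x : U ==> x : addspan M U"
| addspan_add: "x : addspan M U ==> y : addspan M U ==> x +[M] y : addspan M U"

locale generated = galg K A G n e l + M: lmod A M + Q: pieces M Q
  for K :: "'k ring" and A :: "('k, 'a) module" and G n e l and M :: "('a, 'm) module" and Q +
  fixes r :: nat
  assumes act: "a : G s ==> x : Q t ==> a .[M] x : Q (s + t)"
    and gen: "generated_submodule A M (Q r) = carrier M"
begin

lemma component_act:
  assumes a: "a : carrier A" and x: "x : Q t"
  shows "homog_component M Q (s + t) (a .[M] x) = homog_component A G s a .[M] x"
proof -
  obtain c N where c: "!!t. c t : G t" "!!t. t \<ge> N ==> c t = \<zero>[A]" "a = (\<Oplus>\<^bsub>A\<^esub>t\<in>{..<N}. c t)"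
    using G.pieces_exist[OF a] by metis
  let ?N = "Suc (max N s)"
  have xM: "x : carrier M" using x by simp
  have cA: "c i : carrier A" for i by (rule G.piece_carrier[OF c(1)])
  have a': "(\<Oplus>\<^bsub>A\<^esub>t\<in>{..<?N}. c t) = a" unfolding c(3) by (rule G.sum_extend) (use c(1,2) in auto)
  have "(\<Oplus>\<^bsub>A\<^esub>t\<in>{..<?N}. c t) .[M] x = (\<Oplus>\<^bsub>M\<^esub>t\<in>{..<?N}. c t .[M] x)" by (rule M.finsum_smult) (use cA xM in auto)
  then have "a .[M] x = (\<Oplus>\<^bsub>M\<^esub>t\<in>{..<?N}. c t .[M] x)" unfolding a' .
  then have "homog_component M Q (s + t) (a .[M] x) = (\<Oplus>\<^bsub>M\<^esub>i\<in>{..<?N}. homog_component M Q (s + t) (c i .[M] x))"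
    using Q.component_finsum[of "{..<?N}" "%i. c i .[M] x" "s + t"] cA xM by simp
  also have "... = (\<Oplus>\<^bsub>M\<^esub>i\<in>{..<?N}. if i = s then c s .[M] x else \<zero>[M])"
    by (rule M.M.finsum_cong') (use Q.component_homogeneous[OF act[OF c(1) x]] cA xM in auto)
  also have "... = c s .[M] x" by (rule Q.single_sum) (use cA xM in auto)
  also have "c s = homog_component A G s a" unfolding c(3) by (rule G.component_sum[symmetric]) (rule c(1), rule c(2))
  finally show ?thesis .
qed

definition prods :: "nat => 'm set" where
  "prods s = {g .[M] x | g x. g : G s & x : Q r}"

lemma prods_Q: "x : prods s ==> x : Q (r + s)"
  unfolding prods_def using act[of _ s _ r] by (auto simp: add.commute[of r])

text \<open>The additive span of the products is already stable under \<open>A\<close>: a scalar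
  splits into homogeneous parts, each of which merges with the factor \<open>g\<close>.\<close>

lemma homogeneous_span: "carrier M \<subseteq> addspan M (\<Union>s. prods s)"
proof -
  let ?H = "addspan M (\<Union>s. prods s)"
  have sub: "?H \<subseteq> carrier M"
  proof
    fix x assume "x : ?H"
    then show "x : carrier M" by (induction rule: addspan.induct) (use Q.piece_carrier[OF prods_Q] in auto)
  qed
  have "a .[M] x : ?H" if a: "a : carrier A" and x: "x : ?H" for a x
    using x
  proof (induction rule: addspan.induct)
    case addspan_zero
    then show ?case using a addspan.addspan_zero[of M] by simp
  next
    case (addspan_incl x)
    then obtain g z s where x: "x = g .[M] z" "g : G s" "z : Q r" by (auto simp: prods_def)
    have gz: "g : carrier A" "z : carrier M" using x by auto
    obtain c N where c: "!!t. c t : G t" "a = (\<Oplus>\<^bsub>A\<^esub>t\<in>{..<N}. c t)"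
      using G.pieces_exist[OF a] by metis
    have cA: "c i : carrier A" for i by (rule G.piece_carrier[OF c(1)])
    have "c t .[M] x : ?H" for t
    proof -
      have "c t .[M] x = (c t *[A] g) .[M] z" using cA gz x(1) by (simp add: M.smult_assoc)
      then have "c t .[M] x : prods (t + s)" unfolding prods_def using graded_facts(1)[OF c(1) x(2)] x(3) by blast
      then show ?thesis by (intro addspan.addspan_incl) blast
    qed
    then have "(\<Oplus>\<^bsub>M\<^esub>t\<in>{..<N}. c t .[M] x) : ?H"
      by (intro M.M.finsum_in[OF sub addspan.addspan_zero addspan.addspan_add]) auto
    then show ?case unfolding c(2) using M.finsum_smult[of "{..<N}" c x] cA gz x(1) by simp
  next
    case (addspan_add x y)
    then have "x : carrier M" "y : carrier M" using sub by auto
    then show ?case using a addspan_add.IH by (simp add: M.smult_r_distr addspan.addspan_add)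
  qed
  then have "Module.submodule ?H A M"
    by (intro M.submoduleI sub addspan.addspan_zero addspan.addspan_add)
  moreover have "Q r \<subseteq> ?H"
  proof
    fix x assume x: "x : Q r"
    then have "x : prods 0" unfolding prods_def using one_G0 by (intro CollectI exI[of _ "\<one>[A]"] exI[of _ x]) simp
    then show "x : ?H" by (intro addspan.addspan_incl) blast
  qed
  ultimately show ?thesis using M.generated_submodule_least gen by metis
qed

lemma homogeneous_parts:
  assumes "x : carrier M"
  shows "t < r ==> homog_component M Q t x = \<zero>[M]"
    "homog_component M Q (r + s) x : addspan M (prods s)"
proof -
  have "x : addspan M (\<Union>s. prods s)" using assms homogeneous_span by blast
  then have "x : carrier M & (t < r --> homog_component M Q t x = \<zero>[M]) & homog_component M Q (r + s) x : addspan M (prods s)"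
  proof (induction rule: addspan.induct)
    case addspan_zero
    then show ?case using Q.component_homogeneous[OF Q.piece_sub(2)] addspan.addspan_zero[of M] by simp
  next
    case (addspan_incl x)
    then obtain s' where s': "x : prods s'" by blast
    show ?case using Q.component_homogeneous[OF prods_Q[OF s']] s' prods_Q[OF s'] addspan.addspan_zero[of M]
        addspan.addspan_incl[of x "prods s" M] by auto
  next
    case (addspan_add x y)
    then show ?case using addspan.addspan_add[of _ M "prods s"] by (auto simp: Q.component_add)
  qed
  then show "t < r ==> homog_component M Q t x = \<zero>[M]"
    "homog_component M Q (r + s) x : addspan M (prods s)" by auto
qed

lemma degree_low: "x : Q t ==> t < r ==> x = \<zero>[M]"
  using homogeneous_parts(1)[of x t] Q.component_homogeneous[of x t t] by simp

text \<open>Elements above the generating degree are sums of products \<open>g x\<close> with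
  \<open>g\<close> of positive degree.\<close>

lemma degree_high:
  assumes x: "x : Q t" and t: "r < t" shows "x : JM 1 M"
proof -
  note JD = M.submoduleD[OF JM_submodule[OF M.left_module, of 1]]
  have "x : addspan M (prods (t - r))"
    using homogeneous_parts(2)[of x "t - r"] Q.component_homogeneous[OF x, of t] x t by simp
  then show ?thesis
  proof (induction rule: addspan.induct)
    case (addspan_incl x)
    then obtain g z where "x = g .[M] z" "g : G (t - r)" "z : Q r" by (auto simp: prods_def)
    then show ?case using JM_gen[OF M.left_module J_homogeneous[of g "t - r" 1], of z] t by simp
  qed (use JD(2,3) in auto)
qed

end

section \<open>Koszul resolutions are minimal\<close>

locale koszul_resolution = galg K A G n e l
  for K :: "'k ring" and A :: "('k, 'a) module" and G n e l +
  fixes P :: "nat => ('a, nat => 'k) module" and d ep Q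
  assumes res: "projective_resolution A S0 P d ep"
    and grading: "graded_module A G (P r) (Q r)"
    and generating: "generated_submodule A (P r) (Q r r) = carrier (P r)"
    and augmentation: "t > 0 ==> x : Q 0 t ==> ep x = \<zero>[A]"
    and degree: "d r ` Q (Suc r) t \<subseteq> Q r t"
begin

lemma resD: "projective A (P r)" "ep : module_hom A (P 0) S0" "ep ` carrier (P 0) = G 0"
  "d r : module_hom A (P (Suc r)) (P r)" "d 0 ` carrier (P 1) = kernel_of (P 0) S0 ep"
  "d (Suc r) ` carrier (P (Suc (Suc r))) = kernel_of (P (Suc r)) (P r) (d r)"
  using res by (auto simp: projective_resolution_def)

lemma P_left_module: "left_module A (P r)" by (rule projective_left_module[OF resD(1)])

lemma P_pieces: "pieces (P r) (Q r)"
proof -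
  interpret lmod A "P r" by (simp add: lmod_def P_left_module)
  show ?thesis using grading[of r] by unfold_locales (simp add: graded_module_def)
qed

lemma P_generated: "generated K A G n e l (P r) (Q r) r"
proof -
  interpret lmod A "P r" by (simp add: lmod_def P_left_module)
  interpret pieces "P r" "Q r" by (rule P_pieces)
  show ?thesis
    by unfold_locales (use grading[of r] generating[of r] in \<open>auto simp: graded_module_def\<close>)
qed

lemma d_hom: "lmod_hom A (P (Suc r)) (P r) (d r)"
  by (rule lmod_homI[OF P_left_module P_left_module resD(4)])

text \<open>\<open>P (Suc r)\<close> lives in degrees above \<open>r\<close> and \<open>d r\<close>
  preserves degrees, while \<open>P r\<close> is generated in degree \<open>r\<close>. The image
  therefore meets only degrees that are covered by \<open>JM 1 (P r)\<close>.\<close>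

lemma image_in_JM:
  assumes x: "x : carrier (P (Suc r))" shows "d r x : JM 1 (P r)"
proof -
  interpret h: lmod_hom A "P (Suc r)" "P r" "d r" by (rule d_hom)
  interpret S: generated K A G n e l "P (Suc r)" "Q (Suc r)" "Suc r" by (rule P_generated)
  interpret T: generated K A G n e l "P r" "Q r" r by (rule P_generated)
  obtain c N where c: "!!t. c t : Q (Suc r) t" "x = (\<Oplus>\<^bsub>P (Suc r)\<^esub>t\<in>{..<N}. c t)"
    using S.Q.pieces_exist[OF x] by metis
  have JS: "Module.submodule (JM 1 (P r)) A (P r)" by (rule JM_submodule[OF P_left_module])
  have "d r (c t) : JM 1 (P r)" for t
  proof (cases "t <= r")
    case True
    then have "c t = \<zero>[P (Suc r)]" using S.degree_low[OF c(1)] by simp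
    then show ?thesis using h.N.submoduleD(2)[OF JS] by simp
  next
    case False
    have "d r (c t) : Q r t" using degree c(1) by blast
    then show ?thesis using T.degree_high False by simp
  qed
  moreover have "d r x = (\<Oplus>\<^bsub>P r\<^esub>t\<in>{..<N}. d r (c t))"
    unfolding c(2) by (rule h.finsum) (use S.Q.piece_carrier[OF c(1)] in auto)
  ultimately show ?thesis using h.N.finsum_in_submodule[OF JS, of "%t. d r (c t)" "{..<N}"] by simp
qed

lemma superfluous_image:
  assumes "Module.submodule N A (P r)" "N = d r ` carrier (P (Suc r))"
  shows "superfluous N A (P r)"
proof (rule superfluousI[OF assms(1) _ P_left_module])
  interpret lmod A "P r" by (simp add: lmod_def P_left_module)
  fix L assume L: "Module.submodule L A (P r)"
    and sum: "!!x. x : carrier (P r) ==> \<exists>n\<in>N. \<exists>l\<in>L. x = n +[P r] l"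
  have "L = carrier (P r)"
  proof (rule nakayama[OF P_left_module L])
    fix x assume "x : carrier (P r)"
    then obtain u v where uv: "u : N" "v : L" "x = u +[P r] v" using sum by blast
    have "u : JM 1 (P r)" using uv(1) image_in_JM unfolding assms(2) by blast
    moreover have "x = v +[P r] u" using uv submoduleD(1)[OF L] submoduleD(1)[OF assms(1)] by (auto intro: M.a_comm)
    ultimately show "\<exists>u\<in>L. \<exists>v\<in>JM 1 (P r). x = u +[P r] v" using uv(2) by blast
  qed
  then show "carrier (P r) \<subseteq> L" by simp
qed

lemma minimal:
  assumes fi: "inj_on fi (G 0)"
  shows "minimal_projective_resolution A (copy_module fi S0) P d (%x. fi (ep x))"
proof -
  interpret c: copied A S0 fi by (rule copied_intro[OF S0_left_module]) (simp add: fi)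
  interpret ep: lmod_hom A "P 0" S0 ep by (rule lmod_homI[OF P_left_module S0_left_module resD(2)])
  have z: "fi (ep x) = \<zero>[c.M'] \<longleftrightarrow> ep x = \<zero>[S0]" if "x : carrier (P 0)" for x
    using inj_on_eq_iff[OF c.inj ep.closed[OF that] c.M.zero_closed] by simp
  have k: "kernel_of (P 0) c.M' (%x. fi (ep x)) = kernel_of (P 0) S0 ep"
    using z by (auto simp: kernel_of_def)
  have "(%x. fi (ep x)) ` carrier (P 0) = carrier c.M'"
    unfolding c.carrier_copy S0_simps resD(3)[symmetric] by auto
  then have "projective_resolution A c.M' P d (%x. fi (ep x))"
    unfolding projective_resolution_def k
    using resD module_hom_comp[OF resD(2) c.hom_to] by simp
  moreover have "superfluous (kernel_of (P 0) S0 ep) A (P 0)"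
    by (rule superfluous_image[OF ep.kernel_submodule]) (use resD(5) in simp)
  moreover have "superfluous (kernel_of (P (Suc r)) (P r) (d r)) A (P (Suc r))" for r
    by (rule superfluous_image[OF lmod_hom.kernel_submodule[OF d_hom]]) (simp add: resD(6))
  ultimately show ?thesis unfolding minimal_projective_resolution_def k by blast
qed

lemma S0_copy:
  obtains fi :: "'a => nat => 'k" where "inj_on fi (G 0)" "left_module A (copy_module fi S0)" "fd (copy_module fi S0)"
proof -
  obtain fi :: "'a => nat => 'k" where fi: "inj_on fi (carrier A)"
    using fin_dim_embedding[OF AV.vectorspace_axioms fin_A] by blast
  then have inj: "inj_on fi (G 0)" by (rule inj_on_subset) (rule G.piece_sub(1))
  interpret c: copied A S0 fi by (rule copied_intro[OF S0_left_module]) (simp add: inj)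
  have "fd c.M'"
    by (rule iso_dim(1)[OF S0_left_module c.left_module_copy c.hom_to S0_fd])
      (simp add: bij_betw_def c.carrier_copy inj)
  then show ?thesis using that[OF inj c.left_module_copy] by blast
qed

lemma P_fd: "fd (P r)"
proof -
  obtain fi :: "'a => nat => 'k" where "inj_on fi (G 0)" "left_module A (copy_module fi S0)" "fd (copy_module fi S0)"
    by (rule S0_copy)
  then show ?thesis using minres_fd[OF minimal] by blast
qed

end

section \<open>Freeness of projectives generated in one degree\<close>

context fd_alg
begin

lemma vs_finsum: "finsum (vs_of M) f S = finsum M f S"
  unfolding finsum_def finprod_def restrict_scalars_def by simp

lemma subspaceI:
  assumes "left_module A M" "N \<subseteq> carrier M" "\<zero>[M] : N" "!!x y. x : N ==> y : N ==> x +[M] y : N"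
    "!!c x. c : carrier K ==> x : N ==> scal c .[M] x : N"
  shows "Module.submodule N K (vs_of M)"
proof -
  interpret lmod A M by (simp add: lmod_def assms)
  interpret V: vectorspace K "vs_of M" by (rule vs_of_vectorspace[OF assms(1)])
  have "-[vs_of M] x : N" if x: "x : N" for x
  proof -
    have xM: "x : carrier M" using x assms(2) by auto
    then have "-[vs_of M] x = -[M] x" by (intro V.module.M.minus_equality) (simp_all add: M.l_neg)
    also have "... = scal (-[K] \<one>[K]) .[M] x"
      using smult_minus_one[OF xM] AV.smult_l_minus[of "\<one>[K]" "\<one>[A]"] by simp
    finally show ?thesis using assms(5)[OF _ x, of "-[K] \<one>[K]"] by simp
  qed
  then show ?thesis using assms by (intro V.module.submoduleI) auto
qed

lemma subspace_basis:
  assumes "left_module A M" "fd M" "Module.submodule N K (vs_of M)"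
  obtains X where "finite X" "X \<subseteq> N" "card X = vectorspace.dim K ((vs_of M)(|carrier := N|))"
    "!!x. x : N ==> \<exists>c\<in>X \<rightarrow> carrier K. x = (\<Oplus>\<^bsub>M\<^esub>v\<in>X. scal (c v) .[M] v)"
    "!!c v. c : X \<rightarrow> carrier K ==> (\<Oplus>\<^bsub>M\<^esub>v\<in>X. scal (c v) .[M] v) = \<zero>[M] ==> v : X ==> c v = \<zero>[K]"
proof -
  interpret V: vectorspace K "vs_of M" by (rule vs_of_vectorspace[OF assms(1)])
  interpret N: vectorspace K "(vs_of M)(|carrier := N|)" by (rule vectorspace_subspace[OF V.vectorspace_axioms assms(3)])
  have sub: "LinearCombinations.submodule K N (vs_of M)" by (rule submodule_convert[OF V.vectorspace_axioms assms(3)])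
  have NM: "N \<subseteq> carrier M" using sub by (simp add: LinearCombinations.submodule_def)
  have lc: "V.lincomb c X = (\<Oplus>\<^bsub>M\<^esub>v\<in>X. scal (c v) .[M] v)" for c X
    by (simp add: V.lincomb_def vs_finsum)
  have "N.fin_dim" by (rule subspace_dim(1)[OF V.vectorspace_axioms assms(3,2)])
  then obtain X where X: "finite X" "N.basis X" using N.finite_basis_exists by blast
  then have XN: "X \<subseteq> N" "\<not> N.lin_dep X" "N.span X = N" by (auto simp: N.basis_def)
  have li: "V.span X = N" "\<not> V.lin_dep X" using V.span_li_not_depend[OF XN(1) sub] XN by auto
  show ?thesis
  proof (rule that[OF X(1) XN(1)])
    show "card X = N.dim" by (rule N.dim_basis[OF X, symmetric])
  next
    fix x assume "x : N"
    then show "\<exists>c\<in>X \<rightarrow> carrier K. x = (\<Oplus>\<^bsub>M\<^esub>v\<in>X. scal (c v) .[M] v)"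
      using V.finite_span[OF X(1)] XN(1) NM li(1) by (auto simp: lc)
  next
    fix c v assume "c : X \<rightarrow> carrier K" "(\<Oplus>\<^bsub>M\<^esub>v\<in>X. scal (c v) .[M] v) = \<zero>[M]" "v : X"
    then show "c v = \<zero>[K]" using V.not_lindepD[OF li(2) X(1) subset_refl, of c] by (auto simp: lc)
  qed
qed

end

context galg
begin

definition peirce :: "nat => nat => nat => 'a set" where
  "peirce j s i = {a : G s. e j *[A] a = a & a *[A] e i = a}"

definition column :: "nat => 'a set" where
  "column i = {a : carrier A. a *[A] e i = a}"

lemma peirce_subspace:
  assumes "j : {1..n}" "i : {1..n}" shows "Module.submodule (peirce j s i) K A"
proof -
  have "e j : carrier A" "e i : carrier A" using assms graded_facts(3) by auto
  then show ?thesis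
    unfolding peirce_def using G.piece_sub G_scal
    by (intro AV.submoduleI) (auto simp: A.l_distr A.r_distr A.l_minus A.r_minus smult_mult)
qed

lemma column_subspace:
  assumes "i : {1..n}" shows "Module.submodule (column i) K A"
proof -
  have "e i : carrier A" using assms graded_facts(3) by auto
  then show ?thesis
    unfolding column_def by (intro AV.submoduleI) (auto simp: A.l_distr A.l_minus smult_mult)
qed

end

text \<open>\<open>X i\<close> is a basis of \<open>e i Q r\<close>. The aim is that
  \<open>M\<close> is a direct sum of copies of the projectives \<open>A e i\<close>, indexed by
  \<open>X i\<close>, so that its graded dimensions are those of the algebra weighted by
  \<open>card (X i)\<close>.\<close>

locale generated_basis = generated K A G n e l M Q r
  for K :: "'k ring" and A :: "('k, 'a) module" and G n e l
    and M :: "('a, nat => 'k) module" and Q r +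
  fixes X :: "nat => (nat => 'k) set"
  assumes projective: "projective A M"
    and X_finite: "finite (X i)" and X_Q: "v : X i ==> v : Q r" "i : {1..n} ==> v : X i ==> e i .[M] v = v"
    and X_span: "x : Q r ==> i : {1..n} ==> e i .[M] x = x ==>
      \<exists>c\<in>X i \<rightarrow> carrier K. x = (\<Oplus>\<^bsub>M\<^esub>v\<in>X i. scal (c v) .[M] v)"
    and X_indep: "i : {1..n} ==> c : X i \<rightarrow> carrier K ==> (\<Oplus>\<^bsub>M\<^esub>v\<in>X i. scal (c v) .[M] v) = \<zero>[M] ==>
      v : X i ==> c v = \<zero>[K]"
begin

definition "I = (SIGMA i:{1..n}. X i)"

text \<open>The direct sum of one copy of \<open>A e (fst q)\<close> for each \<open>q\<close> in
  \<open>I\<close>, realised as functions on the finite index set.\<close>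

definition F :: "('a, nat \<times> (nat => 'k) => 'a) module" where
  "F = (|carrier = {u : I \<rightarrow>\<^sub>E carrier A. \<forall>q\<in>I. u q *[A] e (fst q) = u q},
     monoid.mult = undefined, one = undefined, zero = \<lambda>q\<in>I. \<zero>[A],
     add = %u v. \<lambda>q\<in>I. u q +[A] v q, module.smult = %a u. \<lambda>q\<in>I. a *[A] u q|)"

lemma F_simps:
  "\<zero>[F] = (\<lambda>q\<in>I. \<zero>[A])" "u +[F] v = (\<lambda>q\<in>I. u q +[A] v q)" "a .[F] u = (\<lambda>q\<in>I. a *[A] u q)"
  by (simp_all add: F_def)

lemma I_facts:
  assumes "q : I"
  shows "fst q : {1..n}" "e (fst q) : carrier A" "snd q : Q r" "snd q : carrier M"
    "e (fst q) .[M] snd q = snd q" "e (fst q) *[A] e (fst q) = e (fst q)"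
  using assms X_Q graded_facts(3,4) Q.piece_carrier[OF X_Q(1)] by (auto simp: I_def)

lemma finite_I: "finite I" unfolding I_def using X_finite by blast

lemma F_D: "u : carrier F ==> q : I ==> u q : carrier A" "u : carrier F ==> q : I ==> u q *[A] e (fst q) = u q"
  by (auto simp: F_def)

lemma F_I:
  assumes "!!q. q : I ==> f q : carrier A" "!!q. q : I ==> f q *[A] e (fst q) = f q"
  shows "(\<lambda>q\<in>I. f q) : carrier F"
  unfolding F_def using assms by simp

lemma F_app [simp]:
  "q : I ==> \<zero>[F] q = \<zero>[A]" "q : I ==> (u +[F] v) q = u q +[A] v q" "q : I ==> (a .[F] u) q = a *[A] u q"
  by (simp_all add: F_simps)

lemma F_eqI: "u : carrier F ==> v : carrier F ==> (!!q. q : I ==> u q = v q) ==> u = v"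
  unfolding F_def by (auto intro: PiE_ext)

lemma F_left_module: "left_module A F"
proof (rule left_moduleI[OF A.ring_axioms])
  show "abelian_group F"
  proof (rule abelian_groupI)
    fix u v assume uv: "u : carrier F" "v : carrier F"
    show "u +[F] v : carrier F" unfolding F_simps
      by (rule F_I) (use F_D uv I_facts in \<open>simp_all add: A.l_distr\<close>)
    show "u +[F] v = v +[F] u" unfolding F_simps
      by (rule restrict_ext) (use F_D uv in \<open>simp add: AV.M.a_comm\<close>)
    fix w assume w: "w : carrier F"
    show "(u +[F] v) +[F] w = u +[F] (v +[F] w)" unfolding F_simps
      by (rule restrict_ext) (use F_D uv w in \<open>simp add: AV.M.a_assoc\<close>)
  next
    show z: "\<zero>[F] : carrier F" unfolding F_simps by (rule F_I) (use I_facts in simp_all)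
    fix u assume u: "u : carrier F"
    have "(\<lambda>q\<in>I. \<zero>[F] q +[A] u q) : carrier F" by (rule F_I) (use F_D[OF u] in simp_all)
    then show "\<zero>[F] +[F] u = u" unfolding F_simps(2) by (intro F_eqI[OF _ u]) (use F_D[OF u] in simp_all)
    have "(\<lambda>q\<in>I. -[A] u q) : carrier F"
      by (rule F_I) (use F_D[OF u] I_facts in \<open>simp_all add: A.l_minus\<close>)
    then show "\<exists>v\<in>carrier F. v +[F] u = \<zero>[F]"
      by (rule bexI[rotated]) (use F_D[OF u] in \<open>auto intro!: restrict_ext simp: F_simps AV.M.l_neg\<close>)
  qed
next
  fix a u assume a: "a : carrier A" and u: "u : carrier F"
  show "a .[F] u : carrier F" unfolding F_simps
    by (rule F_I) (use F_D[OF u] a I_facts in \<open>simp_all add: A.m_assoc\<close>)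
  fix b assume b: "b : carrier A"
  show "(a +[A] b) .[F] u = a .[F] u +[F] b .[F] u" unfolding F_simps
    by (rule restrict_ext) (use F_D[OF u] a b in \<open>simp add: A.l_distr\<close>)
  show "(a *[A] b) .[F] u = a .[F] (b .[F] u)" unfolding F_simps
    by (rule restrict_ext) (use F_D[OF u] a b in \<open>simp add: A.m_assoc\<close>)
next
  fix a u v assume "a : carrier A" "u : carrier F" "v : carrier F"
  then show "a .[F] (u +[F] v) = a .[F] u +[F] a .[F] v" unfolding F_simps
    by (intro restrict_ext) (use F_D in \<open>simp add: A.r_distr\<close>)
next
  fix u assume u: "u : carrier F"
  have "(\<lambda>q\<in>I. \<one>[A] *[A] u q) : carrier F" by (rule F_I) (use F_D[OF u] in simp_all)
  then show "\<one>[A] .[F] u = u" unfolding F_simps(3) by (intro F_eqI[OF _ u]) (use F_D[OF u] in simp_all)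
qed

sublocale F: lmod A F by (simp add: lmod_def F_left_module)

definition "comb u = (\<Oplus>\<^bsub>M\<^esub>q\<in>I. u q .[M] snd q)"

lemma comb_hom: "comb : module_hom A F M"
proof (rule module_homI)
  fix u assume u: "u : carrier F"
  have uc: "(%q. u q .[M] snd q) : I \<rightarrow> carrier M" using F_D(1)[OF u] I_facts(4) by blast
  then show "comb u : carrier M" unfolding comb_def by (rule M.M.finsum_closed)
  fix v assume v: "v : carrier F"
  have vc: "(%q. v q .[M] snd q) : I \<rightarrow> carrier M" using F_D(1)[OF v] I_facts(4) by blast
  have "comb (u +[F] v) = (\<Oplus>\<^bsub>M\<^esub>q\<in>I. u q .[M] snd q +[M] v q .[M] snd q)"
    unfolding comb_def
    by (rule M.M.finsum_cong') (use uc vc F_D(1)[OF u] F_D(1)[OF v] I_facts(4) in \<open>auto simp: M.smult_l_distr Pi_iff\<close>)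
  then show "comb (u +[F] v) = comb u +[M] comb v"
    unfolding comb_def M.M.finsum_addf[OF uc vc] .
next
  fix a u assume a: "a : carrier A" and u: "u : carrier F"
  have uc: "(%q. u q .[M] snd q) : I \<rightarrow> carrier M" using F_D(1)[OF u] I_facts(4) by blast
  have "comb (a .[F] u) = (\<Oplus>\<^bsub>M\<^esub>q\<in>I. a .[M] (u q .[M] snd q))"
    unfolding comb_def
    by (rule M.M.finsum_cong') (use uc a F_D(1)[OF u] I_facts(4) in \<open>auto simp: M.smult_assoc Pi_iff\<close>)
  then show "comb (a .[F] u) = a .[M] comb u" unfolding comb_def M.smult_finsum[OF a uc] .
qed

sublocale comb: lmod_hom A F M comb by (rule lmod_homI[OF F_left_module M.left_module comb_hom])

definition "single q a = (\<lambda>p\<in>I. if p = q then a else \<zero>[A])"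

lemma single_F: "q : I ==> a : carrier A ==> a *[A] e (fst q) = a ==> single q a : carrier F"
  unfolding single_def by (rule F_I) (use I_facts in auto)

lemma comb_single:
  assumes "q : I" "a : carrier A"
  shows "comb (single q a) = a .[M] snd q"
proof -
  have "comb (single q a) = (\<Oplus>\<^bsub>M\<^esub>p\<in>I. if q = p then a .[M] snd p else \<zero>[M])"
    unfolding comb_def single_def by (rule M.M.finsum_cong') (use assms I_facts(4) in auto)
  also have "... = a .[M] snd q"
    by (rule M.M.finsum_singleton[OF assms(1) finite_I]) (use assms I_facts(4) in auto)
  finally show ?thesis .
qed

lemma comb_surj: "comb ` carrier F = carrier M"
proof
  have im: "Module.submodule (comb ` carrier F) A M" by (rule comb.image_submodule[OF F.carrier_submodule])
  have gens: "v : comb ` carrier F" if i: "i : {1..n}" and v: "v : X i" for i v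
  proof -
    have q: "(i, v) : I" using i v by (simp add: I_def)
    have "comb (single (i, v) (e i)) = v" using comb_single[OF q] I_facts[OF q] by simp
    moreover have "single (i, v) (e i) : carrier F" by (rule single_F[OF q]) (use I_facts[OF q] in simp_all)
    ultimately show ?thesis by (metis imageI)
  qed
  have "Q r \<subseteq> comb ` carrier F"
  proof
    fix x assume x: "x : Q r"
    have "e i .[M] x : comb ` carrier F" if i: "i : {1..n}" for i
    proof -
      have ei: "e i : carrier A" "e i *[A] e i = e i" using graded_facts(3,4)[OF i] by auto
      have "e i .[M] x : Q r" using act[OF e_G0[OF i] x] by simp
      moreover have "e i .[M] (e i .[M] x) = e i .[M] x" using ei x by (simp add: M.smult_assoc[symmetric])
      ultimately obtain c where c: "c : X i \<rightarrow> carrier K" "e i .[M] x = (\<Oplus>\<^bsub>M\<^esub>v\<in>X i. scal (c v) .[M] v)"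
        using X_span[OF _ i] by blast
      have "(\<Oplus>\<^bsub>M\<^esub>v\<in>X i. scal (c v) .[M] v) : comb ` carrier F"
        by (rule M.finsum_in_submodule[OF im], rule Pi_I, rule M.submoduleD(4)[OF im]) (use c(1) gens[OF i] in auto)
      then show ?thesis unfolding c(2) .
    qed
    then have "(\<Oplus>\<^bsub>M\<^esub>i\<in>{1..n}. e i .[M] x) : comb ` carrier F" by (intro M.finsum_in_submodule[OF im]) auto
    then show "x : comb ` carrier F" using sum_e_act[OF M.left_module, of x] x by simp
  qed
  then show "carrier M \<subseteq> comb ` carrier F" using M.generated_submodule_least[OF im] gen by metis
qed auto

lemma comb_component:
  assumes u: "u : carrier F"
  shows "homog_component M Q (s + r) (comb u) = (\<Oplus>\<^bsub>M\<^esub>q\<in>I. homog_component A G s (u q) .[M] snd q)"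
proof -
  have "homog_component M Q (s + r) (comb u) = (\<Oplus>\<^bsub>M\<^esub>q\<in>I. homog_component M Q (s + r) (u q .[M] snd q))"
    unfolding comb_def by (rule Q.component_finsum[OF finite_I]) (use F_D(1)[OF u] I_facts(4) in blast)
  also have "... = (\<Oplus>\<^bsub>M\<^esub>q\<in>I. homog_component A G s (u q) .[M] snd q)"
  proof (rule M.M.finsum_cong')
    show "(%q. homog_component A G s (u q) .[M] snd q) : I \<rightarrow> carrier M"
      using G.piece_carrier[OF G.component_closed[OF F_D(1)[OF u]]] I_facts(4) by blast
  qed (use component_act[OF F_D(1)[OF u] I_facts(3)] in simp_all)
  finally show ?thesis .
qed

text \<open>In degree \<open>r\<close> a relation among the generators involves only the degree-zero
  parts of the coefficients, which act as scalars. Multiplying by \<open>e i\<close> isolates the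
  generators in \<open>X i\<close>, and their independence makes these scalars vanish.\<close>

lemma comb_kernel_J:
  assumes u: "u : carrier F" "comb u = \<zero>[M]" and q: "q : I"
  shows "u q : J 1"
proof -
  have hA: "hc0 (u p) : carrier A" "hc0 (u p) : G 0" if "p : I" for p
    by (rule hc0_props(2)[OF F_D(1)[OF u(1) that]], rule hc0_props(1)[OF F_D(1)[OF u(1) that]])
  have "\<forall>p\<in>I. \<exists>c. c : carrier K & hc0 (u p) *[A] e (fst p) = c .[A] e (fst p)"
  proof
    fix p assume p: "p : I"
    show "\<exists>c. c : carrier K & hc0 (u p) *[A] e (fst p) = c .[A] e (fst p)"
      by (rule G0_e[OF hA(2)[OF p] I_facts(1)[OF p]]) blast
  qed
  from bchoice[OF this] obtain c
    where cc: "\<forall>p\<in>I. c p : carrier K & hc0 (u p) *[A] e (fst p) = c p .[A] e (fst p)" by (rule exE)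
  then have c: "c p : carrier K" "hc0 (u p) *[A] e (fst p) = c p .[A] e (fst p)" if "p : I" for p using that by auto
  have cs: "hc0 (u p) .[M] snd p = scal (c p) .[M] snd p" if p: "p : I" for p
  proof -
    note f = I_facts[OF p]
    have "hc0 (u p) .[M] snd p = (hc0 (u p) *[A] e (fst p)) .[M] snd p"
      using f hA(1)[OF p] by (simp add: M.smult_assoc)
    also have "... = (scal (c p) *[A] e (fst p)) .[M] snd p" using f c(1,2)[OF p] by (simp add: scal_mult)
    also have "... = scal (c p) .[M] snd p" using f c(1)[OF p] M.smult_assoc[of "scal (c p)" "e (fst p)" "snd p"] by simp
    finally show ?thesis .
  qed
  have cM: "scal (c p) .[M] snd p : carrier M" if "p : I" for p using c(1) I_facts(4) that by simp
  define i where "i = fst q"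
  have i: "i : {1..n}" "e i : carrier A" using I_facts[OF q] by (simp_all add: i_def)
  have "(\<Oplus>\<^bsub>M\<^esub>p\<in>I. scal (c p) .[M] snd p) = (\<Oplus>\<^bsub>M\<^esub>p\<in>I. hc0 (u p) .[M] snd p)"
    by (rule M.M.finsum_cong') (use cs hA(1) I_facts(4) in auto)
  also have "... = \<zero>[M]"
    using comb_component[OF u(1), of 0] Q.component_homogeneous[OF Q.piece_sub(2)] u(2) by simp
  finally have "e i .[M] (\<Oplus>\<^bsub>M\<^esub>p\<in>I. scal (c p) .[M] snd p) = \<zero>[M]" using i by simp
  moreover have "e i .[M] (\<Oplus>\<^bsub>M\<^esub>p\<in>I. scal (c p) .[M] snd p) = (\<Oplus>\<^bsub>M\<^esub>p\<in>I. e i .[M] (scal (c p) .[M] snd p))"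
    by (rule M.smult_finsum[OF i(2)]) (use cM in blast)
  moreover have "(\<Oplus>\<^bsub>M\<^esub>p\<in>I. e i .[M] (scal (c p) .[M] snd p)) = (\<Oplus>\<^bsub>M\<^esub>p\<in>Pair i ` X i. scal (c p) .[M] snd p)"
  proof (rule M.M.add.finprod_mono_neutral_cong_right[OF finite_I])
    show "Pair i ` X i \<subseteq> I" using i by (auto simp: I_def)
    have ep: "e i .[M] (scal (c p) .[M] snd p) = scal (c p) .[M] ((e i *[A] e (fst p)) .[M] snd p)" if p: "p : I" for p
    proof -
      note f = I_facts[OF p]
      have "e i .[M] (scal (c p) .[M] snd p) = scal (c p) .[M] (e i .[M] snd p)"
        using i f(4) c(1)[OF p] by (simp add: M.smult_assoc[symmetric] scal_mult)
      also have "e i .[M] snd p = (e i *[A] e (fst p)) .[M] snd p" using i f by (simp add: M.smult_assoc)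
      finally show ?thesis .
    qed
    show "e i .[M] (scal (c p) .[M] snd p) = \<zero>[M]" if "p : I - Pair i ` X i" for p
    proof -
      have p: "p : I" "i ~= fst p" using that by (auto simp: I_def)
      show ?thesis using ep[OF p(1)] graded_facts(6)[OF i(1) I_facts(1)[OF p(1)] p(2)] I_facts(4)[OF p(1)] c(1)[OF p(1)] by simp
    qed
    show "e i .[M] (scal (c p) .[M] snd p) = scal (c p) .[M] snd p" if "p : Pair i ` X i" for p
    proof -
      have p: "p : I" "i = fst p" using that i by (auto simp: I_def)
      show ?thesis using ep[OF p(1)] I_facts[OF p(1)] p(2) by simp
    qed
    show "(%p. e i .[M] (scal (c p) .[M] snd p)) : I \<rightarrow> carrier M" using cM i(2) by blast
  qed
  moreover have "(\<Oplus>\<^bsub>M\<^esub>p\<in>Pair i ` X i. scal (c p) .[M] snd p) = (\<Oplus>\<^bsub>M\<^esub>v\<in>X i. scal (c (i, v)) .[M] v)"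
  proof -
    have "(%p. scal (c p) .[M] snd p) : Pair i ` X i \<rightarrow> carrier M" using cM i by (auto simp: I_def)
    from M.M.finsum_reindex[OF this] show ?thesis by (simp add: inj_on_def)
  qed
  ultimately have "(\<Oplus>\<^bsub>M\<^esub>v\<in>X i. scal (c (i, v)) .[M] v) = \<zero>[M]" by simp
  moreover have "(%v. c (i, v)) : X i \<rightarrow> carrier K" using c(1) i by (auto simp: I_def)
  moreover have "snd q : X i" unfolding i_def using q by (auto simp: I_def)
  ultimately have "c (i, snd q) = \<zero>[K]" using X_indep[OF i(1), of "%v. c (i, v)" "snd q"] by blast
  then have cq: "c q = \<zero>[K]" by (simp add: i_def)
  have h0: "hc0 (u q) *[A] e i = \<zero>[A]" using c(2)[OF q] i cq by (simp add: i_def)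
  have uq: "u q : carrier A" by (rule F_D(1)[OF u(1) q])
  have jc: "u q -[A] hc0 (u q) : J 1" by (rule hc0_props(3)[OF uq])
  have "(hc0 (u q) +[A] (u q -[A] hc0 (u q))) *[A] e i = (u q -[A] hc0 (u q)) *[A] e i"
    using h0 i(2) hA(1)[OF q] jc by (simp add: A.l_distr)
  then have "u q = (u q -[A] hc0 (u q)) *[A] e i"
    unfolding hc0_decomp[OF uq, symmetric] i_def F_D(2)[OF u(1) q] .
  moreover have "(u q -[A] hc0 (u q)) *[A] e i : J 1" using J_mult[OF jc, of "e i" 0] i(2) J_0 by simp
  ultimately show ?thesis by (rule forw_subst[where P = "%x. x : J 1"])
qed

text \<open>Induction on the support, splitting off one coordinate at a time as a radical multiple
  of a generator.\<close>

lemma F_J_in_JM: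
  assumes "u : carrier F" "!!q. q : I ==> u q : J 1"
  shows "u : JM 1 F"
proof -
  note JD = F.submoduleD[OF JM_submodule[OF F_left_module, of 1]]
  have "u : JM 1 F" if "finite Y" "Y \<subseteq> I" "u : carrier F" "\<forall>q\<in>I. u q : J 1" "\<forall>q\<in>I - Y. u q = \<zero>[A]" for Y u
    using that
  proof (induction Y arbitrary: u rule: finite_induct)
    case empty
    have "u = \<zero>[F]" by (rule F_eqI[OF empty(2) F.M.zero_closed]) (use empty(4) in simp)
    then show ?case using JD(2) by simp
  next
    case (insert q Y)
    have q: "q : I" using insert by blast
    define u' where "u' = (\<lambda>p\<in>I. if p = q then \<zero>[A] else u p)"
    have u': "u' : carrier F"
      unfolding u'_def by (rule F_I) (use F_D[OF insert.prems(2)] I_facts in auto)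
    have "u' : JM 1 F"
      by (rule insert.IH[OF _ u']) (use insert.prems J_zero in \<open>auto simp: u'_def\<close>)
    moreover have "single q (e (fst q)) : carrier F" by (rule single_F[OF q]) (use I_facts[OF q] in simp_all)
    then have sq: "u q .[F] single q (e (fst q)) : JM 1 F" using JM_gen[OF F_left_module] insert.prems(3) q by blast
    moreover have "u = u' +[F] u q .[F] single q (e (fst q))"
    proof (rule F_eqI[OF insert.prems(2)])
      show "u' +[F] u q .[F] single q (e (fst q)) : carrier F" using sq u' JD(1) F.M.a_closed by blast
      fix p assume p: "p : I"
      then show "u p = (u' +[F] u q .[F] single q (e (fst q))) p"
        using F_D[OF insert.prems(2) p] F_D[OF insert.prems(2) q] by (auto simp: u'_def single_def)
    qed
    ultimately show ?case using JD(3) by metis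
  qed
  then show ?thesis using assms finite_I by blast
qed

text \<open>Lifting against \<open>comb\<close> requires a copy of \<open>F\<close> in
  \<open>nat => 'k\<close>; index and coordinate are packed into one natural number.\<close>

lemma F_embedding: "\<exists>fi :: (nat \<times> (nat => 'k) => 'a) => nat => 'k. inj_on fi (carrier F)"
proof -
  obtain fi :: "'a => nat => 'k" where fi: "inj_on fi (carrier A)"
    using fin_dim_embedding[OF AV.vectorspace_axioms fin_A] by blast
  obtain h :: "nat \<times> (nat => 'k) => nat" where h: "inj_on h I" using finite_imp_inj_to_nat_seg[OF finite_I] by blast
  let ?\<Phi> = "%u m. fi (u (the_inv_into I h (fst (prod_decode m)))) (snd (prod_decode m))"
  have "inj_on ?\<Phi> (carrier F)"
  proof (rule inj_onI)
    fix u v assume uv: "u : carrier F" "v : carrier F" "?\<Phi> u = ?\<Phi> v"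
    show "u = v"
    proof (rule F_eqI[OF uv(1,2)])
      fix q assume q: "q : I"
      have "fi (u q) k = fi (v q) k" for k
        using fun_cong[OF uv(3), of "prod_encode (h q, k)"] q h by (simp add: the_inv_into_f_f)
      then have "fi (u q) = fi (v q)" by (rule ext)
      then show "u q = v q" by (rule inj_onD[OF fi]) (use F_D(1) uv q in blast)+
    qed
  qed
  then show ?thesis by blast
qed

text \<open>A section of the evaluation map is onto by Nakayama, because the kernel of the evaluation
  consists of functions with values in the radical.\<close>

lemma comb_inj: "inj_on comb (carrier F)"
proof -
  obtain fi :: "(nat \<times> (nat => 'k) => 'a) => nat => 'k" where fi: "inj_on fi (carrier F)" using F_embedding by blast
  interpret c: copied A F fi by (rule copied_intro[OF F_left_module fi])
  have h: "(%x. comb (c.ps x)) : module_hom A c.M' M" by (rule module_hom_comp[OF c.hom_from comb_hom])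
  have s: "(%x. comb (c.ps x)) ` carrier c.M' = carrier M"
    using image_image[of comb c.ps "carrier c.M'"] the_inv_into_onto[OF fi] comb_surj
    unfolding c.carrier_copy by simp
  obtain t where t: "t : module_hom A M c.M'" "!!x. x : carrier M ==> comb (c.ps (t x)) = x"
    by (rule projective_lift[OF projective c.left_module_copy M.left_module h s module_hom_id]) (rule that)
  have th: "(%x. c.ps (t x)) : module_hom A M F" by (rule module_hom_comp[OF t(1) c.hom_from])
  interpret t: lmod_hom A M F "%x. c.ps (t x)" by (rule lmod_homI[OF M.left_module F_left_module th])
  have L: "(%x. c.ps (t x)) ` carrier M = carrier F"
  proof (rule nakayama[OF F_left_module t.image_submodule[OF M.carrier_submodule]])
    fix u assume u: "u : carrier F"
    let ?w = "c.ps (t (comb u))"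
    have w: "?w : carrier F" "comb ?w = comb u"
      by (rule t.closed[OF comb.closed[OF u]], rule t(2)[OF comb.closed[OF u]])
    have k: "u -[F] ?w : carrier F" by (rule F.M.minus_closed[OF u w(1)])
    have "comb (u -[F] ?w) = comb u -[M] comb ?w" by (rule comb.minus[OF u w(1)])
    also have "... = \<zero>[M]" unfolding w(2) a_minus_def by (rule M.M.r_neg[OF comb.closed[OF u]])
    finally have kJ: "u -[F] ?w : JM 1 F" using comb_kernel_J[OF k] by (intro F_J_in_JM[OF k])
    have wi: "?w : (%x. c.ps (t x)) ` carrier M" by (rule image_eqI[OF refl comb.closed[OF u]])
    show "\<exists>v\<in>(%x. c.ps (t x)) ` carrier M. \<exists>w\<in>JM 1 F. u = v +[F] w"
      by (rule bexI[OF bexI[OF _ kJ] wi]) (rule F.M.diff_add_left[OF u w(1), symmetric])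
  qed
  show ?thesis
  proof (rule inj_onI)
    fix u v assume uv: "u : carrier F" "v : carrier F" "comb u = comb v"
    have "u : (%x. c.ps (t x)) ` carrier M" "v : (%x. c.ps (t x)) ` carrier M" unfolding L by (rule uv)+
    then show "u = v"
    proof (elim imageE)
      fix x y assume xy: "u = c.ps (t x)" "x : carrier M" "v = c.ps (t y)" "y : carrier M"
      have "x = y" using uv(3) unfolding xy(1,3) t(2)[OF xy(2)] t(2)[OF xy(4)] .
      then show "u = v" unfolding xy(1,3) by (rule arg_cong)
    qed
  qed
qed

text \<open>The set \<open>Y\<close> permits dimension counts by induction on the support. The
  family \<open>W\<close> is later \<open>peirce j s\<close>, for a graded piece at a vertex, and
  \<open>column\<close>, for the whole module.\<close>

definition "FW W Y = {u : carrier F. (\<forall>q\<in>Y. u q : W (fst q)) & (\<forall>q\<in>I - Y. u q = \<zero>[A])}"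

context
  fixes W :: "nat => 'a set"
  assumes W: "i : {1..n} ==> Module.submodule (W i) K A" "i : {1..n} ==> w : W i ==> w *[A] e i = w"
begin

lemma W_D:
  assumes "i : {1..n}"
  shows "W i \<subseteq> carrier A" "\<zero>[A] : W i" "x : W i ==> y : W i ==> x +[A] y : W i"
    "c : carrier K ==> x : W i ==> c .[A] x : W i"
  using submodule_convert[OF AV.vectorspace_axioms W(1)[OF assms]]
  by (auto simp: LinearCombinations.submodule_def)

lemma FW_subspace: "Y \<subseteq> I ==> Module.submodule (FW W Y) K (vs_of F)"
proof (rule subspaceI[OF F_left_module])
  assume Y: "Y \<subseteq> I"
  show "FW W Y \<subseteq> carrier F" by (auto simp: FW_def)
  have qI: "q : I" "fst q : {1..n}" if "q : Y" for q using that Y I_facts(1)[of q] by auto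
  show "\<zero>[F] : FW W Y" unfolding FW_def using F.M.zero_closed W_D(2) qI by simp
  show "u +[F] v : FW W Y" if "u : FW W Y" "v : FW W Y" for u v
    using that F.M.a_closed[of u v] W_D(3)[OF qI(2)] qI(1) unfolding FW_def by simp
  show "scal c .[F] u : FW W Y" if "c : carrier K" "u : FW W Y" for c u
    using that F.smult_closed[of "scal c" u] W_D(4)[OF qI(2)] qI(1) F_D(1)[of u]
    unfolding FW_def by (simp add: scal_mult)
qed

lemma FW_dim:
  assumes "finite Y" "Y \<subseteq> I"
  shows "vectorspace.fin_dim K ((vs_of F)(|carrier := FW W Y|)) &
    vectorspace.dim K ((vs_of F)(|carrier := FW W Y|)) = (\<Sum>q\<in>Y. vectorspace.dim K (A(|carrier := W (fst q)|)))"
  using assms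
proof (induction Y rule: finite_induct)
  case empty
  have "u = \<zero>[F]" if "u : FW W {}" for u
    by (rule F_eqI[OF _ F.M.zero_closed]) (use that in \<open>auto simp: FW_def\<close>)
  moreover have "\<zero>[F] : FW W {}" using F.M.zero_closed by (auto simp: FW_def)
  ultimately have "FW W {} = {\<zero>[F]}" by blast
  moreover have "fd (F(|carrier := {\<zero>[F]}|))" "dimm (F(|carrier := {\<zero>[F]}|)) = 0"
    using zero_dim[OF F.submodule_left_module[OF F.zero_submodule]] by simp_all
  ultimately show ?case by (simp add: dimm_carrier)
next
  case (insert q Y)
  have q: "q : I" and Y: "Y \<subseteq> I" using insert.prems by auto
  note iq = I_facts(1)[OF q]
  let ?V = "(vs_of F)(|carrier := FW W (insert q Y)|)" and ?W = "A(|carrier := W (fst q)|)"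
  have V: "vectorspace K ?V" by (rule vectorspace_subspace[OF vs_of_vectorspace[OF F_left_module] FW_subspace[OF insert.prems]])
  have Wv: "vectorspace K ?W" by (rule vectorspace_subspace[OF AV.vectorspace_axioms W(1)[OF iq]])
  have Wf: "vectorspace.fin_dim K ?W" by (rule subspace_dim(1)[OF AV.vectorspace_axioms W(1)[OF iq] fin_A])
  have h: "(%u. u q) : module_hom K ?V ?W"
    by (rule module_homI) (use q F_D(1) in \<open>auto simp: FW_def scal_mult\<close>)
  have s: "(%u. u q) ` carrier ?V = carrier ?W"
  proof
    show "carrier ?W \<subseteq> (%u. u q) ` carrier ?V"
    proof
      fix w assume "w : carrier ?W"
      then have w: "w : W (fst q)" by simp
      have "single q w : carrier F" by (rule single_F[OF q]) (use w W_D(1)[OF iq] W(2)[OF iq] in auto)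
      then have "single q w : FW W (insert q Y)" using w q Y W_D(2) I_facts(1) by (auto simp: FW_def single_def)
      moreover have "single q w q = w" using q by (simp add: single_def)
      ultimately show "w : (%u. u q) ` carrier ?V" by (intro image_eqI[of _ _ "single q w"]) simp_all
    qed
  qed (auto simp: FW_def)
  have k: "{v : carrier ?V. v q = \<zero>[?W]} = FW W Y"
    using q insert.hyps(2) Y W_D(2)[OF iq] by (auto simp: FW_def)
  have r: "?V(|carrier := FW W Y|) = (vs_of F)(|carrier := FW W Y|)" by simp
  have f: "vectorspace.fin_dim K ?V"
    using fin_dim_extension[OF V Wv h s Wf] insert.IH[OF Y] unfolding k r by blast
  show ?case
    using f rank_nullity_kernel(2)[OF V Wv h f s] insert.IH[OF Y] insert.hyps unfolding k r by simp
qed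

lemma comb_FW_dim:
  "vectorspace.dim K ((vs_of M)(|carrier := comb ` FW W I|)) =
    (\<Sum>i\<in>{1..n}. card (X i) * vectorspace.dim K (A(|carrier := W i|)))"
proof -
  note FI = FW_dim[OF finite_I subset_refl] and sub = FW_subspace[OF subset_refl]
  have FF: "FW W I \<subseteq> carrier F" by (auto simp: FW_def)
  have fs: "\<zero>[F] : FW W I" "!!u v. u : FW W I ==> v : FW W I ==> u +[F] v : FW W I"
    "!!c u. c : carrier K ==> u : FW W I ==> scal c .[F] u : FW W I"
    using submodule_convert[OF vs_of_vectorspace[OF F_left_module] sub]
    unfolding LinearCombinations.submodule_def vs_of_simps by blast+
  have "Module.submodule (comb ` FW W I) K (vs_of M)"
  proof (rule subspaceI[OF M.left_module])
    show "comb ` FW W I \<subseteq> carrier M" using FF by blast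
    show "\<zero>[M] : comb ` FW W I" using fs(1) comb.zero by (metis imageI)
  next
    fix x y assume "x : comb ` FW W I" "y : comb ` FW W I"
    then obtain u v where uv: "u : FW W I" "v : FW W I" "x = comb u" "y = comb v" by blast
    then have "x +[M] y = comb (u +[F] v)" using comb.add[of u v] FF[THEN subsetD] by simp
    then show "x +[M] y : comb ` FW W I" using fs(2) uv by blast
  next
    fix c x assume c: "c : carrier K" and "x : comb ` FW W I"
    then obtain u where u: "u : FW W I" "x = comb u" by blast
    then have "scal c .[M] x = comb (scal c .[F] u)" using comb.smult[of "scal c" u] FF c by auto
    then show "scal c .[M] x : comb ` FW W I" using fs(3) c u by blast
  qed
  note Mv = vectorspace_subspace[OF vs_of_vectorspace[OF M.left_module] this]
  note Fv = vectorspace_subspace[OF vs_of_vectorspace[OF F_left_module] sub]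
  have h: "comb : module_hom K ((vs_of F)(|carrier := FW W I|)) ((vs_of M)(|carrier := comb ` FW W I|))"
    by (rule module_hom_restrict[OF hom_linear[OF F_left_module comb_hom]]) (use FF in auto)
  have b: "bij_betw comb (carrier ((vs_of F)(|carrier := FW W I|))) (carrier ((vs_of M)(|carrier := comb ` FW W I|)))"
    using inj_on_subset[OF comb_inj FF] by (simp add: bij_betw_def)
  have "vectorspace.dim K ((vs_of M)(|carrier := comb ` FW W I|)) = (\<Sum>q\<in>I. vectorspace.dim K (A(|carrier := W (fst q)|)))"
    using vectorspace_iso(2)[OF Fv Mv h b] FI by simp
  also have "... = (\<Sum>i\<in>{1..n}. \<Sum>v\<in>X i. vectorspace.dim K (A(|carrier := W i|)))"
    unfolding I_def using X_finite by (subst sum.Sigma) (auto intro: sum.cong)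
  finally show ?thesis by simp
qed

end

lemma comb_peirce:
  assumes j: "j : {1..n}"
  shows "comb ` FW (peirce j s) I = {x : Q (s + r). e j .[M] x = x}"
proof (intro equalityI subsetI)
  have ej: "e j : carrier A" by (rule graded_facts(3)[OF j])
  fix x assume "x : comb ` FW (peirce j s) I"
  then obtain u where u: "u : carrier F" "!!q. q : I ==> u q : peirce j s (fst q)" "x = comb u" by (auto simp: FW_def)
  have "comb u : Q (s + r)"
    unfolding comb_def
    by (rule M.M.finsum_in[OF Q.piece_sub(1,2,3)]) (use u(2) act[OF _ I_facts(3)] in \<open>auto simp: peirce_def\<close>)
  moreover have "e j .[F] u = u"
    by (rule F_eqI[OF F.smult_closed[OF ej u(1)] u(1)]) (use u(2) in \<open>simp add: peirce_def\<close>)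
  then have "e j .[M] comb u = comb u" using comb.smult[OF ej u(1)] by simp
  ultimately show "x : {x : Q (s + r). e j .[M] x = x}" using u(3) by simp
next
  have ej: "e j : carrier A" "e j *[A] e j = e j" using graded_facts(3,4)[OF j] by auto
  fix x assume "x : {x : Q (s + r). e j .[M] x = x}"
  then have x: "x : Q (s + r)" "e j .[M] x = x" by auto
  obtain u where u: "u : carrier F" "x = comb u" using Q.piece_carrier[OF x(1)] unfolding comb_surj[symmetric] by blast
  let ?h = "%q. homog_component A G s (u q)"
  have h: "?h q : G s" "?h q : carrier A" if "q : I" for q
    by (rule G.component_closed[OF F_D(1)[OF u(1) that]],
        rule G.piece_carrier[OF G.component_closed[OF F_D(1)[OF u(1) that]]])
  \<comment> \<open>Project the coefficients of \<open>u\<close> to degree \<open>s\<close> and to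
    the corner between \<open>e j\<close> and \<open>e (fst q)\<close>. The value under
    \<open>comb\<close> stays \<open>x\<close>, as \<open>x\<close> is homogeneous and fixed by
    \<open>e j\<close>.\<close>
  define v where "v = (\<lambda>q\<in>I. e j *[A] ?h q *[A] e (fst q))"
  have vp: "v q : peirce j s (fst q)" if q: "q : I" for q
  proof -
    note f = I_facts[OF q]
    have "e j *[A] ?h q : G s" using graded_facts(1)[OF e_G0[OF j] h(1)[OF q]] by simp
    then have "e j *[A] ?h q *[A] e (fst q) : G s" using graded_facts(1)[OF _ e_G0[OF f(1)], of _ s] by simp
    moreover have "e j *[A] (e j *[A] ?h q *[A] e (fst q)) = e j *[A] ?h q *[A] e (fst q)"
      using ej h(2)[OF q] f by (simp add: A.m_assoc[symmetric])
    moreover have "e j *[A] ?h q *[A] e (fst q) *[A] e (fst q) = e j *[A] ?h q *[A] e (fst q)"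
      using ej h(2)[OF q] f by (simp add: A.m_assoc)
    ultimately show ?thesis using q by (simp add: v_def peirce_def)
  qed
  have "e j *[A] ?h q *[A] e (fst q) : carrier A & e j *[A] ?h q *[A] e (fst q) *[A] e (fst q) = e j *[A] ?h q *[A] e (fst q)"
    if "q : I" for q
    using vp[OF that] that G.piece_carrier[of "e j *[A] ?h q *[A] e (fst q)" s] by (simp add: v_def peirce_def)
  then have vF: "v : carrier F" unfolding v_def by (intro F_I) blast+
  have "comb v = (\<Oplus>\<^bsub>M\<^esub>q\<in>I. e j .[M] (?h q .[M] snd q))"
    unfolding comb_def
  proof (rule M.M.finsum_cong')
    show "v q .[M] snd q = e j .[M] (?h q .[M] snd q)" if q: "q : I" for q
    proof -
      note f = I_facts[OF q]
      have "v q .[M] snd q = e j .[M] (?h q .[M] (e (fst q) .[M] snd q))"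
        unfolding v_def using q ej h(2)[OF q] f(2,4) by (simp add: M.smult_assoc)
      then show ?thesis unfolding f(5) .
    qed
    show "(%q. e j .[M] (?h q .[M] snd q)) : I \<rightarrow> carrier M" using ej(1) h(2) I_facts(4) by blast
  qed simp
  also have "... = e j .[M] (\<Oplus>\<^bsub>M\<^esub>q\<in>I. ?h q .[M] snd q)"
    by (rule M.smult_finsum[symmetric, OF ej(1)]) (use h(2) I_facts(4) in blast)
  also have "... = e j .[M] homog_component M Q (s + r) (comb u)" unfolding comb_component[OF u(1)] ..
  also have "homog_component M Q (s + r) (comb u) = x"
    using Q.component_homogeneous[OF x(1), of "s + r"] u(2) by simp
  finally have "comb v = x" using x(2) by simp
  moreover have "v : FW (peirce j s) I" using vF vp by (simp add: FW_def)
  ultimately show "x : comb ` FW (peirce j s) I" by blast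
qed

lemma comb_column: "comb ` FW column I = carrier M"
proof -
  have "FW column I = carrier F" using F_D by (auto simp: FW_def column_def)
  then show ?thesis using comb_surj by simp
qed

end

section \<open>Hilbert functions of the terms of the resolution\<close>

context koszul_resolution
begin

text \<open>The Hilbert function of \<open>P r\<close> at vertex \<open>j\<close>: the dimension of
  \<open>e j P r\<close> in degree \<open>t\<close>.\<close>

definition H :: "nat => nat => nat => nat" where
  "H r t j = vectorspace.dim K ((vs_of (P r))(|carrier := {x : Q r t. e j .[P r] x = x}|))"

lemma peirce_part_subspace:
  assumes j: "j : {1..n}"
  shows "Module.submodule {x : Q r t. e j .[P r] x = x} K (vs_of (P r))"
proof -
  interpret S: generated K A G n e l "P r" "Q r" r by (rule P_generated)
  have ej: "e j : carrier A" by (rule graded_facts(3)[OF j])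
  show ?thesis
  proof (rule subspaceI[OF P_left_module])
    fix c x assume c: "c : carrier K" and x: "x : {x : Q r t. e j .[P r] x = x}"
    then have xc: "x : carrier (P r)" using S.Q.piece_carrier by blast
    have "scal c : G 0" by (rule G_scal[OF c one_G0])
    moreover have "e j .[P r] (scal c .[P r] x) = scal c .[P r] (e j .[P r] x)"
      using c ej xc by (simp add: S.M.smult_assoc[symmetric] scal_mult)
    ultimately show "scal c .[P r] x : {x : Q r t. e j .[P r] x = x}"
      using S.act[of "scal c" 0 x t] x by simp
  qed (use S.Q.piece_sub ej in \<open>auto simp: S.M.smult_r_distr\<close>)
qed

lemma generated_basis_exists: "\<exists>X. generated_basis K A G n e l (P r) (Q r) r X & (\<forall>i\<in>{1..n}. card (X i) = H r r i)"
proof -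
  interpret S: generated K A G n e l "P r" "Q r" r by (rule P_generated)
  let ?N = "%i. {x : Q r r. e i .[P r] x = x}"
  let ?B = "%i X. finite X & X \<subseteq> ?N i & card X = H r r i &
    (\<forall>x\<in>?N i. \<exists>c\<in>X \<rightarrow> carrier K. x = (\<Oplus>\<^bsub>P r\<^esub>v\<in>X. scal (c v) .[P r] v)) &
    (\<forall>c\<in>X \<rightarrow> carrier K. (\<Oplus>\<^bsub>P r\<^esub>v\<in>X. scal (c v) .[P r] v) = \<zero>[P r] --> (\<forall>v\<in>X. c v = \<zero>[K]))"
  have "\<forall>i\<in>{1..n}. \<exists>X. ?B i X"
  proof
    fix i assume i: "i : {1..n}"
    obtain X where *: "finite X" "X \<subseteq> ?N i" "card X = vectorspace.dim K ((vs_of (P r))(|carrier := ?N i|))"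
      "!!x. x : ?N i ==> \<exists>c\<in>X \<rightarrow> carrier K. x = (\<Oplus>\<^bsub>P r\<^esub>v\<in>X. scal (c v) .[P r] v)"
      "!!c v. c : X \<rightarrow> carrier K ==> (\<Oplus>\<^bsub>P r\<^esub>v\<in>X. scal (c v) .[P r] v) = \<zero>[P r] ==> v : X ==> c v = \<zero>[K]"
      by (rule subspace_basis[OF P_left_module P_fd peirce_part_subspace[OF i]]) (rule that)
    show "\<exists>X. ?B i X" unfolding H_def
      by (intro exI[of _ X] conjI ballI impI) (rule *; assumption)+
  qed
  from bchoice[OF this] obtain X where X': "\<forall>i\<in>{1..n}. ?B i (X i)" by (rule exE)
  note X = bspec[OF X']
  \<comment> \<open>Indices outside the vertex range get the empty set, so that finiteness and
    membership in \<open>Q r r\<close> hold for every index.\<close>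
  let ?X = "%i. if i : {1..n} then X i else {}"
  have "generated_basis K A G n e l (P r) (Q r) r ?X"
  proof (intro generated_basis.intro generated_basis_axioms.intro)
    show "generated K A G n e l (P r) (Q r) r" by (rule P_generated)
    show "projective A (P r)" by (rule resD(1))
    show "finite (?X i)" for i using X[of i] by simp
    show "v : Q r r" if "v : ?X i" for i v
    proof (cases "i : {1..n}")
      case True
      then show ?thesis using X[OF True] that by auto
    next
      case False
      then show ?thesis using that by (simp only: if_False empty_iff)
    qed
  next
    fix i v assume i: "i : {1..n}" and "v : ?X i"
    then show "e i .[P r] v = v" using X[OF i] by auto
  next
    fix i x assume i: "i : {1..n}" and x: "x : Q r r" "e i .[P r] x = x"
    have "?X i = X i" using i by simp
    then show "\<exists>c\<in>?X i \<rightarrow> carrier K. x = (\<Oplus>\<^bsub>P r\<^esub>v\<in>?X i. scal (c v) .[P r] v)" using X[OF i] x by simp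
  next
    fix i c v assume i: "i : {1..n}" and c: "c : ?X i \<rightarrow> carrier K" "(\<Oplus>\<^bsub>P r\<^esub>v\<in>?X i. scal (c v) .[P r] v) = \<zero>[P r]" "v : ?X i"
    have "?X i = X i" using i by simp
    then show "c v = \<zero>[K]" using X[OF i] c by simp
  qed
  then show ?thesis using X by (intro exI[of _ ?X]) simp
qed

text \<open>\<open>P r\<close> is a sum of projectives \<open>A e i\<close> shifted to degree
  \<open>r\<close>, with \<open>H r r i\<close> copies of each.\<close>

lemma H_shift:
  assumes j: "j : {1..n}"
  shows "H r (s + r) j = (\<Sum>i\<in>{1..n}. H r r i * vectorspace.dim K (A(|carrier := peirce j s i|)))"
proof -
  obtain X where X: "generated_basis K A G n e l (P r) (Q r) r X" "\<forall>i\<in>{1..n}. card (X i) = H r r i"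
    using generated_basis_exists by blast
  interpret X: generated_basis K A G n e l "P r" "Q r" r X by (rule X(1))
  have "H r (s + r) j = vectorspace.dim K ((vs_of (P r))(|carrier := X.comb ` X.FW (peirce j s) X.I|))"
    unfolding H_def X.comb_peirce[OF j] ..
  also have "... = (\<Sum>i\<in>{1..n}. card (X i) * vectorspace.dim K (A(|carrier := peirce j s i|)))"
    by (rule X.comb_FW_dim) (use peirce_subspace[OF j] in \<open>auto simp: peirce_def\<close>)
  finally show ?thesis using X(2) by simp
qed

lemma P_dim: "dimm (P r) = (\<Sum>i\<in>{1..n}. H r r i * vectorspace.dim K (A(|carrier := column i|)))"
proof -
  obtain X where X: "generated_basis K A G n e l (P r) (Q r) r X" "\<forall>i\<in>{1..n}. card (X i) = H r r i"
    using generated_basis_exists by blast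
  interpret X: generated_basis K A G n e l "P r" "Q r" r X by (rule X(1))
  have "dimm (P r) = vectorspace.dim K ((vs_of (P r))(|carrier := X.comb ` X.FW column X.I|))"
    unfolding dimm_def X.comb_column by (simp add: restrict_scalars_def)
  also have "... = (\<Sum>i\<in>{1..n}. card (X i) * vectorspace.dim K (A(|carrier := column i|)))"
    by (rule X.comb_FW_dim) (use column_subspace in \<open>auto simp: column_def\<close>)
  finally show ?thesis using X(2) by simp
qed

end

section \<open>Rationality of the Poincare series\<close>

lemma dim_trivial:
  assumes "vectorspace K V" shows "vectorspace.dim K (V(|carrier := {\<zero>[V]}|)) = 0"
proof -
  interpret V: vectorspace K V by fact
  have "Module.submodule {\<zero>[V]} K V" by (rule V.module.submoduleI) auto
  then interpret N: vectorspace K "V(|carrier := {\<zero>[V]}|)" by (rule vectorspace_subspace[OF assms])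
  have "N.span {\<zero>[V]} = {\<zero>[V]}"
    using N.span_is_subset2[of "{\<zero>[V]}"] N.in_own_span[of "{\<zero>[V]}"] by auto
  then show ?thesis using N.dim0I by simp
qed

lemma dim_line:
  assumes "vectorspace K V" "Module.submodule N K V" "v : N" "v ~= \<zero>[V]"
    "!!x. x : N ==> \<exists>c\<in>carrier K. x = c .[V] v"
  shows "vectorspace.dim K (V(|carrier := N|)) = 1"
proof -
  interpret N: vectorspace K "V(|carrier := N|)" by (rule vectorspace_subspace[OF assms(1,2)])
  have "LinearCombinations.submodule K (N.span {v}) (V(|carrier := N|))"
    by (rule N.span_is_submodule) (use assms(3) in simp)
  then have sm: "!!c x. c : carrier K ==> x : N.span {v} ==> c .[V] x : N.span {v}" "N.span {v} \<subseteq> N"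
    by (auto simp: LinearCombinations.submodule_def)
  have v: "v : N.span {v}" using N.in_own_span[of "{v}"] assms(3) by auto
  have "N \<subseteq> N.span {v}"
  proof
    fix x assume "x : N"
    then obtain c where c: "c : carrier K" "x = c .[V] v" using assms(5) by blast
    show "x : N.span {v}" unfolding c(2) by (rule sm(1)[OF c(1) v])
  qed
  then have "N.gen_set {v}" using sm(2) by auto
  then show ?thesis using N.dim1I[of v] assms(3,4) by simp
qed

context koszul_resolution
begin

abbreviation "part r t j \<equiv> {x : Q r t. e j .[P r] x = x}"

lemma part_trivial:
  assumes "t < r" "j : {1..n}" shows "part r t j = {\<zero>[P r]}"
proof -
  interpret S: generated K A G n e l "P r" "Q r" r by (rule P_generated)
  have "part r t j \<subseteq> {\<zero>[P r]}" using S.degree_low[OF _ assms(1)] by blast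
  moreover have "\<zero>[P r] : part r t j" using S.Q.piece_sub(2)[of t] graded_facts(3)[OF assms(2)] by simp
  ultimately show ?thesis by blast
qed

lemma d_component:
  assumes y: "y : carrier (P (Suc r))"
  shows "homog_component (P r) (Q r) t (d r y) = d r (homog_component (P (Suc r)) (Q (Suc r)) t y)"
proof -
  interpret h: lmod_hom A "P (Suc r)" "P r" "d r" by (rule d_hom)
  interpret S: pieces "P (Suc r)" "Q (Suc r)" by (rule P_pieces)
  interpret T: pieces "P r" "Q r" by (rule P_pieces)
  obtain c N where c: "!!t. c t : Q (Suc r) t" "!!t. t \<ge> N ==> c t = \<zero>[P (Suc r)]" "y = (\<Oplus>\<^bsub>P (Suc r)\<^esub>t\<in>{..<N}. c t)"
    using S.pieces_exist[OF y] by metis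
  have "d r y = (\<Oplus>\<^bsub>P r\<^esub>t\<in>{..<N}. d r (c t))"
    unfolding c(3) by (rule h.finsum) (use S.piece_carrier[OF c(1)] in auto)
  moreover have "homog_component (P r) (Q r) t (\<Oplus>\<^bsub>P r\<^esub>t\<in>{..<N}. d r (c t)) = d r (c t)"
    by (rule T.component_sum) (use degree c(1,2) in \<open>auto simp: image_subset_iff\<close>)
  moreover have "homog_component (P (Suc r)) (Q (Suc r)) t y = c t"
    unfolding c(3) by (rule S.component_sum) (rule c(1), rule c(2))
  ultimately show ?thesis by simp
qed

text \<open>Exactness holds in each degree and at each vertex separately: project a preimage to
  degree \<open>t\<close> and multiply it by \<open>e j\<close>.\<close>

lemma part_lift:
  assumes j: "j : {1..n}" and x: "x : part r t j" "x : d r ` carrier (P (Suc r))"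
  shows "x : d r ` part (Suc r) t j"
proof -
  interpret h: lmod_hom A "P (Suc r)" "P r" "d r" by (rule d_hom)
  interpret S: generated K A G n e l "P (Suc r)" "Q (Suc r)" "Suc r" by (rule P_generated)
  interpret T: pieces "P r" "Q r" by (rule P_pieces)
  obtain y where y: "y : carrier (P (Suc r))" "x = d r y" using x(2) by blast
  define z where "z = homog_component (P (Suc r)) (Q (Suc r)) t y"
  have z: "z : Q (Suc r) t" "z : carrier (P (Suc r))"
    unfolding z_def using S.Q.component_closed[OF y(1)] S.Q.piece_carrier by blast+
  have ej: "e j : carrier A" "e j *[A] e j = e j" using graded_facts(3,4)[OF j] by auto
  have "d r z = x" unfolding z_def d_component[OF y(1), symmetric] y(2)[symmetric]
    using T.component_homogeneous[of x t t] x(1) by simp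
  then have "d r (e j .[P (Suc r)] z) = x" using h.smult[OF ej(1) z(2)] x(1) by simp
  moreover have "e j .[P (Suc r)] z : part (Suc r) t j"
    using S.act[OF e_G0[OF j] z(1)] ej z(2) by (simp add: h.M.smult_assoc[symmetric])
  ultimately show ?thesis by blast
qed

lemma d_part: "j : {1..n} ==> d r ` part (Suc r) t j \<subseteq> part r t j"
proof
  fix x assume j: "j : {1..n}" and "x : d r ` part (Suc r) t j"
  then obtain y where y: "y : Q (Suc r) t" "e j .[P (Suc r)] y = y" "x = d r y" by blast
  interpret h: lmod_hom A "P (Suc r)" "P r" "d r" by (rule d_hom)
  interpret S: pieces "P (Suc r)" "Q (Suc r)" by (rule P_pieces)
  have "e j .[P r] d r y = d r y" using h.smult[OF graded_facts(3)[OF j] S.piece_carrier[OF y(1)]] y(2) by simp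
  moreover have "d r y : Q r t" using degree y(1) by blast
  ultimately show "x : part r t j" using y(3) by simp
qed

text \<open>Dimension of the boundaries in \<open>P r\<close>; exactness splits \<open>H\<close>
  into two consecutive ones.\<close>

definition Z :: "nat => nat => nat => nat" where
  "Z r t j = vectorspace.dim K ((vs_of (P r))(|carrier := d r ` part (Suc r) t j|))"

lemma H_Suc:
  assumes j: "j : {1..n}" shows "H (Suc r) t j = Z (Suc r) t j + Z r t j"
proof -
  interpret h: lmod_hom A "P (Suc r)" "P r" "d r" by (rule d_hom)
  interpret S: pieces "P (Suc r)" "Q (Suc r)" by (rule P_pieces)
  interpret T: pieces "P r" "Q r" by (rule P_pieces)
  let ?V = "(vs_of (P (Suc r)))(|carrier := part (Suc r) t j|)" and ?W = "(vs_of (P r))(|carrier := d r ` part (Suc r) t j|)"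
  note vS = vs_of_vectorspace[OF P_left_module, of "Suc r"] and sub = peirce_part_subspace[OF j, of "Suc r" t]
  have pc: "x : carrier (P (Suc r))" if "x : part (Suc r) t j" for x using that S.piece_carrier by blast
  have cl: "\<zero>[P (Suc r)] : part (Suc r) t j" "!!x y. x : part (Suc r) t j ==> y : part (Suc r) t j ==> x +[P (Suc r)] y : part (Suc r) t j"
    "!!c x. c : carrier K ==> x : part (Suc r) t j ==> scal c .[P (Suc r)] x : part (Suc r) t j"
    using submodule_convert[OF vS sub] unfolding LinearCombinations.submodule_def vs_of_simps by blast+
  have "Module.submodule (d r ` part (Suc r) t j) K (vs_of (P r))"
  proof (rule subspaceI[OF P_left_module])
    show "d r ` part (Suc r) t j \<subseteq> carrier (P r)" using pc by blast
    show "\<zero>[P r] : d r ` part (Suc r) t j" by (rule image_eqI[OF _ cl(1)]) simp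
  next
    fix x y assume "x : d r ` part (Suc r) t j" "y : d r ` part (Suc r) t j"
    then show "x +[P r] y : d r ` part (Suc r) t j"
    proof (elim imageE)
      fix u v assume uv: "x = d r u" "u : part (Suc r) t j" "y = d r v" "v : part (Suc r) t j"
      show ?thesis by (rule image_eqI[OF _ cl(2)[OF uv(2,4)]]) (simp only: uv(1,3) h.add[OF pc[OF uv(2)] pc[OF uv(4)]])
    qed
  next
    fix c x assume c: "c : carrier K" and "x : d r ` part (Suc r) t j"
    then show "scal c .[P r] x : d r ` part (Suc r) t j"
    proof (elim imageE)
      fix u assume u: "x = d r u" "u : part (Suc r) t j"
      show ?thesis by (rule image_eqI[OF _ cl(3)[OF c u(2)]]) (simp only: u(1) h.smult[OF scal_closed[OF c] pc[OF u(2)]])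
    qed
  qed
  note W = vectorspace_subspace[OF vs_of_vectorspace[OF P_left_module] this]
  have f: "d r : module_hom K ?V ?W"
    by (rule module_hom_restrict[OF hom_linear[OF P_left_module resD(4)]]) (use pc in auto)
  have k: "{v : carrier ?V. d r v = \<zero>[?W]} = d (Suc r) ` part (Suc (Suc r)) t j"
  proof
    show "{v : carrier ?V. d r v = \<zero>[?W]} \<subseteq> d (Suc r) ` part (Suc (Suc r)) t j"
    proof
      fix v assume v: "v : {v : carrier ?V. d r v = \<zero>[?W]}"
      then have vp: "v : part (Suc r) t j" by simp
      moreover have "v : kernel_of (P (Suc r)) (P r) (d r)" using v pc[OF vp] by (simp add: kernel_of_def)
      ultimately show "v : d (Suc r) ` part (Suc (Suc r)) t j"
        using part_lift[OF j, of v "Suc r" t] resD(6) by blast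
    qed
    show "d (Suc r) ` part (Suc (Suc r)) t j \<subseteq> {v : carrier ?V. d r v = \<zero>[?W]}"
    proof
      fix v assume v: "v : d (Suc r) ` part (Suc (Suc r)) t j"
      interpret R: pieces "P (Suc (Suc r))" "Q (Suc (Suc r))" by (rule P_pieces)
      have "v : d (Suc r) ` carrier (P (Suc (Suc r)))" using v R.piece_carrier by blast
      then have "v : kernel_of (P (Suc r)) (P r) (d r)" unfolding resD(6) .
      moreover have "v : part (Suc r) t j" using v d_part[OF j] by blast
      ultimately show "v : {v : carrier ?V. d r v = \<zero>[?W]}" by (simp add: kernel_of_def)
    qed
  qed
  have "vectorspace.dim K ?V = vectorspace.dim K ?W + vectorspace.dim K (?V(|carrier := {v : carrier ?V. d r v = \<zero>[?W]}|))"
    by (rule rank_nullity_kernel(2)[OF vectorspace_subspace[OF vS sub] W f subspace_dim(1)[OF vS sub P_fd]]) simp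
  then show ?thesis unfolding k by (simp add: H_def Z_def)
qed

text \<open>In positive degree the augmentation vanishes, so everything is a boundary.\<close>

lemma H_0:
  assumes j: "j : {1..n}" and t: "1 <= t" shows "H 0 t j = Z 0 t j"
proof -
  interpret T: pieces "P 0" "Q 0" by (rule P_pieces)
  have "part 0 t j \<subseteq> d 0 ` part (Suc 0) t j"
  proof
    fix x assume x: "x : part 0 t j"
    then have "x : kernel_of (P 0) S0 ep" using augmentation[of t x] t T.piece_carrier by (auto simp: kernel_of_def)
    then have "x : d 0 ` carrier (P (Suc 0))" using resD(5) by simp
    then show "x : d 0 ` part (Suc 0) t j" by (rule part_lift[OF j x])
  qed
  then have "part 0 t j = d 0 ` part (Suc 0) t j" using d_part[OF j, of 0 t] by blast
  then show ?thesis by (simp add: H_def Z_def)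
qed

lemma Z_low:
  assumes j: "j : {1..n}" and "t <= r" shows "Z r t j = 0"
proof -
  interpret h: lmod_hom A "P (Suc r)" "P r" "d r" by (rule d_hom)
  have "part (Suc r) t j = {\<zero>[P (Suc r)]}" by (rule part_trivial) (use assms in auto)
  then have "d r ` part (Suc r) t j = {\<zero>[vs_of (P r)]}" by simp
  then show ?thesis unfolding Z_def by (simp only: dim_trivial[OF vs_of_vectorspace[OF P_left_module]])
qed

text \<open>By \<open>H_0\<close> and \<open>H_Suc\<close> the sum telescopes to
  \<open>Z t t j\<close> up to sign, which vanishes because \<open>P (Suc t)\<close> begins in
  degree \<open>t + 1\<close>.\<close>

lemma H_alternating:
  assumes j: "j : {1..n}" and t: "1 <= t"
  shows "(\<Sum>r\<le>t. (-1) ^ r * int (H r t j)) = 0"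
proof -
  have "(\<Sum>r\<le>m. (-1) ^ r * int (H r t j)) = (-1) ^ m * int (Z m t j)" for m
    by (induction m) (simp_all add: H_0[OF j t] H_Suc[OF j] algebra_simps)
  then show ?thesis using Z_low[OF j, of t t] by simp
qed

lemma peirce_0:
  assumes "j : {1..n}" "i : {1..n}"
  shows "vectorspace.dim K (A(|carrier := peirce j 0 i|)) = (if i = j then 1 else 0)"
proof -
  have ej: "e j : carrier A" "e j : G 0" "e j *[A] e j = e j" "e j ~= \<zero>[A]" "e i : carrier A"
    using graded_facts(3,4,5) e_G0 assms by auto
  have ex: "\<exists>c\<in>carrier K. x = c .[A] e j" if "x : peirce j 0 i" for x
  proof -
    have x: "x : G 0" "e j *[A] x = x" using that by (simp_all add: peirce_def)
    show ?thesis by (rule G0_e[OF x(1) assms(1)]) (use x(2) in \<open>auto intro: bexI\<close>)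
  qed
  show ?thesis
  proof (cases "i = j")
    case True
    have "e j : peirce j 0 i" using ej True by (simp add: peirce_def)
    then show ?thesis using dim_line[OF AV.vectorspace_axioms peirce_subspace[OF assms] _ ej(4) ex] True by simp
  next
    case False
    have "x = \<zero>[A]" if x: "x : peirce j 0 i" for x
    proof -
      obtain c where c: "c : carrier K" "x = c .[A] e j" using ex[OF x] by blast
      have "x *[A] e i = x" using x by (simp add: peirce_def)
      then show ?thesis unfolding c(2) using c(1) ej graded_facts(6)[OF assms(1,2)] False by (simp add: smult_mult)
    qed
    moreover have "\<zero>[A] : peirce j 0 i" using G.piece_sub(2) ej by (simp add: peirce_def)
    ultimately have "peirce j 0 i = {\<zero>[A]}" by blast
    then show ?thesis using False dim_trivial[OF AV.vectorspace_axioms] by simp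
  qed
qed

text \<open>With \<open>H_shift\<close> inserted, the alternating sums become a recurrence for the
  numbers \<open>H r r i\<close> of generators, and the dimensions of the terms are weighted sums of
  these.\<close>

lemma poincare_rational:
  "\<exists>q p. poly q 0 ~= 0 & fps_of_poly q * Abs_fps (%r. complex_of_real (real (dimm (P r)))) = fps_of_poly p"
proof -
  define \<beta> where "\<beta> r i = H r r (Suc i)" for r i
  \<comment> \<open>The value 0 outside the vertex range makes the vanishing above degree
    \<open>l\<close> hold for all indices, as the recurrence lemma demands; vertices are renumbered
    from 0.\<close>
  define a where "a s j i = (if i < n & j < n then vectorspace.dim K (A(|carrier := peirce (Suc j) s (Suc i)|)) else 0)" for s j i
  define w where "w i = vectorspace.dim K (A(|carrier := column (Suc i)|))" for i
  have shift: "(\<Sum>i\<in>{1..n}. f i) = (\<Sum>i<n. f (Suc i))" for f :: "nat => nat"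
    using sum.atLeast1_atMost_eq[of f n] by simp
  have "\<exists>q. poly q 0 ~= 0 & (\<forall>w :: nat => nat. \<exists>p.
    fps_of_poly q * Abs_fps (%r. complex_of_real (real (\<Sum>i<n. w i * \<beta> r i))) = fps_of_poly p)"
  proof (rule rational_of_recurrence[where a = a and l = l and n = n and \<beta> = \<beta>])
    show "a 0 j i = (if i = j then 1 else 0)" if "i < n" "j < n" for i j
      unfolding a_def using peirce_0[of "Suc j" "Suc i"] that by simp
  next
    fix t j :: nat assume t: "1 <= t" and j: "j < n"
    have j': "Suc j : {1..n}" using j by simp
    have eq: "(\<Sum>i<n. int (\<beta> r i) * int (a (t - r) j i)) = int (H r t (Suc j))" if r: "r <= t" for r
    proof -
      have "H r t (Suc j) = (\<Sum>i<n. H r r (Suc i) * vectorspace.dim K (A(|carrier := peirce (Suc j) (t - r) (Suc i)|)))"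
        using H_shift[OF j', of r "t - r"] r unfolding shift by simp
      also have "... = (\<Sum>i<n. \<beta> r i * a (t - r) j i)" by (rule sum.cong) (use j in \<open>simp_all add: \<beta>_def a_def\<close>)
      finally show ?thesis by simp
    qed
    have "(\<Sum>r\<le>t. (-1) ^ r * (\<Sum>i<n. int (\<beta> r i) * int (a (t - r) j i))) = (\<Sum>r\<le>t. (-1) ^ r * int (H r t (Suc j)))"
      by (rule sum.cong[OF refl]) (simp only: eq atMost_iff)
    then show "(\<Sum>r\<le>t. (-1) ^ r * (\<Sum>i<n. int (\<beta> r i) * int (a (t - r) j i))) = 0"
      using H_alternating[OF j' t] by simp
  next
    fix s i j :: nat assume s: "l < s"
    show "a s j i = 0"
    proof (cases "i < n & j < n")
      case True
      then have "e (Suc j) : carrier A" "e (Suc i) : carrier A" using graded_facts(3) by auto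
      then have "peirce (Suc j) s (Suc i) = {\<zero>[A]}" unfolding peirce_def top[OF s] by auto
      then show ?thesis unfolding a_def by (simp only: dim_trivial[OF AV.vectorspace_axioms] if_cancel)
    next
      case False
      then show ?thesis unfolding a_def by (rule if_not_P)
    qed
  qed
  then obtain q where q: "poly q 0 ~= 0" "\<forall>w :: nat => nat. \<exists>p.
    fps_of_poly q * Abs_fps (%r. complex_of_real (real (\<Sum>i<n. w i * \<beta> r i))) = fps_of_poly p" by blast
  have "dimm (P r) = (\<Sum>i<n. w i * \<beta> r i)" for r
    unfolding P_dim shift w_def \<beta>_def by (simp add: mult.commute)
  moreover obtain p where "fps_of_poly q * Abs_fps (%r. complex_of_real (real (\<Sum>i<n. w i * \<beta> r i))) = fps_of_poly p"
    using q(2) by blast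
  ultimately show ?thesis using q(1) by (intro exI[of _ q] exI[of _ p]) (simp only: simp_thms)
qed

lemma dim_P0: "dimm (P 0) > 0"
proof (rule ccontr)
  assume "\<not> dimm (P 0) > 0"
  then have "carrier (P 0) = {\<zero>[P 0]}" using dim_zero_imp[OF P_left_module P_fd] by simp
  then have "G 0 = {ep \<zero>[P 0]}" using resD(3) by auto
  then have "e 1 = \<zero>[A]" using e_G0[of 1] G.piece_sub(2)[of 0] graded_facts(9) by auto
  then show False using graded_facts(5)[of 1] graded_facts(9) by simp
qed

end

section \<open>Frobenius forms and twisted trivial extensions\<close>

text \<open>\<open>y\<close> is a Frobenius form: its kernel contains no nonzero right
  ideal.\<close>

locale frobenius = fd_alg K A for K :: "'k ring" and A :: "('k, 'a) module" +
  fixes y :: "'a => 'k" and \<sigma> :: "'a => 'a"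
  assumes y: "y : carrier (dual_bimodule K A)"
    and nondegenerate: "a : carrier A ==> a ~= \<zero>[A] ==> \<exists>b\<in>carrier A. y (a *[A] b) ~= \<zero>[K]"
    and \<sigma>: "\<sigma> : ring_iso A A" and \<sigma>_smult: "c : carrier K ==> a : carrier A ==> \<sigma> (c .[A] a) = c .[A] \<sigma> a"
begin

abbreviation "D \<equiv> carrier (dual_bimodule K A)"
abbreviation "DA \<equiv> dual_bimodule K A"

lemma D_D:
  assumes "f : D"
  shows "x : carrier A ==> f x : carrier K"
    "x : carrier A ==> z : carrier A ==> f (x +[A] z) = f x +[K] f z"
    "c : carrier K ==> x : carrier A ==> f (c .[A] x) = c *[K] f x"
  using assms by (auto simp: dual_bimodule_def)

lemma D_I:
  assumes "!!x. x : carrier A ==> h x : carrier K"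
    "!!x z. x : carrier A ==> z : carrier A ==> h (x +[A] z) = h x +[K] h z"
    "!!c x. c : carrier K ==> x : carrier A ==> h (c .[A] x) = c *[K] h x"
  shows "(\<lambda>x\<in>carrier A. h x) : D"
  using assms by (auto simp: dual_bimodule_def)

lemma D_eqI: "f : D ==> g : D ==> (!!x. x : carrier A ==> f x = g x) ==> f = g"
  unfolding dual_bimodule_def by (auto intro: PiE_ext)

lemma \<sigma>_facts: "a : carrier A ==> \<sigma> a : carrier A"
  "a : carrier A ==> b : carrier A ==> \<sigma> (a *[A] b) = \<sigma> a *[A] \<sigma> b"
  "a : carrier A ==> b : carrier A ==> \<sigma> (a +[A] b) = \<sigma> a +[A] \<sigma> b"
  "\<sigma> \<one>[A] = \<one>[A]" "bij_betw \<sigma> (carrier A) (carrier A)"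
  using \<sigma> ring_hom_closed[of \<sigma> A A] ring_hom_mult[of \<sigma> A A] ring_hom_add[of \<sigma> A A] ring_hom_one[of \<sigma> A A]
  by (auto simp: ring_iso_def)

text \<open>For a basis \<open>X\<close> of \<open>A\<close> the endomorphism taking \<open>a\<close> to the sum of the \<open>g a v \<odot> v\<close> with \<open>v\<close> in
  \<open>X\<close> is injective, hence onto.\<close>

lemma interpolation:
  assumes g: "!!a x. a : carrier A ==> x : carrier A ==> g a x : carrier K"
    "!!a b x. a : carrier A ==> b : carrier A ==> x : carrier A ==> g (a +[A] b) x = g a x +[K] g b x"
    "!!a b x. a : carrier A ==> b : carrier A ==> x : carrier A ==> g x (a +[A] b) = g x a +[K] g x b"
    "!!c a x. c : carrier K ==> a : carrier A ==> x : carrier A ==> g (c .[A] a) x = c *[K] g a x"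
    "!!c a x. c : carrier K ==> a : carrier A ==> x : carrier A ==> g a (c .[A] x) = c *[K] g a x"
    and inj: "!!a. a : carrier A ==> (!!x. x : carrier A ==> g a x = \<zero>[K]) ==> a = \<zero>[A]"
  shows "f : D ==> \<exists>a\<in>carrier A. \<forall>x\<in>carrier A. g a x = f x"
    "b : carrier A ==> (!!a. a : carrier A ==> g a b = \<zero>[K]) ==> b = \<zero>[A]"
proof -
  let ?R = "regular_module A"
  have lmR: "left_module A ?R" by (rule regular_left_module[OF A.ring_axioms])
  interpret R: lmod A ?R by (simp add: lmod_def lmR)
  have sub: "Module.submodule (carrier A) K (vs_of ?R)"
    by (rule subspaceI[OF lmR]) simp_all
  have fs: "finsum ?R h S = finsum A h S" for h :: "'a => 'a" and S
    unfolding finsum_def finprod_def regular_module_def by simp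
  obtain X where X: "finite X" "X \<subseteq> carrier A"
    and X_span: "!!x. x : carrier A ==> \<exists>c\<in>X \<rightarrow> carrier K. x = (\<Oplus>\<^bsub>?R\<^esub>v\<in>X. scal (c v) .[?R] v)"
    and X_indep: "!!c v. c : X \<rightarrow> carrier K ==> (\<Oplus>\<^bsub>?R\<^esub>v\<in>X. scal (c v) .[?R] v) = \<zero>[?R] ==> v : X ==> c v = \<zero>[K]"
    by (rule subspace_basis[OF lmR regular_fd(1) sub]) (rule that)
  have conv: "(\<Oplus>\<^bsub>?R\<^esub>v\<in>X. scal (c v) .[?R] v) = (\<Oplus>\<^bsub>A\<^esub>v\<in>X. c v .[A] v)" if "c : X \<rightarrow> carrier K" for c
    unfolding fs by (rule AV.M.finsum_cong') (use that X(2) in \<open>auto simp: scal_mult Pi_iff subset_iff\<close>)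
  have span: "\<exists>c\<in>X \<rightarrow> carrier K. x = (\<Oplus>\<^bsub>A\<^esub>v\<in>X. c v .[A] v)" if x: "x : carrier A" for x
  proof -
    obtain c where c: "c : X \<rightarrow> carrier K" "x = (\<Oplus>\<^bsub>?R\<^esub>v\<in>X. scal (c v) .[?R] v)" using X_span[OF x] by (rule bexE)
    show ?thesis by (rule bexI[OF _ c(1)]) (rule trans[OF c(2) conv[OF c(1)]])
  qed
  have indep: "c v = \<zero>[K]" if c: "c : X \<rightarrow> carrier K" "(\<Oplus>\<^bsub>A\<^esub>v\<in>X. c v .[A] v) = \<zero>[A]" "v : X" for c v
    by (rule X_indep[OF c(1) _ c(3)]) (unfold conv[OF c(1)] c(2), simp)
  have cX: "(%v. c v .[A] v) : X \<rightarrow> carrier A" if "c : X \<rightarrow> carrier K" for c using that X(2) by auto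
  have ext: "P x" if P: "P \<zero>[A]" "!!u v. u : carrier A ==> v : carrier A ==> P u ==> P v ==> P (u +[A] v)"
    "!!c v. c : carrier K ==> v : carrier A ==> P v ==> P (c .[A] v)" "!!v. v : X ==> P v" and x: "x : carrier A"
    for P :: "'a => bool" and x
  proof -
    obtain c where c: "c : X \<rightarrow> carrier K" "x = (\<Oplus>\<^bsub>A\<^esub>v\<in>X. c v .[A] v)" using span[OF x] by blast
    have "(\<Oplus>\<^bsub>A\<^esub>v\<in>X. c v .[A] v) : {u : carrier A. P u}"
      by (rule AV.M.finsum_in) (use P c(1) X(2) in \<open>auto simp: Pi_iff subset_iff\<close>)
    then show ?thesis unfolding c(2) by simp
  qed
  define T where "T a = (\<Oplus>\<^bsub>A\<^esub>v\<in>X. g a v .[A] v)" for a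
  have gX: "g a : X \<rightarrow> carrier K" if "a : carrier A" for a using g(1)[OF that] X(2) by auto
  have Tc: "T a : carrier A" if "a : carrier A" for a
    unfolding T_def by (rule AV.M.finsum_closed[OF cX[OF gX[OF that]]])
  have Tadd: "T (a +[A] b) = T a +[A] T b" if ab: "a : carrier A" "b : carrier A" for a b
    unfolding T_def AV.M.finsum_addf[OF cX[OF gX[OF ab(1)]] cX[OF gX[OF ab(2)]], symmetric]
    by (rule AV.M.finsum_cong') (use g(1,2) ab X(2) in \<open>auto simp: AV.smult_l_distr subset_iff\<close>)
  have Tsm: "T (c .[A] a) = c .[A] T a" if ca: "c : carrier K" "a : carrier A" for c a
    unfolding T_def AV.finsum_smult[OF ca(1) cX[OF gX[OF ca(2)]]]
    by (rule AV.M.finsum_cong') (use g(1,4) ca X(2) in \<open>auto simp: AV.smult_assoc1 subset_iff\<close>)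
  have T0: "T \<zero>[A] = \<zero>[A]"
    using Tsm[of "\<zero>[K]" "\<zero>[A]"] Tc[of "\<zero>[A]"] by simp
  have Tinj: "a = \<zero>[A]" if a: "a : carrier A" "T a = \<zero>[A]" for a
  proof (rule inj[OF a(1)])
    have g0: "g a \<zero>[A] = \<zero>[K]" using g(5)[of "\<zero>[K]" a "\<zero>[A]"] a(1) g(1)[of a "\<zero>[A]"] by simp
    show "g a x = \<zero>[K]" if x: "x : carrier A" for x
      by (rule ext[OF _ _ _ _ x]) (use g0 a g(3,5) indep[OF gX[OF a(1)] a(2)[unfolded T_def]] in auto)
  qed
  have sT: "Module.submodule (T ` carrier A) K A"
  proof (rule AV.submoduleI)
    show "T ` carrier A \<subseteq> carrier A" using Tc by blast
    show "\<zero>[A] : T ` carrier A" by (rule image_eqI[where x = "\<zero>[A]"]) (simp_all add: T0)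
    fix u assume "u : T ` carrier A"
    then obtain a where a: "a : carrier A" "u = T a" by blast
    have "-[A] u = T ((-[K] \<one>[K]) .[A] a)"
      using Tsm[of "-[K] \<one>[K]" a] a Tc[OF a(1)] AV.smult_l_minus[of "\<one>[K]" u] by simp
    then show "-[A] u : T ` carrier A" using a(1)
      by (intro image_eqI[where x = "(-[K] \<one>[K]) .[A] a"]) simp_all
  next
    fix u v assume "u : T ` carrier A" "v : T ` carrier A"
    then obtain a b where ab: "a : carrier A" "u = T a" "b : carrier A" "v = T b" by blast
    show "u +[A] v : T ` carrier A" unfolding ab(2,4) Tadd[OF ab(1,3), symmetric] using ab by simp
  next
    fix c u assume c: "c : carrier K" and "u : T ` carrier A"
    then obtain a where a: "a : carrier A" "u = T a" by blast
    show "c .[A] u : T ` carrier A" unfolding a(2) Tsm[OF c a(1), symmetric] using a c by simp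
  qed
  have Th: "T : module_hom K A (A(|carrier := T ` carrier A|))"
    by (rule module_homI) (simp_all add: Tadd Tsm)
  have "{v : carrier A. T v = \<zero>[A(|carrier := T ` carrier A|)]} = {\<zero>[A]}" using Tinj T0 by auto
  then have "vectorspace.dim K A = vectorspace.dim K (A(|carrier := T ` carrier A|))"
    using rank_nullity_kernel(2)[OF AV.vectorspace_axioms vectorspace_subspace[OF AV.vectorspace_axioms sT] Th fin_A]
      dim_trivial[OF AV.vectorspace_axioms] by simp
  then have Tsurj: "T ` carrier A = carrier A"
    using subspace_dim(3)[OF AV.vectorspace_axioms sT fin_A] by simp
  have interp: "\<exists>a\<in>carrier A. \<forall>v\<in>X. g a v = \<beta> v" if \<beta>: "\<beta> : X \<rightarrow> carrier K" for \<beta>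
  proof -
    have "(\<Oplus>\<^bsub>A\<^esub>v\<in>X. \<beta> v .[A] v) : T ` carrier A" unfolding Tsurj by (rule AV.M.finsum_closed[OF cX[OF \<beta>]])
    then obtain a where a: "a : carrier A" "(\<Oplus>\<^bsub>A\<^esub>v\<in>X. \<beta> v .[A] v) = T a" by blast
    \<comment> \<open>The errors at the basis elements are the coefficients of a vanishing
      combination, so they are all zero.\<close>
    let ?\<gamma> = "%v. g a v -[K] \<beta> v"
    have \<gamma>: "?\<gamma> : X \<rightarrow> carrier K" using gX[OF a(1)] \<beta> by (auto simp: Pi_iff)
    have "(\<Oplus>\<^bsub>A\<^esub>v\<in>X. \<beta> v .[A] v) +[A] (\<Oplus>\<^bsub>A\<^esub>v\<in>X. ?\<gamma> v .[A] v) = (\<Oplus>\<^bsub>A\<^esub>v\<in>X. \<beta> v .[A] v +[A] ?\<gamma> v .[A] v)"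
      by (rule AV.M.finsum_addf[OF cX[OF \<beta>] cX[OF \<gamma>], symmetric])
    also have "... = T a" unfolding T_def
    proof (rule AV.M.finsum_cong'[OF refl cX[OF gX[OF a(1)]]])
      fix v assume v: "v : X"
      then have k: "g a v : carrier K" "\<beta> v : carrier K" "v : carrier A" using gX[OF a(1)] \<beta> X(2) by auto
      have "\<beta> v .[A] v +[A] ?\<gamma> v .[A] v = (\<beta> v +[K] ?\<gamma> v) .[A] v" using k by (simp add: AV.smult_l_distr)
      then show "\<beta> v .[A] v +[A] ?\<gamma> v .[A] v = g a v .[A] v"
        using abelian_group.diff_add_left[OF K.abelian_group_axioms k(1,2)] by simp
    qed
    finally have "(\<Oplus>\<^bsub>A\<^esub>v\<in>X. ?\<gamma> v .[A] v) = \<zero>[A]"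
      unfolding a(2) using AV.M.add.l_cancel_one'[of "T a" "\<Oplus>\<^bsub>A\<^esub>v\<in>X. ?\<gamma> v .[A] v"] Tc[OF a(1)] AV.M.finsum_closed[OF cX[OF \<gamma>]]
      by (simp add: AV.M.add.r_cancel_one)
    then have "?\<gamma> v = \<zero>[K]" if "v : X" for v by (rule indep[OF \<gamma> _ that])
    then have "g a v = \<beta> v" if "v : X" for v using that gX[OF a(1)] \<beta> by (auto simp: Pi_iff)
    then show ?thesis using a(1) by blast
  qed
  show "\<exists>a\<in>carrier A. \<forall>x\<in>carrier A. g a x = f x" if f: "f : D"
  proof -
    have "f : X \<rightarrow> carrier K" using D_D(1)[OF f] X(2) by auto
    then obtain a where a: "a : carrier A" "\<forall>v\<in>X. g a v = f v" using interp by blast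
    have g0: "g a \<zero>[A] = f \<zero>[A]"
      using g(5)[of "\<zero>[K]" a "\<zero>[A]"] D_D(3)[OF f, of "\<zero>[K]" "\<zero>[A]"] a(1) g(1)[of a "\<zero>[A]"] D_D(1)[OF f, of "\<zero>[A]"] by simp
    have "g a x = f x" if x: "x : carrier A" for x
      by (rule ext[OF _ _ _ _ x]) (use g0 a g(3,5) D_D[OF f] in auto)
    then show ?thesis using a(1) by blast
  qed
  show "b = \<zero>[A]" if b: "b : carrier A" "!!a. a : carrier A ==> g a b = \<zero>[K]"
  proof (rule ccontr)
    assume b0: "b ~= \<zero>[A]"
    obtain c where c: "c : X \<rightarrow> carrier K" "b = (\<Oplus>\<^bsub>A\<^esub>v\<in>X. c v .[A] v)" using span[OF b(1)] by blast
    have "\<exists>v\<in>X. c v ~= \<zero>[K]"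
    proof (rule ccontr)
      assume "\<not> (\<exists>v\<in>X. c v ~= \<zero>[K])"
      then have "(\<Oplus>\<^bsub>A\<^esub>v\<in>X. c v .[A] v) = (\<Oplus>\<^bsub>A\<^esub>v\<in>X. \<zero>[A])"
        by (intro AV.M.finsum_cong') (use X(2) in \<open>auto simp: subset_iff\<close>)
      then show False using b0 c(2) by simp
    qed
    then obtain w where w: "w : X" "c w ~= \<zero>[K]" by blast
    \<comment> \<open>Pairing \<open>b\<close> with an element dual to \<open>w\<close> reads off
      the nonzero coefficient \<open>c w\<close>.\<close>
    have "(%v. if v = w then \<one>[K] else \<zero>[K]) : X \<rightarrow> carrier K" by auto
    from interp[OF this] obtain a where a: "a : carrier A" "\<forall>v\<in>X. g a v = (if v = w then \<one>[K] else \<zero>[K])" by blast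
    have wc: "c w : carrier K" "w : carrier A" using w(1) c(1) X(2) by auto
    let ?b = "\<Oplus>\<^bsub>A\<^esub>v\<in>X - {w}. c v .[A] v"
    have cw: "(%v. c v .[A] v) : X - {w} \<rightarrow> carrier A" using cX[OF c(1)] by auto
    have bc: "?b : {u : carrier A. g a u = \<zero>[K]}"
    proof (rule AV.M.finsum_in)
      show "\<zero>[A] : {u : carrier A. g a u = \<zero>[K]}"
        using g(5)[of "\<zero>[K]" a "\<zero>[A]"] a(1) g(1)[of a "\<zero>[A]"] by simp
      show "(%v. c v .[A] v) : X - {w} \<rightarrow> {u : carrier A. g a u = \<zero>[K]}"
        using c(1) X(2) a g(5) by (auto simp: Pi_iff subset_iff)
    qed (use a(1) g(3) in auto)
    have "b = (\<Oplus>\<^bsub>A\<^esub>v\<in>insert w (X - {w}). c v .[A] v)" unfolding c(2) using w(1) by (simp only: insert_Diff)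
    also have "... = c w .[A] w +[A] ?b" by (rule AV.M.finsum_insert) (use X(1) cw wc in simp_all)
    finally have bw: "b = c w .[A] w +[A] ?b" .
    have gb: "?b : carrier A" "g a ?b = \<zero>[K]" using bc by simp_all
    have gw: "g a w = \<one>[K]" using a(2) w(1) by simp
    have "g a (c w .[A] w +[A] ?b) = c w"
      unfolding g(3)[OF _ gb(1) a(1), of "c w .[A] w", OF AV.smult_closed[OF wc]] g(5)[OF wc(1) a(1) wc(2)] gb(2) gw
      using wc(1) by simp
    then show False using b(2)[OF a(1)] w(2) unfolding bw[symmetric] by simp
  qed
qed

lemma right_pairing:
  assumes "f : D"
  shows "\<exists>a\<in>carrier A. \<forall>x\<in>carrier A. y (a *[A] x) = f x"
proof (rule interpolation(1)[where g = "%a x. y (a *[A] x)"])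
  show "a = \<zero>[A]" if "a : carrier A" "!!x. x : carrier A ==> y (a *[A] x) = \<zero>[K]" for a
    using nondegenerate that by blast
qed (use D_D[OF y] assms in \<open>simp_all add: A.l_distr A.r_distr smult_mult\<close>)

text \<open>In finite dimension a pairing that separates its first argument realises every
  functional, hence separates its second argument too.\<close>

lemma nondegenerate':
  assumes "b : carrier A" "!!a. a : carrier A ==> y (a *[A] b) = \<zero>[K]"
  shows "b = \<zero>[A]"
proof (rule interpolation(2)[where g = "%a x. y (a *[A] x)"])
  show "a = \<zero>[A]" if "a : carrier A" "!!x. x : carrier A ==> y (a *[A] x) = \<zero>[K]" for a
    using nondegenerate that by blast
qed (use D_D[OF y] assms in \<open>simp_all add: A.l_distr A.r_distr smult_mult\<close>)

lemma left_pairing: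
  assumes "f : D"
  shows "\<exists>a\<in>carrier A. \<forall>x\<in>carrier A. y (x *[A] a) = f x"
proof (rule interpolation(1)[where g = "%a x. y (x *[A] a)"])
  show "a = \<zero>[A]" if "a : carrier A" "!!x. x : carrier A ==> y (x *[A] a) = \<zero>[K]" for a
    by (rule nondegenerate'[OF that])
qed (use D_D[OF y] assms in \<open>simp_all add: A.l_distr A.r_distr smult_mult\<close>)

text \<open>\<open>L a\<close> is the product \<open>a y\<close> in the dual bimodule; its
  bijectivity says that the dual is free on \<open>y\<close> as a left module.\<close>

definition "L a = (\<lambda>x\<in>carrier A. y (x *[A] a))"

lemma L_D: "a : carrier A ==> L a : D"
  unfolding L_def by (rule D_I) (use D_D[OF y] in \<open>simp_all add: A.l_distr smult_mult\<close>)

lemma L_app: "x : carrier A ==> L a x = y (x *[A] a)" by (simp add: L_def)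

lemma y_minus: "x : carrier A ==> z : carrier A ==> y x = y z ==> y (x -[A] z) = \<zero>[K]"
proof -
  assume xz: "x : carrier A" "z : carrier A" "y x = y z"
  have "y z +[K] y (x -[A] z) = y z"
    using D_D(2)[OF y xz(2), of "x -[A] z"] AV.M.diff_add_left[OF xz(1,2)] xz by simp
  then show ?thesis using D_D(1)[OF y] xz by (simp add: K.add.r_cancel_one)
qed

lemma L_bij: "bij_betw L (carrier A) D"
proof (rule bij_betwI')
  fix a b assume ab: "a : carrier A" "b : carrier A"
  show "L a = L b \<longleftrightarrow> a = b"
  proof
    assume eq: "L a = L b"
    have "a -[A] b = \<zero>[A]"
    proof (rule nondegenerate')
      fix x assume x: "x : carrier A"
      have "y (x *[A] a) = y (x *[A] b)" using L_app[OF x, of a] L_app[OF x, of b] eq by simp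
      then have "y (x *[A] a -[A] x *[A] b) = \<zero>[K]" using x ab by (intro y_minus) simp_all
      then show "y (x *[A] (a -[A] b)) = \<zero>[K]" using x ab by (simp add: a_minus_def A.r_distr A.r_minus)
    qed (use ab in simp)
    then show "a = b" using ab AV.M.minus_other_side by simp
  qed simp
next
  fix f assume f: "f : D"
  then obtain a where a: "a : carrier A" "\<forall>x\<in>carrier A. y (x *[A] a) = f x" using left_pairing by blast
  have "f = L a" by (rule D_eqI[OF f L_D[OF a(1)]]) (use a L_app in simp)
  then show "\<exists>a\<in>carrier A. f = L a" using a(1) by blast
qed (rule L_D)

definition "L' = the_inv_into (carrier A) L"

lemma L'_facts: "f : D ==> L' f : carrier A" "f : D ==> L (L' f) = f" "a : carrier A ==> L' (L a) = a"
  unfolding L'_def using L_bij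
  by (auto simp: bij_betw_def the_inv_into_f_f f_the_inv_into_f intro: the_inv_into_into)

lemma L'_I: "f : D ==> a : carrier A ==> (!!x. x : carrier A ==> f x = y (x *[A] a)) ==> L' f = a"
proof -
  assume f: "f : D" and a: "a : carrier A" and eq: "!!x. x : carrier A ==> f x = y (x *[A] a)"
  have "f = L a" by (rule D_eqI[OF f L_D[OF a]]) (simp add: eq L_app)
  then show ?thesis using L'_facts(3)[OF a] by simp
qed

lemma L'_app: "f : D ==> x : carrier A ==> y (x *[A] L' f) = f x"
  using L_app[of x "L' f"] L'_facts(2) by simp

text \<open>\<open>R a\<close> is the product \<open>y a\<close> in the twisted bimodule.\<close>

definition "R a = (\<lambda>x\<in>carrier A. y (\<sigma> a *[A] x))"

lemma R_D: "a : carrier A ==> R a : D"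
  unfolding R_def by (rule D_I) (use D_D[OF y] \<sigma>_facts(1) in \<open>simp_all add: A.r_distr smult_mult\<close>)

text \<open>Determined by \<open>y a = ps(a) y\<close>: the Nakayama automorphism of the form,
  composed with \<sigma>.\<close>

definition "ps a = L' (R a)"

lemma ps_closed: "a : carrier A ==> ps a : carrier A" unfolding ps_def by (rule L'_facts(1)[OF R_D])

lemma ps_app: "a : carrier A ==> x : carrier A ==> y (x *[A] ps a) = y (\<sigma> a *[A] x)"
  unfolding ps_def using L'_app[OF R_D] by (simp add: R_def)

lemma ps_I: "a : carrier A ==> b : carrier A ==> (!!x. x : carrier A ==> y (x *[A] b) = y (\<sigma> a *[A] x)) ==> ps a = b"
  unfolding ps_def by (rule L'_I[OF R_D]) (simp_all add: R_def)

lemma ps_bij: "bij_betw ps (carrier A) (carrier A)"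
proof (rule bij_betwI')
  fix a b assume ab: "a : carrier A" "b : carrier A"
  show "ps a = ps b \<longleftrightarrow> a = b"
  proof
    assume eq: "ps a = ps b"
    have c: "\<sigma> a : carrier A" "\<sigma> b : carrier A" using ab \<sigma>_facts(1) by auto
    have "\<sigma> a -[A] \<sigma> b = \<zero>[A]"
    proof (rule ccontr)
      assume "\<sigma> a -[A] \<sigma> b ~= \<zero>[A]"
      then obtain x where x: "x : carrier A" "y ((\<sigma> a -[A] \<sigma> b) *[A] x) ~= \<zero>[K]" using nondegenerate[of "\<sigma> a -[A] \<sigma> b"] c by auto
      have "y (\<sigma> a *[A] x -[A] \<sigma> b *[A] x) = \<zero>[K]"
        using ps_app[OF ab(1) x(1)] ps_app[OF ab(2) x(1)] eq c x(1) by (intro y_minus) simp_all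
      then show False using x c by (simp add: a_minus_def A.l_distr A.l_minus)
    qed
    then have "\<sigma> a = \<sigma> b" using c AV.M.minus_other_side by simp
    then show "a = b" using \<sigma>_facts(5) ab by (auto simp: bij_betw_def inj_on_def)
  qed simp
next
  fix b assume b: "b : carrier A"
  obtain d where d: "d : carrier A" "\<forall>x\<in>carrier A. y (d *[A] x) = L b x" using right_pairing[OF L_D[OF b]] by blast
  have "d : \<sigma> ` carrier A" using \<sigma>_facts(5) d(1) by (simp add: bij_betw_def)
  then obtain a where a: "a : carrier A" "d = \<sigma> a" by blast
  have "ps a = b" by (rule ps_I[OF a(1) b]) (use d(2) a(2) L_app in simp)
  then show "\<exists>a\<in>carrier A. b = ps a" using a(1) by blast
qed (rule ps_closed)

section \<open>The twisted trivial extension as a skew extension\<close>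

abbreviation "B \<equiv> twisted_trivial_extension K A \<sigma>"

lemma B_simps: "carrier B = carrier A \<times> D" "\<one>[B] = (\<one>[A], \<lambda>x\<in>carrier A. \<zero>[K])" "\<zero>[B] = (\<zero>[A], \<lambda>x\<in>carrier A. \<zero>[K])"
  "(a, f) +[B] (b, h) = (a +[A] b, \<lambda>x\<in>carrier A. f x +[K] h x)"
  "c .[B] (a, f) = (c .[A] a, \<lambda>x\<in>carrier A. c *[K] f x)"
  "(a, f) *[B] (b, h) = (a *[A] b, \<lambda>x\<in>carrier A. h (x *[A] a) +[K] f (\<sigma> b *[A] x))"
  by (auto simp: twisted_trivial_extension_def trivial_extension_def twist_def dual_bimodule_def intro!: restrict_ext)

lemma D_closed:
  "(\<lambda>x\<in>carrier A. \<zero>[K]) : D"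
  "f : D ==> h : D ==> (\<lambda>x\<in>carrier A. f x +[K] h x) : D"
  "c : carrier K ==> f : D ==> (\<lambda>x\<in>carrier A. c *[K] f x) : D"
  "a : carrier A ==> b : carrier A ==> f : D ==> h : D ==> (\<lambda>x\<in>carrier A. h (x *[A] a) +[K] f (\<sigma> b *[A] x)) : D"
proof -
  show "(\<lambda>x\<in>carrier A. \<zero>[K]) : D" by (rule D_I) simp_all
  show "(\<lambda>x\<in>carrier A. c *[K] f x) : D" if "c : carrier K" "f : D"
    by (rule D_I) (use D_D[OF that(2)] that(1) in \<open>simp_all add: K.r_distr K.m_lcomm\<close>)
  show "(\<lambda>x\<in>carrier A. f x +[K] h x) : D" if "f : D" "h : D"
    by (rule D_I) (use D_D[OF that(1)] D_D[OF that(2)] in \<open>simp_all add: K.a_ac K.r_distr\<close>)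
  show "(\<lambda>x\<in>carrier A. h (x *[A] a) +[K] f (\<sigma> b *[A] x)) : D"
    if "a : carrier A" "b : carrier A" "f : D" "h : D"
    by (rule D_I) (use D_D[OF that(3)] D_D[OF that(4)] that(1) \<sigma>_facts(1)[OF that(2)]
      in \<open>simp_all add: K.a_ac K.r_distr A.l_distr A.r_distr smult_mult\<close>)
qed

lemma B_abelian: "abelian_group B"
proof (rule abelian_groupI)
  fix u v assume "u : carrier B" "v : carrier B"
  then show "u +[B] v : carrier B" "u +[B] v = v +[B] u"
    by (auto simp: B_simps D_closed D_D AV.M.a_comm K.a_comm intro!: restrict_ext)
next
  fix u v w assume "u : carrier B" "v : carrier B" "w : carrier B"
  then show "(u +[B] v) +[B] w = u +[B] (v +[B] w)"
    by (auto simp: B_simps D_D AV.M.a_assoc K.a_assoc intro!: restrict_ext)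
next
  fix u assume "u : carrier B"
  then obtain a f where u: "u = (a, f)" "a : carrier A" "f : D" by (auto simp: B_simps)
  show "\<zero>[B] +[B] u = u" unfolding u(1) B_simps
    using u(2) D_eqI[OF D_closed(2)[OF D_closed(1) u(3)] u(3)] D_D(1)[OF u(3)] by simp
  have "(\<lambda>x\<in>carrier A. (-[K] \<one>[K]) *[K] f x) : D" by (rule D_closed(3)) (use u in simp_all)
  then show "\<exists>v\<in>carrier B. v +[B] u = \<zero>[B]"
    using u by (intro bexI[of _ "(-[A] a, \<lambda>x\<in>carrier A. (-[K] \<one>[K]) *[K] f x)"])
      (auto simp: B_simps D_D AV.M.l_neg K.l_minus K.l_neg intro!: restrict_ext)
qed (simp add: B_simps D_closed)

lemma B_k_algebra: "k_algebra K B"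
proof -
  have ring: "ring B"
  proof (rule ringI[OF B_abelian])
    show "monoid B"
    proof (rule monoidI)
      fix u v assume "u : carrier B" "v : carrier B"
      then show "u *[B] v : carrier B" by (auto simp: B_simps D_closed)
    next
      fix u v w assume "u : carrier B" "v : carrier B" "w : carrier B"
      then show "(u *[B] v) *[B] w = u *[B] (v *[B] w)"
        by (auto simp: B_simps D_D A.m_assoc \<sigma>_facts K.a_assoc intro!: restrict_ext)
    next
      fix u assume "u : carrier B"
      then obtain a f where u: "u = (a, f)" "a : carrier A" "f : D" by (auto simp: B_simps)
      have f: "(\<lambda>x\<in>carrier A. f x) = f" by (rule D_eqI[OF _ u(3)]) (use D_I[of f] D_D[OF u(3)] in auto)
      have "(\<lambda>x\<in>carrier A. f (x *[A] \<one>[A]) +[K] (\<lambda>x\<in>carrier A. \<zero>[K]) (\<sigma> a *[A] x)) = (\<lambda>x\<in>carrier A. f x)"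
        by (rule restrict_ext) (use u D_D[OF u(3)] \<sigma>_facts(1) in simp)
      moreover have "(\<lambda>x\<in>carrier A. (\<lambda>x\<in>carrier A. \<zero>[K]) (x *[A] a) +[K] f (\<sigma> \<one>[A] *[A] x)) = (\<lambda>x\<in>carrier A. f x)"
        by (rule restrict_ext) (use u D_D[OF u(3)] \<sigma>_facts(4) in simp)
      ultimately show "\<one>[B] *[B] u = u" "u *[B] \<one>[B] = u" unfolding u(1) B_simps f using u(2) by simp_all
    qed (simp add: B_simps D_closed)
  next
    fix u v w assume "u : carrier B" "v : carrier B" "w : carrier B"
    then show "(u +[B] v) *[B] w = u *[B] w +[B] v *[B] w" "w *[B] (u +[B] v) = w *[B] u +[B] w *[B] v"
      by (auto simp: B_simps D_D A.l_distr A.r_distr \<sigma>_facts K.a_ac intro!: restrict_ext)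
  qed
  have "module K B"
  proof (rule moduleI[OF K.is_cring B_abelian])
    fix c u assume "c : carrier K" "u : carrier B"
    then show "c .[B] u : carrier B" by (auto simp: B_simps D_closed)
  next
    fix c d u assume "c : carrier K" "d : carrier K" "u : carrier B"
    then show "(c +[K] d) .[B] u = c .[B] u +[B] d .[B] u" "(c *[K] d) .[B] u = c .[B] (d .[B] u)"
      by (auto simp: B_simps D_D AV.smult_l_distr AV.smult_assoc1 K.l_distr K.m_assoc intro!: restrict_ext)
  next
    fix c u v assume "c : carrier K" "u : carrier B" "v : carrier B"
    then show "c .[B] (u +[B] v) = c .[B] u +[B] c .[B] v"
      by (auto simp: B_simps D_D AV.smult_r_distr K.r_distr intro!: restrict_ext)
  next
    fix u assume "u : carrier B"
    then obtain a f where u: "u = (a, f)" "a : carrier A" "f : D" by (auto simp: B_simps)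
    have "(\<lambda>x\<in>carrier A. \<one>[K] *[K] f x) = f"
      by (rule D_eqI[OF D_closed(3)[OF K.one_closed u(3)] u(3)]) (use D_D[OF u(3)] in simp)
    then show "\<one>[K] .[B] u = u" unfolding u(1) B_simps using u(2) by simp
  qed
  moreover have "(c .[B] u) *[B] v = c .[B] (u *[B] v) & u *[B] (c .[B] v) = c .[B] (u *[B] v)"
    if "c : carrier K" "u : carrier B" "v : carrier B" for c u v
    using that by (auto simp: B_simps D_D smult_mult \<sigma>_smult \<sigma>_facts K.r_distr intro!: restrict_ext)
  ultimately show ?thesis using ring field_K by (simp add: k_algebra_def vectorspace_def)
qed

text \<open>The kernel of the first projection is the dual of \<open>A\<close>, which is
  finite-dimensional as an image of \<open>A\<close> under \<open>L\<close>.\<close>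

lemma B_fd: "fd_alg K B"
proof -
  have V: "vectorspace K B" using B_k_algebra by (simp add: k_algebra_def)
  have h: "fst : module_hom K B A" by (rule module_homI) (auto simp: B_simps)
  have s: "fst ` carrier B = carrier A" using D_closed(1) by (force simp: B_simps)
  let ?k = "{v : carrier B. fst v = \<zero>[A]}"
  have k: "?k = (%a. (\<zero>[A], L a)) ` carrier A"
  proof (intro equalityI subsetI)
    fix v assume "v : ?k"
    then obtain f where f: "v = (\<zero>[A], f)" "f : D" by (auto simp: B_simps)
    show "v : (%a. (\<zero>[A], L a)) ` carrier A"
      unfolding f(1) by (rule image_eqI[where x = "L' f"]) (simp_all add: L'_facts f(2))
  qed (use L_D in \<open>auto simp: B_simps\<close>)
  have ih: "(%a. (\<zero>[A], L a)) : module_hom K A (B(|carrier := ?k|))"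
  proof (rule module_homI)
    fix a b assume ab: "a : carrier A" "b : carrier A"
    have "L (a +[A] b) = (\<lambda>x\<in>carrier A. L a x +[K] L b x)"
      unfolding L_def by (rule restrict_ext) (use ab D_D[OF y] in \<open>simp add: A.r_distr\<close>)
    then show "(\<zero>[A], L (a +[A] b)) = (\<zero>[A], L a) +[B(|carrier := ?k|)] (\<zero>[A], L b)" by (simp add: B_simps)
  next
    fix c a assume ca: "c : carrier K" "a : carrier A"
    have "L (c .[A] a) = (\<lambda>x\<in>carrier A. c *[K] L a x)"
      unfolding L_def by (rule restrict_ext) (use ca D_D[OF y] in \<open>simp add: smult_mult\<close>)
    then show "(\<zero>[A], L (c .[A] a)) = c .[B(|carrier := ?k|)] (\<zero>[A], L a)" using ca by (simp add: B_simps)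
  qed (simp add: B_simps L_D)
  interpret fst: linear_map K B A fst by (rule vectorspace_map[OF V AV.vectorspace_axioms h])
  have "Module.submodule ?k K B"
  proof (rule fst.V.module.submoduleI)
    fix u assume "u : ?k"
    then show "-[B] u : ?k" using fst.f_neg[of u] by simp
  qed (use V h in auto)
  then have Vk: "vectorspace K (B(|carrier := ?k|))" by (rule vectorspace_subspace[OF V])
  have "vectorspace.fin_dim K (B(|carrier := ?k|))"
    by (rule rank_nullity_kernel(1)[OF AV.vectorspace_axioms Vk ih fin_A]) (simp add: k)
  then have "vectorspace.fin_dim K B" by (rule fin_dim_extension[OF V AV.vectorspace_axioms h s fin_A])
  then show ?thesis using field_K B_k_algebra by (simp add: fd_alg_def)
qed

text \<open>The second coordinate of \<open>(a, f)\<close> is the coefficient of \<open>f\<close> on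
  the free generator \<open>y\<close>; in this coordinate the twisted right action becomes right
  multiplication by values of \<open>ps\<close>.\<close>

lemma skew_ext: "skew_ext K A B fst (%u. L' (snd u)) (%a. (a, \<lambda>x\<in>carrier A. \<zero>[K])) (\<zero>[A], y) ps (the_inv_into (carrier A) ps)"
proof -
  interpret B: fd_alg K B by (rule B_fd)
  have L'c: "L' f : carrier A" if "f : D" for f using L'_facts(1)[OF that] .
  have L'0: "L' (\<lambda>x\<in>carrier A. \<zero>[K]) = \<zero>[A]"
    by (rule L'_I[OF D_closed(1)]) (use D_D(3)[OF y, of "\<zero>[K]" "\<zero>[A]"] D_D(1)[OF y, of "\<zero>[A]"] in simp_all)
  have L'y: "L' y = \<one>[A]" by (rule L'_I[OF y]) simp_all
  have ps_inv: "the_inv_into (carrier A) ps a : carrier A" "ps (the_inv_into (carrier A) ps a) = a"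
    "the_inv_into (carrier A) ps (ps a) = a" if "a : carrier A" for a
    using ps_bij that by (auto simp: bij_betw_def the_inv_into_f_f f_the_inv_into_f intro: the_inv_into_into)
  have add1: "fst (u +[B] v) = fst u +[A] fst v" and mult1: "fst (u *[B] v) = fst u *[A] fst v"
    and add2: "L' (snd (u +[B] v)) = L' (snd u) +[A] L' (snd v)"
    and mult2: "L' (snd (u *[B] v)) = fst u *[A] L' (snd v) +[A] L' (snd u) *[A] ps (fst v)"
    and inj: "fst u = fst v ==> L' (snd u) = L' (snd v) ==> u = v"
    if uvB: "u : carrier B" "v : carrier B" for u v
  proof -
    obtain a f b h where uv: "u = (a, f)" "v = (b, h)" and c: "a : carrier A" "f : D" "b : carrier A" "h : D"
      using uvB by (auto simp: B_simps)
    note cl = L'c[OF c(2)] L'c[OF c(4)] ps_closed[OF c(3)] \<sigma>_facts(1)[OF c(3)]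
    show "fst (u +[B] v) = fst u +[A] fst v" "fst (u *[B] v) = fst u *[A] fst v" unfolding uv B_simps by simp_all
    show "L' (snd (u +[B] v)) = L' (snd u) +[A] L' (snd v)"
      unfolding uv B_simps snd_conv
    proof (rule L'_I[OF D_closed(2)[OF c(2,4)]])
      fix x assume x: "x : carrier A"
      have "y (x *[A] (L' f +[A] L' h)) = y (x *[A] L' f) +[K] y (x *[A] L' h)"
        using x cl D_D(2)[OF y] by (simp add: A.r_distr)
      then show "(\<lambda>x\<in>carrier A. f x +[K] h x) x = y (x *[A] (L' f +[A] L' h))"
        unfolding L'_app[OF c(2) x] L'_app[OF c(4) x] using x by simp
    qed (use cl in simp)
    show "L' (snd (u *[B] v)) = fst u *[A] L' (snd v) +[A] L' (snd u) *[A] ps (fst v)"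
      unfolding uv B_simps snd_conv fst_conv
    proof (rule L'_I[OF D_closed(4)[OF c(1,3,2,4)]])
      fix x assume x: "x : carrier A"
      have 1: "y (x *[A] (a *[A] L' h +[A] L' f *[A] ps b)) = y ((x *[A] a) *[A] L' h) +[K] y ((x *[A] L' f) *[A] ps b)"
        using x c(1) cl D_D(2)[OF y] by (simp add: A.r_distr A.m_assoc)
      have 2: "y ((x *[A] a) *[A] L' h) = h (x *[A] a)" by (rule L'_app[OF c(4)]) (use x c(1) in simp)
      have "y ((x *[A] L' f) *[A] ps b) = y (\<sigma> b *[A] (x *[A] L' f))" by (rule ps_app[OF c(3)]) (use x cl in simp)
      also have "... = y ((\<sigma> b *[A] x) *[A] L' f)" using x cl by (simp add: A.m_assoc)
      also have "... = f (\<sigma> b *[A] x)" by (rule L'_app[OF c(2)]) (use x cl in simp)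
      finally show "(\<lambda>x\<in>carrier A. h (x *[A] a) +[K] f (\<sigma> b *[A] x)) x = y (x *[A] (a *[A] L' h +[A] L' f *[A] ps b))"
        unfolding 1 2 using x by simp
    qed (use c(1) cl in simp)
    show "u = v" if "fst u = fst v" "L' (snd u) = L' (snd v)"
    proof -
      have "L (L' f) = L (L' h)" using that(2) unfolding uv snd_conv by (rule arg_cong)
      then show ?thesis using that(1) unfolding L'_facts(2)[OF c(2)] L'_facts(2)[OF c(4)] uv by simp
    qed
  qed
  have sc: "fst (r .[B] \<one>[B]) = scal r" "L' (snd (r .[B] \<one>[B])) = \<zero>[A]" "ps (scal r) = scal r" if r: "r : carrier K" for r
  proof -
    have z: "(\<lambda>x\<in>carrier A. r *[K] (\<lambda>x\<in>carrier A. \<zero>[K]) x) = (\<lambda>x\<in>carrier A. \<zero>[K])"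
      by (rule restrict_ext) (use r in simp)
    show "fst (r .[B] \<one>[B]) = scal r" unfolding B_simps fst_conv ..
    show "L' (snd (r .[B] \<one>[B])) = \<zero>[A]" unfolding B_simps snd_conv z by (rule L'0)
    have \<sigma>r: "\<sigma> (scal r) = scal r" using \<sigma>_smult[OF r A.one_closed] unfolding \<sigma>_facts(4) .
    show "ps (scal r) = scal r"
      by (rule ps_I) (use r in \<open>simp_all add: \<sigma>r scal_mult\<close>)
  qed
  have ps_hom: "ps (a +[A] b) = ps a +[A] ps b" "ps (a *[A] b) = ps a *[A] ps b"
    if ab: "a : carrier A" "b : carrier A" for a b
  proof -
    have c: "\<sigma> a : carrier A" "\<sigma> b : carrier A" "ps a : carrier A" "ps b : carrier A" using ab \<sigma>_facts(1) ps_closed by auto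
    show "ps (a +[A] b) = ps a +[A] ps b"
    proof (rule ps_I)
      fix x assume x: "x : carrier A"
      have "y (x *[A] (ps a +[A] ps b)) = y (x *[A] ps a) +[K] y (x *[A] ps b)" using x c D_D(2)[OF y] by (simp add: A.r_distr)
      also have "... = y (\<sigma> a *[A] x) +[K] y (\<sigma> b *[A] x)" unfolding ps_app[OF ab(1) x] ps_app[OF ab(2) x] ..
      also have "... = y (\<sigma> (a +[A] b) *[A] x)" unfolding \<sigma>_facts(3)[OF ab] using x c D_D(2)[OF y] by (simp add: A.l_distr)
      finally show "y (x *[A] (ps a +[A] ps b)) = y (\<sigma> (a +[A] b) *[A] x)" .
    qed (use ab c in simp_all)
    show "ps (a *[A] b) = ps a *[A] ps b"
    proof (rule ps_I)
      fix x assume x: "x : carrier A"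
      have "y (x *[A] (ps a *[A] ps b)) = y ((x *[A] ps a) *[A] ps b)" using x c by (simp add: A.m_assoc)
      also have "... = y (\<sigma> b *[A] (x *[A] ps a))" by (rule ps_app[OF ab(2)]) (use x c in simp)
      also have "... = y ((\<sigma> b *[A] x) *[A] ps a)" using x c by (simp add: A.m_assoc)
      also have "... = y (\<sigma> a *[A] (\<sigma> b *[A] x))" by (rule ps_app[OF ab(1)]) (use x c in simp)
      also have "... = y (\<sigma> (a *[A] b) *[A] x)" unfolding \<sigma>_facts(2)[OF ab] using x c by (simp add: A.m_assoc)
      finally show "y (x *[A] (ps a *[A] ps b)) = y (\<sigma> (a *[A] b) *[A] x)" .
    qed (use ab c in simp_all)
  qed
  have pc: "fst u : carrier A" "L' (snd u) : carrier A" if "u : carrier B" for u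
  proof -
    have "fst u : carrier A" "snd u : D" using that by (auto simp: B_simps)
    then show "fst u : carrier A" "L' (snd u) : carrier A" by (blast intro: L'c)+
  qed
  have one: "fst \<one>[B] = \<one>[A]" "L' (snd \<one>[B]) = \<zero>[A]" unfolding B_simps by (simp_all only: fst_conv snd_conv L'0)
  have yB: "(\<zero>[A], y) : carrier B" unfolding B_simps using y by simp
  have yp: "fst (\<zero>[A], y) = \<zero>[A]" "L' (snd (\<zero>[A], y)) = \<one>[A]" by (simp_all only: fst_conv snd_conv L'y)
  have io: "(a, \<lambda>x\<in>carrier A. \<zero>[K]) : carrier B" "fst (a, \<lambda>x\<in>carrier A. \<zero>[K]) = a" "L' (snd (a, \<lambda>x\<in>carrier A. \<zero>[K])) = \<zero>[A]"
    if "a : carrier A" for a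
    using D_closed(1) that by (simp_all only: B_simps fst_conv snd_conv L'0 mem_Sigma_iff simp_thms)
  show ?thesis
    by (intro skew_ext.intro skew_ext_axioms.intro B_fd fd_alg_axioms pc add1 add2 mult1 mult2 one sc io yB yp inj ps_closed ps_inv ps_hom)
qed

end

section \<open>The Frobenius form of a stable algebra\<close>

lemma line_generator:
  assumes "vectorspace K V" "Module.submodule N K V" "vectorspace.fin_dim K V"
    "vectorspace.dim K (V(|carrier := N|)) = 1"
  shows "\<exists>v\<in>N. v ~= \<zero>[V] & (\<forall>x\<in>N. \<exists>c\<in>carrier K. x = c .[V] v)"
proof -
  interpret N: vectorspace K "V(|carrier := N|)" by (rule vectorspace_subspace[OF assms(1,2)])
  obtain X where X: "finite X" "N.basis X"
    using N.finite_basis_exists subspace_dim(1)[OF assms(1-3)] by blast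
  then have "card X = 1" using N.dim_basis assms(4) by simp
  then obtain v where v: "X = {v}" using card_1_singletonE by blast
  have vN: "v : N" "N.span {v} = N" using X(2) by (auto simp: N.basis_def v)
  have sp: "\<exists>c\<in>carrier K. x = c .[V] v" if x: "x : N" for x
  proof -
    have "x : {N.lincomb a {v} | a. a : {v} \<rightarrow> carrier K}" using N.finite_span[of "{v}"] vN x by simp
    then obtain a where "a : {v} \<rightarrow> carrier K" "x = N.lincomb a {v}" by blast
    then have a: "a v : carrier K" "x = N.lincomb a {v}" by auto
    have "a v .[V] v : N" using N.smult_closed[OF a(1), of v] vN(1) by simp
    then have "N.lincomb a {v} = a v .[V] v"
      unfolding N.lincomb_def using N.M.finsum_insert[of "{}" v "%v. a v .[V] v"] N.M.r_zero[of "a v .[V] v"] by simp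
    then show ?thesis using a by (intro bexI[of _ "a v"]) simp_all
  qed
  have "v ~= \<zero>[V]"
  proof
    assume v0: "v = \<zero>[V]"
    have "N \<subseteq> {\<zero>[V]}"
    proof
      fix x assume "x : N"
      then obtain c where c: "c : carrier K" "x = c .[V] v" using sp by blast
      show "x : {\<zero>[V]}" using N.smult_r_null[OF c(1)] unfolding c(2) v0 by simp
    qed
    then have "N = {\<zero>[V]}" using vN(1) v0 by blast
    then show False using assms(4) dim_trivial[OF assms(1)] by simp
  qed
  then show ?thesis using vN(1) sp by blast
qed

context galg
begin

lemma component_sandwich:
  assumes gh: "g : G 0" "h : G 0" and x: "x : carrier A"
  shows "homog_component A G s (g *[A] x *[A] h) = g *[A] homog_component A G s x *[A] h"
proof -
  obtain c N where c: "!!t. c t : G t" "!!t. t \<ge> N ==> c t = \<zero>[A]" "x = (\<Oplus>\<^bsub>A\<^esub>t\<in>{..<N}. c t)"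
    using G.pieces_exist[OF x] by metis
  have cA: "c t : carrier A" for t by (rule G.piece_carrier[OF c(1)])
  have ghA: "g : carrier A" "h : carrier A" by (rule G.piece_carrier[OF gh(1)], rule G.piece_carrier[OF gh(2)])
  have "g *[A] x = (\<Oplus>\<^bsub>A\<^esub>t\<in>{..<N}. g *[A] c t)"
    unfolding c(3) by (rule A.finsum_rdistr) (use cA ghA in auto)
  then have "g *[A] x *[A] h = (\<Oplus>\<^bsub>A\<^esub>t\<in>{..<N}. g *[A] c t) *[A] h" by (rule arg_cong)
  also have "... = (\<Oplus>\<^bsub>A\<^esub>t\<in>{..<N}. g *[A] c t *[A] h)"
    by (rule A.finsum_ldistr) (use cA ghA in auto)
  finally have 1: "g *[A] x *[A] h = (\<Oplus>\<^bsub>A\<^esub>t\<in>{..<N}. g *[A] c t *[A] h)" .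
  have "g *[A] c t *[A] h : G t" for t
    using graded_facts(1)[OF graded_facts(1)[OF gh(1) c(1)[of t]] gh(2)] by simp
  then have "homog_component A G s (\<Oplus>\<^bsub>A\<^esub>t\<in>{..<N}. g *[A] c t *[A] h) = g *[A] c s *[A] h"
    by (rule G.component_sum) (use c(2) ghA in simp)
  moreover have "homog_component A G s x = c s"
    unfolding c(3) by (rule G.component_sum) (rule c(1), rule c(2))
  ultimately show ?thesis unfolding 1 by simp
qed

lemma opposite_simps: "carrier (opposite A) = carrier A" "\<zero>[opposite A] = \<zero>[A]" "\<one>[opposite A] = \<one>[A]"
  "x +[opposite A] z = x +[A] z" "x *[opposite A] z = z *[A] x"
  by (simp_all add: opposite_def)

lemma opposite_ring: "ring (opposite A)"
proof (rule ringI)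
  show "abelian_group (opposite A)"
    by (rule abelian_group_cong[OF A.is_abelian_group]) (simp_all add: opposite_simps)
  show "monoid (opposite A)"
    by (rule monoidI) (simp_all add: opposite_simps A.m_assoc)
qed (simp_all add: opposite_simps A.l_distr A.r_distr)

lemma smult_inverse:
  assumes "c : carrier K" "c ~= \<zero>[K]" "x : carrier A"
  shows "inv\<^bsub>K\<^esub> c : carrier K" "inv\<^bsub>K\<^esub> c .[A] (c .[A] x) = x"
proof -
  show i: "inv\<^bsub>K\<^esub> c : carrier K" using assms by (simp add: K.field_Units)
  have "inv\<^bsub>K\<^esub> c *[K] c = \<one>[K]" using assms by (simp add: K.field_Units)
  then show "inv\<^bsub>K\<^esub> c .[A] (c .[A] x) = x" using AV.smult_assoc1[OF i assms(1,3)] assms(3) by simp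
qed

text \<open>An element of \<open>e i A\<close> annihilated by the radical spans a simple right submodule.\<close>

lemma socle_memI:
  assumes x: "x : carrier A" "e i *[A] x = x" "x ~= \<zero>[A]" "x *[A] e k = x"
    and ik: "i : {1..n}" "k : {1..n}" and ann: "!!a. a : J 1 ==> x *[A] a = \<zero>[A]"
  shows "x : socle (opposite A) (right_projective A (e i))"
proof -
  let ?O = "opposite A" and ?M = "right_projective A (e i)" and ?S = "{c .[A] x | c. c : carrier K}"
  let ?E = "{e i *[A] a | a. a : carrier A}"
  have ei: "e i : carrier A" "e k : carrier A" using ik graded_facts(3) by auto
  have lmR: "left_module ?O (regular_module ?O)" by (rule regular_left_module[OF opposite_ring])
  interpret R: lmod ?O "regular_module ?O" by (simp add: lmod_def lmR)
  have E: "Module.submodule ?E ?O (regular_module ?O)"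
  proof (rule R.submoduleI)
    show "?E \<subseteq> carrier (regular_module ?O)" using ei by (auto simp: opposite_simps)
    show "\<zero>[regular_module ?O] : ?E" using ei by (auto simp: opposite_simps intro!: exI[of _ "\<zero>[A]"])
  next
    fix u v assume "u : ?E" "v : ?E"
    then obtain a b where "u = e i *[A] a" "a : carrier A" "v = e i *[A] b" "b : carrier A" by blast
    then show "u +[regular_module ?O] v : ?E"
      using ei by (auto simp: opposite_simps A.r_distr intro!: exI[of _ "a +[A] b"])
  next
    fix a u assume "a : carrier ?O" "u : ?E"
    then obtain b where "a : carrier A" "u = e i *[A] b" "b : carrier A" by (auto simp: opposite_simps)
    then show "a .[regular_module ?O] u : ?E"
      using ei by (auto simp: opposite_simps A.m_assoc intro!: exI[of _ "b *[A] a"])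
  qed
  have M_simps: "carrier ?M = ?E" "\<zero>[?M] = \<zero>[A]" "u +[?M] v = u +[A] v" "a .[?M] u = u *[A] a" for u v a
    by (simp_all add: right_projective_def regular_module_def opposite_def)
  interpret M: lmod ?O ?M
    unfolding right_projective_def by (rule R.submodule_lmod[OF E])
  \<comment> \<open>As \<open>J 1\<close> annihilates \<open>x\<close>, only the degree-zero part of
    \<open>a\<close> acts, and it acts by a scalar because \<open>x\<close> ends in
    \<open>e k\<close>.\<close>
  have act: "\<exists>t\<in>carrier K. x *[A] a = t .[A] x" if a: "a : carrier A" for a
  proof -
    obtain t where t: "t : carrier K" "e k *[A] hc0 a = t .[A] e k"
      by (rule G0_e[OF hc0_props(1)[OF a] ik(2)])
    have c: "hc0 a : carrier A" "a -[A] hc0 a : carrier A" by (rule hc0_props(2)[OF a], rule J_closed[OF hc0_props(3)[OF a]])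
    have "x *[A] (hc0 a +[A] (a -[A] hc0 a)) = x *[A] hc0 a"
      using x(1) c ann[OF hc0_props(3)[OF a]] by (simp add: A.r_distr)
    then have "x *[A] a = x *[A] hc0 a" unfolding hc0_decomp[OF a, symmetric] .
    also have "... = (x *[A] e k) *[A] hc0 a" unfolding x(4) ..
    also have "... = x *[A] (t .[A] e k)" using x(1) ei c by (simp add: A.m_assoc t(2))
    also have "... = t .[A] x" using x(1,4) ei t(1) by (simp add: smult_mult)
    finally show ?thesis using t(1) by blast
  qed
  have S: "Module.submodule ?S ?O ?M"
  proof (rule M.submoduleI)
    show "?S \<subseteq> carrier ?M"
    proof
      fix u assume "u : ?S"
      then obtain c where c: "c : carrier K" "u = c .[A] x" by blast
      then have "u = e i *[A] (c .[A] x)" using x(1,2) ei by (simp add: smult_mult)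
      then show "u : carrier ?M" unfolding M_simps using c x(1) by blast
    qed
    show "\<zero>[?M] : ?S" unfolding M_simps using x(1) by (intro CollectI exI[of _ "\<zero>[K]"]) simp
  next
    fix u v assume "u : ?S" "v : ?S"
    then obtain c d where "u = c .[A] x" "c : carrier K" "v = d .[A] x" "d : carrier K" by blast
    then show "u +[?M] v : ?S" unfolding M_simps
      using x(1) by (intro CollectI exI[of _ "c +[K] d"]) (simp add: AV.smult_l_distr)
  next
    fix a u assume "a : carrier ?O" "u : ?S"
    then obtain c where c: "a : carrier A" "u = c .[A] x" "c : carrier K" by (auto simp: opposite_simps)
    obtain t where "t : carrier K" "x *[A] a = t .[A] x" using act[OF c(1)] by blast
    then show "a .[?M] u : ?S" unfolding M_simps
      using x(1) c by (intro CollectI exI[of _ "c *[K] t"]) (simp add: smult_mult AV.smult_assoc1)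
  qed
  have xS: "x : ?S" using x(1) by (intro CollectI exI[of _ "\<one>[K]"]) simp
  have "simple_module ?O (?M(|carrier := ?S|))"
    unfolding simple_module_def
  proof (intro conjI allI impI)
    show "left_module ?O (?M(|carrier := ?S|))" by (rule M.submodule_left_module[OF S])
    show "carrier (?M(|carrier := ?S|)) ~= {\<zero>[?M(|carrier := ?S|)]}" using xS x(3) by (auto simp: M_simps)
    fix N assume N: "Module.submodule N ?O (?M(|carrier := ?S|))"
    then have N': "Module.submodule N ?O ?M" "N \<subseteq> ?S" using M.submodule_carrier_iff[OF S] by auto
    have "?S \<subseteq> N" if "N ~= {\<zero>[A]}"
    proof -
      have "\<zero>[A] : N" using M.submoduleD(2)[OF N'(1)] by (simp add: M_simps)
      then obtain z where z: "z : N" "z ~= \<zero>[A]" using \<open>N ~= {\<zero>[A]}\<close> by blast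
      then obtain c where c: "c : carrier K" "z = c .[A] x" using N'(2) by blast
      have c0: "c ~= \<zero>[K]" using z(2) c(2) x(1) by auto
      note inv = smult_inverse[OF c(1) c0 x(1)]
      have zA: "z : carrier A" unfolding c(2) using c(1) x(1) by simp
      show "?S \<subseteq> N"
      proof
        fix u assume "u : ?S"
        then obtain d where d: "d : carrier K" "u = d .[A] x" by blast
        have r: "d *[K] inv\<^bsub>K\<^esub> c : carrier K" using d inv by simp
        have "scal (d *[K] inv\<^bsub>K\<^esub> c) .[?M] z : N"
          by (rule M.submoduleD(4)[OF N'(1) _ z(1)]) (use r in \<open>simp add: opposite_simps\<close>)
        moreover have "scal (d *[K] inv\<^bsub>K\<^esub> c) .[?M] z = d .[A] (inv\<^bsub>K\<^esub> c .[A] z)"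
          unfolding M_simps scal_mult(2)[OF r zA] by (rule AV.smult_assoc1[OF d(1) inv(1) zA])
        moreover have "inv\<^bsub>K\<^esub> c .[A] z = x" unfolding c(2) by (rule inv(2))
        ultimately show "u : N" unfolding d(2) by simp
      qed
    qed
    then show "N = {\<zero>[?M(|carrier := ?S|)]} \<or> N = carrier (?M(|carrier := ?S|))" using N'(2) by (auto simp: M_simps)
  qed
  then have "x : \<Union>{S. Module.submodule S ?O ?M & simple_module ?O (?M(|carrier := S|))}" using S xS by blast
  then show ?thesis unfolding socle_def by (rule subsetD[OF M.generated_submodule_incl])
qed

lemma e_nonzero:
  assumes a: "a : carrier A" "a ~= \<zero>[A]"
  shows "\<exists>i\<in>{1..n}. e i *[A] a ~= \<zero>[A]" "\<exists>i\<in>{1..n}. a *[A] e i ~= \<zero>[A]"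
proof -
  have "(\<Oplus>\<^bsub>A\<^esub>i\<in>{1..n}. e i) *[A] a = (\<Oplus>\<^bsub>A\<^esub>i\<in>{1..n}. e i *[A] a)"
    by (rule A.finsum_ldistr) (use a e_pi in auto)
  then have 1: "(\<Oplus>\<^bsub>A\<^esub>i\<in>{1..n}. e i *[A] a) = a" unfolding graded_facts(7) using a by simp
  have "a *[A] (\<Oplus>\<^bsub>A\<^esub>i\<in>{1..n}. e i) = (\<Oplus>\<^bsub>A\<^esub>i\<in>{1..n}. a *[A] e i)"
    by (rule A.finsum_rdistr) (use a e_pi in auto)
  then have 2: "(\<Oplus>\<^bsub>A\<^esub>i\<in>{1..n}. a *[A] e i) = a" unfolding graded_facts(7) using a by simp
  have z: "(\<Oplus>\<^bsub>A\<^esub>i\<in>{1..n}. f i) = \<zero>[A]" if "\<forall>i\<in>{1..n}. f i = \<zero>[A]" for f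
  proof -
    have "(\<Oplus>\<^bsub>A\<^esub>i\<in>{1..n}. f i) = (\<Oplus>\<^bsub>A\<^esub>i\<in>{1..n}. \<zero>[A])" by (rule AV.M.finsum_cong') (use that in auto)
    then show ?thesis by simp
  qed
  show "\<exists>i\<in>{1..n}. e i *[A] a ~= \<zero>[A]" using z[of "%i. e i *[A] a"] a(2) unfolding 1 by blast
  show "\<exists>i\<in>{1..n}. a *[A] e i ~= \<zero>[A]" using z[of "%i. a *[A] e i"] a(2) unfolding 2 by blast
qed

text \<open>Choose a vertex with \<open>e i a\<close> nonzero and multiply by an element of the last
  \<open>J m'\<close> that does not annihilate it. The next power kills the product, which therefore
  lies in the socle; a right factor \<open>e k\<close> keeps it nonzero at one vertex.\<close>

lemma socle_reached:
  assumes a: "a : carrier A" "a ~= \<zero>[A]"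
  obtains i k b where "i : {1..n}" "k : {1..n}" "b : carrier A" "e i *[A] (a *[A] b) ~= \<zero>[A]"
    "e i *[A] (a *[A] b) : socle (opposite A) (right_projective A (e i))"
proof -
  obtain i where i: "i : {1..n}" "e i *[A] a ~= \<zero>[A]" using e_nonzero(1)[OF a] by blast
  have ei: "e i : carrier A" "e i *[A] e i = e i" using graded_facts(3,4)[OF i(1)] by auto
  define a' where "a' = e i *[A] a"
  have a': "a' : carrier A" "a' ~= \<zero>[A]" "e i *[A] a' = a'"
    using ei a i by (simp_all add: a'_def A.m_assoc[symmetric])
  define m where "m = (LEAST m. \<forall>b\<in>J m. a' *[A] b = \<zero>[A])"
  have "\<forall>b\<in>J (Suc l). a' *[A] b = \<zero>[A]" using a'(1) by (simp add: J_beyond)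
  then have m: "\<forall>b\<in>J m. a' *[A] b = \<zero>[A]" unfolding m_def by (rule LeastI)
  have "m ~= 0"
  proof
    assume "m = 0"
    then have "a' *[A] \<one>[A] = \<zero>[A]" using m J_0 by blast
    then show False using a' by simp
  qed
  then obtain m' where m': "m = Suc m'" using not0_implies_Suc by blast
  then have "\<not> (\<forall>b\<in>J m'. a' *[A] b = \<zero>[A])" using not_less_Least[of m' "%m. \<forall>b\<in>J m. a' *[A] b = \<zero>[A]"] by (simp add: m_def)
  then obtain b where b: "b : J m'" "a' *[A] b ~= \<zero>[A]" by blast
  have bA: "b : carrier A" by (rule J_closed[OF b(1)])
  obtain k where k: "k : {1..n}" "a' *[A] b *[A] e k ~= \<zero>[A]" using e_nonzero(2)[OF _ b(2)] a'(1) bA by auto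
  have ek: "e k : carrier A" "e k *[A] e k = e k" using graded_facts(3,4)[OF k(1)] by auto
  have eq: "e i *[A] (a *[A] (b *[A] e k)) = a' *[A] b *[A] e k"
    unfolding a'_def using ei a(1) bA ek by (simp add: A.m_assoc)
  have "a' *[A] b *[A] e k : socle (opposite A) (right_projective A (e i))"
  proof (rule socle_memI[OF _ _ k(2) _ i(1) k(1)])
    show "a' *[A] b *[A] e k : carrier A" using a'(1) bA ek(1) by simp
    show "e i *[A] (a' *[A] b *[A] e k) = a' *[A] b *[A] e k"
      using a'(1,3) bA ek(1) ei(1) by (simp add: A.m_assoc[symmetric])
    show "a' *[A] b *[A] e k *[A] e k = a' *[A] b *[A] e k"
      using a'(1) bA ek by (simp add: A.m_assoc)
    fix c assume c: "c : J 1"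
    have "e k : J 0" using ek(1) J_0 by simp
    from J_mult[OF this c] have "e k *[A] c : J 1" by simp
    from J_mult[OF b(1) this] have "b *[A] (e k *[A] c) : J m" by (simp add: m')
    then have "a' *[A] (b *[A] (e k *[A] c)) = \<zero>[A]" using m by blast
    then show "a' *[A] b *[A] e k *[A] c = \<zero>[A]" using a'(1) bA ek(1) J_closed[OF c] by (simp add: A.m_assoc)
  qed
  then show ?thesis using that[OF i(1) k(1), of "b *[A] e k"] k(2) bA ek(1) unfolding eq by simp
qed

text \<open>The form adds up, over all vertices, the coordinate of the degree \<open>l\<close> part
  in the line \<open>e i G l e (\<tau> i)\<close>. By \<open>socle_reached\<close> a nonzero
  \<open>a\<close> can be moved into one of these lines; a right factor \<open>e (\<tau> i)\<close>
  then removes all other summands because \<tau> is injective, so nothing cancels.\<close>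

lemma frobenius_form:
  assumes \<tau>: "bij_betw \<tau> {1..n} {1..n}"
    and soc: "!!i. i : {1..n} ==> socle (opposite A) (right_projective A (e i)) = {e i *[A] x *[A] e (\<tau> i) | x. x : G l}"
    and dim: "!!i. i : {1..n} ==> vectorspace.dim K (A(|carrier := {e i *[A] x *[A] e (\<tau> i) | x. x : G l}|)) = 1"
  shows "\<exists>y\<in>carrier (dual_bimodule K A). \<forall>a\<in>carrier A. a ~= \<zero>[A] --> (\<exists>b\<in>carrier A. y (a *[A] b) ~= \<zero>[K])"
proof -
  define W where "W i = {e i *[A] x *[A] e (\<tau> i) | x. x : G l}" for i
  have \<tau>_mem: "\<tau> i : {1..n}" if "i : {1..n}" for i using bij_betwE[OF \<tau>] that by blast
  have eA: "e i : carrier A" "e (\<tau> i) : carrier A" if "i : {1..n}" for i using graded_facts(3) \<tau>_mem that by auto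
  have W_sub: "Module.submodule (W i) K A" if i: "i : {1..n}" for i
  proof (rule AV.submoduleI)
    show "W i \<subseteq> carrier A" using eA[OF i] G.piece_carrier by (auto simp: W_def)
    show "\<zero>[A] : W i" unfolding W_def using eA[OF i] G.piece_sub(2)[of l] by (intro CollectI exI[of _ "\<zero>[A]"]) simp
  next
    fix u assume "u : W i"
    then obtain x where x: "x : G l" "u = e i *[A] x *[A] e (\<tau> i)" unfolding W_def by blast
    show "-[A] u : W i" unfolding W_def x(2) using G.piece_sub(4)[OF x(1)] eA[OF i] G.piece_carrier[OF x(1)]
      by (intro CollectI exI[of _ "-[A] x"]) (simp add: A.l_minus A.r_minus)
  next
    fix u v assume "u : W i" "v : W i"
    then obtain x z where x: "x : G l" "u = e i *[A] x *[A] e (\<tau> i)" "z : G l" "v = e i *[A] z *[A] e (\<tau> i)" unfolding W_def by blast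
    show "u +[A] v : W i" unfolding W_def x(2,4)
      using G.piece_sub(3)[OF x(1,3)] eA[OF i] G.piece_carrier[OF x(1)] G.piece_carrier[OF x(3)]
      by (intro CollectI exI[of _ "x +[A] z"]) (simp add: A.l_distr A.r_distr)
  next
    fix c u assume c: "c : carrier K" and "u : W i"
    then obtain x where x: "x : G l" "u = e i *[A] x *[A] e (\<tau> i)" unfolding W_def by blast
    show "c .[A] u : W i" unfolding W_def x(2) using G_scal[OF c x(1)] eA[OF i] G.piece_carrier[OF x(1)] c
      by (intro CollectI exI[of _ "c .[A] x"]) (simp add: smult_mult)
  qed
  have "\<forall>i\<in>{1..n}. \<exists>v. v : W i & v ~= \<zero>[A] & (\<forall>x\<in>W i. \<exists>c\<in>carrier K. x = c .[A] v)"
    using line_generator[OF AV.vectorspace_axioms W_sub fin_A] dim unfolding W_def by blast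
  from bchoice[OF this] obtain s where s: "\<forall>i\<in>{1..n}. s i : W i & s i ~= \<zero>[A] & (\<forall>x\<in>W i. \<exists>c\<in>carrier K. x = c .[A] s i)" ..
  have sA: "s i : carrier A" if i: "i : {1..n}" for i
  proof -
    have "s i : W i" using s i by blast
    then show ?thesis using eA[OF i] G.piece_carrier by (auto simp: W_def)
  qed
  \<comment> \<open>The coordinate with respect to the chosen generator \<open>s i\<close> of the
    line \<open>W i\<close>.\<close>
  define ka where "ka i x = (SOME c. c : carrier K & x = c .[A] s i)" for i x
  have ka: "ka i x : carrier K" "x = ka i x .[A] s i" if "i : {1..n}" "x : W i" for i x
  proof -
    have "\<exists>c. c : carrier K & x = c .[A] s i" using s that by blast
    from someI_ex[OF this] show "ka i x : carrier K" "x = ka i x .[A] s i" unfolding ka_def by blast+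
  qed
  have uniq: "c = d" if i: "i : {1..n}" and cd: "c : carrier K" "d : carrier K" "c .[A] s i = d .[A] s i" for i c d
  proof (rule ccontr)
    assume ne: "c ~= d"
    have k: "c -[K] d : carrier K" "c -[K] d ~= \<zero>[K]" using cd ne by simp_all
    have "d +[K] (c -[K] d) = c" by (rule abelian_group.diff_add_left[OF K.abelian_group_axioms cd(1,2)])
    then have "d .[A] s i +[A] (c -[K] d) .[A] s i = d .[A] s i"
      using AV.smult_l_distr[OF cd(2) k(1) sA[OF i]] cd(3) by simp
    then have "(c -[K] d) .[A] s i = \<zero>[A]"
      using AV.M.add_diff_left[of "d .[A] s i" "(c -[K] d) .[A] s i"] cd(2) k(1) sA[OF i] by (simp add: a_minus_def AV.M.r_neg)
    then have "s i = \<zero>[A]" using smult_inverse[OF k sA[OF i]] by simp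
    then show False using s i by blast
  qed
  have kaI: "ka i x = c" if i: "i : {1..n}" and "x : W i" "c : carrier K" "x = c .[A] s i" for i x c
    by (rule uniq[OF i ka(1)[OF i that(2)] that(3)]) (use ka(2)[OF i that(2)] that(4) in metis)
  define \<pi> where "\<pi> i x = e i *[A] homog_component A G l x *[A] e (\<tau> i)" for i x
  have hcA: "homog_component A G l x : carrier A" if "x : carrier A" for x
    by (rule G.piece_carrier[OF G.component_closed[OF that]])
  have \<pi>W: "\<pi> i x : W i" if "x : carrier A" for i x
    unfolding \<pi>_def W_def using G.component_closed[OF that] by blast
  have \<pi>_add: "\<pi> i (x +[A] z) = \<pi> i x +[A] \<pi> i z" if "i : {1..n}" "x : carrier A" "z : carrier A" for i x z
    unfolding \<pi>_def using that eA hcA by (simp add: G.component_add A.l_distr A.r_distr)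
  have hc_smult: "homog_component A G l (c .[A] x) = c .[A] homog_component A G l x" if cx: "c : carrier K" "x : carrier A" for c x
    using component_sandwich[OF G_scal[OF cx(1) one_G0] one_G0 cx(2), of l] cx hcA[OF cx(2)] by (simp add: scal_mult)
  have \<pi>_smult: "\<pi> i (c .[A] x) = c .[A] \<pi> i x" if "i : {1..n}" "c : carrier K" "x : carrier A" for i c x
    unfolding \<pi>_def using that eA hcA by (simp add: hc_smult smult_mult)
  have kp: "ka i (\<pi> i x) : carrier K" if "i : {1..n}" "x : carrier A" for i x by (rule ka(1)[OF that(1) \<pi>W[OF that(2)]])
  have ka_add: "ka i (\<pi> i (x +[A] z)) = ka i (\<pi> i x) +[K] ka i (\<pi> i z)"
    if i: "i : {1..n}" and xz: "x : carrier A" "z : carrier A" for i x z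
  proof (rule kaI[OF i \<pi>W])
    show "\<pi> i (x +[A] z) = (ka i (\<pi> i x) +[K] ka i (\<pi> i z)) .[A] s i"
      unfolding \<pi>_add[OF i xz] AV.smult_l_distr[OF kp[OF i xz(1)] kp[OF i xz(2)] sA[OF i]]
        ka(2)[OF i \<pi>W[OF xz(1)], symmetric] ka(2)[OF i \<pi>W[OF xz(2)], symmetric] ..
  qed (use xz kp i in simp_all)
  have ka_smult: "ka i (\<pi> i (c .[A] x)) = c *[K] ka i (\<pi> i x)"
    if i: "i : {1..n}" and cx: "c : carrier K" "x : carrier A" for i c x
  proof (rule kaI[OF i \<pi>W])
    show "\<pi> i (c .[A] x) = (c *[K] ka i (\<pi> i x)) .[A] s i"
      unfolding \<pi>_smult[OF i cx] AV.smult_assoc1[OF cx(1) kp[OF i cx(2)] sA[OF i]]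
        ka(2)[OF i \<pi>W[OF cx(2)], symmetric] ..
  qed (use cx kp i in simp_all)
  define h where "h x = (\<Oplus>\<^bsub>K\<^esub>i\<in>{1..n}. ka i (\<pi> i x))" for x
  have kpi: "(%i. ka i (\<pi> i x)) : {1..n} \<rightarrow> carrier K" if "x : carrier A" for x using kp that by blast
  define y where "y = (\<lambda>x\<in>carrier A. h x)"
  have "y : carrier (dual_bimodule K A)"
  proof -
    have "h x : carrier K" if "x : carrier A" for x unfolding h_def by (rule K.finsum_closed[OF kpi[OF that]])
    moreover have "h (x +[A] z) = h x +[K] h z" if "x : carrier A" "z : carrier A" for x z
      unfolding h_def K.finsum_addf[OF kpi[OF that(1)] kpi[OF that(2)], symmetric]
      by (rule K.finsum_cong') (use ka_add kp that in auto)
    moreover have "h (c .[A] x) = c *[K] h x" if "c : carrier K" "x : carrier A" for c x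
      unfolding h_def K.finsum_rdistr[OF finite_atLeastAtMost that(1) kpi[OF that(2)]]
      by (rule K.finsum_cong') (use ka_smult kp that in auto)
    ultimately show ?thesis unfolding y_def dual_bimodule_def by simp
  qed
  moreover have "\<exists>b\<in>carrier A. y (a *[A] b) ~= \<zero>[K]" if a: "a : carrier A" "a ~= \<zero>[A]" for a
  proof -
    obtain i k b where b: "i : {1..n}" "k : {1..n}" "b : carrier A" "e i *[A] (a *[A] b) ~= \<zero>[A]"
      "e i *[A] (a *[A] b) : socle (opposite A) (right_projective A (e i))"
      by (rule socle_reached[OF a]) (rule that)
    let ?x = "e i *[A] (a *[A] b)"
    note i = b(1)
    have xW: "?x : W i" using b(5) unfolding soc[OF i] W_def .
    then obtain g where g: "g : G l" "?x = e i *[A] g *[A] e (\<tau> i)" unfolding W_def mem_Collect_eq by (elim exE conjE)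
    have gA: "g : carrier A" by (rule G.piece_carrier[OF g(1)])
    have "e i *[A] g *[A] e (\<tau> i) : G l"
      using graded_facts(1)[OF graded_facts(1)[OF e_G0[OF i] g(1)] e_G0[OF \<tau>_mem[OF i]]] by simp
    then have xG: "?x : G l" unfolding g(2) .
    have ee: "e (\<tau> i) *[A] e (\<tau> i) = e (\<tau> i)" by (rule graded_facts(4)[OF \<tau>_mem[OF i]])
    have xe: "?x *[A] e (\<tau> i) = ?x" unfolding g(2) using gA eA[OF i] ee by (simp add: A.m_assoc)
    \<comment> \<open>The test element carries no factor \<open>e i\<close> on the left of
      \<open>a\<close>; the projection \<open>\<pi> i\<close> supplies it.\<close>
    let ?b = "b *[A] e (\<tau> i)"
    let ?z = "homog_component A G l (a *[A] b)"
    have abA: "a *[A] b : carrier A" by (rule A.m_closed[OF a(1) b(3)])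
    have zA: "?z : carrier A" by (rule hcA[OF abA])
    have hb: "homog_component A G l (a *[A] ?b) = ?z *[A] e (\<tau> i)"
      using component_sandwich[OF one_G0 e_G0[OF \<tau>_mem[OF i]] abA, of l]
      unfolding A.l_one[OF abA] A.l_one[OF zA] A.m_assoc[OF a(1) b(3) eA(2)[OF i]] .
    have "homog_component A G l (e i *[A] (a *[A] b) *[A] e (\<tau> i)) = e i *[A] ?z *[A] e (\<tau> i)"
      by (rule component_sandwich[OF e_G0[OF i] e_G0[OF \<tau>_mem[OF i]] abA])
    then have xz: "e i *[A] ?z *[A] e (\<tau> i) = ?x"
      unfolding xe G.component_homogeneous[OF xG, of l] if_P[OF refl] by (rule sym)
    have \<pi>i: "\<pi> i (a *[A] ?b) = ?x"
    proof -
      have "e i *[A] (?z *[A] e (\<tau> i)) *[A] e (\<tau> i) = e i *[A] ?z *[A] e (\<tau> i)"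
        using eA[OF i] zA ee by (simp add: A.m_assoc)
      then show ?thesis unfolding \<pi>_def hb xz .
    qed
    have \<pi>j: "\<pi> j (a *[A] ?b) = \<zero>[A]" if j: "j : {1..n}" "i ~= j" for j
    proof -
      have "\<tau> i ~= \<tau> j" using inj_on_eq_iff[OF bij_betw_imp_inj_on[OF \<tau>] i j(1)] j(2) by simp
      then have "e (\<tau> i) *[A] e (\<tau> j) = \<zero>[A]" by (intro graded_facts(6) \<tau>_mem i j)
      then show ?thesis unfolding \<pi>_def hb using eA[OF i] eA[OF j(1)] zA by (simp add: A.m_assoc)
    qed
    have ka0: "ka j \<zero>[A] = \<zero>[K]" if j: "j : {1..n}" for j
    proof (rule kaI[OF j])
      show "\<zero>[A] : W j"
        using submodule_convert[OF AV.vectorspace_axioms W_sub[OF j]] unfolding LinearCombinations.submodule_def by blast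
    qed (use sA[OF j] in simp_all)
    have bA: "a *[A] ?b : carrier A" by (intro A.m_closed a(1) b(3) eA[OF i])
    have kx: "ka i ?x : carrier K" by (rule ka(1)[OF i xW])
    have "h (a *[A] ?b) = (\<Oplus>\<^bsub>K\<^esub>j\<in>{1..n}. if i = j then ka i ?x else \<zero>[K])"
      unfolding h_def
    proof (rule K.finsum_cong'[OF refl])
      show "(%j. if i = j then ka i ?x else \<zero>[K]) : {1..n} \<rightarrow> carrier K" using kx by (auto simp: Pi_def)
      fix j assume j: "j : {1..n}"
      show "ka j (\<pi> j (a *[A] ?b)) = (if i = j then ka i ?x else \<zero>[K])"
      proof (cases "i = j")
        case True
        show ?thesis unfolding True[symmetric] \<pi>i by (simp only: refl if_True)
      next
        case False
        show ?thesis unfolding if_not_P[OF False] \<pi>j[OF j False] by (rule ka0[OF j])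
      qed
    qed
    also have "... = ka i ?x" by (rule K.finsum_singleton[OF i finite_atLeastAtMost]) (use kx in blast)
    finally have "y (a *[A] ?b) = ka i ?x" unfolding y_def restrict_apply'[OF bA] .
    moreover have "ka i ?x ~= \<zero>[K]"
    proof
      assume "ka i ?x = \<zero>[K]"
      then have "?x = \<zero>[K] .[A] s i" using ka(2)[OF i xW] by (simp only:)
      also have "... = \<zero>[A]" using sA[OF i] by simp
      finally show False using b(4) by (rule notE[rotated])
    qed
    ultimately have "y (a *[A] ?b) ~= \<zero>[K]" by (simp only: not_False_eq_True)
    then show ?thesis by (rule bexI) (intro A.m_closed b(3) eA[OF i])
  qed
  ultimately show ?thesis by blast
qed

end

section \<open>The complexity of the twisted trivial extension\<close>

text \<open>Constant factors do not change the complexity of a sequence, so a bound up to a constant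
  that depends on the module suffices for the supremum.\<close>

lemma (in fd_alg) algebra_complexity_eqI:
  assumes upper: "!!M :: ('a, nat => 'k) module. left_module A M ==> fd M ==> \<exists>k. \<forall>r. betti_le r M (k * b r)"
    and lower: "\<exists>(S :: ('a, nat => 'k) module) (P :: nat => ('a, nat => 'k) module) d ep. left_module A S & fd S &
      minimal_projective_resolution A S P d ep & seq_complexity (%r. dimm (P r)) = seq_complexity b"
  shows "algebra_complexity K A = seq_complexity b"
proof (rule antisym)
  show "algebra_complexity K A <= seq_complexity b"
    unfolding algebra_complexity_def
  proof (rule Sup_least)
    fix c assume "c : {module_complexity K A M | M :: ('a, nat => 'k) module. left_module A M & finitely_generated A M}"
    then obtain M :: "('a, nat => 'k) module" where M: "c = module_complexity K A M" "left_module A M" "finitely_generated A M" by blast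
    have fdM: "fd M" using finitely_generated_iff_fd[OF M(2)] M(3) by simp
    obtain k where k: "\<forall>r. betti_le r M (k * b r)" using upper[OF M(2) fdM] by blast
    obtain c' where c': "\<forall>r. c' r <= k * b r" "module_complexity K A M = seq_complexity c'"
      using module_complexity_le[OF M(2) fdM, of "%r. k * b r"] k by blast
    have "seq_complexity c' <= seq_complexity b" by (rule seq_complexity_mono[of c' k b]) (use c'(1) in blast)
    then show "c <= seq_complexity b" using M(1) c'(2) by simp
  qed
  obtain S :: "('a, nat => 'k) module" and P :: "nat => ('a, nat => 'k) module" and d ep
    where S: "left_module A S" "fd S" "minimal_projective_resolution A S P d ep" "seq_complexity (%r. dimm (P r)) = seq_complexity b"
    using lower by blast
  have "module_complexity K A S = seq_complexity b" using module_complexity_minres[OF S(3,1,2)] S(4) by simp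
  moreover have "finitely_generated A S" using finitely_generated_iff_fd[OF S(1)] S(2) by simp
  ultimately show "seq_complexity b <= algebra_complexity K A"
    unfolding algebra_complexity_def using S(1) by (intro Sup_upper) (auto intro!: exI[of _ S])
qed

theorem theorem3p12:
  fixes K :: "'k ring" and \<Lambda> :: "('k, 'a) module"
    and G :: "nat \<Rightarrow> 'a set" and n l :: nat and e :: "nat \<Rightarrow> 'a" and \<sigma> :: "'a \<Rightarrow> 'a"
  assumes "field K"
    and "koszul_self_injective_algebra K \<Lambda> G n e l"
    and "graded_automorphism K \<Lambda> G \<sigma>"
  shows "algebra_complexity K (twisted_trivial_extension K \<Lambda> \<sigma>) = algebra_complexity K \<Lambda> + 1"
proof -
  note ksi = assms(2)[unfolded koszul_self_injective_algebra_def]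
  have gr: "graded_algebra K \<Lambda> G n e" and fin: "vectorspace.fin_dim K \<Lambda>" and tp: "\<forall>t>l. G t = {\<zero>[\<Lambda>]}"
    and kz: "koszul \<Lambda> G" and st: "stable_of_loewy_length K \<Lambda> G n e l" using ksi by blast+
  have "fd_alg K \<Lambda>" using gr fin assms(1) by (simp add: fd_alg_def graded_algebra_def)
  then interpret galg K \<Lambda> G n e l using gr tp by (simp add: galg_def galg_axioms_def)
  obtain P :: "nat => ('a, nat => 'k) module" and d ep Q where
    "projective_resolution \<Lambda> S0 P d ep & (\<forall>r. graded_module \<Lambda> G (P r) (Q r)) &
     (\<forall>r. generated_submodule \<Lambda> (P r) (Q r r) = carrier (P r)) &
     (\<forall>t>0. \<forall>x\<in>Q 0 t. ep x = \<zero>[\<Lambda>]) & (\<forall>r t. d r ` Q (Suc r) t \<subseteq> Q r t)"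
    using kz unfolding koszul_def by (elim exE)
  then interpret R: koszul_resolution K \<Lambda> G n e l P d ep Q by unfold_locales blast+
  obtain \<tau> where \<tau>: "bij_betw \<tau> {1..n} {1..n}" "\<forall>i\<in>{1..n}. let S = {e i *[\<Lambda>] x *[\<Lambda>] e (\<tau> i) | x. x : G l} in
      socle (opposite \<Lambda>) (right_projective \<Lambda> (e i)) = S & vectorspace.dim K (\<Lambda>(|carrier := S|)) = 1"
    using st unfolding stable_of_loewy_length_def by blast
  have "\<exists>y\<in>carrier (dual_bimodule K \<Lambda>). \<forall>a\<in>carrier \<Lambda>. a ~= \<zero>[\<Lambda>] --> (\<exists>b\<in>carrier \<Lambda>. y (a *[\<Lambda>] b) ~= \<zero>[K])"
    by (rule frobenius_form[OF \<tau>(1)]) (use \<tau>(2) in \<open>simp_all add: Let_def\<close>)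
  then obtain y where y: "y : carrier (dual_bimodule K \<Lambda>)"
    "\<forall>a\<in>carrier \<Lambda>. a ~= \<zero>[\<Lambda>] --> (\<exists>b\<in>carrier \<Lambda>. y (a *[\<Lambda>] b) ~= \<zero>[K])" by blast
  have ga: "\<sigma> : ring_iso \<Lambda> \<Lambda>" "\<forall>c\<in>carrier K. \<forall>a\<in>carrier \<Lambda>. \<sigma> (c .[\<Lambda>] a) = c .[\<Lambda>] \<sigma> a"
    using assms(3) by (simp_all add: graded_automorphism_def)
  interpret Y: frobenius K \<Lambda> y \<sigma> by unfold_locales (use y ga in blast)+
  interpret E: skew_ext K \<Lambda> Y.B fst "%u. Y.L' (snd u)" "%a. (a, \<lambda>x\<in>carrier \<Lambda>. \<zero>[K])" "(\<zero>[\<Lambda>], y)" Y.ps "the_inv_into (carrier \<Lambda>) Y.ps"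
    by (rule Y.skew_ext)
  define b where "b r = dimm (P r)" for r
  obtain fi :: "'a => nat => 'k" where fi: "inj_on fi (G 0)" "left_module \<Lambda> (copy_module fi S0)" "fd (copy_module fi S0)"
    by (rule R.S0_copy)
  note min = R.minimal[OF fi(1)]
  have bound: "betti_le r M (dimm M * b r)" if "left_module \<Lambda> M" "fd M" for M :: "('a, nat => 'k) module" and r
    unfolding b_def by (rule betti_bound[OF that fi(1) refl minres_betti_le[OF min fi(2,3)]])
  have A: "algebra_complexity K \<Lambda> = seq_complexity b"
  proof (rule algebra_complexity_eqI)
    show "\<exists>k. \<forall>r. betti_le r M (k * b r)" if "left_module \<Lambda> M" "fd M" for M :: "('a, nat => 'k) module"
      using bound[OF that] by blast
    show "\<exists>(S :: ('a, nat => 'k) module) (P :: nat => ('a, nat => 'k) module) d ep. left_module \<Lambda> S & fd S &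
      minimal_projective_resolution \<Lambda> S P d ep & seq_complexity (%r. dimm (P r)) = seq_complexity b"
      using fi(2,3) min unfolding b_def by blast
  qed
  have "algebra_complexity K Y.B = seq_complexity (%r. \<Sum>s\<le>r. b s)"
  proof (rule E.B.algebra_complexity_eqI)
    show "\<exists>k. \<forall>r. E.B.betti_le r N (k * (\<Sum>s\<le>r. b s))" if "left_module Y.B N" "E.B.fd N" for N :: "('a \<times> ('a => 'k), nat => 'k) module"
      using E.skew_betti_bound[OF that bound] by blast
    \<comment> \<open>The inflation of \<open>S0\<close> has twice the partial sums as Betti numbers
      and so attains the upper bound over the extension.\<close>
    obtain P' :: "nat => ('a \<times> ('a => 'k), nat => 'k) module" and d' ep' where P':
      "minimal_projective_resolution Y.B (pull fst (copy_module fi S0)) P' d' ep'" "\<forall>r. E.B.dimm (P' r) = 2 * (\<Sum>s\<le>r. dimm (P s))"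
      using E.inflate_minres[OF min fi(2,3)] by blast
    \<comment> \<open>The two sequences differ by the factor 2 only, which leaves the complexity
      unchanged.\<close>
    have "seq_complexity (%r. E.B.dimm (P' r)) = seq_complexity (%r. \<Sum>s\<le>r. b s)"
      by (rule antisym; rule seq_complexity_mono[where k = 2] seq_complexity_mono[where k = 1]; use P'(2) in \<open>simp add: b_def\<close>)
    then show "\<exists>(S :: ('a \<times> ('a => 'k), nat => 'k) module) (P :: nat => ('a \<times> ('a => 'k), nat => 'k) module) d ep.
      left_module Y.B S & E.B.fd S & minimal_projective_resolution Y.B S P d ep &
      seq_complexity (%r. E.B.dimm (P r)) = seq_complexity (%r. \<Sum>s\<le>r. b s)"
      using E.inflate[OF fi(2)] E.inflate_fd[OF fi(2,3)] P'(1) by blast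
  qed
  also have "... = seq_complexity b + 1"
  proof -
    obtain q p where q: "poly q 0 ~= 0" "fps_of_poly q * Abs_fps (%r. complex_of_real (real (b r))) = fps_of_poly p"
      using R.poincare_rational unfolding b_def by blast
    have "b 0 > 0" using R.dim_P0 by (simp add: b_def)
    from seq_complexity_sums[OF this q] show ?thesis .
  qed
  finally show ?thesis unfolding A .
qed

end
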